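(* Let $n\ge1$ and let $p_t(r,\eta)$ be the subelliptic heat kernel on $\mathbb{S}^{4n+3}$ issued from the north pole, in cylindric coordinates. For $r\in(0,\frac{\pi}{2})$, $$p_t(r,0)\sim_{t\to0}\frac{1}{(4\pi t)^{2n+\frac32}}\left(\frac{r}{\sin r}\right)^{2n+1}e^{-\frac{r^2}{4t}}\left(\frac{1}{1-r\cot r}\right)^{\frac32}.$$
   Context: $\mathbb{S}^{4n+3}=\{q\in\mathbb{H}^{n+1}:\|q\|=1\}$ ($\mathbb{H}$ the quaternions) with its round metric and Laplace–Beltrami operator $\Delta$. The unit quaternions $\mathbf{SU}(2)$ act isometrically by $g\cdot(q_1,\dots,q_{n+1})=(gq_1,\dots,gq_{n+1})$ with quotient $\mathbb{HP}^n$. The sub-Laplacian $L$ is the lift of the Laplace–Beltrami operator of $\mathbb{HP}^n$, i.e. $L=\Delta-T_1^2-T_2^2-T_3^2$ with $T_1,T_2,T_3$ the unit-length generators $f\mapsto\frac{d}{d\theta}|_{\theta=0}f(e^{S\theta}q)$, $S=I,J,K$. $p_t$ is the kernel of $e^{tL}$ from the north pole $(0,\dots,0,1)$ with respect to the Riemannian volume; it depends only on $(r,\eta)\in[0,\pi/2)\times[0,\pi]$ defined by $|q_{n+1}|=\cos r$, $\mathrm{Re}(q_{n+1})=\cos r\cos\eta$. The notation $a(t)\sim_{t\to0}b(t)$ means $a(t)/b(t)\to1$ as $t\to0^+$. *)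

theory Defs
  imports "HOL-Analysis.Analysis" "HOL-Library.Landau_Symbols"
begin

section \<open>Quaternions and \<open>\<bbbH>\<close>-vectors\<close>

text \<open>
  The quaternion \<open>a + b j\<close> with complex \<open>a\<close>, \<open>b\<close> is the pair \<open>(a, b)\<close>; the product comes from
  \<open>j c = cnj c j\<close> and \<open>j\<^sup>2 = -1\<close>.  The norm of the product type is the quaternion norm.
\<close>

type_synonym quat = "complex \<times> complex"

definition qmult :: "quat \<Rightarrow> quat \<Rightarrow> quat" where
  "qmult p q = (fst p * fst q - snd p * cnj (snd q), fst p * snd q + snd p * cnj (fst q))"

definition qone :: quat where "qone = (1, 0)"
definition qI :: quat where "qI = (\<i>, 0)"
definition qJ :: quat where "qJ = (0, 1)"
definition qK :: quat where "qK = (0, \<i>)"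

definition qRe :: "quat \<Rightarrow> real" where "qRe q = Re (fst q)"

definition qexp :: "quat \<Rightarrow> quat" where
  "qexp q = (\<Sum>k. (qmult q ^^ k) qone /\<^sub>R fact k)"

text \<open>
  \<open>\<bbbH>\<^sup>n\<^sup>+\<^sup>1\<close> is \<open>\<bbbH>\<^sup>n \<times> \<bbbH>\<close> with \<open>n = CARD('n)\<close>, so \<^const>\<open>snd\<close> is the last coordinate.  This type is
  Euclidean of dimension \<open>4n + 4\<close>, and its unit sphere is \<open>sphere 0 1\<close>.
\<close>

type_synonym 'n hvec = "(quat ^ 'n) \<times> quat"

definition hact :: "quat \<Rightarrow> 'n::finite hvec \<Rightarrow> 'n hvec" where
  "hact g q = ((\<chi> i. qmult g (fst q $ i)), qmult g (snd q))"

definition north_pole :: "'n::finite hvec" where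
  "north_pole = (0, qone)"

definition has_cyl_coords :: "'n::finite hvec \<Rightarrow> real \<Rightarrow> real \<Rightarrow> bool" where
  "has_cyl_coords q r \<eta> \<longleftrightarrow>
     q \<in> sphere 0 1 \<and> 0 \<le> r \<and> r < pi / 2 \<and> 0 \<le> \<eta> \<and> \<eta> \<le> pi \<and>
     norm (snd q) = cos r \<and> qRe (snd q) = cos r * cos \<eta>"


section \<open>Smooth functions on the unit sphere\<close>

text \<open>
  Functions on the sphere are functions on the ambient space of which only the values on
  \<open>sphere 0 1\<close> matter.
\<close>

fun C_k_on :: "nat \<Rightarrow> 'a::euclidean_space set \<Rightarrow> ('a \<Rightarrow> real) \<Rightarrow> bool" where
  "C_k_on 0 U f \<longleftrightarrow> continuous_on U f"
| "C_k_on (Suc k) U f \<longleftrightarrow>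
     (\<forall>x\<in>U. f differentiable (at x)) \<and>
     (\<forall>v. C_k_on k U (\<lambda>x. frechet_derivative f (at x) v))"

definition smooth_on_sphere :: "('a::euclidean_space \<Rightarrow> real) \<Rightarrow> bool" where
  "smooth_on_sphere f \<longleftrightarrow>
     (\<exists>U F. open U \<and> sphere 0 1 \<subseteq> U \<and> (\<forall>k. C_k_on k U F) \<and> (\<forall>q\<in>sphere 0 1. F q = f q))"


section \<open>Riemannian geometry of the round unit sphere\<close>

definition tproj :: "'a::euclidean_space \<Rightarrow> 'a \<Rightarrow> 'a" where
  "tproj q v = v - (v \<bullet> q) *\<^sub>R q"

text \<open>
  Derivative at \<open>q\<close> along the curve \<open>s \<mapsto> (q + s w) / |q + s w|\<close>, which lies in the sphere and has
  initial velocity \<open>w\<close> when \<open>w\<close> is tangent at \<open>q\<close>.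
\<close>

definition sderiv :: "('a::euclidean_space \<Rightarrow> 'b::real_normed_vector) \<Rightarrow> 'a \<Rightarrow> 'a \<Rightarrow> 'b" where
  "sderiv F q w = vector_derivative (\<lambda>s. F ((q + s *\<^sub>R w) /\<^sub>R norm (q + s *\<^sub>R w))) (at 0)"

text \<open>
  The Riemannian gradient: the tangent vector at \<open>q\<close> whose inner product with each tangent vector
  \<open>w\<close> is \<open>df(w)\<close>.  Expanding \<open>w = tproj q w\<close> in the ambient orthonormal basis gives the formula.
\<close>

definition sgrad :: "('a::euclidean_space \<Rightarrow> real) \<Rightarrow> 'a \<Rightarrow> 'a" where
  "sgrad f q = (\<Sum>b\<in>Basis. sderiv f q (tproj q b) *\<^sub>R b)"

text \<open>
  The Levi-Civita connection of the induced metric is the tangential part of the ambient derivative.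
\<close>

definition cov_deriv :: "('a::euclidean_space \<Rightarrow> 'a) \<Rightarrow> 'a \<Rightarrow> 'a \<Rightarrow> 'a" where
  "cov_deriv X q w = tproj q (sderiv X q w)"

text \<open>
  The divergence is the trace of \<open>w \<mapsto> \<nabla>\<^sub>w X\<close> on the tangent space; composing with the orthogonal
  projection onto the tangent space, it may be computed in the ambient orthonormal basis.
\<close>

definition sdiv :: "('a::euclidean_space \<Rightarrow> 'a) \<Rightarrow> 'a \<Rightarrow> real" where
  "sdiv X q = (\<Sum>b\<in>Basis. cov_deriv X q (tproj q b) \<bullet> b)"

definition laplace_beltrami :: "('a::euclidean_space \<Rightarrow> real) \<Rightarrow> 'a \<Rightarrow> real" where
  "laplace_beltrami f = sdiv (sgrad f)"

text \<open>
  Riemannian volume: the measure of \<open>A\<close> is \<open>DIM('a)\<close> times the Lebesgue measure of the cone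
  \<open>{s q | q \<in> A, 0 < s \<le> 1}\<close>, as Lebesgue measure is \<open>s\<^bsup>DIM('a) - 1\<^esup> ds\<close> times the volume in polar
  coordinates.
\<close>

definition sphere_vol :: "'a::euclidean_space measure" where
  "sphere_vol = scale_measure (of_nat DIM('a))
     (distr (restrict_space lborel (cball 0 1 - {0})) (restrict_space borel (sphere 0 1))
        (\<lambda>x. x /\<^sub>R norm x))"


section \<open>The sub-Laplacian and its heat kernel\<close>

definition fibre_deriv :: "quat \<Rightarrow> ('n::finite hvec \<Rightarrow> real) \<Rightarrow> 'n hvec \<Rightarrow> real" where
  "fibre_deriv S f q = deriv (\<lambda>\<theta>. f (hact (qexp (\<theta> *\<^sub>R S)) q)) 0"

definition sub_laplacian :: "('n::finite hvec \<Rightarrow> real) \<Rightarrow> 'n hvec \<Rightarrow> real" where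
  "sub_laplacian f q = laplace_beltrami f q
     - fibre_deriv qI (fibre_deriv qI f) q
     - fibre_deriv qJ (fibre_deriv qJ f) q
     - fibre_deriv qK (fibre_deriv qK f) q"

text \<open>
  \<open>P t = e\<^sup>t\<^sup>L\<close> as a strongly continuous semigroup of bounded operators on the space of continuous
  functions on the sphere with the supremum norm, whose generator extends \<open>L\<close> on smooth functions.
  The smooth functions form a core (\<open>L\<close> is symmetric and hypoelliptic), so this determines \<open>P\<close>.
\<close>

definition is_sub_heat_semigroup ::
  "(real \<Rightarrow> ('n::finite hvec \<Rightarrow> real) \<Rightarrow> 'n hvec \<Rightarrow> real) \<Rightarrow> bool" where
  "is_sub_heat_semigroup P \<longleftrightarrow>
     (let S = sphere 0 1; C = {f. continuous_on S f} in
      (\<forall>t\<ge>0. \<forall>f\<in>C. P t f \<in> C) \<and>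
      (\<forall>t\<ge>0. \<forall>f\<in>C. \<forall>g\<in>C. \<forall>a b. \<forall>q\<in>S.
         P t (\<lambda>x. a * f x + b * g x) q = a * P t f q + b * P t g q) \<and>
      (\<forall>t\<ge>0. \<exists>M. \<forall>f\<in>C. \<forall>c. (\<forall>q\<in>S. \<bar>f q\<bar> \<le> c) \<longrightarrow> (\<forall>q\<in>S. \<bar>P t f q\<bar> \<le> M * c)) \<and>
      (\<forall>f\<in>C. \<forall>q\<in>S. P 0 f q = f q) \<and>
      (\<forall>s\<ge>0. \<forall>t\<ge>0. \<forall>f\<in>C. \<forall>q\<in>S. P (s + t) f q = P s (P t f) q) \<and>
      (\<forall>f\<in>C. uniform_limit S (\<lambda>t. P t f) f (at_right 0)) \<and>
      (\<forall>f. smooth_on_sphere f \<longrightarrow>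
         uniform_limit S (\<lambda>t q. (P t f q - f q) / t) (sub_laplacian f) (at_right 0)))"

definition is_subelliptic_heat_kernel :: "(real \<Rightarrow> 'n::finite hvec \<Rightarrow> real) \<Rightarrow> bool" where
  "is_subelliptic_heat_kernel p \<longleftrightarrow>
     (\<exists>P. is_sub_heat_semigroup P \<and>
        (\<forall>t>0. continuous_on (sphere 0 1) (p t) \<and>
           (\<forall>f. continuous_on (sphere 0 1) f \<longrightarrow>
              P t f north_pole = (\<integral>q. p t q * f q \<partial>sphere_vol))))"

end

theory Submission
  imports Defs "HOL-Probability.Probability" "HOL-Real_Asymp.Real_Asymp"
begin

text \<open>
  Put \<open>N = 2n + 1\<close> and let \<open>T\<^sub>k\<close> be the Chebyshev polynomials.  The zonal spherical harmonic
  \<open>T\<^sub>k\<^bsup>(N)\<^esup>(x \<bullet> w)\<close> splits into eigenfunctions of the sub-Laplacian with eigenvalues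
  \<open>-(k\<^sup>2 - N\<^sup>2) + m (m + 2)\<close>.  The factors \<open>exp ((m + 1)\<^sup>2 t)\<close> are Gaussian moments of hyperbolic sines, so
  summation over \<open>k\<close> along an approximate identity yields, for small \<open>t\<close>,
  \<open>p\<^sub>t(w) = c\<^sub>t \<integral> exp (- y\<^sup>2 / 4t) y sinh y \<Theta>\<^sub>t\<^bsup>(N)\<^esup>(cos r cosh y) dy\<close>, where
  \<open>\<Theta>\<^sub>t = 1 + 2 \<Sum>\<^sub>k exp (- k\<^sup>2 t) T\<^sub>k\<close>.

  By Poisson summation \<open>\<surd>(t / \<pi>) \<Theta>\<^sub>t(cos d)\<close> is asymptotic to \<open>exp (- d\<^sup>2 / 4t)\<close>, so Laplace's method at
  \<open>y = 0\<close> handles the integral with \<open>\<Theta>\<^sub>t\<close> in place of its derivative.  By the Jacobi triple product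
  \<open>\<Theta>\<^sub>t\<close> is a limit of products of linear factors increasing on \<open>[-1, \<infinity>)\<close>, so all its derivatives are
  nonnegative there, and \<open>\<Theta>\<^sub>t\<^bsup>(N)\<^esup>\<close> can be squeezed between finite differences with steps of order \<open>t\<close>.
\<close>

section \<open>Chebyshev polynomials\<close>

text \<open>Removing the fibre directions multiplies the fibre component m by exp (m (m + 2) t), so
  the spectral expansion carries growing factors. Writing these as moments amounts to moving along
  the fibre in an imaginary direction: Theta is then read at cos r cosh y, beyond 1 for large y, and
  cos r < 1 is the margin by which the Gaussian outweighs its growth there for small t. The kernel
  is known only through the action of the semigroup, evaluated at one point. Its value at w is
  recovered by testing it against zonal polynomials that concentrate at w and on which the semigroup
  is explicit. The choice of N makes the N-th derivative of T_k a Gegenbauer polynomial of the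
  sphere of dimension 2N + 1 = 4n + 3. A step of order t changes the exponent d^2 / 4t by a bounded
  amount. With beta = r / (2 sin r) the difference quotients with step t sigma have limits
  proportional to ((exp (beta sigma) - 1) / sigma)^N, and sigma -> 0 leaves beta^N: hence the power
  of r / sin r. The other constant is the second moment of a Gaussian with exponent - (1 - r cot r)
  v^2 / 4, hence the power 3/2.\<close>

fun cheb :: "nat \<Rightarrow> real poly" where
  "cheb 0 = 1"
| "cheb (Suc 0) = [:0, 1:]"
| "cheb (Suc (Suc k)) = [:0, 2:] * cheb (Suc k) - cheb k"

lemma cheb_cos: "poly (cheb k) (cos x) = cos (real k * x)"
proof (induction k rule: cheb.induct)
  case (3 k)
  have "cos (real (Suc (Suc k)) * x) = 2 * cos x * cos (real (Suc k) * x) - cos (real k * x)"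
  proof -
    have "real (Suc (Suc k)) * x = real (Suc k) * x + x" "real k * x = real (Suc k) * x - x"
      by (simp_all add: algebra_simps)
    then show ?thesis by (simp only: cos_add cos_diff) (simp add: algebra_simps)
  qed
  with 3 show ?case by simp
qed auto

lemma cheb_cosh: "poly (cheb k) (cosh x) = cosh (real k * x)"
proof (induction k rule: cheb.induct)
  case (3 k)
  have "cosh (real (Suc (Suc k)) * x) = 2 * cosh x * cosh (real (Suc k) * x) - cosh (real k * x)"
  proof -
    have "real (Suc (Suc k)) * x = real (Suc k) * x + x" "real k * x = real (Suc k) * x - x"
      by (simp_all add: algebra_simps)
    then show ?thesis by (simp only: cosh_add cosh_diff) (simp add: algebra_simps)
  qed
  with 3 show ?case by simp
qed auto

lemma degree_cheb: "degree (cheb k) \<le> k"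
proof (induction k rule: cheb.induct)
  case (3 k)
  have "degree ([:0, 2:] * cheb (Suc k)) \<le> Suc (Suc k)"
    using 3(1) by (intro degree_mult_le[THEN order_trans]) auto
  moreover have "degree (cheb k) \<le> Suc (Suc k)" using 3(2) by simp
  ultimately show ?case by (simp add: degree_diff_le del: mult_pCons_left)
qed auto

text \<open>The points cos x with sin x nonzero fill (-1, 1). Leaving out the zeros of the sine
  permits cancelling the factor sin x that differentiating T_k(cos x) produces.\<close>

lemma poly_eqI_cos:
  fixes p q :: "real poly"
  assumes "\<And>x. sin x \<noteq> 0 \<Longrightarrow> poly p (cos x) = poly q (cos x)"
  shows "p = q"
proof (rule ccontr)
  assume "p \<noteq> q"
  then have nz: "p - q \<noteq> 0" by simp
  have "{-1<..<1::real} \<subseteq> {x. poly (p - q) x = 0}"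
  proof
    fix y :: real assume y: "y \<in> {-1<..<1}"
    then have "cos (arccos y) = y" by (intro cos_arccos) auto
    moreover have "sin (arccos y) \<noteq> 0" using y by (intro sin_arccos_nonzero) auto
    ultimately show "y \<in> {x. poly (p - q) x = 0}" using assms[of "arccos y"] by simp
  qed
  with poly_roots_finite[OF nz] have "finite {-1<..<1::real}" by (rule finite_subset[rotated])
  then show False by (simp add: infinite_Ioo)
qed

text \<open>Both sides are, up to sign, the derivative of T_k(cos x) = cos (k x).\<close>

lemma poly_pderiv_cheb_cos: "poly (pderiv (cheb k)) (cos x) * sin x = real k * sin (real k * x)"
proof -
  have f: "(\<lambda>x. poly (cheb k) (cos x)) = (\<lambda>x. cos (real k * x))" by (simp add: cheb_cos)
  have d1: "((\<lambda>x. poly (cheb k) (cos x)) has_real_derivative poly (pderiv (cheb k)) (cos x) * (- sin x)) (at x)" for x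
    by (rule DERIV_chain2[OF poly_DERIV]) (auto intro!: derivative_eq_intros)
  have d1': "((\<lambda>x. cos (real k * x)) has_real_derivative - real k * sin (real k * x)) (at x)" for x
    by (auto intro!: derivative_eq_intros)
  show ?thesis using DERIV_unique[OF d1[unfolded f] d1'] by simp
qed

text \<open>A second differentiation of T_k(cos x) = cos (k x), rewritten in terms of cos x.\<close>

lemma cheb_ode:
  "[:1, 0, -1:] * pderiv (pderiv (cheb k)) - [:0, 1:] * pderiv (cheb k) + smult ((real k)\<^sup>2) (cheb k) = 0"
proof (rule poly_eqI_cos)
  fix x :: real
  let ?T = "cheb k"
  have "((\<lambda>x. poly (pderiv ?T) (cos x)) has_real_derivative poly (pderiv (pderiv ?T)) (cos x) * (- sin x)) (at x)"
    by (rule DERIV_chain2[OF poly_DERIV]) (auto intro!: derivative_eq_intros)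
  then have d2: "((\<lambda>x. poly (pderiv ?T) (cos x) * sin x) has_real_derivative
      poly (pderiv (pderiv ?T)) (cos x) * (- sin x) * sin x + poly (pderiv ?T) (cos x) * cos x) (at x)"
    by (auto intro!: derivative_eq_intros)
  have d2': "((\<lambda>x. real k * sin (real k * x)) has_real_derivative real k * (real k * cos (real k * x))) (at x)"
    by (auto intro!: derivative_eq_intros)
  have e: "poly (pderiv (pderiv ?T)) (cos x) * (- sin x) * sin x + poly (pderiv ?T) (cos x) * cos x
      = real k * (real k * cos (real k * x))"
    using DERIV_unique[OF d2[unfolded poly_pderiv_cheb_cos] d2'] .
  have s: "1 - cos x * cos x = sin x * sin x"
    using sin_squared_eq[of x] by (simp add: power2_eq_square)
  have "poly ([:1, 0, -1:] * pderiv (pderiv ?T) - [:0, 1:] * pderiv ?T + smult ((real k)\<^sup>2) ?T) (cos x)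
      = (1 - cos x * cos x) * poly (pderiv (pderiv ?T)) (cos x)
      - cos x * poly (pderiv ?T) (cos x) + real k * real k * cos (real k * x)"
    by (simp add: cheb_cos algebra_simps power2_eq_square)
  also have "\<dots> = poly 0 (cos x)" using e unfolding s by (simp add: algebra_simps)
  finally show "poly ([:1, 0, -1:] * pderiv (pderiv ?T) - [:0, 1:] * pderiv ?T + smult ((real k)\<^sup>2) ?T) (cos x)
      = poly 0 (cos x)" .
qed

lemma coeff_cheb_rec:
  "real ((i + 2) * (i + 1)) * coeff (cheb k) (i + 2) = ((real i)\<^sup>2 - (real k)\<^sup>2) * coeff (cheb k) i"
proof -
  have *: "coeff ([:1, 0, -1:] * pderiv (pderiv (cheb k)) - [:0, 1:] * pderiv (cheb k) + smult ((real k)\<^sup>2) (cheb k)) i = 0"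
    by (simp only: cheb_ode coeff_0)
  consider "i = 0" | "i = 1" | j where "i = Suc (Suc j)" by (cases i; cases "i - 1") auto
  then show ?thesis
    by cases (use * in \<open>auto simp: coeff_pderiv algebra_simps power2_eq_square numeral_eq_Suc\<close>)
qed

text \<open>Coefficient form of the Gegenbauer equation (1 - x^2) p'' - (2N + 1) x p' + (k^2 - N^2)
  p = 0. It serves twice: with the sub-Laplacian it produces eigenfunctions, with the moments of the
  sphere it produces orthogonality to constants.\<close>

lemma coeff_higher_pderiv_cheb_rec:
  "real ((i + 2) * (i + 1)) * coeff ((pderiv ^^ N) (cheb k)) (i + 2)
   = (real i * (real i + 2 * real N) + (real N)\<^sup>2 - (real k)\<^sup>2) * coeff ((pderiv ^^ N) (cheb k)) i"
proof -
  let ?P = "\<lambda>a n. pochhammer (a::real) n"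
  have 1: "?P (real i + 1) (N + 2) = ?P (real i + 1) N * (real i + 1 + real N) * (real i + 2 + real N)"
    by (simp add: pochhammer_Suc algebra_simps)
  have 2: "?P (real i + 1) (N + 2) = (real i + 1) * (real i + 2) * ?P (real i + 3) N"
    by (simp add: pochhammer_rec algebra_simps)
  have "real ((i + 2) * (i + 1)) * coeff ((pderiv ^^ N) (cheb k)) (i + 2)
     = (real i + 1) * (real i + 2) * ?P (real i + 3) N * coeff (cheb k) (i + N + 2)"
    by (simp add: coeff_higher_pderiv algebra_simps)
  also have "\<dots> = ?P (real i + 1) N * (real ((i + N + 2) * (i + N + 1)) * coeff (cheb k) (i + N + 2))"
    unfolding 2[symmetric] 1 by (simp add: algebra_simps)
  also have "\<dots> = ?P (real i + 1) N * (((real (i + N))\<^sup>2 - (real k)\<^sup>2) * coeff (cheb k) (i + N))"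
    by (subst coeff_cheb_rec) simp
  finally show ?thesis
    by (simp add: coeff_higher_pderiv algebra_simps power2_eq_square)
qed

text \<open>Derivatives of Chebyshev polynomials stay in the cone they span, which controls their size.\<close>

inductive cheb_cone :: "real poly \<Rightarrow> bool" where
  zero: "cheb_cone 0"
| basis: "cheb_cone (cheb k)"
| add: "cheb_cone p \<Longrightarrow> cheb_cone q \<Longrightarrow> cheb_cone (p + q)"
| smult: "c \<ge> 0 \<Longrightarrow> cheb_cone p \<Longrightarrow> cheb_cone (smult c p)"

text \<open>In the form T_{k+2}' / (k + 2) - T_k' / k = 2 T_{k+1} this is the identity sin ((k + 2)
  x) - sin (k x) = 2 cos ((k + 1) x) sin x. The nonnegative coefficients keep derivatives inside the
  cone; the division by k forces k = 0 to be treated separately.\<close>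

lemma pderiv_cheb_rec:
  assumes "k > 0"
  shows "pderiv (cheb (Suc (Suc k)))
    = smult (2 * (real k + 2)) (cheb (Suc k)) + smult ((real k + 2) / real k) (pderiv (cheb k))"
proof (rule poly_eqI_cos)
  fix x :: real
  assume s: "sin x \<noteq> 0"
  have "sin (real (Suc (Suc k)) * x) = 2 * cos (real (Suc k) * x) * sin x + sin (real k * x)"
  proof -
    have "real (Suc (Suc k)) * x = real (Suc k) * x + x" "real k * x = real (Suc k) * x - x"
      by (simp_all add: algebra_simps)
    then show ?thesis by (simp only: sin_add sin_diff)
  qed
  then have "poly (pderiv (cheb (Suc (Suc k)))) (cos x) * sin x
     = real (Suc (Suc k)) * (2 * cos (real (Suc k) * x) * sin x + sin (real k * x))"
    by (simp only: poly_pderiv_cheb_cos)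
  also have "\<dots> = 2 * (real k + 2) * poly (cheb (Suc k)) (cos x) * sin x
      + (real k + 2) / real k * (poly (pderiv (cheb k)) (cos x) * sin x)"
    unfolding poly_pderiv_cheb_cos cheb_cos using assms by (simp add: field_simps)
  finally have "poly (pderiv (cheb (Suc (Suc k)))) (cos x) * sin x = 
     (2 * (real k + 2) * poly (cheb (Suc k)) (cos x) + (real k + 2) / real k * poly (pderiv (cheb k)) (cos x)) * sin x"
    by (simp only: algebra_simps)
  then show "poly (pderiv (cheb (Suc (Suc k)))) (cos x) = 
     poly (smult (2 * (real k + 2)) (cheb (Suc k)) + smult ((real k + 2) / real k) (pderiv (cheb k))) (cos x)"
    using s by (simp only: mult_cancel_right) simp
qed

lemma cheb_cone_pderiv_cheb: "cheb_cone (pderiv (cheb k))"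
proof (induction k rule: cheb.induct)
  case 2
  have "pderiv (cheb (Suc 0)) = cheb 0" by (simp add: pderiv_pCons one_pCons)
  then show ?case by (metis cheb_cone.basis)
next
  case (3 k)
  show ?case
  proof (cases "k = 0")
    case True
    have "pderiv (cheb (Suc (Suc 0))) = smult 4 (cheb 1)"
      by (simp add: pderiv_pCons one_pCons pderiv_diff pderiv_1 numeral_poly)
    then show ?thesis using True cheb_cone.basis cheb_cone.smult by (metis zero_le_numeral)
  next
    case False
    then show ?thesis
      using 3 by (simp only: pderiv_cheb_rec) (intro cheb_cone.intros; simp)
  qed
qed (simp add: cheb_cone.zero)

lemma cheb_cone_pderiv: "cheb_cone p \<Longrightarrow> cheb_cone (pderiv p)"
  by (induction rule: cheb_cone.induct)
    (auto intro: cheb_cone.intros cheb_cone_pderiv_cheb simp: pderiv_add pderiv_smult)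

lemma cheb_cone_higher_pderiv: "cheb_cone p \<Longrightarrow> cheb_cone ((pderiv ^^ n) p)"
  by (induction n) (auto intro: cheb_cone_pderiv)

lemma cosh_arcosh_ex:
  fixes x :: real assumes "1 \<le> x"
  obtains y where "0 \<le> y" "x = cosh y"
  using that[of "arcosh x"] assms by (simp add: arcosh_nonneg_real)

lemma cheb_ge_1: 
  assumes "1 \<le> x" shows "1 \<le> poly (cheb k) x"
  using assms by (elim cosh_arcosh_ex) (simp add: cheb_cosh cosh_real_ge_1)

lemma cheb_abs_le_1: 
  assumes "\<bar>x\<bar> \<le> 1" shows "\<bar>poly (cheb k) x\<bar> \<le> 1"
proof -
  have "x = cos (arccos x)" using assms by (intro cos_arccos[symmetric]) auto
  then show ?thesis by (metis abs_cos_le_one cheb_cos)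
qed

lemma cheb_minus: "poly (cheb k) (- x) = (-1) ^ k * poly (cheb k) x"
  by (induction k rule: cheb.induct) (auto simp: algebra_simps)

lemma cheb_cone_nonneg: "cheb_cone p \<Longrightarrow> 1 \<le> x \<Longrightarrow> 0 \<le> poly p x"
  by (induction rule: cheb_cone.induct) (auto intro: order_trans[OF _ cheb_ge_1])

lemma cheb_abs_le: "\<bar>poly (cheb k) x\<bar> \<le> poly (cheb k) (max 1 \<bar>x\<bar>)"
proof (cases "\<bar>x\<bar> \<le> 1")
  case True
  then have "\<bar>poly (cheb k) x\<bar> \<le> 1" by (rule cheb_abs_le_1)
  also have "\<dots> \<le> poly (cheb k) (max 1 \<bar>x\<bar>)" by (rule cheb_ge_1) simp
  finally show ?thesis .
next
  case False
  have "\<bar>poly (cheb k) x\<bar> = \<bar>poly (cheb k) \<bar>x\<bar>\<bar>"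
    by (auto simp: abs_if[of x] cheb_minus abs_mult power_abs)
  then show ?thesis using cheb_ge_1[of "\<bar>x\<bar>" k] False by (simp add: max_def)
qed

lemma cheb_cone_abs_le: "cheb_cone p \<Longrightarrow> \<bar>poly p x\<bar> \<le> poly p (max 1 \<bar>x\<bar>)"
proof (induction rule: cheb_cone.induct)
  case (basis k)
  then show ?case by (rule cheb_abs_le)
next
  case (add p q)
  then show ?case using abs_triangle_ineq[of "poly p x" "poly q x"] by simp
next
  case (smult c p)
  then show ?case by (simp add: abs_mult mult_left_mono)
qed simp

lemma cheb_cone_mono:
  assumes "cheb_cone p" "1 \<le> x" "x \<le> y"
  shows "poly p x \<le> poly p y"
proof (rule DERIV_nonneg_imp_nondecreasing[OF assms(3)])
  fix z assume "x \<le> z"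
  with assms show "\<exists>d. (poly p has_real_derivative d) (at z) \<and> 0 \<le> d"
    by (meson poly_DERIV cheb_cone_nonneg[OF cheb_cone_pderiv] order_trans)
qed

text \<open>The derivative lies in the cone too, hence increases beyond 1, so the increment over
  [x, x + h] dominates h p'(x). This plays the part of a Cauchy estimate: derivatives are traded for
  a shift of the argument.\<close>

lemma cheb_cone_pderiv_le:
  assumes "cheb_cone p" "1 \<le> x" "0 < h"
  shows "poly (pderiv p) x \<le> poly p (x + h) / h"
proof -
  obtain z where z: "x < z" "z < x + h" "poly p (x + h) - poly p x = (x + h - x) * poly (pderiv p) z"
    using poly_MVT[of x "x + h" p] assms by auto
  have "poly (pderiv p) x \<le> poly (pderiv p) z"
    using z assms by (intro cheb_cone_mono cheb_cone_pderiv) auto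
  moreover have "0 \<le> poly p x" using assms by (intro cheb_cone_nonneg)
  ultimately show ?thesis using z(3) assms(3) by (simp add: field_simps) (smt (verit) mult_left_mono)
qed

lemma cheb_cone_higher_pderiv_le:
  assumes "cheb_cone p" "1 \<le> x" "0 < h"
  shows "poly ((pderiv ^^ n) p) x \<le> poly p (x + real n * h) / h ^ n"
  using assms(2)
proof (induction n arbitrary: x)
  case (Suc n)
  have "poly ((pderiv ^^ Suc n) p) x \<le> poly ((pderiv ^^ n) p) (x + h) / h"
    using Suc.prems assms by (simp add: cheb_cone_pderiv_le cheb_cone_higher_pderiv)
  also have "\<dots> \<le> poly p (x + h + real n * h) / h ^ n / h"
    using Suc assms by (intro divide_right_mono Suc) auto
  finally show ?case by (simp add: algebra_simps)
qed simp

lemma higher_pderiv_cheb_abs_le: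
  assumes "0 < h"
  shows "\<bar>poly ((pderiv ^^ n) (cheb k)) x\<bar> \<le> poly (cheb k) (max 1 \<bar>x\<bar> + real n * h) / h ^ n"
  by (rule order_trans[OF cheb_cone_abs_le cheb_cone_higher_pderiv_le])
    (auto intro: cheb_cone_higher_pderiv cheb_cone.basis assms)

section \<open>The Laplace--Beltrami operator on homogeneous functions\<close>

lemma tproj_inner_right: "tproj q v \<bullet> w = v \<bullet> tproj q w"
  by (simp add: tproj_def inner_diff_left inner_diff_right inner_commute)

lemma tproj_tangent: "norm q = 1 \<Longrightarrow> tproj q v \<bullet> q = 0"
  by (simp add: tproj_def inner_diff_left norm_eq_1)

lemma tangent_curve_nonzero:
  assumes "norm q = 1" "w \<bullet> q = 0"
  shows "q + s *\<^sub>R w \<noteq> 0"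
proof
  assume "q + s *\<^sub>R w = 0"
  then have "(q + s *\<^sub>R w) \<bullet> q = 0" by simp
  with assms show False by (simp add: inner_add_left norm_eq_1)
qed

text \<open>The defining curve stays on the sphere because q + s w never vanishes for tangent w.
  This matters since the spherical gradient is identified only on the sphere itself.\<close>

lemma sderiv_cong:
  assumes "\<And>x. norm x = 1 \<Longrightarrow> F x = G x" "norm q = 1" "w \<bullet> q = 0"
  shows "sderiv F q w = sderiv G q w"
proof -
  have "F ((q + s *\<^sub>R w) /\<^sub>R norm (q + s *\<^sub>R w)) = G ((q + s *\<^sub>R w) /\<^sub>R norm (q + s *\<^sub>R w))" for s
    using tangent_curve_nonzero[OF assms(2,3), of s] by (intro assms(1)) simp
  then show ?thesis by (simp add: sderiv_def)
qed

text \<open>For tangent w the derivative of |q + s w| vanishes at s = 0, so the normalisation drops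
  out to first order.\<close>

lemma sderiv_eq:
  fixes q :: "'a::euclidean_space"
  assumes "(F has_derivative F') (at q)" "norm q = 1" "w \<bullet> q = 0"
  shows "sderiv F q w = F' w"
proof -
  define c where "c s = (q + s *\<^sub>R w) /\<^sub>R norm (q + s *\<^sub>R w)" for s
  have "((\<lambda>s. q + s *\<^sub>R w) has_derivative (\<lambda>s. s *\<^sub>R w)) (at 0)"
    by (auto intro!: derivative_eq_intros)
  moreover have "(norm has_derivative (\<lambda>v. v \<bullet> sgn q)) (at (q + 0 *\<^sub>R w))"
  proof -
    have "q \<noteq> 0" using assms(2) by auto
    then show ?thesis using has_derivative_norm by simp
  qed
  ultimately have "((\<lambda>s. norm (q + s *\<^sub>R w)) has_derivative (\<lambda>s. s * (sgn q \<bullet> w))) (at 0)"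
    by (rule has_derivative_compose[THEN has_derivative_eq_rhs]) (simp add: inner_commute)
  then have n: "((\<lambda>s. norm (q + s *\<^sub>R w)) has_derivative (\<lambda>s. 0)) (at 0)"
    using assms(2,3) by (simp add: sgn_div_norm inner_commute)
  have i: "((\<lambda>s. inverse (norm (q + s *\<^sub>R w))) has_derivative (\<lambda>s. 0)) (at 0)"
    using assms(2) by (auto intro!: derivative_eq_intros n)
  have "((\<lambda>s. q + s *\<^sub>R w) has_derivative (\<lambda>s. s *\<^sub>R w)) (at 0)"
    by (auto intro!: derivative_eq_intros)
  from has_derivative_scaleR[OF i this] have "(c has_derivative (\<lambda>s. s *\<^sub>R w)) (at 0)"
    using assms(2) by (simp add: c_def[abs_def])
  moreover have "(F has_derivative F') (at (c 0))" using assms(1,2) by (simp add: c_def)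
  ultimately have "((\<lambda>s. F (c s)) has_derivative (\<lambda>s. F' (s *\<^sub>R w))) (at 0)"
    by (rule has_derivative_compose)
  then have "((\<lambda>s. F (c s)) has_vector_derivative F' w) (at 0)"
    using assms(1) by (simp add: has_vector_derivative_def linear_scale has_derivative_linear)
  then show ?thesis unfolding sderiv_def c_def[symmetric] by (rule vector_derivative_at)
qed

text \<open>With B the symmetric projection \<open>tproj q\<close>, the left side is the trace of B
  A B. Since B annihilates exactly the direction q, only the normal entry is lost.\<close>

lemma sum_tproj_Basis:
  fixes q :: "'a::euclidean_space"
  assumes "linear A" "norm q = 1"
  shows "(\<Sum>b\<in>Basis. tproj q (A (tproj q b)) \<bullet> b) = (\<Sum>b\<in>Basis. A b \<bullet> b) - A q \<bullet> q"
proof -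
  have q: "(\<Sum>b\<in>Basis. (b \<bullet> q) *\<^sub>R b) = q"
    using euclidean_representation[of q] by (simp add: inner_commute)
  have "(\<Sum>b\<in>Basis. tproj q (A (tproj q b)) \<bullet> b) =
      (\<Sum>b\<in>Basis. A b \<bullet> b - (b \<bullet> q) * (A q \<bullet> b) - A b \<bullet> ((b \<bullet> q) *\<^sub>R q) + (A q \<bullet> q) * ((b \<bullet> q) * (b \<bullet> q)))"
    using assms(1) by (intro sum.cong refl)
      (simp add: tproj_inner_right tproj_def linear_diff linear_scale inner_diff_left inner_diff_right inner_commute algebra_simps)
  also have "\<dots> = (\<Sum>b\<in>Basis. A b \<bullet> b) - A q \<bullet> (\<Sum>b\<in>Basis. (b \<bullet> q) *\<^sub>R b)
     - A (\<Sum>b\<in>Basis. (b \<bullet> q) *\<^sub>R b) \<bullet> q + (A q \<bullet> q) * (q \<bullet> (\<Sum>b\<in>Basis. (b \<bullet> q) *\<^sub>R b))"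
    using assms(1)
    by (simp add: sum.distrib sum_subtractf inner_sum_right inner_sum_left linear_sum linear_scale
        sum_distrib_left inner_commute mult.commute)
  finally show ?thesis using assms(2) by (simp add: q norm_eq_1)
qed

text \<open>The tangential gradient extends to the ambient field \<open>X\<close>. Its tangential
  trace consists of the trace of the ambient Hessian, less the normal second derivative, less dim -
  1 times the normal derivative; the last is the mean curvature term of the unit sphere.\<close>

lemma laplace_beltrami_eq:
  fixes q :: "'a::euclidean_space"
  assumes F: "\<And>x. (F has_derivative (\<lambda>v. g x \<bullet> v)) (at x)"
    and g: "\<And>x. (g has_derivative A x) (at x)" and q: "norm q = 1"
  shows "laplace_beltrami F q
    = (\<Sum>b\<in>Basis. A q b \<bullet> b) - A q q \<bullet> q - (real DIM('a) - 1) * (g q \<bullet> q)"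
proof -
  define X where "X x = g x - (g x \<bullet> x) *\<^sub>R x" for x
  have grad: "sgrad F x = X x" if x: "norm x = 1" for x
  proof -
    have "sgrad F x = (\<Sum>b\<in>Basis. (g x \<bullet> tproj x b) *\<^sub>R b)"
      unfolding sgrad_def by (intro sum.cong refl arg_cong2[where f = scaleR] sderiv_eq[OF F x] tproj_tangent x)
    also have "\<dots> = tproj x (g x)"
      by (simp add: tproj_inner_right[symmetric] euclidean_representation)
    finally show ?thesis by (simp add: X_def tproj_def)
  qed
  define X' where "X' w = A q w - ((A q w \<bullet> q + g q \<bullet> w) *\<^sub>R q + (g q \<bullet> q) *\<^sub>R w)" for w
  have X': "(X has_derivative X') (at q)"
    unfolding X_def[abs_def] X'_def[abs_def]
    by (auto intro!: derivative_eq_intros g simp: algebra_simps)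
  have lin: "linear (A q)" using g has_derivative_linear by blast
  have sd: "sderiv (sgrad F) q (tproj q b) = X' (tproj q b)" for b
  proof -
    have "sderiv (sgrad F) q (tproj q b) = sderiv X q (tproj q b)"
      using q by (intro sderiv_cong grad tproj_tangent) auto
    also have "\<dots> = X' (tproj q b)" using q by (intro sderiv_eq X' tproj_tangent)
    finally show ?thesis .
  qed
  have "tproj q (X' w) = tproj q (A q w) - (g q \<bullet> q) *\<^sub>R tproj q w" for w
    using q by (simp add: X'_def tproj_def inner_diff_left inner_add_left norm_eq_1 algebra_simps)
  then have "laplace_beltrami F q = (\<Sum>b\<in>Basis. tproj q (A q (tproj q b)) \<bullet> b)
     - (g q \<bullet> q) * (\<Sum>b\<in>Basis. tproj q (tproj q b) \<bullet> b)"
    by (simp add: laplace_beltrami_def sdiv_def cov_deriv_def sd inner_diff_left sum_subtractf sum_distrib_left)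
  also have "(\<Sum>b\<in>Basis. tproj q (tproj q b) \<bullet> b) = real DIM('a) - 1"
    using sum_tproj_Basis[of "\<lambda>x. x" q] q by (simp add: norm_eq_1 linear_id[unfolded id_def])
  also have "(\<Sum>b\<in>Basis. tproj q (A q (tproj q b)) \<bullet> b) = (\<Sum>b\<in>Basis. A q b \<bullet> b) - A q q \<bullet> q"
    by (rule sum_tproj_Basis[OF lin q])
  finally show ?thesis by (simp add: mult.commute)
qed

text \<open>Differentiating Euler's relation in the direction q gives d (d - 1) F q for the normal
  second derivative; with the normal derivative d F q this makes the radial constant d (d + dim -
  2).\<close>

lemma laplace_beltrami_homogeneous:
  fixes q :: "'a::euclidean_space"
  assumes F: "\<And>x. (F has_derivative (\<lambda>v. g x \<bullet> v)) (at x)"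
    and g: "\<And>x. (g has_derivative A x) (at x)" and q: "norm q = 1"
    and euler: "\<And>x. g x \<bullet> x = d * F x"
  shows "laplace_beltrami F q = (\<Sum>b\<in>Basis. A q b \<bullet> b) - d * (d + real DIM('a) - 2) * F q"
proof -
  have "((\<lambda>x. g x \<bullet> x) has_derivative (\<lambda>v. A q v \<bullet> q + g q \<bullet> v)) (at q)"
    by (auto intro!: derivative_eq_intros g)
  moreover have "((\<lambda>x. d * F x) has_derivative (\<lambda>v. d * (g q \<bullet> v))) (at q)"
    by (auto intro!: derivative_eq_intros F)
  ultimately have "(\<lambda>v. A q v \<bullet> q + g q \<bullet> v) = (\<lambda>v. d * (g q \<bullet> v))"
    unfolding euler by (rule has_derivative_unique)
  then have "A q q \<bullet> q + g q \<bullet> q = d * (g q \<bullet> q)" by (rule fun_cong)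
  then show ?thesis
    using euler[of q] by (subst laplace_beltrami_eq[OF F g q]) (simp add: algebra_simps)
qed

section \<open>Polynomial functions are smooth on the sphere\<close>

lemma real_polynomial_function_derivative:
  fixes f :: "'a::euclidean_space \<Rightarrow> real"
  assumes "real_polynomial_function f"
  shows "\<exists>f'. (\<forall>v. real_polynomial_function (\<lambda>x. f' x v)) \<and> (\<forall>x. (f has_derivative f' x) (at x))"
  using assms
proof (induction rule: real_polynomial_function.induct)
  case (linear f)
  then show ?case
    by (intro exI[of _ "\<lambda>x. f"]) (auto intro: real_polynomial_function.intros bounded_linear_imp_has_derivative)
next
  case (const c)
  show ?case by (intro exI[of _ "\<lambda>x v. 0"]) (auto intro: real_polynomial_function.intros)
next
  case (add f g)
  then obtain f' g' where "\<forall>v. real_polynomial_function (\<lambda>x. f' x v)" "\<forall>x. (f has_derivative f' x) (at x)"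
     "\<forall>v. real_polynomial_function (\<lambda>x. g' x v)" "\<forall>x. (g has_derivative g' x) (at x)" by blast
  then show ?case
    by (intro exI[of _ "\<lambda>x v. f' x v + g' x v"])
      (auto intro: real_polynomial_function.intros has_derivative_add)
next
  case (mult f g)
  then obtain f' g' where "\<forall>v. real_polynomial_function (\<lambda>x. f' x v)" "\<forall>x. (f has_derivative f' x) (at x)"
     "\<forall>v. real_polynomial_function (\<lambda>x. g' x v)" "\<forall>x. (g has_derivative g' x) (at x)" by blast
  then show ?case using mult(1,2)
    by (intro exI[of _ "\<lambda>x v. f x * g' x v + f' x v * g x"])
      (auto intro!: real_polynomial_function.intros(3,4) has_derivative_mult)
qed

lemma C_k_on_real_polynomial_function:
  "real_polynomial_function f \<Longrightarrow> C_k_on k UNIV f"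
proof (induction k arbitrary: f)
  case 0
  then show ?case by (simp add: continuous_on_polymonial_function real_polynomial_function_eq)
next
  case (Suc k)
  obtain f' where f': "\<And>v. real_polynomial_function (\<lambda>x. f' x v)" "\<And>x. (f has_derivative f' x) (at x)"
    using real_polynomial_function_derivative[OF Suc.prems] by blast
  have "frechet_derivative f (at x) = f' x" for x
    using frechet_derivative_at[OF f'(2)] by simp
  with f' Suc.IH show ?case by (auto simp: differentiable_def)
qed

lemma smooth_on_sphere_real_polynomial_function:
  "real_polynomial_function f \<Longrightarrow> smooth_on_sphere f"
  unfolding smooth_on_sphere_def using C_k_on_real_polynomial_function
  by (intro exI[of _ UNIV] exI[of _ f]) auto

section \<open>The quaternionic fibres\<close>

lemma qmult_scaleR_right: "qmult p (c *\<^sub>R q) = c *\<^sub>R qmult p q"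
  by (simp add: qmult_def algebra_simps)

lemma qmult_add_left: "qmult (p + r) q = qmult p q + qmult r q"
  by (simp add: qmult_def algebra_simps)

lemma qmult_scaleR_left: "qmult (c *\<^sub>R p) q = c *\<^sub>R qmult p q"
  by (simp add: qmult_def algebra_simps)

lemma qmult_qone: "qmult qone q = q" "qmult p qone = p"
  by (simp_all add: qmult_def qone_def)

abbreviation qunits :: "quat set" where "qunits \<equiv> {qI, qJ, qK}"

lemma qmult_qunit_sq: "S \<in> qunits \<Longrightarrow> qmult S (qmult S p) = - p"
  by (auto simp: qmult_def qI_def qJ_def qK_def prod_eq_iff complex_eq_iff)

lemma qmult_qunit_inner: "S \<in> qunits \<Longrightarrow> qmult S p \<bullet> qmult S q = p \<bullet> q"
  by (auto simp: qmult_def qI_def qJ_def qK_def inner_prod_def inner_complex_def)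

lemma qmult_power_even:
  assumes "S \<in> qunits"
  shows "(qmult (\<theta> *\<^sub>R S) ^^ (2 * k)) p = ((-1) ^ k * \<theta> ^ (2 * k)) *\<^sub>R p"
proof (induction k)
  case (Suc k)
  have *: "(qmult (\<theta> *\<^sub>R S) ^^ (2 * Suc k)) p = qmult (\<theta> *\<^sub>R S) (qmult (\<theta> *\<^sub>R S) ((qmult (\<theta> *\<^sub>R S) ^^ (2 * k)) p))"
    by simp
  show ?case
    unfolding * Suc using assms by (simp add: qmult_scaleR_left qmult_scaleR_right qmult_qunit_sq)
qed simp

lemma qexp_qunit:
  assumes "S \<in> qunits"
  shows "qexp (\<theta> *\<^sub>R S) = cos \<theta> *\<^sub>R qone + sin \<theta> *\<^sub>R S"
proof -
  have term_eq: "(qmult (\<theta> *\<^sub>R S) ^^ n) qone /\<^sub>R fact n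
      = (cos_coeff n * \<theta> ^ n) *\<^sub>R qone + (sin_coeff n * \<theta> ^ n) *\<^sub>R S" for n
  proof (cases "even n")
    case True
    then obtain k where "n = 2 * k" by (elim evenE)
    then show ?thesis using qmult_power_even[OF assms, of k \<theta> qone]
      by (simp add: cos_coeff_def sin_coeff_def field_simps)
  next
    case False
    then obtain k where "n = Suc (2 * k)" by (auto elim: oddE)
    then show ?thesis using qmult_power_even[OF assms, of k \<theta> qone]
      by (simp add: cos_coeff_def sin_coeff_def field_simps qmult_scaleR_left qmult_scaleR_right qmult_qone)
  qed
  have "(\<lambda>n. (qmult (\<theta> *\<^sub>R S) ^^ n) qone /\<^sub>R fact n) sums (cos \<theta> *\<^sub>R qone + sin \<theta> *\<^sub>R S)"
    unfolding term_eq using cos_converges[of \<theta>] sin_converges[of \<theta>]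
    by (intro sums_add sums_scaleR_left) auto
  then show ?thesis by (simp add: qexp_def sums_iff)
qed

lemma hact_qexp:
  "S \<in> qunits \<Longrightarrow> hact (qexp (\<theta> *\<^sub>R S)) x = cos \<theta> *\<^sub>R x + sin \<theta> *\<^sub>R hact S x"
  by (simp add: qexp_qunit hact_def qmult_add_left qmult_scaleR_left qmult_qone prod_eq_iff vec_eq_iff)

lemma hact_qunit_sq: "S \<in> qunits \<Longrightarrow> hact S (hact S x) = - x"
  by (simp add: hact_def qmult_qunit_sq prod_eq_iff vec_eq_iff)

lemma hact_qunit_inner: "S \<in> qunits \<Longrightarrow> hact S x \<bullet> hact S y = x \<bullet> y"
  by (simp add: hact_def inner_prod_def inner_vec_def qmult_qunit_inner[unfolded inner_prod_def])

text \<open>An isometry whose square is -1 is skew.\<close>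

lemma hact_qunit_skew: 
  assumes "S \<in> qunits" shows "hact S x \<bullet> y = - (x \<bullet> hact S y)"
  using hact_qunit_inner[OF assms, of x "hact S y"] hact_qunit_sq[OF assms, of y] by simp

lemma hact_qunit_mult:
  "hact qI (hact qJ x) = hact qK x" "hact qJ (hact qK x) = hact qI x" "hact qK (hact qI x) = hact qJ x"
  "hact qJ (hact qI x) = - hact qK x" "hact qK (hact qJ x) = - hact qI x" "hact qI (hact qK x) = - hact qJ x"
  by (simp_all add: hact_def qmult_def qI_def qJ_def qK_def prod_eq_iff vec_eq_iff complex_eq_iff)

lemma hact_qunit_orth: 
  assumes "S \<in> qunits" shows "hact S x \<bullet> x = 0"
  using hact_qunit_skew[OF assms, of x x] by (simp add: inner_commute)

lemma hact_qunits_orth: 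
  "hact qI x \<bullet> hact qJ x = 0" "hact qJ x \<bullet> hact qK x = 0" "hact qI x \<bullet> hact qK x = 0"
  using hact_qunit_orth[of qK x] hact_qunit_orth[of qJ x] hact_qunit_orth[of qI x]
  by (simp_all add: hact_qunit_skew hact_qunit_mult inner_commute)

text \<open>
  The squared norm of the quaternion \<open>\<Sum>\<^sub>i x\<^sub>i cnj w\<^sub>i\<close>, whose real part is \<open>x \<bullet> w\<close>.
\<close>

definition qnorm2 :: "'n::finite hvec \<Rightarrow> 'n hvec \<Rightarrow> real" where
  "qnorm2 w x = (x \<bullet> w)\<^sup>2 + (\<Sum>S\<in>qunits. (x \<bullet> hact S w)\<^sup>2)"

text \<open>For a unit vector w this is the orthogonal projection onto the quaternionic line through
  w, with orthonormal basis w, I w, J w, K w. Twice this vector is the gradient of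
  \<open>qnorm2 w\<close>.\<close>

definition qproj :: "'n::finite hvec \<Rightarrow> 'n hvec \<Rightarrow> 'n hvec" where
  "qproj w x = (x \<bullet> w) *\<^sub>R w + (\<Sum>S\<in>qunits. (x \<bullet> hact S w) *\<^sub>R hact S w)"

lemma qunits_distinct: "qI \<noteq> qJ" "qI \<noteq> qK" "qJ \<noteq> qK"
  by (auto simp: qI_def qJ_def qK_def complex_eq_iff)

lemma sum_qunits: "(\<Sum>S\<in>qunits. f S) = f qI + f qJ + f qK"
  using qunits_distinct by (simp add: add.assoc)

text \<open>The numbers x . w and x . \<open>hact S w\<close> over the three units form two pairs,
  each of which is rotated by the one-parameter group of S. Hence the sum of the four squares is
  constant along the fibre.\<close>

lemma fibre_curve:
  assumes "S \<in> qunits"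
  shows "(cos \<theta> *\<^sub>R x + sin \<theta> *\<^sub>R hact S x) \<bullet> w = cos \<theta> * (x \<bullet> w) - sin \<theta> * (x \<bullet> hact S w)"
    and "(cos \<theta> *\<^sub>R x + sin \<theta> *\<^sub>R hact S x) \<bullet> hact S w = cos \<theta> * (x \<bullet> hact S w) + sin \<theta> * (x \<bullet> w)"
    and "qnorm2 w (cos \<theta> *\<^sub>R x + sin \<theta> *\<^sub>R hact S x) = qnorm2 w x"
proof -
  show "(cos \<theta> *\<^sub>R x + sin \<theta> *\<^sub>R hact S x) \<bullet> w = cos \<theta> * (x \<bullet> w) - sin \<theta> * (x \<bullet> hact S w)"
    "(cos \<theta> *\<^sub>R x + sin \<theta> *\<^sub>R hact S x) \<bullet> hact S w = cos \<theta> * (x \<bullet> hact S w) + sin \<theta> * (x \<bullet> w)"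
    using assms by (simp_all add: inner_add_left hact_qunit_skew[OF assms, of x w] hact_qunit_inner)
  have rot: "(cos \<theta> * u - sin \<theta> * v)\<^sup>2 + (cos \<theta> * v + sin \<theta> * u)\<^sup>2 = u\<^sup>2 + v\<^sup>2" for u v :: real
  proof -
    have "(cos \<theta> * u - sin \<theta> * v)\<^sup>2 + (cos \<theta> * v + sin \<theta> * u)\<^sup>2 = ((sin \<theta>)\<^sup>2 + (cos \<theta>)\<^sup>2) * (u\<^sup>2 + v\<^sup>2)"
      by algebra
    then show ?thesis by simp
  qed
  have rot': "(cos \<theta> * v + sin \<theta> * u)\<^sup>2 + (cos \<theta> * u - sin \<theta> * v)\<^sup>2 = u\<^sup>2 + v\<^sup>2" for u v :: real
    using rot[of u v] by simp
  consider "S = qI" | "S = qJ" | "S = qK" using assms by auto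
  then show "qnorm2 w (cos \<theta> *\<^sub>R x + sin \<theta> *\<^sub>R hact S x) = qnorm2 w x"
  proof cases
    case 1
    then show ?thesis
      using rot[of "x \<bullet> w" "x \<bullet> hact qI w"] rot[of "x \<bullet> hact qJ w" "x \<bullet> hact qK w"]
      by (simp add: qnorm2_def sum_qunits inner_add_left hact_qunit_skew hact_qunit_mult hact_qunit_sq)
  next
    case 2
    then show ?thesis
      using rot[of "x \<bullet> w" "x \<bullet> hact qJ w"] rot[of "x \<bullet> hact qK w" "x \<bullet> hact qI w"]
      by (simp add: qnorm2_def sum_qunits inner_add_left hact_qunit_skew hact_qunit_mult hact_qunit_sq)
  next
    case 3
    then show ?thesis
      using rot[of "x \<bullet> w" "x \<bullet> hact qK w"] rot[of "x \<bullet> hact qI w" "x \<bullet> hact qJ w"]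
      by (simp add: qnorm2_def sum_qunits inner_add_left hact_qunit_skew hact_qunit_mult hact_qunit_sq)
  qed
qed

text \<open>Along a fibre \<open>qnorm2 w x\<close> is constant, so only the argument x . w is
  differentiated and the polynomial may depend on this parameter in any way.\<close>

lemma fibre_deriv_class_function:
  fixes p :: "real \<Rightarrow> real poly" and w :: "'n::finite hvec"
  assumes "S \<in> qunits"
  defines "F \<equiv> \<lambda>x. poly (p (qnorm2 w x)) (x \<bullet> w)"
  shows "fibre_deriv S (fibre_deriv S F) x
    = (x \<bullet> hact S w)\<^sup>2 * poly (pderiv (pderiv (p (qnorm2 w x)))) (x \<bullet> w)
      - (x \<bullet> w) * poly (pderiv (p (qnorm2 w x))) (x \<bullet> w)"
proof -
  note curve = fibre_curve[OF assms(1)]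
  have 1: "fibre_deriv S F = (\<lambda>x. - (x \<bullet> hact S w) * poly (pderiv (p (qnorm2 w x))) (x \<bullet> w))"
  proof
    fix x :: "'n hvec"
    let ?q = "p (qnorm2 w x)"
    let ?z = "\<lambda>\<theta>. cos \<theta> * (x \<bullet> w) - sin \<theta> * (x \<bullet> hact S w)"
    have "((\<lambda>\<theta>. poly ?q (?z \<theta>)) has_real_derivative poly (pderiv ?q) (?z 0) * (- (x \<bullet> hact S w))) (at 0)"
      by (rule DERIV_chain2[OF poly_DERIV]) (auto intro!: derivative_eq_intros)
    then show "fibre_deriv S F x = - (x \<bullet> hact S w) * poly (pderiv ?q) (x \<bullet> w)"
      unfolding fibre_deriv_def F_def hact_qexp[OF assms(1)] curve by (simp add: DERIV_imp_deriv)
  qed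
  let ?q = "pderiv (p (qnorm2 w x))"
  let ?z = "\<lambda>\<theta>. cos \<theta> * (x \<bullet> w) - sin \<theta> * (x \<bullet> hact S w)"
  have "((\<lambda>\<theta>. poly ?q (?z \<theta>)) has_real_derivative poly (pderiv ?q) (?z 0) * (- (x \<bullet> hact S w))) (at 0)"
    by (rule DERIV_chain2[OF poly_DERIV]) (auto intro!: derivative_eq_intros)
  then have "((\<lambda>\<theta>. - (cos \<theta> * (x \<bullet> hact S w) + sin \<theta> * (x \<bullet> w)) * poly ?q (?z \<theta>)) has_real_derivative
      - (x \<bullet> w) * poly ?q (x \<bullet> w) + (x \<bullet> hact S w) * ((x \<bullet> hact S w) * poly (pderiv ?q) (x \<bullet> w))) (at 0)"
    by (auto intro!: derivative_eq_intros)
  then show ?thesis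
    unfolding 1 unfolding fibre_deriv_def hact_qexp[OF assms(1)] curve(2) unfolding curve(1,3)
    by (simp add: DERIV_imp_deriv power2_eq_square)
qed

lemma qproj_simps:
  assumes "norm w = 1"
  shows "qproj w x \<bullet> x = qnorm2 w x" "qproj w x \<bullet> w = x \<bullet> w" "qproj w x \<bullet> qproj w x = qnorm2 w x"
proof -
  have n: "w \<bullet> w = 1" using assms by (simp add: norm_eq_1)
  have o: "w \<bullet> hact qI w = 0" "w \<bullet> hact qJ w = 0" "w \<bullet> hact qK w = 0"
    using hact_qunit_orth[of _ w] by (auto simp: inner_commute)
  show "qproj w x \<bullet> x = qnorm2 w x"
    by (simp add: qproj_def qnorm2_def sum_qunits inner_add_left inner_add_right inner_commute power2_eq_square)
  show "qproj w x \<bullet> w = x \<bullet> w"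
    by (simp add: qproj_def sum_qunits inner_add_left n hact_qunit_orth)
  show "qproj w x \<bullet> qproj w x = qnorm2 w x"
    using hact_qunits_orth[of w]
    by (simp add: qproj_def qnorm2_def sum_qunits inner_add_left inner_add_right n o hact_qunit_orth
        hact_qunit_inner inner_commute power2_eq_square)
qed

text \<open>The solid zonal harmonics of degree \<open>m\<close> on \<open>\<bbbH>\<close>, with the squared norm as parameter.\<close>

fun zonal :: "real \<Rightarrow> nat \<Rightarrow> real poly" where
  "zonal s 0 = 1"
| "zonal s (Suc 0) = [:0, 2:]"
| "zonal s (Suc (Suc m)) = [:0, 2:] * zonal s (Suc m) - smult s (zonal s m)"

text \<open>First-order relation between consecutive zonal polynomials. It supplies the
  first-derivative term that arises when the second-order equation is pushed through the three-term
  recurrence.\<close>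

lemma pderiv_zonal:
  "(s - a\<^sup>2) * poly (pderiv (zonal s (Suc m))) a
   = - (real m + 1) * a * poly (zonal s (Suc m)) a + (real m + 2) * s * poly (zonal s m) a"
proof (induction m rule: induct_nat_012)
  case (ge2 m)
  have *: "(s - a\<^sup>2) * poly (pderiv (zonal s (Suc (Suc (Suc m))))) a
     = 2 * (s - a\<^sup>2) * poly (zonal s (Suc (Suc m))) a
     + 2 * a * ((s - a\<^sup>2) * poly (pderiv (zonal s (Suc (Suc m)))) a) - s * ((s - a\<^sup>2) * poly (pderiv (zonal s (Suc m))) a)"
    by (simp add: pderiv_diff pderiv_mult pderiv_pCons pderiv_smult algebra_simps del: mult_pCons_left)
  show ?case unfolding * ge2 by (simp add: algebra_simps power2_eq_square)
qed (simp_all add: pderiv_diff pderiv_mult pderiv_pCons pderiv_smult pderiv_1 algebra_simps power2_eq_square)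

text \<open>Up to powers of sqrt s, \<open>zonal s m\<close> is the Chebyshev polynomial U_m of the
  second kind, and m (m + 2) is its eigenvalue on the three-sphere. The induction is polynomial in s
  and so covers the degenerate case s = 0.\<close>

lemma zonal_ode:
  "(s - a\<^sup>2) * poly (pderiv (pderiv (zonal s m))) a - 3 * a * poly (pderiv (zonal s m)) a
   = - real m * (real m + 2) * poly (zonal s m) a"
proof (induction m rule: induct_nat_012)
  case (ge2 m)
  have *: "(s - a\<^sup>2) * poly (pderiv (pderiv (zonal s (Suc (Suc m))))) a - 3 * a * poly (pderiv (zonal s (Suc (Suc m)))) a
     = 2 * a * ((s - a\<^sup>2) * poly (pderiv (pderiv (zonal s (Suc m)))) a - 3 * a * poly (pderiv (zonal s (Suc m))) a)
     - s * ((s - a\<^sup>2) * poly (pderiv (pderiv (zonal s m))) a - 3 * a * poly (pderiv (zonal s m)) a)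
     + 4 * ((s - a\<^sup>2) * poly (pderiv (zonal s (Suc m))) a) - 6 * a * poly (zonal s (Suc m)) a"
    by (simp add: pderiv_diff pderiv_mult pderiv_add pderiv_pCons pderiv_smult algebra_simps del: mult_pCons_left)
  show ?case unfolding * ge2 pderiv_zonal by (simp add: algebra_simps)
qed (simp_all add: pderiv_pCons pderiv_1)

text \<open>Hyperbolic form of U_m(cos y) sin y = sin ((m + 1) y). Reading the zonal polynomial at
  rho cosh y instead of rho replaces its value by a hyperbolic sine, whose Gaussian moments are
  explicit.\<close>

lemma zonal_cosh: "poly (zonal (\<rho>\<^sup>2) m) (\<rho> * cosh y) * sinh y = \<rho> ^ m * sinh ((real m + 1) * y)"
proof (induction m rule: induct_nat_012)
  case 1
  then show ?case using sinh_double[of y] by (simp add: algebra_simps)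
next
  case (ge2 m)
  have "sinh ((real (Suc (Suc m)) + 1) * y) = 2 * cosh y * sinh ((real (Suc m) + 1) * y) - sinh ((real m + 1) * y)"
  proof -
    have "(real (Suc (Suc m)) + 1) * y = (real (Suc m) + 1) * y + y"
      "(real m + 1) * y = (real (Suc m) + 1) * y - y" by (simp_all add: algebra_simps)
    then show ?thesis by (simp only: sinh_add sinh_diff) (simp add: algebra_simps)
  qed
  moreover have "poly (zonal (\<rho>\<^sup>2) (Suc (Suc m))) (\<rho> * cosh y) * sinh y
    = 2 * \<rho> * cosh y * (poly (zonal (\<rho>\<^sup>2) (Suc m)) (\<rho> * cosh y) * sinh y)
      - \<rho>\<^sup>2 * (poly (zonal (\<rho>\<^sup>2) m) (\<rho> * cosh y) * sinh y)"
    by (simp add: algebra_simps)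
  ultimately show ?case by (simp only: ge2) (simp add: algebra_simps power2_eq_square)
qed simp

lemma zonal_diag: "poly (zonal (\<rho>\<^sup>2) m) \<rho> = (real m + 1) * \<rho> ^ m"
  by (induction m rule: induct_nat_012) (simp_all add: algebra_simps power2_eq_square)

section \<open>Zonal harmonics of the sub-Laplacian\<close>

text \<open>Bundles a gradient with the trace of its derivative, the Euclidean Laplacian of F, so
  that recurrences for F pass through sums and products without handling Hessians.\<close>

definition lap_data :: "('a::euclidean_space \<Rightarrow> real) \<Rightarrow> ('a \<Rightarrow> 'a) \<Rightarrow> ('a \<Rightarrow> real) \<Rightarrow> bool" where
  "lap_data F g l \<longleftrightarrow> (\<forall>x. (F has_derivative (\<lambda>v. g x \<bullet> v)) (at x)) \<and>
     (\<exists>A. (\<forall>x. (g has_derivative A x) (at x)) \<and> (\<forall>x. (\<Sum>b\<in>Basis. A x b \<bullet> b) = l x))"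

lemma lap_data_add:
  assumes "lap_data F g l" "lap_data F' g' l'"
  shows "lap_data (\<lambda>x. F x + F' x) (\<lambda>x. g x + g' x) (\<lambda>x. l x + l' x)"
proof -
  from assms obtain A A' where A: "\<And>x. (g has_derivative A x) (at x)" "\<And>x. (\<Sum>b\<in>Basis. A x b \<bullet> b) = l x"
     "\<And>x. (g' has_derivative A' x) (at x)" "\<And>x. (\<Sum>b\<in>Basis. A' x b \<bullet> b) = l' x"
    and F: "\<And>x. (F has_derivative (\<lambda>v. g x \<bullet> v)) (at x)" "\<And>x. (F' has_derivative (\<lambda>v. g' x \<bullet> v)) (at x)"
    unfolding lap_data_def by blast
  show ?thesis
    unfolding lap_data_def
  proof (intro conjI allI exI)
    fix x
    show "((\<lambda>x. F x + F' x) has_derivative (\<lambda>v. (g x + g' x) \<bullet> v)) (at x)"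
      unfolding inner_add_left by (intro has_derivative_add F)
    show "((\<lambda>x. g x + g' x) has_derivative (\<lambda>v. A x v + A' x v)) (at x)"
      by (intro has_derivative_add A)
    show "(\<Sum>b\<in>Basis. (A x b + A' x b) \<bullet> b) = l x + l' x"
      by (simp add: inner_add_left sum.distrib A)
  qed
qed

lemma lap_data_mult:
  assumes "lap_data F g l" "lap_data F' g' l'"
  shows "lap_data (\<lambda>x. F x * F' x) (\<lambda>x. F x *\<^sub>R g' x + F' x *\<^sub>R g x)
    (\<lambda>x. F x * l' x + F' x * l x + 2 * (g x \<bullet> g' x))"
proof -
  from assms obtain A A' where A: "\<And>x. (g has_derivative A x) (at x)" "\<And>x. (\<Sum>b\<in>Basis. A x b \<bullet> b) = l x"
     "\<And>x. (g' has_derivative A' x) (at x)" "\<And>x. (\<Sum>b\<in>Basis. A' x b \<bullet> b) = l' x"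
    and F: "\<And>x. (F has_derivative (\<lambda>v. g x \<bullet> v)) (at x)" "\<And>x. (F' has_derivative (\<lambda>v. g' x \<bullet> v)) (at x)"
    unfolding lap_data_def by blast
  show ?thesis
    unfolding lap_data_def
  proof (intro conjI allI exI)
    fix x
    show "((\<lambda>x. F x * F' x) has_derivative (\<lambda>v. (F x *\<^sub>R g' x + F' x *\<^sub>R g x) \<bullet> v)) (at x)"
      by (rule has_derivative_eq_rhs[OF has_derivative_mult[OF F]]) (simp add: inner_add_left mult.commute)
    show "((\<lambda>x. F x *\<^sub>R g' x + F' x *\<^sub>R g x) has_derivative
       (\<lambda>v. F x *\<^sub>R A' x v + (g x \<bullet> v) *\<^sub>R g' x + (F' x *\<^sub>R A x v + (g' x \<bullet> v) *\<^sub>R g x))) (at x)"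
      by (intro has_derivative_add has_derivative_scaleR F A(1,3))
    have "(\<Sum>b\<in>Basis. (F x *\<^sub>R A' x b + (g x \<bullet> b) *\<^sub>R g' x + (F' x *\<^sub>R A x b + (g' x \<bullet> b) *\<^sub>R g x)) \<bullet> b)
      = F x * (\<Sum>b\<in>Basis. A' x b \<bullet> b) + F' x * (\<Sum>b\<in>Basis. A x b \<bullet> b)
        + 2 * (\<Sum>b\<in>Basis. (g x \<bullet> b) * (g' x \<bullet> b))"
      by (simp add: inner_add_left sum.distrib sum_distrib_left mult.commute)
    then show "(\<Sum>b\<in>Basis. (F x *\<^sub>R A' x b + (g x \<bullet> b) *\<^sub>R g' x + (F' x *\<^sub>R A x b + (g' x \<bullet> b) *\<^sub>R g x)) \<bullet> b)
      = F x * l' x + F' x * l x + 2 * (g x \<bullet> g' x)"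
      unfolding euclidean_inner[of "g x" "g' x"] by (simp add: A)
  qed
qed

lemma lap_data_const: "lap_data (\<lambda>x. c) (\<lambda>x. 0) (\<lambda>x. 0)"
proof -
  have "((\<lambda>x. c) has_derivative (\<lambda>v. 0 \<bullet> v)) (at x)" for x :: 'a
    by (rule has_derivative_eq_rhs[OF has_derivative_const]) simp
  then show ?thesis
    unfolding lap_data_def by (intro conjI allI exI[of _ "\<lambda>x v. 0"]) (fact | simp)+
qed

lemma lap_data_inner: "lap_data (\<lambda>x. x \<bullet> w) (\<lambda>x. w) (\<lambda>x. 0)"
proof -
  have "((\<lambda>x. x \<bullet> w) has_derivative (\<lambda>v. w \<bullet> v)) (at x)" for x
    using bounded_linear_imp_has_derivative[OF bounded_linear_inner_left, of w "at x"]
    by (rule has_derivative_eq_rhs) (simp add: fun_eq_iff inner_commute)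
  then show ?thesis
    unfolding lap_data_def by (intro conjI allI exI[of _ "\<lambda>x v. 0"]) (fact | simp)+
qed

lemma lap_data_inner_sq: "lap_data (\<lambda>x. (x \<bullet> w)\<^sup>2) (\<lambda>x. 2 *\<^sub>R (x \<bullet> w) *\<^sub>R w) (\<lambda>x. 2 * (w \<bullet> w))"
  using lap_data_mult[OF lap_data_inner[of w] lap_data_inner[of w]]
  by (simp add: power2_eq_square scaleR_left_distrib[symmetric])

lemma lap_data_cmult:
  assumes "lap_data F g l"
  shows "lap_data (\<lambda>x. c * F x) (\<lambda>x. c *\<^sub>R g x) (\<lambda>x. c * l x)"
  using lap_data_mult[OF lap_data_const[of c] assms] by simp

text \<open>Half the Hessian is the projection onto a space of real dimension four, whence 2 * 4 =
  8.\<close>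

lemma lap_data_qnorm2:
  fixes w :: "'n::finite hvec"
  assumes "norm w = 1"
  shows "lap_data (qnorm2 w) (\<lambda>x. 2 *\<^sub>R qproj w x) (\<lambda>x. 8)"
proof -
  have "w \<bullet> w = 1" using assms by (simp add: norm_eq_1)
  then have n: "hact S w \<bullet> hact S w = 1" if "S \<in> qunits" for S
    using that by (simp add: hact_qunit_inner)
  note * = lap_data_add[OF lap_data_inner_sq[of w] lap_data_add[OF lap_data_add[OF
      lap_data_inner_sq[of "hact qI w"] lap_data_inner_sq[of "hact qJ w"]] lap_data_inner_sq[of "hact qK w"]]]
  show ?thesis
    using * unfolding qnorm2_def[abs_def] qproj_def[abs_def] sum_qunits
    by (simp add: n \<open>w \<bullet> w = 1\<close> scaleR_add_right)
qed

text \<open>A zonal polynomial on the quaternionic line through w times a power of the squared norm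
  there: homogeneous of degree m + 2j, with fibre eigenvalue - m (m + 2). The sub-Laplacian changes
  only the index j.\<close>

definition solid :: "'n::finite hvec \<Rightarrow> nat \<Rightarrow> nat \<Rightarrow> 'n hvec \<Rightarrow> real" where
  "solid w m j x = qnorm2 w x ^ j * poly (zonal (qnorm2 w x) m) (x \<bullet> w)"

text \<open>The recurrence for \<open>zonal\<close> reduces harmonicity in degree m + 2 to 4 (w .
  g1) - 8 h0 - 4 (\<open>qproj w x\<close> . g0) = 0. The inner products of the gradient are
  therefore carried through the induction: Euler's relation, Euler's relation on the quaternionic
  line, and lowering of the degree in the direction w.\<close>

lemma solid_zonal_lap_data:
  fixes w :: "'n::finite hvec"
  assumes w: "norm w = 1"
  shows "\<exists>g. lap_data (solid w m 0) g (\<lambda>x. 0) \<and>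
     (\<forall>x. g x \<bullet> x = real m * solid w m 0 x) \<and>
     (\<forall>x. g x \<bullet> qproj w x = real m * solid w m 0 x) \<and>
     (\<forall>x. g x \<bullet> w = (real m + 1) * (if m = 0 then 0 else solid w (m - 1) 0 x))"
proof (induction m rule: induct_nat_012)
  case 0
  have "solid w 0 0 = (\<lambda>x. 1)" by (simp add: solid_def fun_eq_iff)
  then show ?case using lap_data_const[of 1] by (intro exI[of _ "\<lambda>x. 0"]) simp
next
  case 1
  have "solid w (Suc 0) 0 = (\<lambda>x. 2 * (x \<bullet> w))" by (simp add: solid_def fun_eq_iff)
  moreover have "w \<bullet> w = 1" using w by (simp add: norm_eq_1)
  ultimately show ?case using lap_data_cmult[OF lap_data_inner[of w], of 2] qproj_simps(2)[OF w]
    by (intro exI[of _ "\<lambda>x. 2 *\<^sub>R w"]) (simp add: solid_def inner_commute)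
next
  case (ge2 m)
  let ?h0 = "solid w m 0" and ?h1 = "solid w (Suc m) 0"
  from ge2 obtain g0 g1 where
    g0: "lap_data ?h0 g0 (\<lambda>x. 0)" "\<And>x. g0 x \<bullet> x = real m * ?h0 x" "\<And>x. g0 x \<bullet> qproj w x = real m * ?h0 x"
      "\<And>x. g0 x \<bullet> w = (real m + 1) * (if m = 0 then 0 else solid w (m - 1) 0 x)" and
    g1: "lap_data ?h1 g1 (\<lambda>x. 0)" "\<And>x. g1 x \<bullet> x = real (Suc m) * ?h1 x" "\<And>x. g1 x \<bullet> qproj w x = real (Suc m) * ?h1 x"
      "\<And>x. g1 x \<bullet> w = (real m + 2) * ?h0 x"
    by (auto simp: algebra_simps)
  define g where "g x = 2 *\<^sub>R ((x \<bullet> w) *\<^sub>R g1 x + ?h1 x *\<^sub>R w) + (-1) *\<^sub>R (qnorm2 w x *\<^sub>R g0 x + ?h0 x *\<^sub>R 2 *\<^sub>R qproj w x)" for x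
  have h: "solid w (Suc (Suc m)) 0 = (\<lambda>x. 2 * ((x \<bullet> w) * ?h1 x) + (-1) * (qnorm2 w x * ?h0 x))"
    by (simp add: solid_def fun_eq_iff)
  have "lap_data (solid w (Suc (Suc m)) 0) g
    (\<lambda>x. 2 * (2 * (w \<bullet> g1 x)) + (-1) * (?h0 x * 8 + 2 * (2 *\<^sub>R qproj w x \<bullet> g0 x)))"
    using lap_data_add[OF lap_data_cmult[OF lap_data_mult[OF lap_data_inner[of w] g1(1)], of 2]
       lap_data_cmult[OF lap_data_mult[OF lap_data_qnorm2[OF w] g0(1)], of "-1"]]
    unfolding h g_def[abs_def] by simp
  moreover have "2 * (2 * (w \<bullet> g1 x)) + (-1) * (?h0 x * 8 + 2 * (2 *\<^sub>R qproj w x \<bullet> g0 x)) = 0" for x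
    using g1(4)[of x] g0(3)[of x] by (simp add: inner_commute algebra_simps)
  ultimately have "lap_data (solid w (Suc (Suc m)) 0) g (\<lambda>x. 0)" by simp
  moreover have "g x \<bullet> x = real (Suc (Suc m)) * solid w (Suc (Suc m)) 0 x" for x
    unfolding h g_def using g0(2)[of x] g1(2)[of x]
    by (simp add: inner_add_left inner_diff_left qproj_simps[OF w] inner_commute[of w x]) (simp add: algebra_simps)
  moreover have "g x \<bullet> qproj w x = real (Suc (Suc m)) * solid w (Suc (Suc m)) 0 x" for x
    unfolding h g_def using g0(3)[of x] g1(3)[of x] qproj_simps(2)[OF w, of x]
    by (simp add: inner_add_left inner_diff_left qproj_simps[OF w] inner_commute[of w "qproj w x"]) (simp add: algebra_simps)
  moreover have "g x \<bullet> w = (real m + 3) * ?h1 x" for x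
  proof -
    have "g x \<bullet> w = 2 * ((x \<bullet> w) * ((real m + 2) * ?h0 x) + ?h1 x)
       - (qnorm2 w x * (g0 x \<bullet> w) + 2 * (?h0 x * (x \<bullet> w)))"
      using w by (simp add: g_def g1(4) inner_add_left inner_diff_left qproj_simps[OF w] norm_eq_1)
    also have "\<dots> = (real m + 3) * ?h1 x"
    proof (cases m)
      case (Suc k)
      then show ?thesis unfolding g0(4) by (simp add: solid_def algebra_simps)
    qed (simp add: g0(4) solid_def)
    finally show ?thesis .
  qed
  ultimately show ?case by (intro exI[of _ g]) (simp add: algebra_simps)
qed

text \<open>One more factor \<open>qnorm2 w\<close> adds 8 + 4 (m + 2j) to the coefficient 4j (m + j
  + 1), which makes 4 (j + 1) (m + j + 2). At j = 0 the coefficient vanishes, so the truncated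
  \<open>j - 1\<close> is harmless.\<close>

lemma solid_lap_data:
  fixes w :: "'n::finite hvec"
  assumes w: "norm w = 1"
  shows "\<exists>g. lap_data (solid w m j) g (\<lambda>x. 4 * real j * (real m + real j + 1) * solid w m (j - 1) x) \<and>
     (\<forall>x. g x \<bullet> x = (real m + 2 * real j) * solid w m j x) \<and>
     (\<forall>x. g x \<bullet> qproj w x = (real m + 2 * real j) * solid w m j x)"
proof (induction j)
  case 0
  then show ?case using solid_zonal_lap_data[OF w, of m] by auto
next
  case (Suc j)
  let ?h = "solid w m j"
  from Suc obtain g where
    g: "lap_data ?h g (\<lambda>x. 4 * real j * (real m + real j + 1) * solid w m (j - 1) x)"
      "\<And>x. g x \<bullet> x = (real m + 2 * real j) * ?h x" "\<And>x. g x \<bullet> qproj w x = (real m + 2 * real j) * ?h x"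
    by blast
  define g' where "g' x = qnorm2 w x *\<^sub>R g x + ?h x *\<^sub>R 2 *\<^sub>R qproj w x" for x
  have h: "solid w m (Suc j) = (\<lambda>x. qnorm2 w x * ?h x)"
    by (simp add: solid_def fun_eq_iff)
  have "lap_data (solid w m (Suc j)) g' (\<lambda>x. qnorm2 w x * (4 * real j * (real m + real j + 1) * solid w m (j - 1) x)
       + ?h x * 8 + 2 * (2 *\<^sub>R qproj w x \<bullet> g x))"
    using lap_data_mult[OF lap_data_qnorm2[OF w] g(1)] unfolding h g'_def[abs_def] .
  moreover have "qnorm2 w x * (4 * real j * (real m + real j + 1) * solid w m (j - 1) x)
       + ?h x * 8 + 2 * (2 *\<^sub>R qproj w x \<bullet> g x) = 4 * real (Suc j) * (real m + real (Suc j) + 1) * ?h x" for x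
  proof -
    have "qnorm2 w x * (4 * real j * (real m + real j + 1) * solid w m (j - 1) x) = 4 * real j * (real m + real j + 1) * ?h x"
      by (cases j) (simp_all add: solid_def)
    then show ?thesis using g(3)[of x] by (simp add: inner_commute algebra_simps)
  qed
  ultimately have "lap_data (solid w m (Suc j)) g' (\<lambda>x. 4 * real (Suc j) * (real m + real (Suc j) + 1) * solid w m (Suc j - 1) x)"
    by simp
  moreover have "g' x \<bullet> x = (real m + 2 * real (Suc j)) * solid w m (Suc j) x"
    "g' x \<bullet> qproj w x = (real m + 2 * real (Suc j)) * solid w m (Suc j) x" for x
    unfolding h g'_def using g(2,3)[of x] by (simp_all add: inner_add_left qproj_simps[OF w] algebra_simps)
  ultimately show ?case by (intro exI[of _ g']) simp
qed

text \<open>The spherical formula in degree m + 2j and ambient dimension 4n + 4, with the fibre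
  eigenvalue - m (m + 2) subtracted. The result is triangular in j and preserves m, so
  eigenfunctions are sought as sums over j with m fixed.\<close>

lemma sub_laplacian_solid:
  fixes w :: "'n::finite hvec"
  assumes w: "norm w = 1" and x: "norm x = 1"
  shows "sub_laplacian (solid w m j) x = 4 * real j * (real m + real j + 1) * solid w m (j - 1) x
    - (4 * real j * (real m + real j + 1) + 4 * real CARD('n) * (real m + 2 * real j)) * solid w m j x"
proof -
  obtain g where g: "lap_data (solid w m j) g (\<lambda>x. 4 * real j * (real m + real j + 1) * solid w m (j - 1) x)"
     "\<And>x. g x \<bullet> x = (real m + 2 * real j) * solid w m j x"
    using solid_lap_data[OF w] by blast
  then obtain A where A: "\<And>x. (g has_derivative A x) (at x)"
    "\<And>x. (\<Sum>b\<in>Basis. A x b \<bullet> b) = 4 * real j * (real m + real j + 1) * solid w m (j - 1) x"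
    "\<And>x. (solid w m j has_derivative (\<lambda>v. g x \<bullet> v)) (at x)"
    unfolding lap_data_def by blast
  let ?d = "real m + 2 * real j"
  have lb: "laplace_beltrami (solid w m j) x = 4 * real j * (real m + real j + 1) * solid w m (j - 1) x
     - ?d * (?d + real DIM('n hvec) - 2) * solid w m j x"
    by (subst laplace_beltrami_homogeneous[OF A(3,1) x g(2)]) (simp add: A(2))
  let ?p = "\<lambda>s. smult (s ^ j) (zonal s m)"
  let ?s = "qnorm2 w x" and ?a = "x \<bullet> w"
  have F: "solid w m j = (\<lambda>x. poly (?p (qnorm2 w x)) (x \<bullet> w))"
    by (simp add: solid_def fun_eq_iff)
  have fd: "fibre_deriv S (fibre_deriv S (solid w m j)) x = (x \<bullet> hact S w)\<^sup>2 * (?s ^ j * poly (pderiv (pderiv (zonal ?s m))) ?a)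
      - ?a * (?s ^ j * poly (pderiv (zonal ?s m)) ?a)" if "S \<in> qunits" for S
    unfolding F using fibre_deriv_class_function[OF that, of ?p w x] by (simp only: pderiv_smult poly_smult)
  have s: "?s - ?a\<^sup>2 = (x \<bullet> hact qI w)\<^sup>2 + (x \<bullet> hact qJ w)\<^sup>2 + (x \<bullet> hact qK w)\<^sup>2"
    by (simp add: qnorm2_def sum_qunits)
  have "fibre_deriv qI (fibre_deriv qI (solid w m j)) x + fibre_deriv qJ (fibre_deriv qJ (solid w m j)) x
      + fibre_deriv qK (fibre_deriv qK (solid w m j)) x
      = ?s ^ j * ((?s - ?a\<^sup>2) * poly (pderiv (pderiv (zonal ?s m))) ?a - 3 * ?a * poly (pderiv (zonal ?s m)) ?a)"
    unfolding s using fd[of qI] fd[of qJ] fd[of qK] by (simp add: algebra_simps)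
  also have "\<dots> = - real m * (real m + 2) * solid w m j x"
    unfolding zonal_ode by (simp add: solid_def)
  finally show ?thesis
    unfolding sub_laplacian_def lb by (simp add: algebra_simps)
qed

lemma real_polynomial_function_solid: "real_polynomial_function (solid w m j)"
proof -
  have lin: "real_polynomial_function (\<lambda>x. x \<bullet> v)" for v :: "'a hvec"
    by (intro real_polynomial_function.intros(1) bounded_linear_inner_left)
  have sq: "real_polynomial_function (\<lambda>x. (x \<bullet> v)\<^sup>2)" for v :: "'a hvec"
    unfolding power2_eq_square by (intro real_polynomial_function.intros(4) lin)
  have s: "real_polynomial_function (qnorm2 w)"
    unfolding qnorm2_def[abs_def] sum_qunits by (intro real_polynomial_function.intros(3) sq)
  have "real_polynomial_function (solid w m 0)"
  proof (induction m rule: induct_nat_012)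
    case 0
    have "solid w 0 0 = (\<lambda>x. 1)" by (simp add: solid_def fun_eq_iff)
    then show ?case by (simp add: real_polynomial_function.intros(2))
  next
    case 1
    have "solid w (Suc 0) 0 = (\<lambda>x. 2 * (x \<bullet> w))" by (simp add: solid_def fun_eq_iff)
    then show ?case using lin by (simp add: real_polynomial_function.intros(2,4))
  next
    case (ge2 m)
    have "solid w (Suc (Suc m)) 0 = (\<lambda>x. 2 * ((x \<bullet> w) * solid w (Suc m) 0 x) + (-1) * (qnorm2 w x * solid w m 0 x))"
      by (simp add: solid_def fun_eq_iff)
    then show ?case using ge2 lin s by (simp only:) (intro real_polynomial_function.intros(2-4); assumption)
  qed
  then show ?thesis
  proof (induction j)
    case (Suc j)
    have "solid w m (Suc j) = (\<lambda>x. qnorm2 w x * solid w m j x)" by (simp add: solid_def fun_eq_iff)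
    then show ?case using Suc s by (simp add: real_polynomial_function.intros(4))
  qed
qed

section \<open>Eigenfunctions of the semigroup\<close>

locale sub_heat =
  fixes P :: "real \<Rightarrow> ('n::finite hvec \<Rightarrow> real) \<Rightarrow> 'n hvec \<Rightarrow> real"
  assumes semigroup: "is_sub_heat_semigroup P"
begin

abbreviation "S \<equiv> sphere (0 :: 'n hvec) 1"

lemma
  shows P_cont: "0 \<le> t \<Longrightarrow> continuous_on S f \<Longrightarrow> continuous_on S (P t f)"
    and P_lin: "0 \<le> t \<Longrightarrow> continuous_on S f \<Longrightarrow> continuous_on S g \<Longrightarrow> q \<in> S \<Longrightarrow>
         P t (\<lambda>x. a * f x + b * g x) q = a * P t f q + b * P t g q"
    and P_bnd: "0 \<le> t \<Longrightarrow> \<exists>M. \<forall>f c. continuous_on S f \<longrightarrow> (\<forall>q\<in>S. \<bar>f q\<bar> \<le> c) \<longrightarrow> (\<forall>q\<in>S. \<bar>P t f q\<bar> \<le> M * c)"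
    and P_0: "continuous_on S f \<Longrightarrow> q \<in> S \<Longrightarrow> P 0 f q = f q"
    and P_add: "0 \<le> s \<Longrightarrow> 0 \<le> t \<Longrightarrow> continuous_on S f \<Longrightarrow> q \<in> S \<Longrightarrow> P (s + t) f q = P s (P t f) q"
    and P_strong: "continuous_on S f \<Longrightarrow> uniform_limit S (\<lambda>t. P t f) f (at_right 0)"
    and P_gen: "smooth_on_sphere f \<Longrightarrow>
         uniform_limit S (\<lambda>t q. (P t f q - f q) / t) (sub_laplacian f) (at_right 0)"
proof -
  note * = semigroup[unfolded is_sub_heat_semigroup_def Let_def]
  note c1 = conjunct1 and c2 = conjunct2
  show "0 \<le> t \<Longrightarrow> continuous_on S f \<Longrightarrow> continuous_on S (P t f)"
    using *[THEN c1] by simp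
  show "0 \<le> t \<Longrightarrow> continuous_on S f \<Longrightarrow> continuous_on S g \<Longrightarrow> q \<in> S \<Longrightarrow>
      P t (\<lambda>x. a * f x + b * g x) q = a * P t f q + b * P t g q"
    using *[THEN c2, THEN c1] by simp
  show "\<exists>M. \<forall>f c. continuous_on S f \<longrightarrow> (\<forall>q\<in>S. \<bar>f q\<bar> \<le> c) \<longrightarrow> (\<forall>q\<in>S. \<bar>P t f q\<bar> \<le> M * c)" if "0 \<le> t"
  proof -
    from *[THEN c2, THEN c2, THEN c1, rule_format, OF that] obtain M where
      "\<forall>f\<in>{f. continuous_on S f}. \<forall>c. (\<forall>q\<in>S. \<bar>f q\<bar> \<le> c) \<longrightarrow> (\<forall>q\<in>S. \<bar>P t f q\<bar> \<le> M * c)" ..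
    then show ?thesis by (intro exI[of _ M]) simp
  qed
  show "continuous_on S f \<Longrightarrow> q \<in> S \<Longrightarrow> P 0 f q = f q"
    using *[THEN c2, THEN c2, THEN c2, THEN c1] by simp
  show "0 \<le> s \<Longrightarrow> 0 \<le> t \<Longrightarrow> continuous_on S f \<Longrightarrow> q \<in> S \<Longrightarrow> P (s + t) f q = P s (P t f) q"
    using *[THEN c2, THEN c2, THEN c2, THEN c2, THEN c1] by simp
  show "continuous_on S f \<Longrightarrow> uniform_limit S (\<lambda>t. P t f) f (at_right 0)"
    using *[THEN c2, THEN c2, THEN c2, THEN c2, THEN c2, THEN c1] by simp
  show "smooth_on_sphere f \<Longrightarrow> uniform_limit S (\<lambda>t q. (P t f q - f q) / t) (sub_laplacian f) (at_right 0)"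
    using *[THEN c2, THEN c2, THEN c2, THEN c2, THEN c2, THEN c2] by simp
qed

lemma P_cmult: "0 \<le> t \<Longrightarrow> continuous_on S f \<Longrightarrow> q \<in> S \<Longrightarrow> P t (\<lambda>x. a * f x) q = a * P t f q"
  using P_lin[of t f f q a 0] by simp

lemma P_diff: "0 \<le> t \<Longrightarrow> continuous_on S f \<Longrightarrow> continuous_on S g \<Longrightarrow> q \<in> S \<Longrightarrow>
    P t (\<lambda>x. f x - g x) q = P t f q - P t g q"
  using P_lin[of t f g q 1 "-1"] by simp

lemma P_plus: "0 \<le> t \<Longrightarrow> continuous_on S f \<Longrightarrow> continuous_on S g \<Longrightarrow> q \<in> S \<Longrightarrow>
    P t (\<lambda>x. f x + g x) q = P t f q + P t g q"
  using P_lin[of t f g q 1 1] by simp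

lemma P_sum:
  assumes "0 \<le> t" "q \<in> S" "finite I" "\<And>i. i \<in> I \<Longrightarrow> continuous_on S (f i)"
  shows "P t (\<lambda>x. \<Sum>i\<in>I. c i * f i x) q = (\<Sum>i\<in>I. c i * P t (f i) q)"
  using assms(3,4)
proof (induction rule: finite_induct)
  case empty
  show ?case using P_cmult[OF assms(1) _ assms(2), of "\<lambda>x. 0" 0] by simp
next
  case (insert i I)
  then show ?case
    using P_plus[OF assms(1) _ _ assms(2), of "\<lambda>x. c i * f i x" "\<lambda>x. \<Sum>i\<in>I. c i * f i x"]
      P_cmult[OF assms(1) _ assms(2), of "f i" "c i"]
    by (simp add: continuous_on_sum continuous_on_mult_left)
qed

lemma sphere_bounded:
  assumes "continuous_on S f"
  obtains B :: real where "0 \<le> B" "\<And>q. q \<in> S \<Longrightarrow> \<bar>f q\<bar> \<le> B"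
proof -
  have "bounded (f ` S)" using assms by (intro compact_imp_bounded compact_continuous_image) auto
  then obtain B where "\<forall>y\<in>f ` S. norm y \<le> B" unfolding bounded_iff ..
  then have "\<bar>f q\<bar> \<le> max 0 B" if "q \<in> S" for q
    using that by (simp add: le_max_iff_disj)
  then show ?thesis using that[of "max 0 B"] by simp
qed

text \<open>A gliding hump argument.\<close>

lemma P_locally_bounded:
  "\<exists>\<delta>>0. \<exists>M. \<forall>s\<in>{0..\<delta>}. \<forall>f c. continuous_on S f \<longrightarrow> (\<forall>q\<in>S. \<bar>f q\<bar> \<le> c) \<longrightarrow> (\<forall>q\<in>S. \<bar>P s f q\<bar> \<le> M * c)"
proof (rule ccontr)
  assume unb: "\<not> ?thesis"
  have ne: "(0, qone) \<in> S" by (simp add: norm_Pair qone_def)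
  obtain Mb0 where Mb0: "\<And>s f c q. 0 \<le> s \<Longrightarrow> continuous_on S f \<Longrightarrow> (\<forall>q\<in>S. \<bar>f q\<bar> \<le> c) \<Longrightarrow> q \<in> S \<Longrightarrow> \<bar>P s f q\<bar> \<le> Mb0 s * c"
    using P_bnd by metis
  define Mb where "Mb s = max 1 (Mb0 s)" for s
  have Mb: "\<bar>P s f q\<bar> \<le> Mb s * c" if "0 \<le> s" "continuous_on S f" "\<forall>q\<in>S. \<bar>f q\<bar> \<le> c" "q \<in> S" for s f c q
  proof -
    have "0 \<le> c" using that(3,4) by force
    then have "Mb0 s * c \<le> Mb s * c" by (intro mult_right_mono) (auto simp: Mb_def)
    with Mb0[OF that] show ?thesis by simp
  qed
  have big: "\<exists>s\<in>{0..\<delta>}. \<exists>f. \<exists>q\<in>S. continuous_on S f \<and> (\<forall>q\<in>S. \<bar>f q\<bar> \<le> 1) \<and> K < \<bar>P s f q\<bar>"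
    if \<delta>: "0 < \<delta>" for \<delta> K
  proof -
    from unb \<delta> obtain s f c q where s: "s \<in> {0..\<delta>}" and f: "continuous_on S f" "\<forall>q\<in>S. \<bar>f q\<bar> \<le> c"
      and q: "q \<in> S" "\<not> \<bar>P s f q\<bar> \<le> K * c" by blast
    have c0: "0 \<le> c" using f(2) q(1) by force
    have "c \<noteq> 0" using Mb[of s f c q] s f q by auto
    with c0 have c: "0 < c" by simp
    have eq: "P s (\<lambda>x. (1 / c) * f x) q = (1 / c) * P s f q" using s f q by (intro P_cmult) auto
    have "K < \<bar>P s (\<lambda>x. (1 / c) * f x) q\<bar>" unfolding eq using q(2) c by (simp add: field_simps abs_mult)
    moreover have "continuous_on S (\<lambda>x. (1 / c) * f x)" by (intro continuous_intros f(1))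
    moreover have "\<forall>q\<in>S. \<bar>(1 / c) * f q\<bar> \<le> 1" using f(2) c by (simp add: field_simps abs_mult)
    ultimately show ?thesis using s q(1) by blast
  qed
  \<comment> \<open>A state holds the partial sum x, a budget \<epsilon> for later corrections, a
    time s and a point q at which \<open>P s x\<close> is already large. Later corrections add up to
    at most 2 \<epsilon>, so the condition on \<epsilon> and \<open>Mb s\<close> lets them change
    this value by at most 1/2.\<close>
  define good :: "nat \<Rightarrow> ('n hvec \<Rightarrow> real) \<times> real \<times> real \<times> 'n hvec \<Rightarrow> bool" where
    "good n = (\<lambda>(x, \<epsilon>, s, q). continuous_on S x \<and> 0 < \<epsilon> \<and> s \<in> {0..1 / (real n + 1)} \<and> q \<in> S \<and>
       real n \<le> \<bar>P s x q\<bar> \<and> \<epsilon> * Mb s \<le> 1 / 4)" for n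
  define nxt :: "nat \<Rightarrow> ('n hvec \<Rightarrow> real) \<times> real \<times> real \<times> 'n hvec \<Rightarrow> ('n hvec \<Rightarrow> real) \<times> real \<times> real \<times> 'n hvec \<Rightarrow> bool" where
    "nxt n = (\<lambda>(x, \<epsilon>, s, q) (x', \<epsilon>', s', q'). (\<forall>z\<in>S. \<bar>x' z - x z\<bar> \<le> \<epsilon>) \<and> \<epsilon>' \<le> \<epsilon> / 2)" for n
  have "\<exists>st. \<forall>n. good n (st n) \<and> nxt n (st n) (st (Suc n))"
  proof (rule dependent_nat_choice)
    have "good 0 (\<lambda>x. 0, 1 / (4 * Mb 0), 0, (0, qone))"
      using ne by (simp add: good_def Mb_def max_def)
    then show "\<exists>st. good 0 st" by blast
  next
    fix st n assume st: "good n st"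
    obtain x \<epsilon> s q where st_eq: "st = (x, \<epsilon>, s, q)" by (cases st)
    with st have x: "continuous_on S x" "0 < \<epsilon>" by (auto simp: good_def)
    obtain s' f q' where s': "s' \<in> {0..1 / (real (Suc n) + 1)}" and f: "continuous_on S f" "\<forall>q\<in>S. \<bar>f q\<bar> \<le> 1"
      and q': "q' \<in> S" "real (Suc n) / \<epsilon> < \<bar>P s' f q'\<bar>"
      using big[of "1 / (real (Suc n) + 1)" "real (Suc n) / \<epsilon>"] by auto
    have s0: "0 \<le> s'" using s' by simp
    have "real (Suc n) \<le> \<epsilon> * \<bar>P s' f q'\<bar>" using q'(2) x(2) by (simp add: field_simps)
    moreover have "P s' (\<lambda>z. 1 * x z + \<epsilon> * f z) q' = 1 * P s' x q' + \<epsilon> * P s' f q'"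
      "P s' (\<lambda>z. 1 * x z + (- \<epsilon>) * f z) q' = 1 * P s' x q' + (- \<epsilon>) * P s' f q'"
      by (intro P_lin x f q' s0)+
    moreover have "\<bar>\<epsilon> * P s' f q'\<bar> = \<epsilon> * \<bar>P s' f q'\<bar>" using x(2) by (simp add: abs_mult)
    \<comment> \<open>One of a + b and a - b has modulus at least |b|, so a suitable sign of the
      correction makes the value large whatever the old partial sum contributes.\<close>
    ultimately have "real (Suc n) \<le> \<bar>P s' (\<lambda>z. 1 * x z + \<epsilon> * f z) q'\<bar> \<or> real (Suc n) \<le> \<bar>P s' (\<lambda>z. 1 * x z + (- \<epsilon>) * f z) q'\<bar>"
      by linarith
    then obtain \<eta> where \<eta>: "\<eta> = \<epsilon> \<or> \<eta> = - \<epsilon>" "real (Suc n) \<le> \<bar>P s' (\<lambda>z. 1 * x z + \<eta> * f z) q'\<bar>" by blast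
    define x' where "x' = (\<lambda>z. 1 * x z + \<eta> * f z)"
    define \<epsilon>' where "\<epsilon>' = min (\<epsilon> / 2) (1 / (4 * Mb s'))"
    have Mb1: "1 \<le> Mb s'" by (simp add: Mb_def)
    have "continuous_on S x'" unfolding x'_def by (intro continuous_intros x(1) f(1))
    moreover have "0 < \<epsilon>'" using x Mb1 by (simp add: \<epsilon>'_def)
    moreover have "\<epsilon>' * Mb s' \<le> 1 / (4 * Mb s') * Mb s'" using Mb1 by (intro mult_right_mono) (auto simp: \<epsilon>'_def)
    moreover have "1 / (4 * Mb s') * Mb s' = 1 / 4" using Mb1 by simp
    ultimately have "good (Suc n) (x', \<epsilon>', s', q')"
      using s' q' \<eta>(2) by (simp add: good_def x'_def)
    moreover have "nxt n st (x', \<epsilon>', s', q')"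
    proof -
      have "\<bar>x' z - x z\<bar> \<le> \<epsilon>" if "z \<in> S" for z
      proof -
        have "\<bar>x' z - x z\<bar> = \<epsilon> * \<bar>f z\<bar>" using \<eta>(1) x(2) by (auto simp: x'_def abs_mult)
        also have "\<dots> \<le> \<epsilon> * 1" using f(2) that x(2) by (intro mult_left_mono) auto
        finally show ?thesis by simp
      qed
      then show ?thesis by (simp add: nxt_def st_eq \<epsilon>'_def)
    qed
    ultimately show "\<exists>st'. good (Suc n) st' \<and> nxt n st st'" by blast
  qed
  then obtain st where st: "\<And>n. good n (st n)" "\<And>n. nxt n (st n) (st (Suc n))" by blast
  define x where "x n = fst (st n)" for n
  define \<epsilon> where "\<epsilon> n = fst (snd (st n))" for n
  define s where "s n = fst (snd (snd (st n)))" for n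
  define q where "q n = snd (snd (snd (st n)))" for n
  have g: "continuous_on S (x n)" "0 < \<epsilon> n" "0 \<le> s n" "s n \<le> 1 / (real n + 1)" "q n \<in> S"
      "real n \<le> \<bar>P (s n) (x n) (q n)\<bar>" "\<epsilon> n * Mb (s n) \<le> 1 / 4" for n
    using st(1)[of n] by (auto simp: good_def x_def \<epsilon>_def s_def q_def split: prod.splits)
  have nx: "\<bar>x (Suc n) z - x n z\<bar> \<le> \<epsilon> n" if "z \<in> S" for n z
    using st(2)[of n] that by (auto simp: nxt_def x_def \<epsilon>_def split: prod.splits)
  have ne: "\<epsilon> (Suc n) \<le> \<epsilon> n / 2" for n
    using st(2)[of n] by (auto simp: nxt_def x_def \<epsilon>_def split: prod.splits)
  have eps: "\<epsilon> (n + k) \<le> \<epsilon> n / 2 ^ k" for n k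
  proof (induction k)
    case (Suc k)
    have "\<epsilon> (n + Suc k) \<le> \<epsilon> (n + k) / 2" using ne by simp
    with Suc show ?case by simp
  qed simp
  have dist: "\<bar>x (n + k) z - x n z\<bar> \<le> 2 * \<epsilon> n * (1 - 1 / 2 ^ k)" if "z \<in> S" for n k z
  proof (induction k)
    case (Suc k)
    have "\<bar>x (n + Suc k) z - x n z\<bar> \<le> \<bar>x (Suc (n + k)) z - x (n + k) z\<bar> + \<bar>x (n + k) z - x n z\<bar>"
      by simp
    also have "\<dots> \<le> \<epsilon> n / 2 ^ k + 2 * \<epsilon> n * (1 - 1 / 2 ^ k)"
      using nx[OF that, of "n + k"] eps[of n k] Suc by linarith
    also have "\<dots> = 2 * \<epsilon> n * (1 - 1 / 2 ^ Suc k)" by (simp add: algebra_simps)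
    finally show ?case .
  qed simp
  have dist': "\<bar>x m z - x n z\<bar> \<le> 2 * \<epsilon> n" if "z \<in> S" "n \<le> m" for n m z
  proof -
    have "2 * \<epsilon> n * (1 - 1 / 2 ^ (m - n)) \<le> 2 * \<epsilon> n * 1" using g(2)[of n] by (intro mult_left_mono) auto
    then show ?thesis using dist[OF that(1), of n "m - n"] that(2) by simp
  qed
  have eps0: "\<epsilon> \<longlonglongrightarrow> 0"
  proof (rule tendsto_sandwich[where f = "\<lambda>_. 0"])
    have "(\<lambda>n. (1 / 2 :: real) ^ n) \<longlonglongrightarrow> 0" by (rule LIMSEQ_power_zero) simp
    then have "(\<lambda>n. \<epsilon> 0 * (1 / 2) ^ n) \<longlonglongrightarrow> 0" by (rule tendsto_mult_right_zero)
    then show "(\<lambda>n. \<epsilon> 0 / 2 ^ n) \<longlonglongrightarrow> 0" by (simp add: power_one_over)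
    show "\<forall>\<^sub>F n in sequentially. 0 \<le> \<epsilon> n" using g(2) by (simp add: less_imp_le)
    show "\<forall>\<^sub>F n in sequentially. \<epsilon> n \<le> \<epsilon> 0 / 2 ^ n" using eps[of 0] by simp
  qed simp
  have "uniformly_Cauchy_on S x"
    unfolding uniformly_Cauchy_on_def
  proof (intro allI impI)
    fix e :: real assume "0 < e"
    then have "eventually (\<lambda>n. \<epsilon> n < e / 4) sequentially" using order_tendstoD(2)[OF eps0, of "e / 4"] by simp
    then obtain N where N: "\<epsilon> N < e / 4" by (auto simp: eventually_sequentially)
    have "dist (x m z) (x n z) < e" if "z \<in> S" "m \<ge> N" "n \<ge> N" for z m n
      using dist'[OF that(1,2)] dist'[OF that(1,3)] N by (simp add: dist_real_def)
    then show "\<exists>M. \<forall>z\<in>S. \<forall>m\<ge>M. \<forall>n\<ge>M. dist (x m z) (x n z) < e" by blast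
  qed
  then obtain f where f: "uniform_limit S x f sequentially"
    using Cauchy_uniformly_convergent[of S x] by (auto simp: uniformly_convergent_on_def)
  have fc: "continuous_on S f"
    using f g(1) by (intro uniform_limit_theorem[OF _ f]) (auto intro: always_eventually)
  have fx: "\<bar>f z - x n z\<bar> \<le> 2 * \<epsilon> n" if "z \<in> S" for n z
  proof (rule LIMSEQ_le_const2)
    show "(\<lambda>m. \<bar>x m z - x n z\<bar>) \<longlonglongrightarrow> \<bar>f z - x n z\<bar>"
      by (intro tendsto_intros tendsto_uniform_limitI[OF f that])
    show "\<exists>N. \<forall>m\<ge>N. \<bar>x m z - x n z\<bar> \<le> 2 * \<epsilon> n" using dist'[OF that] by blast
  qed
  have low: "real n - 1 / 2 \<le> \<bar>P (s n) f (q n)\<bar>" for n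
  proof -
    have "\<bar>P (s n) (\<lambda>z. f z - x n z) (q n)\<bar> \<le> Mb (s n) * (2 * \<epsilon> n)"
      using fx g(3,5) by (intro Mb continuous_intros fc g(1)) auto
    moreover have "P (s n) (\<lambda>z. f z - x n z) (q n) = P (s n) f (q n) - P (s n) (x n) (q n)"
      using g fc by (intro P_diff)
    ultimately show ?thesis using g(6,7)[of n] by (simp add: algebra_simps)
  qed
  obtain B where B: "\<And>q. q \<in> S \<Longrightarrow> \<bar>f q\<bar> \<le> B" using sphere_bounded[OF fc] by blast
  have "\<forall>\<^sub>F t in at_right 0. \<forall>z\<in>S. dist (P t f z) (f z) < 1"
    using P_strong[OF fc] uniform_limitD zero_less_one by blast
  then obtain d where d: "0 < d" "\<And>t z. 0 < t \<Longrightarrow> t < d \<Longrightarrow> z \<in> S \<Longrightarrow> \<bar>P t f z - f z\<bar> < 1"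
    unfolding eventually_at_right_field dist_real_def by blast
  \<comment> \<open>The times of the humps tend to 0, where strong continuity keeps
    \<open>P s f\<close> close to the bounded f; this contradicts the growth in
    \<open>low\<close>.\<close>
  obtain n :: nat where n: "1 / d < real n" "B + 2 < real n"
    using reals_Archimedean2[of "max (1 / d) (B + 2)"] by auto
  have "1 / (real n + 1) < d" using n(1) d(1) by (simp add: field_simps)
  with g(4)[of n] have "s n < d" by linarith
  then have "\<bar>P (s n) f (q n) - f (q n)\<bar> < 1"
    using d(2)[of "s n" "q n"] g(3,5)[of n] P_0[OF fc] by (cases "s n = 0") auto
  with B[OF g(5)[of n]] low[of n] n(2) show False by linarith
qed

text \<open>The semigroup law spreads the bound near time 0 over any compact interval, at the cost
  of a power of the constant.\<close>

lemma P_bounded_on: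
  assumes "0 \<le> T"
  shows "\<exists>M\<ge>0. \<forall>s\<in>{0..T}. \<forall>f c. continuous_on S f \<longrightarrow> (\<forall>q\<in>S. \<bar>f q\<bar> \<le> c) \<longrightarrow> (\<forall>q\<in>S. \<bar>P s f q\<bar> \<le> M * c)"
proof -
  obtain \<delta> M0 where \<delta>: "0 < \<delta>" and M0: "\<And>s f c q. s \<in> {0..\<delta>} \<Longrightarrow> continuous_on S f \<Longrightarrow> (\<forall>q\<in>S. \<bar>f q\<bar> \<le> c) \<Longrightarrow> q \<in> S \<Longrightarrow> \<bar>P s f q\<bar> \<le> M0 * c"
    using P_locally_bounded by metis
  define M where "M = max 1 M0"
  have M: "\<bar>P s f q\<bar> \<le> M * c" if "s \<in> {0..\<delta>}" "continuous_on S f" "\<forall>q\<in>S. \<bar>f q\<bar> \<le> c" "q \<in> S" for s f c q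
  proof -
    have "0 \<le> c" using that(3,4) by force
    then have "M0 * c \<le> M * c" by (intro mult_right_mono) (auto simp: M_def)
    with M0[OF that] show ?thesis by simp
  qed
  have M1: "1 \<le> M" by (simp add: M_def)
  have "\<bar>P s f q\<bar> \<le> M ^ Suc k * c" if "s \<in> {0..real (Suc k) * \<delta>}" "continuous_on S f" "\<forall>q\<in>S. \<bar>f q\<bar> \<le> c" "q \<in> S" for s f c q k
    using that
  proof (induction k arbitrary: s f c q)
    case 0
    then show ?case using M by simp
  next
    case (Suc k)
    define u where "u = min s \<delta>"
    have u: "u \<in> {0..\<delta>}" "s - u \<in> {0..real (Suc k) * \<delta>}"
      using Suc.prems(1) \<delta> by (auto simp: u_def min_def algebra_simps)
    have "\<forall>q\<in>S. \<bar>P u f q\<bar> \<le> M * c" using M[OF u(1) Suc.prems(2,3)] by blast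
    moreover have "continuous_on S (P u f)" using u Suc.prems by (intro P_cont) auto
    ultimately have "\<bar>P (s - u) (P u f) q\<bar> \<le> M ^ Suc k * (M * c)" using Suc.prems u by (intro Suc.IH) auto
    moreover have "P (s - u + u) f q = P (s - u) (P u f) q" using u Suc.prems by (intro P_add) auto
    ultimately show ?case by (simp add: algebra_simps)
  qed
  moreover obtain k :: nat where "T / \<delta> < real k" using reals_Archimedean2 by blast
  then have "T \<le> real (Suc k) * \<delta>" using \<delta> by (simp add: field_simps)
  then have "{0..T} \<subseteq> {0..real (Suc k) * \<delta>}" by auto
  ultimately show ?thesis using M1 by (intro exI[of _ "M ^ Suc k"]) (auto simp del: power_Suc)
qed

text \<open>The generator relation is given at time 0 only. So [0, t] is cut into steps of length h:
  each replaces P h f by exp (\<mu> h) f with an error (1 + B) e h, and the uniform bound on the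
  semigroup sums these errors to a fixed multiple of e.\<close>

lemma P_eigenfunction:
  assumes f: "continuous_on S f"
    and gen: "uniform_limit S (\<lambda>t q. (P t f q - f q) / t) (\<lambda>q. \<mu> * f q) (at_right 0)"
    and t: "0 \<le> t" and q: "q \<in> S"
  shows "P t f q = exp (\<mu> * t) * f q"
proof (cases "t = 0")
  case True
  then show ?thesis using P_0[OF f q] by simp
next
  case False
  with t have t: "0 < t" by simp
  obtain M where M: "0 \<le> M" "\<And>s f c q. s \<in> {0..t} \<Longrightarrow> continuous_on S f \<Longrightarrow> (\<forall>q\<in>S. \<bar>f q\<bar> \<le> c) \<Longrightarrow> q \<in> S \<Longrightarrow> \<bar>P s f q\<bar> \<le> M * c"
    using P_bounded_on[of t] t by (metis less_imp_le)
  obtain B where B: "0 \<le> B" "\<And>q. q \<in> S \<Longrightarrow> \<bar>f q\<bar> \<le> B" using sphere_bounded[OF f] by blast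
  have key: "\<bar>P t f q - exp (\<mu> * t) * f q\<bar> \<le> (t * M * exp (\<bar>\<mu>\<bar> * t) * (1 + B)) * e" if e: "0 < e" for e
  proof -
    have "((\<lambda>h. (exp (\<mu> * h) - 1) / h) \<longlongrightarrow> \<mu>) (at_right 0)"
    proof -
      have "((\<lambda>h. exp (\<mu> * h)) has_real_derivative \<mu>) (at 0)" by (auto intro!: derivative_eq_intros)
      then have "((\<lambda>h. (exp (\<mu> * h) - 1) / h) \<longlongrightarrow> \<mu>) (at 0)" by (simp add: has_field_derivative_iff)
      then show ?thesis by (rule filterlim_mono[OF _ order_refl at_le]) simp
    qed
    then have "\<forall>\<^sub>F h in at_right 0. dist ((exp (\<mu> * h) - 1) / h) \<mu> < e" using e by (rule tendstoD)
    moreover have "\<forall>\<^sub>F h in at_right 0. \<forall>q\<in>S. dist ((P h f q - f q) / h) (\<mu> * f q) < e"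
      using gen e by (rule uniform_limitD)
    ultimately have "\<forall>\<^sub>F h in at_right 0. dist ((exp (\<mu> * h) - 1) / h) \<mu> < e \<and> (\<forall>q\<in>S. dist ((P h f q - f q) / h) (\<mu> * f q) < e)"
      by (rule eventually_conj)
    then obtain d where d: "0 < d" "\<And>h. 0 < h \<Longrightarrow> h < d \<Longrightarrow> \<bar>(exp (\<mu> * h) - 1) / h - \<mu>\<bar> < e"
      "\<And>h q. 0 < h \<Longrightarrow> h < d \<Longrightarrow> q \<in> S \<Longrightarrow> \<bar>(P h f q - f q) / h - \<mu> * f q\<bar> < e"
      unfolding eventually_at_right_field dist_real_def by blast
    obtain n :: nat where n: "t / d < real n" using reals_Archimedean2 by blast
    have n0: "0 < real n" using n t d(1) by (metis divide_pos_pos less_trans)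
    define h where "h = t / real n"
    have h: "0 < h" "h < d" using n n0 t d(1) by (auto simp: h_def field_simps)
    have step: "\<bar>P h f q - exp (\<mu> * h) * f q\<bar> \<le> (1 + B) * e * h" if "q \<in> S" for q
    proof -
      have "P h f q - exp (\<mu> * h) * f q = h * (((P h f q - f q) / h - \<mu> * f q) - ((exp (\<mu> * h) - 1) / h - \<mu>) * f q)"
        using h by (simp add: field_simps)
      also have "\<bar>\<dots>\<bar> = h * \<bar>((P h f q - f q) / h - \<mu> * f q) - ((exp (\<mu> * h) - 1) / h - \<mu>) * f q\<bar>"
        using h by (simp add: abs_mult)
      also have "\<dots> \<le> h * (e + e * B)"
      proof (rule mult_left_mono)
        have "\<bar>((exp (\<mu> * h) - 1) / h - \<mu>) * f q\<bar> \<le> e * B"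
          unfolding abs_mult using d(2)[OF h] B(2)[OF that] e by (intro mult_mono) auto
        then show "\<bar>((P h f q - f q) / h - \<mu> * f q) - ((exp (\<mu> * h) - 1) / h - \<mu>) * f q\<bar> \<le> e + e * B"
          using d(3)[OF h that] by linarith
      qed (use h in simp)
      finally show ?thesis by (simp add: algebra_simps)
    qed
    let ?g = "\<lambda>q. P h f q - exp (\<mu> * h) * f q"
    have Phf: "continuous_on S (P h f)" using h f by (intro P_cont) auto
    have gc: "continuous_on S ?g" by (intro continuous_intros Phf f)
    \<comment> \<open>Telescoping invariant: after i steps the error is at most i single-step
      errors, inflated by the operator bound and by the exponential growth so far.\<close>
    have "\<bar>P (real i * h) f q - exp (\<mu> * (real i * h)) * f q\<bar> \<le> real i * M * ((1 + B) * e * h) * exp (\<bar>\<mu>\<bar> * (real i * h))"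
      if "i \<le> n" for i
      using that
    proof (induction i)
      case 0
      then show ?case using P_0[OF f q] by simp
    next
      case (Suc i)
      let ?s = "real i * h"
      have s: "?s \<in> {0..t}" using Suc.prems h n0 t by (auto simp: h_def field_simps)
      have s0: "0 \<le> ?s" using s by simp
      have "P (?s + h) f q = P ?s (P h f) q" using h s by (intro P_add f q) auto
      also have "\<dots> = P ?s (\<lambda>x. 1 * ?g x + exp (\<mu> * h) * f x) q" by simp
      also have "\<dots> = 1 * P ?s ?g q + exp (\<mu> * h) * P ?s f q" by (rule P_lin[OF s0 gc f q])
      finally have eq: "P (?s + h) f q - exp (\<mu> * (?s + h)) * f q = P ?s ?g q + exp (\<mu> * h) * (P ?s f q - exp (\<mu> * ?s) * f q)"
        by (simp add: algebra_simps exp_add)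
      let ?c = "M * ((1 + B) * e * h)"
      have c0: "0 \<le> ?c" using M B e h by simp
      have "\<bar>P ?s ?g q\<bar> \<le> ?c" using step by (intro M(2)[OF s gc _ q]) auto
      moreover have "\<bar>exp (\<mu> * h) * (P ?s f q - exp (\<mu> * ?s) * f q)\<bar> \<le> exp (\<bar>\<mu>\<bar> * h) * (real i * ?c * exp (\<bar>\<mu>\<bar> * ?s))"
      proof -
        have "exp (\<mu> * h) \<le> exp (\<bar>\<mu>\<bar> * h)" using h by (simp add: mult_right_mono)
        then show ?thesis unfolding abs_mult using Suc by (intro mult_mono) (auto simp: mult.assoc)
      qed
      moreover have "?c \<le> ?c * exp (\<bar>\<mu>\<bar> * (?s + h))"
        using c0 s0 h by (intro mult_right_le_one_le[THEN order_trans] mult_le_cancel_left1[THEN iffD2]) auto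
      moreover have "exp (\<bar>\<mu>\<bar> * h) * (real i * ?c * exp (\<bar>\<mu>\<bar> * ?s)) = real i * ?c * exp (\<bar>\<mu>\<bar> * (?s + h))"
        by (simp add: algebra_simps exp_add)
      ultimately have "\<bar>P (?s + h) f q - exp (\<mu> * (?s + h)) * f q\<bar>
          \<le> ?c * exp (\<bar>\<mu>\<bar> * (?s + h)) + real i * ?c * exp (\<bar>\<mu>\<bar> * (?s + h))"
        unfolding eq by linarith
      then have "\<bar>P (?s + h) f q - exp (\<mu> * (?s + h)) * f q\<bar> \<le> (real i + 1) * ?c * exp (\<bar>\<mu>\<bar> * (?s + h))"
        by (simp only: distrib_right mult_1)
      moreover have "?s + h = real (Suc i) * h" by (simp add: algebra_simps)
      ultimately show ?case by (simp add: algebra_simps)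
    qed
    from this[of n] show ?thesis using n0 by (simp add: h_def algebra_simps)
  qed
  have "((\<lambda>e. (t * M * exp (\<bar>\<mu>\<bar> * t) * (1 + B)) * e) \<longlongrightarrow> 0) (at_right 0)"
    by (rule tendsto_mult_right_zero) simp
  moreover have "\<forall>\<^sub>F e in at_right 0. \<bar>P t f q - exp (\<mu> * t) * f q\<bar> \<le> (t * M * exp (\<bar>\<mu>\<bar> * t) * (1 + B)) * e"
    using key by (intro eventually_at_rightI[of 0 1]) auto
  ultimately have "\<bar>P t f q - exp (\<mu> * t) * f q\<bar> \<le> 0"
    by (rule tendsto_lowerbound) simp
  then show ?thesis by simp
qed

end

section \<open>Gaussian moments of hyperbolic sines\<close>

lemma exp_normal_density:
  assumes "0 < t"
  shows "normal_density 0 (sqrt (2 * t)) y * exp (b * y) = exp (b\<^sup>2 * t) * normal_density (2 * b * t) (sqrt (2 * t)) y"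
proof -
  have "- y\<^sup>2 / (4 * t) + b * y = b\<^sup>2 * t - (y - 2 * b * t)\<^sup>2 / (4 * t)"
    using assms by (simp add: field_simps power2_eq_square)
  then have "exp (- y\<^sup>2 / (4 * t)) * exp (b * y) = exp (b\<^sup>2 * t) * exp (- (y - 2 * b * t)\<^sup>2 / (4 * t))"
    by (simp flip: exp_add)
  then show ?thesis using assms by (simp add: normal_density_def)
qed

text \<open>An exponential factor moves the Gaussian of variance 2t to mean 2bt and pulls out exp
  (b^2 t). The two halves of the sinh have opposite means, and the factor y makes their
  contributions add up.\<close>

lemma has_bochner_integral_normal_density_sinh:
  assumes "0 < t"
  shows "has_bochner_integral lborel (\<lambda>y. normal_density 0 (sqrt (2 * t)) y * (y * sinh (b * y))) (2 * t * b * exp (b\<^sup>2 * t))"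
proof -
  have *: "has_bochner_integral lborel (\<lambda>y. exp (b\<^sup>2 * t) * (normal_density (2 * b * t) (sqrt (2 * t)) y * y)) (exp (b\<^sup>2 * t) * (2 * b * t))" for b
    using assms by (intro has_bochner_integral_mult_right normal_moment_nz_1) simp
  have "has_bochner_integral lborel (\<lambda>y. 1 / 2 * (exp (b\<^sup>2 * t) * (normal_density (2 * b * t) (sqrt (2 * t)) y * y)
      - exp ((- b)\<^sup>2 * t) * (normal_density (2 * (- b) * t) (sqrt (2 * t)) y * y)))
    (1 / 2 * (exp (b\<^sup>2 * t) * (2 * b * t) - exp ((- b)\<^sup>2 * t) * (2 * (- b) * t)))"
    by (intro has_bochner_integral_mult_right has_bochner_integral_diff *)
  moreover have "1 / 2 * (exp (b\<^sup>2 * t) * (normal_density (2 * b * t) (sqrt (2 * t)) y * y)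
      - exp ((- b)\<^sup>2 * t) * (normal_density (2 * (- b) * t) (sqrt (2 * t)) y * y))
      = normal_density 0 (sqrt (2 * t)) y * (y * sinh (b * y))" for y
  proof -
    have "normal_density 0 (sqrt (2 * t)) y * (y * sinh (b * y))
       = 1 / 2 * ((normal_density 0 (sqrt (2 * t)) y * exp (b * y)) * y - (normal_density 0 (sqrt (2 * t)) y * exp ((- b) * y)) * y)"
      by (simp add: sinh_field_def field_simps)
    also have "\<dots> = 1 / 2 * (exp (b\<^sup>2 * t) * (normal_density (2 * b * t) (sqrt (2 * t)) y * y)
      - exp ((- b)\<^sup>2 * t) * (normal_density (2 * (- b) * t) (sqrt (2 * t)) y * y))"
      unfolding exp_normal_density[OF assms] by simp
    finally show ?thesis by simp
  qed
  ultimately show ?thesis by (simp only:) (simp add: mult.assoc mult.commute mult.left_commute)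
qed

text \<open>Coefficients of the power \<open>a\<^sup>i\<close> in the solid zonal harmonics: twice-shifted differences of binomials.\<close>

definition zcoeff :: "nat \<Rightarrow> nat \<Rightarrow> real" where
  "zcoeff m j = (real m + 1) * fact (m + 2 * j) / (2 ^ (m + 2 * j) * fact j * fact (m + j + 1))"

text \<open>The left factor is the lowering coefficient of the sub-Laplacian, the right one occurs
  in the recurrence for the coefficients of the N-th derivative of T_k. This relation translates one
  into the other.\<close>

lemma zcoeff_rec:
  "4 * (real j + 1) * (real m + real j + 2) * zcoeff m (Suc j) = (real m + 2 * real j + 2) * (real m + 2 * real j + 1) * zcoeff m j"
proof -
  have 1: "fact (m + 2 * Suc j) = (real m + 2 * real j + 2) * (real m + 2 * real j + 1) * fact (m + 2 * j)"
    by (simp add: algebra_simps)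
  have 2: "fact (m + Suc j + 1) = (real m + real j + 2) * fact (m + j + 1)"
    by (simp add: algebra_simps)
  have 3: "fact (Suc j) = (real j + 1) * fact j" by (simp add: algebra_simps)
  have 4: "(2::real) ^ (m + 2 * Suc j) = 4 * 2 ^ (m + 2 * j)" by simp
  have "real m + real j + 2 \<noteq> 0" "real j + 1 \<noteq> 0" by linarith+
  then show ?thesis unfolding zcoeff_def 1 2 3 4 by (simp add: divide_simps del: fact_Suc) 
qed

text \<open>Multiplication by a sends the term (m, j) to the mean of (m + 1, j) and (m - 1, j + 1).
  The coefficients are therefore ballot numbers divided by 2^i, and the induction step is Pascal's
  rule for them.\<close>

lemma power_zonal_expansion:
  "a ^ i = (\<Sum>j | 2 * j \<le> i. zcoeff (i - 2 * j) j * (s ^ j * poly (zonal s (i - 2 * j)) a))"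
proof -
  define h where "h i j = (if 2 * j \<le> i then s ^ j * poly (zonal s (i - 2 * j)) a else 0)" for i j
  \<comment> \<open>The first factor vanishes at 2j = i + 1, which is the absorbing boundary just
    outside the range where h is nonzero.\<close>
  define c where "c i j = (real (i + 1) - 2 * real j) * fact i / (2 ^ i * fact j * fact (i + 1 - j))" for i j :: nat
  have rec: "c i j * (a * h i j) = c i j * ((h (Suc i) j + h (Suc i) (Suc j)) / 2)" for i j
  proof -
    consider k where "i = 2 * j + Suc k" | "i = 2 * j" | "i + 1 = 2 * j" | "i + 1 < 2 * j"
    proof -
      have "2 * j < i \<Longrightarrow> \<exists>k. i = 2 * j + Suc k" by presburger
      then show ?thesis using that by (metis less_linear less_iff_Suc_add Suc_eq_plus1 Suc_lessI)
    qed
    then show ?thesis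
    proof cases
      case 1
      have "a * h i j = (h (Suc i) j + h (Suc i) (Suc j)) / 2"
        unfolding h_def 1 by (simp add: algebra_simps)
      then show ?thesis by simp
    qed (simp_all add: h_def c_def)
  qed
  have pascal: "(if j \<le> i then c i j else 0) / 2 + (if j = 0 then 0 else c i (j - 1)) / 2 = c (Suc i) j" if "2 * j \<le> Suc i" for i j
  proof -
    have ji: "j \<le> i" using that by (cases i) auto
    obtain d where d: "i = j + d" using ji le_Suc_ex by blast
    have f1: "fact (i + 1 - j) = (real d + 1) * fact d" unfolding d by (simp add: algebra_simps)
    have f2: "fact (Suc i + 1 - j) = (real d + 2) * ((real d + 1) * fact d)" unfolding d by (simp add: algebra_simps)
    have f3: "fact (Suc i) = (real j + real d + 1) * fact i" unfolding d by (simp add: algebra_simps)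
    have nz: "real d + 1 \<noteq> 0" "real d + 2 \<noteq> 0" by linarith+
    have C1: "c i j = (real d + 1 - real j) * fact i / (2 ^ i * fact j * ((real d + 1) * fact d))"
      unfolding c_def f1 using d by simp
    have C2: "c (Suc i) j = (real d + 2 - real j) * ((real j + real d + 1) * fact i) / (2 * 2 ^ i * fact j * ((real d + 2) * ((real d + 1) * fact d)))"
      unfolding c_def f2 f3 using d by simp
    show ?thesis
    proof (cases j)
      case 0
      have r: "real j = 0" using 0 by simp
      have "c i j / 2 = c (Suc i) j"
        unfolding C1 C2 r using nz by (simp add: divide_simps)
      then show ?thesis using 0 by simp
    next
      case (Suc j')
      have f4: "fact (i + 1 - j') = (real d + 2) * ((real d + 1) * fact d)" unfolding d Suc by (simp add: algebra_simps)
      have f5: "fact j = (real j' + 1) * fact j'" unfolding Suc by (simp add: algebra_simps)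
      have rj: "real j = real j' + 1" using Suc by simp
      have C3: "c i j' = (real d + 2 - real j') * fact i / (2 ^ i * fact j' * ((real d + 2) * ((real d + 1) * fact d)))"
        unfolding c_def f4 using d Suc by simp
      have id: "(d + 1 - (J + 1)) * F / (W * ((J + 1) * G) * ((d + 1) * D)) / 2 + (d + 2 - J) * F / (W * G * ((d + 2) * ((d + 1) * D))) / 2
          = (d + 2 - (J + 1)) * ((J + 1 + d + 1) * F) / (2 * W * ((J + 1) * G) * ((d + 2) * ((d + 1) * D)))"
        if "0 \<le> d" "0 \<le> J" "W \<noteq> 0" "G \<noteq> 0" "D \<noteq> 0" for d J F W G D :: real
      proof -
        have "d + 1 \<noteq> 0" "d + 2 \<noteq> 0" "J + 1 \<noteq> 0" using that by linarith+
        then show ?thesis using that by (simp add: divide_simps) (simp add: algebra_simps)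
      qed
      have "c i j / 2 + c i j' / 2 = c (Suc i) j"
        unfolding C1 C2 C3 f5 rj by (rule id) auto
      then show ?thesis using Suc ji by simp
    qed
  qed
  have "a ^ i = (\<Sum>j\<le>i. c i j * h i j)"
  proof (induction i)
    case 0
    show ?case by (simp add: c_def h_def)
  next
    case (Suc i)
    have "a ^ Suc i = (\<Sum>j\<le>i. c i j * (a * h i j))" by (simp add: Suc sum_distrib_left mult_ac)
    also have "\<dots> = (\<Sum>j\<le>i. c i j / 2 * h (Suc i) j) + (\<Sum>j\<le>i. c i j / 2 * h (Suc i) (Suc j))"
      unfolding rec by (simp add: sum.distrib[symmetric] algebra_simps add_divide_distrib)
    also have "(\<Sum>j\<le>i. c i j / 2 * h (Suc i) j) = (\<Sum>j\<le>Suc i. (if j \<le> i then c i j else 0) / 2 * h (Suc i) j)"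
      by simp
    also have "(\<Sum>j\<le>i. c i j / 2 * h (Suc i) (Suc j)) = (\<Sum>j\<le>Suc i. (if j = 0 then 0 else c i (j - 1)) / 2 * h (Suc i) j)"
      by (subst sum.atMost_Suc_shift) simp
    finally have "a ^ Suc i = (\<Sum>j\<le>Suc i. ((if j \<le> i then c i j else 0) / 2 + (if j = 0 then 0 else c i (j - 1)) / 2) * h (Suc i) j)"
      by (simp only: sum.distrib[symmetric] distrib_right[symmetric])
    also have "\<dots> = (\<Sum>j\<le>Suc i. c (Suc i) j * h (Suc i) j)"
    proof (rule sum.cong[OF refl])
      fix j
      show "((if j \<le> i then c i j else 0) / 2 + (if j = 0 then 0 else c i (j - 1)) / 2) * h (Suc i) j = c (Suc i) j * h (Suc i) j"
        using pascal[of j i] by (cases "2 * j \<le> Suc i") (simp_all add: h_def)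
    qed
    finally show ?case .
  qed
  also have "\<dots> = (\<Sum>j | 2 * j \<le> i. c i j * h i j)"
    by (rule sum.mono_neutral_right) (auto simp: h_def)
  also have "\<dots> = (\<Sum>j | 2 * j \<le> i. zcoeff (i - 2 * j) j * (s ^ j * poly (zonal s (i - 2 * j)) a))"
  proof (rule sum.cong[OF refl])
    fix j assume "j \<in> {j. 2 * j \<le> i}"
    then have j: "2 * j \<le> i" by simp
    then have "i - 2 * j + 2 * j = i" "i - 2 * j + j + 1 = i + 1 - j" "real (i - 2 * j) = real i - 2 * real j" by auto
    then show "c i j * h i j = zcoeff (i - 2 * j) j * (s ^ j * poly (zonal s (i - 2 * j)) a)"
      using j by (simp add: c_def h_def zcoeff_def algebra_simps)
  qed
  finally show ?thesis .
qed

lemma poly_zonal_expansion: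
  fixes p :: "real poly"
  assumes "degree p \<le> k"
  shows "poly p a = (\<Sum>m\<le>k. \<Sum>j\<le>k. coeff p (m + 2 * j) * zcoeff m j * (s ^ j * poly (zonal s m) a))"
proof -
  let ?F = "\<lambda>m j. coeff p (m + 2 * j) * zcoeff m j * (s ^ j * poly (zonal s m) a)"
  have "poly p a = (\<Sum>i\<le>k. coeff p i * a ^ i)"
    unfolding poly_altdef using assms by (intro sum.mono_neutral_left) (auto simp: coeff_eq_0)
  also have "\<dots> = (\<Sum>i\<le>k. \<Sum>j | 2 * j \<le> i. ?F (i - 2 * j) j)"
    by (subst power_zonal_expansion[of _ _ s], subst sum_distrib_left) (intro sum.cong refl, simp add: mult.assoc)
  also have "\<dots> = (\<Sum>i\<le>k. \<Sum>j\<le>k. if 2 * j \<le> i then ?F (i - 2 * j) j else 0)"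
    by (intro sum.cong refl sum.mono_neutral_cong_left) auto
  also have "\<dots> = (\<Sum>j\<le>k. \<Sum>i\<le>k. if 2 * j \<le> i then ?F (i - 2 * j) j else 0)"
    by (rule sum.swap)
  also have "\<dots> = (\<Sum>j\<le>k. \<Sum>m\<le>k. ?F m j)"
  proof (rule sum.cong[OF refl])
    fix j
    have "(\<Sum>i\<le>k. if 2 * j \<le> i then ?F (i - 2 * j) j else 0) = (\<Sum>i\<in>{2 * j..k}. ?F (i - 2 * j) j)"
      by (rule sum.mono_neutral_cong_right) auto
    also have "\<dots> = (\<Sum>m\<in>{m. m + 2 * j \<le> k}. ?F m j)"
      by (rule sum.reindex_bij_witness[where i = "\<lambda>m. m + 2 * j" and j = "\<lambda>i. i - 2 * j"]) auto
    also have "\<dots> = (\<Sum>m\<le>k. ?F m j)"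
      using assms by (intro sum.mono_neutral_left) (auto simp: coeff_eq_0)
    finally show "(\<Sum>i\<le>k. if 2 * j \<le> i then ?F (i - 2 * j) j else 0) = (\<Sum>m\<le>k. ?F m j)" .
  qed
  also have "\<dots> = (\<Sum>m\<le>k. \<Sum>j\<le>k. ?F m j)" by (rule sum.swap)
  finally show ?thesis .
qed

lemma degree_higher_pderiv_cheb: "degree ((pderiv ^^ n) (cheb k)) \<le> k"
  using degree_cheb[of k] by (simp add: degree_higher_pderiv)

section \<open>Action of the semigroup on zonal polynomials\<close>

context sub_heat
begin

lemma solid_cont: "continuous_on A (solid w m j)" for w :: "'n hvec"
  using real_polynomial_function_solid[of w m j] real_polynomial_function_eq[of "solid w m j"]
    continuous_on_polymonial_function by blast

lemma P_gen_sum: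
  assumes "finite I" "\<And>i. i \<in> I \<Longrightarrow> continuous_on S (f i)"
    "\<And>i. i \<in> I \<Longrightarrow> uniform_limit S (\<lambda>t q. (P t (f i) q - f i q) / t) (g i) (at_right 0)"
  shows "uniform_limit S (\<lambda>t q. (P t (\<lambda>x. \<Sum>i\<in>I. c i * f i x) q - (\<Sum>i\<in>I. c i * f i q)) / t)
    (\<lambda>q. \<Sum>i\<in>I. c i * g i q) (at_right 0)"
proof -
  have "uniform_limit S (\<lambda>t q. \<Sum>i\<in>I. c i * ((P t (f i) q - f i q) / t)) (\<lambda>q. \<Sum>i\<in>I. c i * g i q) (at_right 0)"
    using assms(1,3)
  proof (induction rule: finite_induct)
    case empty
    show ?case by (simp add: uniform_limit_const)
  next
    case (insert i I)
    have "uniform_limit S (\<lambda>t q. c i * ((P t (f i) q - f i q) / t)) (\<lambda>q. c i * g i q) (at_right 0)"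
      by (intro bounded_linear.uniform_limit[OF bounded_linear_mult_right] insert) simp
    with insert show ?case by (simp add: uniform_limit_add)
  qed
  moreover have "\<forall>\<^sub>F t in at_right 0. \<forall>q\<in>S. (P t (\<lambda>x. \<Sum>i\<in>I. c i * f i x) q - (\<Sum>i\<in>I. c i * f i q)) / t
      = (\<Sum>i\<in>I. c i * ((P t (f i) q - f i q) / t))"
  proof (rule eventually_at_rightI[of 0 1])
    fix t :: real assume "t \<in> {0<..<1}"
    then have "0 \<le> t" by simp
    from P_sum[OF this _ assms(1,2)] show "\<forall>q\<in>S. (P t (\<lambda>x. \<Sum>i\<in>I. c i * f i x) q - (\<Sum>i\<in>I. c i * f i q)) / t
      = (\<Sum>i\<in>I. c i * ((P t (f i) q - f i q) / t))"
      by (simp add: sum_subtractf[symmetric] sum_divide_distrib right_diff_distrib)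
  qed simp
  ultimately show ?thesis
    by (subst uniform_limit_cong[where g = "\<lambda>t q. \<Sum>i\<in>I. c i * ((P t (f i) q - f i q) / t)"]) auto
qed

text \<open>By \<open>W_rec\<close> the term lowered from j + 1 to j and the diagonal term combine
  to a multiple of \<open>solid w m j\<close> whose factor is the same for all j. For fixed m the
  weighted sum over j is thus an eigenfunction with eigenvalue m (m + 2) - (k^2 - N^2).\<close>

lemma P_cheb_derivative:
  fixes w :: "'n hvec" and k :: nat
  assumes w: "norm w = 1" and N: "N = 2 * CARD('n) + 1" and t: "0 \<le> t" and q: "q \<in> S"
  defines "p \<equiv> (pderiv ^^ N) (cheb k)"
  shows "P t (\<lambda>x. poly p (x \<bullet> w)) q =
    (\<Sum>m\<le>k. exp ((real m * (real m + 2) - (real k)\<^sup>2 + (real N)\<^sup>2) * t)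
       * (\<Sum>j\<le>k. coeff p (m + 2 * j) * zcoeff m j * solid w m j q))"
proof -
  define W where "W m j = coeff p (m + 2 * j) * zcoeff m j" for m j
  define \<mu> where "\<mu> m = real m * (real m + 2) - (real k)\<^sup>2 + (real N)\<^sup>2" for m
  define Z where "Z m x = (\<Sum>j\<le>k. W m j * solid w m j x)" for m x
  have deg: "degree p \<le> k" unfolding p_def by (rule degree_higher_pderiv_cheb)
  have Zc: "continuous_on A (Z m)" for A m
    unfolding Z_def[abs_def] by (intro continuous_on_sum continuous_on_mult_left solid_cont)
  have W_rec: "4 * (real j + 1) * (real m + real j + 2) * W m (Suc j)
      = ((real m + 2 * real j) * (real m + 2 * real j + 2 * real N) + (real N)\<^sup>2 - (real k)\<^sup>2) * W m j" for m j
  proof -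
    have c: "(real m + 2 * real j + 2) * (real m + 2 * real j + 1) * coeff p (m + 2 * Suc j)
      = ((real m + 2 * real j) * (real m + 2 * real j + 2 * real N) + (real N)\<^sup>2 - (real k)\<^sup>2) * coeff p (m + 2 * j)"
      using coeff_higher_pderiv_cheb_rec[of "m + 2 * j" N k, folded p_def] by (simp add: algebra_simps)
    have "4 * (real j + 1) * (real m + real j + 2) * W m (Suc j)
      = coeff p (m + 2 * Suc j) * (4 * (real j + 1) * (real m + real j + 2) * zcoeff m (Suc j))"
      by (simp add: W_def)
    also have "\<dots> = ((real m + 2 * real j + 2) * (real m + 2 * real j + 1) * coeff p (m + 2 * Suc j)) * zcoeff m j"
      unfolding zcoeff_rec by (simp only: mult_ac)
    finally show ?thesis unfolding c W_def by (simp only: mult_ac)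
  qed
  have n: "4 * real CARD('n) = 2 * real N - 2" using N by simp
  have eig: "(\<Sum>j\<le>k. W m j * sub_laplacian (solid w m j) x) = \<mu> m * Z m x" if x: "norm x = 1" for m x
  proof -
    let ?s = "\<lambda>j. solid w m j x"
    \<comment> \<open>The degree bound makes the weight beyond k vanish, so the index shift loses
      nothing at the upper end.\<close>
    have W0: "W m (Suc k) = 0" using deg by (simp add: W_def coeff_eq_0)
    have "(\<Sum>j\<le>k. W m j * sub_laplacian (solid w m j) x)
      = (\<Sum>j\<le>k. W m j * (4 * real j * (real m + real j + 1)) * ?s (j - 1))
        - (\<Sum>j\<le>k. W m j * (4 * real j * (real m + real j + 1) + (2 * real N - 2) * (real m + 2 * real j)) * ?s j)"
      unfolding sub_laplacian_solid[OF w x] n by (simp add: sum_subtractf[symmetric] algebra_simps)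
    also have "(\<Sum>j\<le>k. W m j * (4 * real j * (real m + real j + 1)) * ?s (j - 1))
      = (\<Sum>j\<le>Suc k. W m j * (4 * real j * (real m + real j + 1)) * ?s (j - 1))"
      using W0 by simp
    also have "\<dots> = (\<Sum>j\<le>k. (4 * (real j + 1) * (real m + real j + 2) * W m (Suc j)) * ?s j)"
      by (subst sum.atMost_Suc_shift) (simp add: mult_ac add_ac)
    also have "\<dots> - (\<Sum>j\<le>k. W m j * (4 * real j * (real m + real j + 1) + (2 * real N - 2) * (real m + 2 * real j)) * ?s j)
      = (\<Sum>j\<le>k. \<mu> m * (W m j * ?s j))"
      unfolding W_rec sum_subtractf[symmetric]
      by (intro sum.cong refl) (simp add: \<mu>_def algebra_simps power2_eq_square)
    finally show ?thesis by (simp add: Z_def sum_distrib_left)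
  qed
  have "uniform_limit S (\<lambda>t q. (P t (\<lambda>x. \<Sum>j\<le>k. W m j * solid w m j x) q - (\<Sum>j\<le>k. W m j * solid w m j q)) / t)
    (\<lambda>q. \<Sum>j\<le>k. W m j * sub_laplacian (solid w m j) q) (at_right 0)" for m
    by (rule P_gen_sum) (auto intro: solid_cont P_gen smooth_on_sphere_real_polynomial_function real_polynomial_function_solid)
  then have "uniform_limit S (\<lambda>t q. (P t (Z m) q - Z m q) / t) (\<lambda>q. \<mu> m * Z m q) (at_right 0)" for m
    unfolding Z_def[symmetric] by (rule uniform_limit_cong'[THEN iffD1, rotated 2]) (simp_all add: eig)
  then have eigZ: "P t (Z m) q = exp (\<mu> m * t) * Z m q" for m
    using t q by (intro P_eigenfunction Zc)
  have "(\<lambda>x. poly p (x \<bullet> w)) = (\<lambda>x. \<Sum>m\<le>k. 1 * Z m x)"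
    unfolding Z_def W_def solid_def mult_1 by (intro ext poly_zonal_expansion[OF deg])
  then have "P t (\<lambda>x. poly p (x \<bullet> w)) q = (\<Sum>m\<le>k. 1 * P t (Z m) q)"
    using P_sum[OF t q, of "{..k}" Z "\<lambda>_. 1"] Zc by simp
  then show ?thesis by (simp add: eigZ) (simp add: \<mu>_def Z_def W_def)
qed

text \<open>
  The Gaussian moments of \<open>y sinh ((m + 1) y)\<close> produce the factors \<open>exp ((m + 1)\<^sup>2 t)\<close> by which \<open>P t\<close> differs
  from the heat semigroup of the round metric on the components of the zonal polynomial.
\<close>

lemma P_cheb_derivative_integral:
  fixes w :: "'n hvec" and k :: nat
  assumes w: "norm w = 1" and N: "N = 2 * CARD('n) + 1" and t: "0 < t"
    and \<rho>: "north_pole \<bullet> w = \<rho>" "qnorm2 w north_pole = \<rho>\<^sup>2"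
  defines "p \<equiv> (pderiv ^^ N) (cheb k)"
  shows "has_bochner_integral lborel
    (\<lambda>y. normal_density 0 (sqrt (2 * t)) y * (y * sinh y) * (exp (- (real k)\<^sup>2 * t) * poly p (\<rho> * cosh y)))
    (2 * t * exp ((1 - (real N)\<^sup>2) * t) * P t (\<lambda>x. poly p (x \<bullet> w)) north_pole)"
proof -
  have deg: "degree p \<le> k" unfolding p_def by (rule degree_higher_pderiv_cheb)
  have np: "north_pole \<in> S" by (simp add: north_pole_def norm_Pair qone_def)
  let ?W = "\<lambda>m j. coeff p (m + 2 * j) * zcoeff m j"
  let ?e = "exp (- (real k)\<^sup>2 * t)"
  have "has_bochner_integral lborel (\<lambda>y. \<Sum>m\<le>k. \<Sum>j\<le>k. ?e * (?W m j * \<rho> ^ (m + 2 * j)) *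
       (normal_density 0 (sqrt (2 * t)) y * (y * sinh ((real m + 1) * y))))
     (\<Sum>m\<le>k. \<Sum>j\<le>k. ?e * (?W m j * \<rho> ^ (m + 2 * j)) * (2 * t * (real m + 1) * exp ((real m + 1)\<^sup>2 * t)))"
    by (intro has_bochner_integral_sum has_bochner_integral_mult_right has_bochner_integral_normal_density_sinh t)
  moreover have "(\<Sum>m\<le>k. \<Sum>j\<le>k. ?e * (?W m j * \<rho> ^ (m + 2 * j)) *
       (normal_density 0 (sqrt (2 * t)) y * (y * sinh ((real m + 1) * y))))
     = normal_density 0 (sqrt (2 * t)) y * (y * sinh y) * (?e * poly p (\<rho> * cosh y))" for y
  proof -
    have "normal_density 0 (sqrt (2 * t)) y * (y * sinh y) * (?e * poly p (\<rho> * cosh y))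
      = (\<Sum>m\<le>k. \<Sum>j\<le>k. ?e * (?W m j * (\<rho>\<^sup>2) ^ j) *
        (normal_density 0 (sqrt (2 * t)) y * (y * (poly (zonal (\<rho>\<^sup>2) m) (\<rho> * cosh y) * sinh y))))"
      unfolding poly_zonal_expansion[OF deg, of "\<rho> * cosh y" "\<rho>\<^sup>2"] by (simp add: sum_distrib_left mult_ac)
    then show ?thesis unfolding zonal_cosh by (simp add: power_add power_mult[symmetric] mult_ac)
  qed
  moreover have "(\<Sum>m\<le>k. \<Sum>j\<le>k. ?e * (?W m j * \<rho> ^ (m + 2 * j)) * (2 * t * (real m + 1) * exp ((real m + 1)\<^sup>2 * t)))
     = 2 * t * exp ((1 - (real N)\<^sup>2) * t) * P t (\<lambda>x. poly p (x \<bullet> w)) north_pole"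
  proof -
    let ?E = "exp ((1 - (real N)\<^sup>2) * t)"
    let ?f = "\<lambda>m. exp ((real m * (real m + 2) - (real k)\<^sup>2 + (real N)\<^sup>2) * t)"
    let ?a = "\<lambda>m. \<Sum>j\<le>k. ?W m j * solid w m j north_pole"
    \<comment> \<open>The prefactor \<open>?E\<close> completes m (m + 2) + N^2 - k^2 to (m + 1)^2 -
      k^2, whose first part is the exponent produced by the Gaussian moment.\<close>
    have e: "?E * ?f m = ?e * exp ((real m + 1)\<^sup>2 * t)" for m
      by (simp add: exp_add[symmetric] algebra_simps power2_eq_square)
    \<comment> \<open>At the pole both parameters come from the same \<rho>, and the zonal value
      leaves the multiplicity m + 1, which is the linear factor of the Gaussian moment.\<close>
    have sol: "solid w m j north_pole = (real m + 1) * \<rho> ^ (m + 2 * j)" for m j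
      by (simp add: solid_def \<rho> zonal_diag power_add power_mult)
    have "?E * P t (\<lambda>x. poly p (x \<bullet> w)) north_pole = (\<Sum>m\<le>k. ?E * (?f m * ?a m))"
      unfolding p_def P_cheb_derivative[OF w N less_imp_le[OF t] np] by (rule sum_distrib_left)
    also have "\<dots> = (\<Sum>m\<le>k. (?e * exp ((real m + 1)\<^sup>2 * t)) * (\<Sum>j\<le>k. ?W m j * ((real m + 1) * \<rho> ^ (m + 2 * j))))"
      unfolding mult.assoc[of ?E, symmetric] e sol ..
    finally have "2 * t * (?E * P t (\<lambda>x. poly p (x \<bullet> w)) north_pole) = 2 * t * \<dots>"
      by (rule arg_cong)
    then show ?thesis
      by (simp add: sum_distrib_left mult_ac del: distrib_left_numeral distrib_right_numeral)
  qed
  ultimately show ?thesis by simp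
qed

end

section \<open>Integration over the sphere\<close>

lemma sphere_vol_map_measurable:
  "(\<lambda>x::'a::euclidean_space. x /\<^sub>R norm x) \<in> restrict_space lborel (cball 0 1 - {0}) \<rightarrow>\<^sub>M restrict_space borel (sphere 0 1)"
proof (rule measurable_restrict_space2)
  show "(\<lambda>x::'a. x /\<^sub>R norm x) \<in> space (restrict_space lborel (cball 0 1 - {0})) \<rightarrow> sphere 0 1"
    by (auto simp: space_restrict_space)
  show "(\<lambda>x::'a. x /\<^sub>R norm x) \<in> restrict_space lborel (cball 0 1 - {0}) \<rightarrow>\<^sub>M borel"
    by (rule measurable_restrict_space1) measurable
qed

lemma space_sphere_vol [simp]: "space (sphere_vol :: 'a::euclidean_space measure) = sphere 0 1"
  by (simp add: sphere_vol_def space_restrict_space space_scale_measure)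

lemma sets_sphere_vol [simp, measurable_cong]:
  "sets (sphere_vol :: 'a::euclidean_space measure) = sets (restrict_space borel (sphere 0 1))"
  by (simp add: sphere_vol_def)

lemma scale_measure_eq_density: "scale_measure c M = density M (\<lambda>_. c)"
  by (rule measure_eqI) (auto simp: emeasure_density_const)

lemma integral_sphere_vol:
  fixes f :: "'a::euclidean_space \<Rightarrow> real"
  assumes "f \<in> borel_measurable (restrict_space borel (sphere 0 1))"
  shows "(\<integral>q. f q \<partial>sphere_vol) = real DIM('a) * (LINT x:cball 0 1 - {0}|lborel. f (x /\<^sub>R norm x))"
proof -
  have "(\<integral>q. f q \<partial>sphere_vol) = real DIM('a) *
     (\<integral>q. f q \<partial>(distr (restrict_space lborel (cball 0 1 - {0})) (restrict_space borel (sphere 0 1)) (\<lambda>x. x /\<^sub>R norm x)))"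
    unfolding sphere_vol_def scale_measure_eq_density ennreal_of_nat_eq_real_of_nat
    using assms by (subst integral_density) auto
  also have "\<dots> = real DIM('a) * (\<integral>x. f (x /\<^sub>R norm x) \<partial>(restrict_space lborel (cball 0 1 - {0})))"
    by (subst integral_distr[OF sphere_vol_map_measurable assms]) simp
  also have "\<dots> = real DIM('a) * (LINT x:cball 0 1 - {0}|lborel. f (x /\<^sub>R norm x))"
    by (subst integral_restrict_space) (simp_all add: set_lebesgue_integral_def)
  finally show ?thesis .
qed

lemma emeasure_sphere_vol_space:
  "emeasure sphere_vol (sphere (0::'a::euclidean_space) 1) < \<infinity>"
proof -
  have "emeasure (restrict_space lborel (cball (0::'a) 1 - {0})) (cball 0 1 - {0}) < \<infinity>"
  proof -
    have "emeasure lborel (cball (0::'a) 1 - {0}) \<le> emeasure lborel (cball (0::'a) 1)"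
      by (intro emeasure_mono) auto
    also have "\<dots> < \<infinity>" by (rule emeasure_lborel_cball_finite)
    finally show ?thesis by (subst emeasure_restrict_space) auto
  qed
  moreover have "(\<lambda>x::'a. x /\<^sub>R norm x) -` sphere 0 1 \<inter> space (restrict_space lborel (cball 0 1 - {0})) = cball 0 1 - {0}"
    by (auto simp: space_restrict_space)
  ultimately show ?thesis
    unfolding sphere_vol_def
    by (subst emeasure_scale_measure, subst emeasure_distr[OF sphere_vol_map_measurable])
      (auto simp: ennreal_mult_less_top sets_restrict_space_iff of_nat_less_top)
qed

lemma finite_measure_sphere_vol: "finite_measure (sphere_vol :: 'a::euclidean_space measure)"
  using emeasure_sphere_vol_space by (intro finite_measureI) (simp add: less_top)

lemma borel_measurable_sphere:
  fixes f :: "'a::euclidean_space \<Rightarrow> real"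
  assumes "continuous_on (sphere 0 1) f"
  shows "f \<in> borel_measurable (restrict_space borel (sphere 0 1))"
  by (rule borel_measurable_continuous_on_restrict[OF assms])

lemma integrable_sphere_vol:
  fixes f :: "'a::euclidean_space \<Rightarrow> real"
  assumes "continuous_on (sphere 0 1) f"
  shows "integrable sphere_vol f"
proof -
  have "compact (f ` sphere 0 1)" by (intro compact_continuous_image assms) simp
  then obtain B where B: "\<forall>y\<in>f ` sphere 0 1. norm y \<le> B" using compact_imp_bounded bounded_iff by metis
  interpret finite_measure "sphere_vol :: 'a measure" by (rule finite_measure_sphere_vol)
  have "f \<in> borel_measurable sphere_vol"
    using borel_measurable_sphere[OF assms] by (simp cong: measurable_cong_sets)
  then show ?thesis using B
    by (intro integrable_const_bound[where B = B]) auto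
qed

text \<open>Dilation by s contributes s to the dimension, the weight contributes s^d, and g is
  invariant.\<close>

lemma scaled_ball_integral:
  fixes g :: "'a::euclidean_space \<Rightarrow> real"
  assumes g: "g \<in> borel_measurable borel" and hom: "\<And>c x. 0 < c \<Longrightarrow> g (c *\<^sub>R x) = g x" and s: "0 < s"
  shows "(LINT x:cball 0 s|lborel. norm x ^ d * g x) = s ^ (DIM('a) + d) * (LINT x:cball 0 1|lborel. norm x ^ d * g x)"
proof -
  let ?f = "\<lambda>x::'a. indicator (cball 0 s) x *\<^sub>R (norm x ^ d * g x)"
  have lb: "(lborel :: 'a measure) = density (distr lborel borel (\<lambda>x. 0 + s *\<^sub>R x)) (\<lambda>_. \<bar>s\<bar> ^ DIM('a))"
    using s by (intro lborel_affine) simp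
  note g[measurable]
  have [measurable]: "cball (0::'a) s \<in> sets borel" by simp
  have m: "?f \<in> borel_measurable borel" by measurable
  have "(\<integral>x. ?f x \<partial>lborel) = (\<integral>x. s ^ DIM('a) *\<^sub>R ?f x \<partial>(distr lborel borel (\<lambda>x. 0 + s *\<^sub>R x)))"
    using s m by (subst lb, subst integral_density) auto
  also have "\<dots> = (\<integral>x. s ^ DIM('a) *\<^sub>R ?f (s *\<^sub>R x) \<partial>lborel)"
    using m by (subst integral_distr) auto
  also have "\<dots> = (\<integral>x. s ^ (DIM('a) + d) *\<^sub>R (indicator (cball 0 1) x *\<^sub>R (norm x ^ d * g x)) \<partial>lborel)"
    using s by (intro Bochner_Integration.integral_cong refl)
      (auto simp: indicator_def hom power_mult_distrib power_add mult_le_cancel_left_pos[of s _ 1, simplified])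
  also have "\<dots> = s ^ (DIM('a) + d) * (\<integral>x. indicator (cball 0 1) x *\<^sub>R (norm x ^ d * g x) \<partial>lborel)"
    by simp
  finally show ?thesis by (simp add: set_lebesgue_integral_def)
qed

lemma set_integrable_ball_bounded:
  fixes f :: "'a::euclidean_space \<Rightarrow> real"
  assumes "f \<in> borel_measurable borel" "\<And>x. norm x \<le> s \<Longrightarrow> \<bar>f x\<bar> \<le> B"
  shows "set_integrable lborel (cball 0 s) f"
  unfolding set_integrable_def
proof (rule integrableI_bounded_set_indicator[where B = B])
  show "emeasure lborel (cball (0::'a) s) < \<infinity>" by (rule emeasure_lborel_cball_finite)
qed (use assms in auto)

lemma power_diff_quotient_tendsto: "((\<lambda>s::real. (1 - s ^ n) / (1 - s)) \<longlongrightarrow> real n) (at_left 1)"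
proof -
  have "((\<lambda>s::real. s ^ n) has_real_derivative real n) (at 1)"
    by (auto intro!: derivative_eq_intros)
  then have "((\<lambda>s::real. (s ^ n - 1) / (s - 1)) \<longlongrightarrow> real n) (at 1)"
    by (simp add: has_field_derivative_iff)
  then have "((\<lambda>s::real. (s ^ n - 1) / (s - 1)) \<longlongrightarrow> real n) (at_left 1)"
    by (rule filterlim_mono[OF _ order_refl at_le]) simp
  moreover have "(s ^ n - 1) / (s - 1) = (1 - s ^ n) / (1 - s)" for s :: real
    by (metis minus_diff_eq minus_divide_divide)
  ultimately show ?thesis by simp
qed

text \<open>
  Comparing the integrals over thin shells \<open>s < |x| \<le> 1\<close> determines how a homogeneous weight changes
  the integral over the ball.
\<close>

lemma weighted_ball_integral_nonneg:
  fixes g :: "'a::euclidean_space \<Rightarrow> real"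
  assumes g: "g \<in> borel_measurable borel" and hom: "\<And>c x. 0 < c \<Longrightarrow> g (c *\<^sub>R x) = g x"
    and B: "\<And>x. \<bar>g x\<bar> \<le> B" and pos: "\<And>x. 0 \<le> g x"
  shows "(real DIM('a) + real d) * (LINT x:cball 0 1|lborel. norm x ^ d * g x) = real DIM('a) * (LINT x:cball 0 1|lborel. g x)"
proof -
  define \<phi> where "\<phi> = (LINT x:cball (0::'a) 1|lborel. norm x ^ d * g x)"
  define \<gamma> where "\<gamma> = (LINT x:cball (0::'a) 1|lborel. g x)"
  let ?D = "DIM('a)"
  have B0: "0 \<le> B" using B[of 0] by simp
  have int: "set_integrable lborel (cball 0 s) (\<lambda>x. norm x ^ e * g x)" if "s \<le> 1" for s e
  proof (rule set_integrable_ball_bounded[where B = B])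
    fix x :: 'a assume "norm x \<le> s"
    then have "norm x ^ e \<le> 1" using that by (intro power_le_one) auto
    then have "norm x ^ e * \<bar>g x\<bar> \<le> 1 * B" using B by (intro mult_mono) auto
    then show "\<bar>norm x ^ e * g x\<bar> \<le> B" by (simp add: abs_mult)
  qed (use g in measurable)
  have shell: "(LINT x:cball 0 1 - cball 0 s|lborel. norm x ^ e * g x)
      = (LINT x:cball 0 1|lborel. norm x ^ e * g x) - (LINT x:cball 0 s|lborel. norm x ^ e * g x)" if "0 < s" "s \<le> 1" for s e
  proof -
    have "(LINT x:(cball 0 1 - cball 0 s) \<union> cball 0 s|lborel. norm x ^ e * g x)
      = (LINT x:cball 0 1 - cball 0 s|lborel. norm x ^ e * g x) + (LINT x:cball 0 s|lborel. norm x ^ e * g x)"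
      by (rule set_integral_Un[OF _ set_integrable_subset[OF int[of 1 e]] int[OF that(2)]]) auto
    also have "(cball 0 1 - cball 0 s) \<union> cball (0::'a) s = cball 0 1" using that by auto
    finally show ?thesis by simp
  qed
  \<comment> \<open>On the shell the weight lies between s^d and 1, which traps the weighted
    integral between multiples of the unweighted one.\<close>
  have "(1 - s ^ (?D + d)) * \<phi> \<le> (1 - s ^ ?D) * \<gamma>" and "s ^ d * ((1 - s ^ ?D) * \<gamma>) \<le> (1 - s ^ (?D + d)) * \<phi>"
    if s: "0 < s" "s \<le> 1" for s
  proof -
    let ?A = "cball (0::'a) 1 - cball 0 s"
    have iA: "set_integrable lborel ?A (\<lambda>x. norm x ^ e * g x)" for e
      by (rule set_integrable_subset[OF int[of 1 e]]) auto
    have e1: "(LINT x:?A|lborel. norm x ^ d * g x) = (1 - s ^ (?D + d)) * \<phi>"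
      using shell[OF s, of d] scaled_ball_integral[OF g hom s(1), of d] by (simp add: \<phi>_def algebra_simps)
    have e2: "(LINT x:?A|lborel. norm x ^ 0 * g x) = (1 - s ^ ?D) * \<gamma>"
      using shell[OF s, of 0] scaled_ball_integral[OF g hom s(1), of 0] by (simp add: \<gamma>_def algebra_simps)
    have "(LINT x:?A|lborel. norm x ^ d * g x) \<le> (LINT x:?A|lborel. norm x ^ 0 * g x)"
      by (rule set_integral_mono[OF iA iA]) (auto intro!: mult_left_le_one_le pos power_le_one)
    then show "(1 - s ^ (?D + d)) * \<phi> \<le> (1 - s ^ ?D) * \<gamma>" unfolding e1 e2 .
    have "(LINT x:?A|lborel. s ^ d * (norm x ^ 0 * g x)) \<le> (LINT x:?A|lborel. norm x ^ d * g x)"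
      using s by (intro set_integral_mono[OF _ iA] set_integrable_mult_right iA)
        (auto intro!: mult_right_mono pos power_mono)
    then show "s ^ d * ((1 - s ^ ?D) * \<gamma>) \<le> (1 - s ^ (?D + d)) * \<phi>" unfolding set_integral_mult_right e1 e2 .
  qed
  note ineq = this
  have ev: "\<forall>\<^sub>F s::real in at_left 1. 0 < s \<and> s < 1"
    by (rule eventually_at_leftI[of 0]) auto
  have "real (?D + d) * \<phi> \<le> real ?D * \<gamma>"
  proof (rule tendsto_le)
    show "((\<lambda>s. (1 - s ^ ?D) / (1 - s) * \<gamma>) \<longlongrightarrow> real ?D * \<gamma>) (at_left 1)"
      by (intro tendsto_mult tendsto_const power_diff_quotient_tendsto)
    show "((\<lambda>s. (1 - s ^ (?D + d)) / (1 - s) * \<phi>) \<longlongrightarrow> real (?D + d) * \<phi>) (at_left 1)"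
      by (intro tendsto_mult tendsto_const power_diff_quotient_tendsto)
    show "\<forall>\<^sub>F s in at_left 1. (1 - s ^ (?D + d)) / (1 - s) * \<phi> \<le> (1 - s ^ ?D) / (1 - s) * \<gamma>"
      using ev by eventually_elim (use ineq(1) in \<open>simp add: divide_simps\<close>)
  qed simp
  moreover have "1 ^ d * (real ?D * \<gamma>) \<le> real (?D + d) * \<phi>"
  proof (rule tendsto_le)
    show "((\<lambda>s. s ^ d * ((1 - s ^ ?D) / (1 - s) * \<gamma>)) \<longlongrightarrow> 1 ^ d * (real ?D * \<gamma>)) (at_left 1)"
      by (intro tendsto_mult tendsto_const power_diff_quotient_tendsto tendsto_power tendsto_ident_at)
    show "((\<lambda>s. (1 - s ^ (?D + d)) / (1 - s) * \<phi>) \<longlongrightarrow> real (?D + d) * \<phi>) (at_left 1)"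
      by (intro tendsto_mult tendsto_const power_diff_quotient_tendsto)
    show "\<forall>\<^sub>F s in at_left 1. s ^ d * ((1 - s ^ ?D) / (1 - s) * \<gamma>) \<le> (1 - s ^ (?D + d)) / (1 - s) * \<phi>"
      using ev by eventually_elim (use ineq(2) in \<open>simp add: divide_simps\<close>)
  qed simp
  ultimately show ?thesis by (simp add: \<phi>_def \<gamma>_def)
qed

lemma weighted_ball_integral:
  fixes g :: "'a::euclidean_space \<Rightarrow> real"
  assumes g: "g \<in> borel_measurable borel" and hom: "\<And>c x. 0 < c \<Longrightarrow> g (c *\<^sub>R x) = g x"
    and B: "\<And>x. \<bar>g x\<bar> \<le> B"
  shows "(real DIM('a) + real d) * (LINT x:cball 0 1|lborel. norm x ^ d * g x) = real DIM('a) * (LINT x:cball 0 1|lborel. g x)"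
proof -
  have B0: "0 \<le> B" using B[of 0] by simp
  let ?p = "\<lambda>x. max 0 (g x)" and ?m = "\<lambda>x. max 0 (- g x)"
  have p: "(real DIM('a) + real d) * (LINT x:cball 0 1|lborel. norm x ^ d * ?p x) = real DIM('a) * (LINT x:cball 0 1|lborel. ?p x)"
    using g hom B B0 by (intro weighted_ball_integral_nonneg[where B = B]) (auto simp: max_def abs_le_iff)
  have m: "(real DIM('a) + real d) * (LINT x:cball 0 1|lborel. norm x ^ d * ?m x) = real DIM('a) * (LINT x:cball 0 1|lborel. ?m x)"
    using g hom B B0 by (intro weighted_ball_integral_nonneg[where B = B]) (auto simp: max_def abs_le_iff)
  have int: "set_integrable lborel (cball 0 1) (\<lambda>x. norm x ^ e * h x)"
    if "\<And>x. \<bar>h x\<bar> \<le> B" "h \<in> borel_measurable borel" for e and h :: "'a \<Rightarrow> real"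
  proof (rule set_integrable_ball_bounded[where B = B])
    fix x :: 'a assume "norm x \<le> 1"
    then have "norm x ^ e \<le> 1" by (intro power_le_one) auto
    then have "norm x ^ e * \<bar>h x\<bar> \<le> 1 * B" using that by (intro mult_mono) auto
    then show "\<bar>norm x ^ e * h x\<bar> \<le> B" by (simp add: abs_mult)
  qed (use that in measurable)
  have ip: "set_integrable lborel (cball 0 1) (\<lambda>x. norm x ^ e * ?p x)" for e
    using B B0 g by (intro int) (auto simp: max_def abs_le_iff)
  have im: "set_integrable lborel (cball 0 1) (\<lambda>x. norm x ^ e * ?m x)" for e
    using B B0 g by (intro int) (auto simp: max_def abs_le_iff)
  have split: "(LINT x:cball 0 1|lborel. norm x ^ e * g x) = (LINT x:cball 0 1|lborel. norm x ^ e * ?p x) - (LINT x:cball 0 1|lborel. norm x ^ e * ?m x)" for e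
    by (subst set_integral_diff(2)[OF ip im, symmetric]) (auto intro!: arg_cong2[where f = set_lebesgue_integral] simp: max_def set_lebesgue_integral_def algebra_simps intro!: Bochner_Integration.integral_cong)
  have split0: "(LINT x:cball 0 1|lborel. g x) = (LINT x:cball 0 1|lborel. ?p x) - (LINT x:cball 0 1|lborel. ?m x)"
    using split[of 0] by simp
  show ?thesis unfolding split[of d] split0 right_diff_distrib p m ..
qed

section \<open>Moments of linear functionals over the sphere\<close>

definition sphere_moment :: "'a::euclidean_space \<Rightarrow> nat \<Rightarrow> real" where
  "sphere_moment w i = (\<integral>q. (q \<bullet> w) ^ i \<partial>sphere_vol)"

text \<open>The integrand is norm^(i+d) times a function homogeneous of degree 0 that equals (q .
  w)^i on the sphere; the weight formula turns the ball integral into a sphere integral.\<close>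

lemma ball_moment:
  fixes w :: "'a::euclidean_space"
  shows "(real DIM('a) + real (i + d)) * (LINT x:cball 0 1|lborel. norm x ^ d * (x \<bullet> w) ^ i) = sphere_moment w i"
proof -
  define g where "g x = ((x /\<^sub>R norm x) \<bullet> w) ^ i" for x :: 'a
  have gm: "g \<in> borel_measurable borel" unfolding g_def by measurable
  have B: "\<bar>g x\<bar> \<le> norm w ^ i" for x
  proof -
    have "\<bar>(x /\<^sub>R norm x) \<bullet> w\<bar> \<le> norm (x /\<^sub>R norm x) * norm w" by (rule Cauchy_Schwarz_ineq2)
    also have "\<dots> \<le> 1 * norm w" by (cases "x = 0") (auto intro!: mult_right_mono)
    finally show ?thesis by (simp add: g_def power_abs power_mono)
  qed
  have hom: "g (c *\<^sub>R x) = g x" if "0 < c" for c x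
    using that by (simp add: g_def field_simps)
  have eq: "norm x ^ d * (x \<bullet> w) ^ i = norm x ^ (i + d) * g x" for x
    by (cases "x = 0"; cases "i = 0"; cases "d = 0")
      (simp_all add: g_def power_add power_mult_distrib field_simps power_inverse)
  have "(\<lambda>q. (q \<bullet> w) ^ i) \<in> borel_measurable (restrict_space borel (sphere 0 1))"
    by (intro borel_measurable_sphere continuous_intros)
  then have "sphere_moment w i = real DIM('a) * (LINT x:cball 0 1 - {0}|lborel. g x)"
    unfolding sphere_moment_def g_def by (rule integral_sphere_vol)
  also have "(LINT x:cball 0 1 - {0}|lborel. g x) = (LINT x:cball 0 1|lborel. g x)"
    unfolding set_lebesgue_integral_def
  proof (rule integral_cong_AE)
    show "AE x in lborel. indicator (cball 0 1 - {0}) x *\<^sub>R g x = indicator (cball 0 1) x *\<^sub>R g x"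
      using AE_lborel_singleton[of 0] by eventually_elim (simp add: indicator_def)
  qed (auto intro!: borel_measurable_times borel_measurable_indicator gm)
  finally show ?thesis unfolding eq
    using weighted_ball_integral[of g "norm w ^ i" "i + d"] hom B gm by simp
qed

text \<open>The integrand is the derivative in the direction w of (1 - |x|^2) (x . w)^e, extended by
  zero outside the ball. Difference quotients of the extension integrate to 0 by translation
  invariance; the first factor vanishes on the boundary, so the extension is Lipschitz and dominated
  convergence applies.\<close>

lemma ball_integral_by_parts:
  fixes w :: "'a::euclidean_space"
  assumes w: "norm w = 1"
  shows "(LINT x:cball 0 1|lborel. real e * (x \<bullet> w) ^ (e - 1) * (1 - (norm x)\<^sup>2) - 2 * (x \<bullet> w) ^ (e + 1)) = 0"
proof -
  define G where "G x = (1 - (norm x)\<^sup>2) * (x \<bullet> w) ^ e" for x :: 'a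
  define G' where "G' x = real e * (x \<bullet> w) ^ (e - 1) * (1 - (norm x)\<^sup>2) - 2 * (x \<bullet> w) ^ (e + 1)" for x :: 'a
  define g where "g x = indicator (cball 0 1) x * G x" for x
  define h where "h n = 1 / (real n + 1)" for n
  have h: "0 < h n" "h n \<le> 1" for n by (auto simp: h_def)
  have hne: "h n \<noteq> 0" for n using h(1)[of n] by simp
  have h0: "h \<longlonglongrightarrow> 0" unfolding h_def using LIMSEQ_inverse_real_of_nat by (simp add: inverse_eq_divide add.commute)
  have [measurable]: "cball (0::'a) s \<in> sets borel" for s by simp
  have [measurable]: "g \<in> borel_measurable borel" "G' \<in> borel_measurable borel"
    unfolding g_def G_def G'_def by measurable
  have aw: "\<bar>x \<bullet> w\<bar> \<le> norm x" for x using Cauchy_Schwarz_ineq2[of x w] w by simp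
  have G1: "\<bar>G x\<bar> \<le> 1 - (norm x)\<^sup>2" "0 \<le> 1 - (norm x)\<^sup>2" if "norm x \<le> 1" for x
  proof -
    show p: "0 \<le> 1 - (norm x)\<^sup>2" using that by (simp add: abs_square_le_1)
    have "\<bar>x \<bullet> w\<bar> ^ e \<le> 1" using aw[of x] that by (intro power_le_one) auto
    then show "\<bar>G x\<bar> \<le> 1 - (norm x)\<^sup>2"
      using p by (simp add: G_def abs_mult power_abs mult_left_le)
  qed
  have G2: "\<bar>G x\<bar> \<le> 2 * (norm y - norm x)" if "norm x \<le> 1" "1 < norm y" for x y :: 'a
  proof -
    have "1 - (norm x)\<^sup>2 = (1 + norm x) * (1 - norm x)" by (simp add: power2_eq_square algebra_simps)
    also have "\<dots> \<le> 2 * (norm y - norm x)" using that by (intro mult_mono) auto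
    finally show ?thesis using G1[OF that(1)] by simp
  qed
  have lip: "\<bar>g (x + h n *\<^sub>R w) - g x\<bar> \<le> (real e + 2) * h n" for x n
  proof -
    let ?y = "x + h n *\<^sub>R w"
    have d: "\<bar>norm ?y - norm x\<bar> \<le> h n"
      using norm_triangle_ineq3[of ?y x] h[of n] w by simp
    have d2: "2 * h n \<le> (real e + 2) * h n" using h[of n] by simp
    \<comment> \<open>Only a step across the boundary goes beyond ordinary calculus: there 1 - |x|^2
      is at most twice the change of the norm.\<close>
    consider "norm x \<le> 1" "norm ?y \<le> 1" | "norm x \<le> 1" "1 < norm ?y" | "1 < norm x" "norm ?y \<le> 1" | "1 < norm x" "1 < norm ?y"
      by linarith
    then show ?thesis
    proof cases
      case 1
      have "G ?y - G x = ((norm x)\<^sup>2 - (norm ?y)\<^sup>2) * (?y \<bullet> w) ^ e + (1 - (norm x)\<^sup>2) * ((?y \<bullet> w) ^ e - (x \<bullet> w) ^ e)"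
        by (simp add: G_def algebra_simps)
      also have "\<bar>\<dots>\<bar> \<le> 2 * h n * 1 + 1 * (real e * h n)"
      proof (rule order_trans[OF abs_triangle_ineq add_mono])
        have "(norm x)\<^sup>2 - (norm ?y)\<^sup>2 = (norm x + norm ?y) * (norm x - norm ?y)"
          by (simp add: power2_eq_square algebra_simps)
        also have "\<bar>\<dots>\<bar> = (norm x + norm ?y) * \<bar>norm x - norm ?y\<bar>" by (simp add: abs_mult)
        also have "\<dots> \<le> 2 * h n" using 1 d h[of n] by (intro mult_mono) (auto simp: abs_minus_commute)
        finally have "\<bar>(norm x)\<^sup>2 - (norm ?y)\<^sup>2\<bar> \<le> 2 * h n" .
        moreover have "\<bar>(?y \<bullet> w) ^ e\<bar> \<le> 1" unfolding power_abs
          using aw[of ?y] 1 by (intro power_le_one) auto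
        ultimately show "\<bar>((norm x)\<^sup>2 - (norm ?y)\<^sup>2) * (?y \<bullet> w) ^ e\<bar> \<le> 2 * h n * 1"
          unfolding abs_mult using h[of n] by (intro mult_mono) auto
        have "\<bar>(?y \<bullet> w) ^ e - (x \<bullet> w) ^ e\<bar> \<le> real e * \<bar>?y \<bullet> w - x \<bullet> w\<bar>"
          using norm_power_diff[of "?y \<bullet> w" "x \<bullet> w" e] aw[of ?y] aw[of x] 1 by auto
        also have "\<dots> = real e * h n" using w h[of n] by (simp add: inner_add_left norm_eq_1)
        finally show "\<bar>(1 - (norm x)\<^sup>2) * ((?y \<bullet> w) ^ e - (x \<bullet> w) ^ e)\<bar> \<le> 1 * (real e * h n)"
          unfolding abs_mult using G1(2)[OF 1(1)] by (intro mult_mono) auto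
      qed
      finally show ?thesis using 1 by (simp add: g_def algebra_simps)
    next
      case 2
      then have "\<bar>g ?y - g x\<bar> \<le> 2 * h n" using G2[of x ?y] d by (simp add: g_def)
      with d2 show ?thesis by linarith
    next
      case 3
      then have "\<bar>g ?y - g x\<bar> \<le> 2 * h n" using G2[of ?y x] d by (simp add: g_def)
      with d2 show ?thesis by linarith
    next
      case 4
      then have "\<bar>g ?y - g x\<bar> \<le> 2 * h n" using h[of n] by (simp add: g_def)
      with d2 show ?thesis by linarith
    qed
  qed
  have gint: "integrable lborel g"
  proof -
    have "set_integrable lborel (cball 0 1) G"
    proof (rule set_integrable_ball_bounded[where B = 1])
      fix x :: 'a assume "norm x \<le> 1"
      then show "\<bar>G x\<bar> \<le> 1" using G1[of x] by (smt (verit) zero_le_power2)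
    qed (simp add: G_def[abs_def])
    then show ?thesis by (simp add: set_integrable_def g_def[abs_def])
  qed
  have shift_int: "integrable lborel (\<lambda>x. g (x + c))" and shift: "(\<integral>x. g (x + c) \<partial>lborel) = (\<integral>x. g x \<partial>lborel)" for c
  proof -
    have l: "(lborel :: 'a measure) = distr lborel borel ((+) c)" by (simp add: lborel_distr_plus)
    have "integrable (distr lborel borel ((+) c)) g" using gint unfolding l[symmetric] .
    then show "integrable lborel (\<lambda>x. g (x + c))" by (subst (asm) integrable_distr_eq) (auto simp: add.commute)
    have "(\<integral>x. g x \<partial>lborel) = (\<integral>x. g x \<partial>(distr lborel borel ((+) c)))" using l by simp
    also have "\<dots> = (\<integral>x. g (c + x) \<partial>lborel)" by (subst integral_distr) auto
    finally show "(\<integral>x. g (x + c) \<partial>lborel) = (\<integral>x. g x \<partial>lborel)" by (simp add: add.commute)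
  qed
  have "(\<lambda>n. \<integral>x. (g (x + h n *\<^sub>R w) - g x) / h n \<partial>lborel) \<longlonglongrightarrow> (\<integral>x. indicator (cball 0 1) x * G' x \<partial>lborel)"
  proof (rule integral_dominated_convergence)
    show "integrable lborel (\<lambda>x::'a. (real e + 2) * indicator (cball 0 2) x)"
      using emeasure_lborel_cball_finite[of "0::'a" 2] by (intro integrable_mult_right integrable_real_indicator) auto
    fix n
    have "\<bar>g (x + h n *\<^sub>R w) - g x\<bar> / h n \<le> (real e + 2) * indicator (cball 0 2) x" for x
    proof (cases "norm x \<le> 2")
      case True
      then show ?thesis using lip[of x n] h[of n] by (simp add: field_simps)
    next
      case False
      have "norm x - h n \<le> norm (x + h n *\<^sub>R w)" using norm_triangle_ineq3[of "x + h n *\<^sub>R w" x] h[of n] w by simp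
      then show ?thesis using False h[of n] by (simp add: g_def)
    qed
    then show "AE x in lborel. norm ((g (x + h n *\<^sub>R w) - g x) / h n) \<le> (real e + 2) * indicator (cball 0 2) x"
      using h[of n] by simp
  next
    \<comment> \<open>Boundary points, where the extension may fail to be differentiable, form a
      null set.\<close>
    have "sphere (0::'a) 1 \<in> null_sets lborel"
      using negligible_sphere[of "0::'a" 1] by (simp add: negligible_iff_null_sets null_sets_completion_iff)
    then have "AE x in lborel. x \<notin> sphere (0::'a) 1" by (rule AE_not_in)
    then show "AE x in lborel. (\<lambda>n. (g (x + h n *\<^sub>R w) - g x) / h n) \<longlonglongrightarrow> indicator (cball 0 1) x * G' x"
    proof eventually_elim
      fix x :: 'a assume x: "x \<notin> sphere 0 1"
      have lim: "(\<lambda>n. norm (x + h n *\<^sub>R w)) \<longlonglongrightarrow> norm (x + 0 *\<^sub>R w)" by (intro tendsto_intros h0)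
      show "(\<lambda>n. (g (x + h n *\<^sub>R w) - g x) / h n) \<longlonglongrightarrow> indicator (cball 0 1) x * G' x"
      proof (cases "norm x < 1")
        case True
        have "((\<lambda>s. G (x + s *\<^sub>R w)) has_real_derivative G' x) (at 0)"
          unfolding G_def G'_def power2_norm_eq_inner
          using w by (auto intro!: derivative_eq_intros simp: norm_eq_1 inner_commute algebra_simps)
        then have "((\<lambda>s. (G (x + s *\<^sub>R w) - G x) / s) \<longlongrightarrow> G' x) (at 0)"
          by (simp add: has_field_derivative_iff)
        moreover have "filterlim h (at 0) sequentially"
          using h0 hne by (simp add: filterlim_at)
        ultimately have "(\<lambda>n. (G (x + h n *\<^sub>R w) - G x) / h n) \<longlonglongrightarrow> G' x"
          by (rule filterlim_compose)
        moreover have "\<forall>\<^sub>F n in sequentially. norm (x + h n *\<^sub>R w) < 1"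
          using order_tendstoD(2)[OF lim, of 1] True by simp
        then have "\<forall>\<^sub>F n in sequentially. (G (x + h n *\<^sub>R w) - G x) / h n = (g (x + h n *\<^sub>R w) - g x) / h n"
          by eventually_elim (use True in \<open>simp add: g_def\<close>)
        ultimately have "(\<lambda>n. (g (x + h n *\<^sub>R w) - g x) / h n) \<longlonglongrightarrow> G' x"
          by (rule Lim_transform_eventually)
        then show ?thesis using True by simp
      next
        case False
        with x have x1: "1 < norm x" by simp
        have "\<forall>\<^sub>F n in sequentially. 1 < norm (x + h n *\<^sub>R w)"
          using order_tendstoD(1)[OF lim, of 1] x1 by simp
        then have "\<forall>\<^sub>F n in sequentially. 0 = (g (x + h n *\<^sub>R w) - g x) / h n"
          by eventually_elim (use x1 in \<open>simp add: g_def\<close>)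
        with tendsto_const have "(\<lambda>n. (g (x + h n *\<^sub>R w) - g x) / h n) \<longlonglongrightarrow> 0"
          by (rule Lim_transform_eventually)
        then show ?thesis using x1 by simp
      qed
    qed
  qed measurable
  moreover have "(\<integral>x. (g (x + h n *\<^sub>R w) - g x) / h n \<partial>lborel) = 0" for n
    using shift[of "h n *\<^sub>R w"] shift_int[of "h n *\<^sub>R w"] gint by simp
  ultimately have "(\<lambda>n. 0 :: real) \<longlonglongrightarrow> (\<integral>x. indicator (cball 0 1) x * G' x \<partial>lborel)"
    by (simp only:)
  then have "(\<integral>x. indicator (cball 0 1) x * G' x \<partial>lborel) = 0"
    by (simp only: LIMSEQ_const_iff)
  then show ?thesis by (simp add: set_lebesgue_integral_def G'_def)
qed

lemma sphere_moment_ball_int: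
  "set_integrable lborel (cball 0 1) (\<lambda>x::'a::euclidean_space. norm x ^ d * (x \<bullet> w) ^ i)"
proof (rule set_integrable_ball_bounded[where B = "norm w ^ i"])
  fix x :: 'a assume x: "norm x \<le> 1"
  have "\<bar>x \<bullet> w\<bar> \<le> norm x * norm w" by (rule Cauchy_Schwarz_ineq2)
  also have "\<dots> \<le> 1 * norm w" using x by (intro mult_right_mono) auto
  finally have "\<bar>x \<bullet> w\<bar> ^ i \<le> norm w ^ i" by (intro power_mono) auto
  moreover have "norm x ^ d \<le> 1" using x by (intro power_le_one) auto
  ultimately have "norm x ^ d * \<bar>x \<bullet> w\<bar> ^ i \<le> 1 * norm w ^ i" by (intro mult_mono) auto
  then show "\<bar>norm x ^ d * (x \<bullet> w) ^ i\<bar> \<le> norm w ^ i" by (simp add: abs_mult power_abs)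
qed measurable

lemma sphere_moment_1:
  fixes w :: "'a::euclidean_space"
  assumes w: "norm w = 1"
  shows "sphere_moment w 1 = 0"
proof -
  have "real 0 * (x \<bullet> w) ^ (0 - 1) * (1 - (norm x)\<^sup>2) - 2 * (x \<bullet> w) ^ (0 + 1) = (- 2) * (norm x ^ 0 * (x \<bullet> w) ^ 1)" for x
    by simp
  from ball_integral_by_parts[OF w, of 0, unfolded this set_integral_mult_right]
  have "(LINT x:cball 0 1|lborel. norm x ^ 0 * (x \<bullet> w) ^ 1) = 0" by simp
  then show ?thesis using ball_moment[of 1 0 w] by simp
qed

text \<open>With e = i + 1, \<open>ball_integral_by_parts\<close> relates three ball integrals, each
  a multiple of a sphere moment by \<open>ball_moment\<close>.\<close>

lemma sphere_moment_rec:
  fixes w :: "'a::euclidean_space"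
  assumes w: "norm w = 1"
  shows "(real DIM('a) + real i) * sphere_moment w (i + 2) = (real i + 1) * sphere_moment w i"
proof -
  let ?K = "\<lambda>d i. LINT x:cball 0 1|lborel. norm x ^ d * (x \<bullet> w) ^ i"
  have "(LINT x:cball 0 1|lborel. real (i + 1) * (norm x ^ 0 * (x \<bullet> w) ^ i) - real (i + 1) * (norm x ^ 2 * (x \<bullet> w) ^ i) - 2 * (norm x ^ 0 * (x \<bullet> w) ^ (i + 2))) = 0"
    using ball_integral_by_parts[OF w, of "i + 1"] by (simp add: algebra_simps)
  moreover have "(LINT x:cball 0 1|lborel. real (i + 1) * (norm x ^ 0 * (x \<bullet> w) ^ i) - real (i + 1) * (norm x ^ 2 * (x \<bullet> w) ^ i) - 2 * (norm x ^ 0 * (x \<bullet> w) ^ (i + 2)))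
    = real (i + 1) * ?K 0 i - real (i + 1) * ?K 2 i - 2 * ?K 0 (i + 2)"
    using sphere_moment_ball_int[of 0 w i] sphere_moment_ball_int[of 2 w i] sphere_moment_ball_int[of 0 w "i + 2"]
    by (simp only: set_integral_diff set_integral_mult_right set_integrable_mult_right)
  ultimately have "real (i + 1) * ?K 0 i - real (i + 1) * ?K 2 i - 2 * ?K 0 (i + 2) = 0" by (simp only:)
  moreover have "(real DIM('a) + real i) * ?K 0 i = sphere_moment w i" 
    "(real DIM('a) + real i + 2) * ?K 2 i = sphere_moment w i"
    "(real DIM('a) + real i + 2) * ?K 0 (i + 2) = sphere_moment w (i + 2)"
    using ball_moment[of i 0 w] ball_moment[of i 2 w] ball_moment[of "i + 2" 0 w] by (simp_all add: algebra_simps)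
  ultimately have "2 * ((real DIM('a) + real i) * sphere_moment w (i + 2)) = 2 * ((real i + 1) * sphere_moment w i)"
    by (simp only: of_nat_add of_nat_1) algebra
  then show ?thesis by simp
qed

lemma sphere_moment_0:
  fixes w :: "'a::euclidean_space"
  shows "sphere_moment w 0 = real DIM('a) * unit_ball_vol (real DIM('a))"
  using ball_moment[of 0 0 w] content_cball[of 1 "0::'a"] by (simp add: set_lebesgue_integral_def)

section \<open>A polynomial approximate identity\<close>

lemma lead_coeff_cheb: "coeff (cheb (Suc k)) (Suc k) = 2 ^ k"
proof (induction k)
  case (Suc k)
  have "coeff (cheb k) (Suc (Suc k)) = 0" using degree_cheb[of k] by (intro coeff_eq_0) simp
  then show ?case using Suc by simp
qed simp

lemma sphere_integral_poly:
  fixes w :: "'a::euclidean_space"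
  assumes "degree p \<le> K"
  shows "(\<integral>q. poly p (q \<bullet> w) \<partial>sphere_vol) = (\<Sum>i\<le>K. coeff p i * sphere_moment w i)"
proof -
  have int: "integrable sphere_vol (\<lambda>q. coeff p i * (q \<bullet> w) ^ i)" for i
    by (intro integrable_sphere_vol continuous_intros)
  have "(\<integral>q. poly p (q \<bullet> w) \<partial>sphere_vol) = (\<integral>q. (\<Sum>i\<le>degree p. coeff p i * (q \<bullet> w) ^ i) \<partial>sphere_vol)"
    by (simp add: poly_altdef)
  also have "\<dots> = (\<Sum>i\<le>degree p. coeff p i * sphere_moment w i)"
    using int by (subst Bochner_Integration.integral_sum) (auto simp: sphere_moment_def)
  also have "\<dots> = (\<Sum>i\<le>K. coeff p i * sphere_moment w i)"
    using assms by (intro sum.mono_neutral_left) (auto simp: coeff_eq_0)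
  finally show ?thesis .
qed

text \<open>The Gegenbauer operator is symmetric for the sphere measure and kills constants. In
  coordinates, the coefficient recurrence summed against the adjoint recurrence \<open>M\<close> of
  the moments leaves (N^2 - k^2) times the integral equal to 0. For k = N the derivative is the
  constant 2^(N-1) N!.\<close>

lemma sphere_integral_cheb:
  fixes w :: "'a::euclidean_space"
  assumes w: "norm w = 1" and D: "DIM('a) = 2 * N + 2" and "N \<noteq> 0"
  shows "(\<integral>q. poly ((pderiv ^^ N) (cheb k)) (q \<bullet> w) \<partial>sphere_vol)
    = (if k = N then 2 ^ (N - 1) * fact N * sphere_moment w 0 else 0)"
proof (cases "k = N")
  case True
  obtain N' where N': "N = Suc N'" using assms(3) not0_implies_Suc by blast
  have "degree ((pderiv ^^ N) (cheb k)) \<le> 0" using degree_cheb[of k] True by (simp add: degree_higher_pderiv)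
  from sphere_integral_poly[OF this, of w]
  have "(\<integral>q. poly ((pderiv ^^ N) (cheb k)) (q \<bullet> w) \<partial>sphere_vol) = coeff ((pderiv ^^ N) (cheb k)) 0 * sphere_moment w 0"
    by simp
  also have "coeff ((pderiv ^^ N) (cheb k)) 0 = fact N * coeff (cheb N) N"
    using True by (simp add: coeff_higher_pderiv pochhammer_fact)
  also have "coeff (cheb N) N = 2 ^ (N - 1)"
    using lead_coeff_cheb[of N'] N' by simp
  finally show ?thesis using True by simp
next
  case False
  define c where "c = coeff ((pderiv ^^ N) (cheb k))"
  let ?M = "sphere_moment w"
  have deg: "degree ((pderiv ^^ N) (cheb k)) \<le> k"
    using degree_cheb[of k] by (simp add: degree_higher_pderiv)
  have c0: "c i = 0" if "i > k" for i using that deg by (simp add: c_def coeff_eq_0)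
  have rec: "((real N)\<^sup>2 - (real k)\<^sup>2) * c i = real ((i + 2) * (i + 1)) * c (i + 2) - real i * (real i + 2 * real N) * c i" for i
    using coeff_higher_pderiv_cheb_rec[of i N k] by (simp add: c_def algebra_simps)
  have M: "real i * (real i + 2 * real N) * ?M i = real (i * (i - 1)) * ?M (i - 2)" for i
  proof -
    consider "i = 0" | "i = 1" | j where "i = j + 2" by (metis One_nat_def add_2_eq_Suc' not0_implies_Suc)
    then show ?thesis
    proof cases
      case 2
      then show ?thesis using sphere_moment_1[OF w] by simp
    next
      case 3
      have "real i * (real i + 2 * real N) * ?M i = real i * ((real DIM('a) + real j) * ?M (j + 2))"
        using 3 D by simp
      also have "\<dots> = real i * ((real j + 1) * ?M j)" unfolding sphere_moment_rec[OF w] ..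
      finally show ?thesis using 3 by (simp add: algebra_simps)
    qed simp
  qed
  have "((real N)\<^sup>2 - (real k)\<^sup>2) * (\<Sum>i\<le>k. c i * ?M i) = (\<Sum>i\<le>k + 2. ((real N)\<^sup>2 - (real k)\<^sup>2) * c i * ?M i)"
    using c0 by (simp add: sum_distrib_left mult.assoc)
  also have "\<dots> = (\<Sum>i\<le>k + 2. real ((i + 2) * (i + 1)) * c (i + 2) * ?M i) - (\<Sum>i\<le>k + 2. c i * (real i * (real i + 2 * real N) * ?M i))"
    unfolding rec sum_subtractf[symmetric] by (intro sum.cong refl) (simp only: left_diff_distrib right_diff_distrib mult_ac)
  also have "(\<Sum>i\<le>k + 2. real ((i + 2) * (i + 1)) * c (i + 2) * ?M i) = (\<Sum>i\<le>k. real ((i + 2) * (i + 1)) * c (i + 2) * ?M i)"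
    using c0 by simp
  also have "(\<Sum>i\<le>k + 2. c i * (real i * (real i + 2 * real N) * ?M i)) = (\<Sum>i\<le>Suc (Suc k). c i * (real (i * (i - 1)) * ?M (i - 2)))"
    unfolding M by simp
  also have "\<dots> = (\<Sum>i\<le>k. c (i + 2) * (real ((i + 2) * (i + 1)) * ?M i))"
    unfolding sum.atMost_Suc_shift by simp
  finally have "((real N)\<^sup>2 - (real k)\<^sup>2) * (\<Sum>i\<le>k. c i * ?M i) = 0" by (simp add: mult_ac)
  moreover have "(real N)\<^sup>2 - (real k)\<^sup>2 \<noteq> 0" using False by (simp add: power2_eq_iff)
  ultimately show ?thesis using False sphere_integral_poly[OF deg, of w] by (simp add: c_def)
qed

section \<open>Chebyshev coefficients of products of linear factors\<close>

definition cw :: "nat \<Rightarrow> real" where "cw k = (if k = 0 then 1 else 2)"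

lemma cw_simps [simp]: "cw 0 = 1" "cw (Suc k) = 2" by (simp_all add: cw_def)

lemma cw_nonneg [simp]: "0 \<le> cw k" by (simp add: cw_def)

text \<open>Multiplication by 2x is the neighbour sum on Chebyshev coefficients, regarded as a
  sequence even in k; this explains the weight \<open>cw\<close> and the doubled neighbour at k = 0.
  The factors are left general in order to serve binomial and q-binomial coefficients alike.\<close>

lemma cheb_product_expansion:
  fixes a :: "nat \<Rightarrow> nat \<Rightarrow> real"
  assumes a: "a 0 0 = 1" "\<And>M k. M < k \<Longrightarrow> a M k = 0"
    "\<And>M. a (Suc M) 0 = \<alpha> M * a M 0 + 2 * \<beta> M * a M 1"
    "\<And>M k. a (Suc M) (Suc k) = \<alpha> M * a M (Suc k) + \<beta> M * (a M k + a M (Suc (Suc k)))"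
  shows "(\<Prod>i<M. [:\<alpha> i, 2 * \<beta> i:]) = (\<Sum>k\<le>M. smult (cw k * a M k) (cheb k))"
proof -
  have "(\<Prod>i<M. \<alpha> i + 2 * \<beta> i * x) = (\<Sum>k\<le>M. cw k * a M k * poly (cheb k) x)" for x
  proof (induction M)
    case 0
    show ?case by (simp add: a)
  next
    case (Suc M)
    let ?T = "\<lambda>k. poly (cheb k) x" and ?a = "a M"
    have x: "2 * x * ?T (Suc k) = ?T (Suc (Suc k)) + ?T k" for k by simp
    have S: "(\<Sum>k\<le>M. cw k * ?a k * ?T k) = ?a 0 + (\<Sum>k\<le>M. 2 * ?a (Suc k) * ?T (Suc k))"
    proof -
      have "(\<Sum>k\<le>M. cw k * ?a k * ?T k) = (\<Sum>k\<le>Suc M. cw k * ?a k * ?T k)" using a(2) by simp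
      then show ?thesis by (simp only: sum.atMost_Suc_shift) simp
    qed
    have "2 * x * (\<Sum>k\<le>M. cw k * ?a k * ?T k) = 2 * ?a 0 * ?T 1 + (\<Sum>k\<le>M. 2 * ?a (Suc k) * (2 * x * ?T (Suc k)))"
      unfolding S by (simp add: distrib_left sum_distrib_left mult_ac)
    also have "\<dots> = 2 * ?a 0 * ?T 1 + (\<Sum>k\<le>M. 2 * ?a (Suc k) * (?T (Suc (Suc k)) + ?T k))"
      unfolding x ..
    also have "\<dots> = (2 * ?a 0 * ?T 1 + (\<Sum>k\<le>M. 2 * ?a (Suc k) * ?T (Suc (Suc k)))) + (\<Sum>k\<le>M. 2 * ?a (Suc k) * ?T k)"
      by (simp only: distrib_left sum.distrib add.assoc)
    also have "2 * ?a 0 * ?T 1 + (\<Sum>k\<le>M. 2 * ?a (Suc k) * ?T (Suc (Suc k))) = (\<Sum>k\<le>M. 2 * ?a k * ?T (Suc k))"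
    proof -
      have "(\<Sum>k\<le>M. 2 * ?a k * ?T (Suc k)) = (\<Sum>k\<le>Suc M. 2 * ?a k * ?T (Suc k))" using a(2) by simp
      then show ?thesis by (simp only: sum.atMost_Suc_shift) simp
    qed
    also have "(\<Sum>k\<le>M. 2 * ?a (Suc k) * ?T k) = 2 * ?a 1 + (\<Sum>k\<le>M. 2 * ?a (Suc (Suc k)) * ?T (Suc k))"
    proof -
      have "(\<Sum>k\<le>M. 2 * ?a (Suc k) * ?T k) = (\<Sum>k\<le>Suc M. 2 * ?a (Suc k) * ?T k)" using a(2) by simp
      then show ?thesis by (simp only: sum.atMost_Suc_shift) simp
    qed
    finally have X: "2 * x * (\<Sum>k\<le>M. cw k * ?a k * ?T k)
      = 2 * ?a 1 + (\<Sum>k\<le>M. 2 * (?a k + ?a (Suc (Suc k))) * ?T (Suc k))"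
      by (simp add: sum.distrib[symmetric] algebra_simps)
    have "(\<Prod>i<Suc M. \<alpha> i + 2 * \<beta> i * x) = \<alpha> M * (\<Sum>k\<le>M. cw k * ?a k * ?T k) + \<beta> M * (2 * x * (\<Sum>k\<le>M. cw k * ?a k * ?T k))"
      by (simp only: prod.lessThan_Suc Suc.IH) algebra
    also have "\<dots> = a (Suc M) 0 + (\<Sum>k\<le>M. 2 * a (Suc M) (Suc k) * ?T (Suc k))"
      unfolding X unfolding S a(3,4) by (simp add: distrib_left sum_distrib_left sum.distrib[symmetric] algebra_simps)
    also have "\<dots> = (\<Sum>k\<le>Suc M. cw k * a (Suc M) k * ?T k)"
      by (simp only: sum.atMost_Suc_shift) simp
    finally show ?case .
  qed
  then have "poly (\<Prod>i<M. [:\<alpha> i, 2 * \<beta> i:]) x = poly (\<Sum>k\<le>M. smult (cw k * a M k) (cheb k)) x" for x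
    by (simp add: poly_prod poly_sum mult_ac)
  then show ?thesis by (simp add: poly_eq_poly_eq_iff[symmetric] fun_eq_iff)
qed

text \<open>Binomials indexed from the middle of the row: the Fourier coefficients of (2 + 2 cos
  x)^J.\<close>

definition cbin :: "nat \<Rightarrow> nat \<Rightarrow> real" where "cbin J k = real ((2 * J) choose (J + k))"

lemma cbin_Suc:
  "cbin (Suc J) 0 = 2 * cbin J 0 + 2 * 1 * cbin J 1"
  "cbin (Suc J) (Suc k) = 2 * cbin J (Suc k) + 1 * (cbin J k + cbin J (Suc (Suc k)))"
proof -
  show "cbin (Suc J) (Suc k) = 2 * cbin J (Suc k) + 1 * (cbin J k + cbin J (Suc (Suc k)))"
    by (simp add: cbin_def)
  show "cbin (Suc J) 0 = 2 * cbin J 0 + 2 * 1 * cbin J 1"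
  proof (cases J)
    case (Suc j)
    have "(2 * J) choose (J - 1) = (2 * J) choose (J + 1)"
      using Suc binomial_symmetric[of "J + 1" "2 * J"] by simp
    then have "(2 * J) choose j = (2 * J) choose (Suc J)" using Suc by simp
    moreover have "(2 * Suc J) choose (Suc J) = ((2 * J) choose (Suc J)) + 2 * ((2 * J) choose J) + ((2 * J) choose j)"
      using Suc by simp
    ultimately show ?thesis by (simp add: cbin_def del: binomial_Suc_Suc mult_Suc_right)
  qed (simp add: cbin_def)
qed

lemma cbin_expansion: "[:2, 2:] ^ J = (\<Sum>k\<le>J. smult (cw k * cbin J k) (cheb k))"
proof -
  have "(\<Prod>i<J. [:2::real, 2 * 1:]) = (\<Sum>k\<le>J. smult (cw k * cbin J k) (cheb k))"
    by (rule cheb_product_expansion[where \<alpha> = "\<lambda>_. 2" and \<beta> = "\<lambda>_. 1"]) (simp_all only: cbin_Suc, simp_all add: cbin_def)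
  then show ?thesis by simp
qed

lemma cbin_pos: "0 < cbin J 0" by (simp add: cbin_def)

lemma cbin_ratio_le: "cbin J k / cbin J 0 \<le> 1"
proof -
  have "(2 * J) choose (J + k) \<le> (2 * J) choose (2 * J div 2)" by (rule binomial_maximum)
  then have "cbin J k \<le> cbin J 0" unfolding cbin_def by simp
  then show ?thesis using cbin_pos[of J] by simp
qed

lemma cbin_ratio_nonneg: "0 \<le> cbin J k / cbin J 0" by (simp add: cbin_def)

lemma cbin_ratio_tendsto: "(\<lambda>J. cbin J k / cbin J 0) \<longlonglongrightarrow> 1"
proof (induction k)
  case 0
  then show ?case using cbin_pos by (simp add: less_imp_neq[symmetric])
next
  case (Suc k)
  have rec: "cbin J (Suc k) / cbin J 0 = cbin J k / cbin J 0 * ((real J - real k) / (real J + real k + 1))" if "k \<le> J" for J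
  proof -
    have "Suc (J + k) * ((2 * J) choose Suc (J + k)) = (2 * J - (J + k)) * ((2 * J) choose (J + k))"
      by (simp only: binomial_absorption binomial_absorb_comp)
    then have "real (Suc (J + k)) * cbin J (Suc k) = (real J - real k) * cbin J k"
      using that unfolding cbin_def by (metis (mono_tags, opaque_lifting) add_Suc_right add_diff_cancel_left diff_diff_left mult_2 of_nat_diff of_nat_mult)
    moreover have "real J + real k + 1 \<noteq> 0" by linarith
    ultimately have "cbin J (Suc k) = cbin J k * ((real J - real k) / (real J + real k + 1))"
      by (simp add: field_simps)
    then show ?thesis by simp
  qed
  have "(\<lambda>J. (real J - real k) / (real J + real k + 1)) \<longlonglongrightarrow> 1" by real_asymp
  from tendsto_mult[OF Suc this] have "(\<lambda>J. cbin J k / cbin J 0 * ((real J - real k) / (real J + real k + 1))) \<longlonglongrightarrow> 1" by simp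
  moreover have "\<forall>\<^sub>F J in sequentially. cbin J k / cbin J 0 * ((real J - real k) / (real J + real k + 1)) = cbin J (Suc k) / cbin J 0"
    using eventually_ge_at_top[of k] by eventually_elim (simp add: rec)
  ultimately show ?case by (rule Lim_transform_eventually)
qed

text \<open>The central entry is the largest of the 2J + 1 entries in a row of sum 4^J.\<close>

lemma cbin_0_lower: "4 ^ J \<le> (2 * real J + 1) * cbin J 0"
proof -
  have "(2::nat) ^ (2 * J) = (\<Sum>k\<le>2 * J. (2 * J) choose k)" by (simp add: choose_row_sum)
  also have "\<dots> \<le> (\<Sum>k\<le>2 * J. (2 * J) choose J)"
    by (intro sum_mono) (use binomial_maximum[of "2 * J"] in simp)
  finally have "(2::nat) ^ (2 * J) \<le> (2 * J + 1) * ((2 * J) choose J)" by simp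
  then have "real (2 ^ (2 * J)) \<le> real ((2 * J + 1) * ((2 * J) choose J))" by (rule of_nat_mono)
  moreover have "(4::real) ^ J = 2 ^ (2 * J)" by (simp add: power_mult)
  ultimately show ?thesis by (simp add: cbin_def algebra_simps)
qed

text \<open>For J < N the falling factorial contains the factor 0, so the truncated exponent
  \<open>J - N\<close> does no harm.\<close>

lemma higher_pderiv_linear_power:
  "(pderiv ^^ N) ([:2, 2:] ^ J) = smult (2 ^ N * (\<Prod>i<N. real J - real i)) ([:2, 2:] ^ (J - N))"
proof (induction N)
  case (Suc N)
  have "pderiv ([:2, 2:] ^ (J - N)) = smult (2 * (real J - real N)) ([:2, 2:] ^ (J - Suc N))" if "N \<le> J"
    using that by (simp add: pderiv_power pderiv_pCons of_nat_diff mult.commute)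
  moreover have "(\<Prod>i<Suc N. real J - real i) = 0" if "J < Suc N"
    using that by auto
  moreover have "pderiv ([:2, 2:] ^ (J - N)) = (0::real poly)" if "J \<le> N" using that by (simp add: pderiv_1)
  ultimately show ?case
    by (cases "N \<le> J") (auto simp: Suc pderiv_smult algebra_simps)
qed simp

lemma power_times_geometric_tendsto_0:
  assumes "0 < \<theta>" "\<theta> < (1::real)"
  shows "(\<lambda>J. real J ^ k * \<theta> ^ J) \<longlonglongrightarrow> 0"
proof (cases "k = 0")
  case False
  define s where "s = root k \<theta>"
  have s: "0 < s" "s < 1" "s ^ k = \<theta>" using assms False by (auto simp: s_def)
  have "(\<lambda>J. (real J * s ^ J) ^ k) \<longlonglongrightarrow> 0 ^ k"
    using s by (intro tendsto_power powser_times_n_limit_0) auto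
  moreover have "(real J * s ^ J) ^ k = real J ^ k * \<theta> ^ J" for J
    by (simp add: power_mult_distrib s(3)[symmetric] power_mult[symmetric] mult.commute)
  ultimately show ?thesis using False by (simp add: power_0_left)
qed (use assms in \<open>simp add: LIMSEQ_power_zero\<close>)

lemma inner_eq_one_minus_dist:
  assumes "norm q = 1" "norm w = 1"
  shows "q \<bullet> w = 1 - (dist q w)\<^sup>2 / 2"
proof -
  have "(dist q w)\<^sup>2 = q \<bullet> q - 2 * (q \<bullet> w) + w \<bullet> w"
    by (simp add: dist_norm power2_norm_eq_inner inner_diff_left inner_diff_right inner_commute)
  then show ?thesis using assms by (simp add: norm_eq_1 field_simps)
qed

text \<open>
  Up to normalization the kernel is the zonal polynomial \<open>((1 + q \<bullet> w) / 2)\<^bsup>J - N\<^esup>\<close>, which is nonnegative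
  and concentrates at \<open>q = w\<close>.
\<close>

lemma sphere_approximate_identity:
  fixes w :: "'a::euclidean_space" and f :: "'a \<Rightarrow> real"
  assumes w: "norm w = 1" and D: "DIM('a) = 2 * N + 2" and N: "N \<noteq> 0" and f: "continuous_on (sphere 0 1) f"
  shows "(\<lambda>J. \<Sum>k\<le>J. cw k * (cbin J k / cbin J 0) * (\<integral>q. f q * poly ((pderiv ^^ N) (cheb k)) (q \<bullet> w) \<partial>sphere_vol))
    \<longlonglongrightarrow> 2 ^ N * fact N * sphere_moment w 0 * f w"
proof -
  let ?S = "sphere (0::'a) 1"
  let ?p = "\<lambda>k. (pderiv ^^ N) (cheb k)"
  define \<phi> where "\<phi> J x = (\<Sum>k\<le>J. cw k * (cbin J k / cbin J 0) * poly (?p k) x)" for J x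
  have \<phi>_eq: "\<phi> J x = 2 ^ N * (\<Prod>i<N. real J - real i) * (2 + 2 * x) ^ (J - N) / cbin J 0" for J x
  proof -
    have "(\<Sum>k\<le>J. smult (cw k * cbin J k) (?p k)) = (pderiv ^^ N) (\<Sum>k\<le>J. smult (cw k * cbin J k) (cheb k))"
      by (simp add: higher_pderiv_sum higher_pderiv_smult)
    also have "\<dots> = smult (2 ^ N * (\<Prod>i<N. real J - real i)) ([:2, 2:] ^ (J - N))"
      by (simp only: cbin_expansion[symmetric] higher_pderiv_linear_power)
    finally have "poly (\<Sum>k\<le>J. smult (cw k * cbin J k) (?p k)) x = poly (smult (2 ^ N * (\<Prod>i<N. real J - real i)) ([:2, 2:] ^ (J - N))) x"
      by simp
    then show ?thesis by (simp add: \<phi>_def poly_sum sum_divide_distrib[symmetric] mult_ac)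
  qed
  have cont\<phi>: "continuous_on ?S (\<lambda>q. \<phi> J (q \<bullet> w))" for J
    unfolding \<phi>_eq divide_inverse by (intro continuous_intros)
  have contp: "continuous_on ?S (\<lambda>q. poly (?p k) (q \<bullet> w))" for k
    by (intro continuous_intros)
  \<comment> \<open>Orthogonality to constants leaves only the term k = N.\<close>
  have mass: "(\<integral>q. \<phi> J (q \<bullet> w) \<partial>sphere_vol) = 2 * (cbin J N / cbin J 0) * (2 ^ (N - 1) * fact N * sphere_moment w 0)" if "N \<le> J" for J
  proof -
    have "(\<integral>q. \<phi> J (q \<bullet> w) \<partial>sphere_vol) = (\<Sum>k\<le>J. cw k * (cbin J k / cbin J 0) * (\<integral>q. poly (?p k) (q \<bullet> w) \<partial>sphere_vol))"
      unfolding \<phi>_def using integrable_sphere_vol[OF contp] by (subst Bochner_Integration.integral_sum) auto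
    also have "\<dots> = (\<Sum>k\<le>J. if k = N then cw k * (cbin J k / cbin J 0) * (2 ^ (N - 1) * fact N * sphere_moment w 0) else 0)"
      unfolding sphere_integral_cheb[OF w D N] by (intro sum.cong refl) simp
    also have "\<dots> = cw N * (cbin J N / cbin J 0) * (2 ^ (N - 1) * fact N * sphere_moment w 0)"
      using that by (subst sum.delta) auto
    finally show ?thesis using N by (simp add: cw_def)
  qed
  let ?m = "2 ^ N * fact N * sphere_moment w 0"
  have mass_lim: "(\<lambda>J. \<integral>q. \<phi> J (q \<bullet> w) \<partial>sphere_vol) \<longlonglongrightarrow> ?m"
  proof -
    have "(\<lambda>J. 2 * (cbin J N / cbin J 0) * (2 ^ (N - 1) * fact N * sphere_moment w 0)) \<longlonglongrightarrow> 2 * 1 * (2 ^ (N - 1) * fact N * sphere_moment w 0)"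
      by (intro tendsto_mult tendsto_const cbin_ratio_tendsto)
    also have "2 * 1 * (2 ^ (N - 1) * fact N * sphere_moment w 0) = ?m"
      using N by (cases N) auto
    finally have L: "(\<lambda>J. 2 * (cbin J N / cbin J 0) * (2 ^ (N - 1) * fact N * sphere_moment w 0)) \<longlonglongrightarrow> ?m" .
    have "\<forall>\<^sub>F J in sequentially. 2 * (cbin J N / cbin J 0) * (2 ^ (N - 1) * fact N * sphere_moment w 0) = (\<integral>q. \<phi> J (q \<bullet> w) \<partial>sphere_vol)"
      using eventually_ge_at_top[of N] by eventually_elim (rule mass[symmetric])
    with L show ?thesis by (rule Lim_transform_eventually)
  qed
  have inner_bound: "- 1 \<le> q \<bullet> w" "q \<bullet> w \<le> 1" if "q \<in> ?S" for q
    using Cauchy_Schwarz_ineq2[of q w] that w by auto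
  have \<phi>_nonneg: "0 \<le> \<phi> J x" if "- 1 \<le> x" "N \<le> J" for J x
  proof -
    have "0 \<le> (\<Prod>i<N. real J - real i)" using that by (intro prod_nonneg) auto
    then show ?thesis unfolding \<phi>_eq using that cbin_pos[of J] by (intro divide_nonneg_pos mult_nonneg_nonneg) auto
  qed
  obtain B where B: "0 \<le> B" "\<And>q. q \<in> ?S \<Longrightarrow> \<bar>f q\<bar> \<le> B"
  proof -
    have "compact (f ` ?S)" by (intro compact_continuous_image f) simp
    then obtain B where "\<forall>y\<in>f ` ?S. norm y \<le> B" using compact_imp_bounded bounded_iff by metis
    then have "\<bar>f q\<bar> \<le> max 0 B" if "q \<in> ?S" for q using that by (simp add: le_max_iff_disj)
    then show ?thesis using that[of "max 0 B"] by simp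
  qed
  have wS: "w \<in> ?S" using w by simp
  interpret finite_measure "sphere_vol :: 'a measure" by (rule finite_measure_sphere_vol)
  have main: "(\<lambda>J. (\<integral>q. f q * \<phi> J (q \<bullet> w) \<partial>sphere_vol) - f w * (\<integral>q. \<phi> J (q \<bullet> w) \<partial>sphere_vol)) \<longlonglongrightarrow> 0"
  proof (rule tendstoI)
    fix e :: real assume e: "0 < e"
    define e' where "e' = e / (2 * (\<bar>?m\<bar> + 1))"
    have e': "0 < e'" using e by (simp add: e'_def add_nonneg_pos)
    from f e' wS obtain d where d: "0 < d" "\<And>q. q \<in> ?S \<Longrightarrow> dist q w < d \<Longrightarrow> dist (f q) (f w) < e'"
      unfolding continuous_on_iff by metis
    define c where "c = min 1 (d\<^sup>2 / 2)"
    have c: "0 < c" "c \<le> 1" "c \<le> d\<^sup>2 / 2" using d(1) by (auto simp: c_def)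
    define \<theta> where "\<theta> = 1 - c / 2"
    have \<theta>: "0 < \<theta>" "\<theta> < 1" using c by (auto simp: \<theta>_def)
    then have \<theta>n: "\<theta> \<noteq> 0" by simp
    \<comment> \<open>Off the cap around w the power ((1 + x) / 2)^J is at most \<theta>^J. The
      other factors, including 4^J over the central binomial, grow at most polynomially.\<close>
    define \<eta> where "\<eta> J = (2 / (4 * \<theta>)) ^ N * (2 * (real J ^ (N + 1) * \<theta> ^ J) + real J ^ N * \<theta> ^ J)" for J
    have far: "\<phi> J x \<le> \<eta> J" if "- 1 \<le> x" "x \<le> 1 - c" "N \<le> J" for J x
    proof -
      have 1: "(\<Prod>i<N. real J - real i) \<le> real J ^ N"
        using prod_mono[of "{..<N}" "\<lambda>i. real J - real i" "\<lambda>i. real J"] that(3) by simp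
      have 0: "0 \<le> (\<Prod>i<N. real J - real i)" using that by (intro prod_nonneg) auto
      have 2: "(2 + 2 * x) ^ (J - N) \<le> (4 * \<theta>) ^ (J - N)" using that by (intro power_mono) (auto simp: \<theta>_def)
      have 3: "1 / cbin J 0 \<le> (2 * real J + 1) / 4 ^ J"
        using cbin_0_lower[of J] cbin_pos[of J] by (simp add: field_simps)
      have "\<phi> J x = 2 ^ N * ((\<Prod>i<N. real J - real i) * ((2 + 2 * x) ^ (J - N) * (1 / cbin J 0)))"
        by (simp add: \<phi>_eq)
      also have "\<dots> \<le> 2 ^ N * (real J ^ N * ((4 * \<theta>) ^ (J - N) * ((2 * real J + 1) / 4 ^ J)))"
        using that \<theta> cbin_pos[of J] 0
        by (intro mult_left_mono mult_mono 1 2 3) (auto intro!: mult_nonneg_nonneg)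
      also have "(4 * \<theta>) ^ (J - N) = (4 * \<theta>) ^ J / (4 * \<theta>) ^ N"
        using \<theta> that(3) by (intro power_diff) auto
      also have "2 ^ N * (real J ^ N * ((4 * \<theta>) ^ J / (4 * \<theta>) ^ N * ((2 * real J + 1) / 4 ^ J))) = \<eta> J"
        by (simp only: \<eta>_def power_divide power_mult_distrib[of 4 \<theta> J]) (simp add: field_simps \<theta>n)
      finally show ?thesis .
    qed
    have \<eta>0: "\<eta> \<longlonglongrightarrow> 0"
    proof -
      have "(\<lambda>J. (2 / (4 * \<theta>)) ^ N * (2 * (real J ^ (N + 1) * \<theta> ^ J) + real J ^ N * \<theta> ^ J)) \<longlonglongrightarrow> (2 / (4 * \<theta>)) ^ N * (2 * 0 + 0)"
        by (intro tendsto_mult tendsto_add tendsto_const power_times_geometric_tendsto_0 \<theta>)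
      then show ?thesis by (simp add: \<eta>_def[abs_def])
    qed
    define \<sigma> where "\<sigma> = measure sphere_vol ?S"
    have bound: "\<bar>(\<integral>q. f q * \<phi> J (q \<bullet> w) \<partial>sphere_vol) - f w * (\<integral>q. \<phi> J (q \<bullet> w) \<partial>sphere_vol)\<bar>
        \<le> e' * (\<integral>q. \<phi> J (q \<bullet> w) \<partial>sphere_vol) + 2 * B * \<eta> J * \<sigma>" if J: "N \<le> J" for J
    proof -
      have i1: "integrable sphere_vol (\<lambda>q. f q * \<phi> J (q \<bullet> w))" and i2: "integrable sphere_vol (\<lambda>q. \<phi> J (q \<bullet> w))"
        by (intro integrable_sphere_vol continuous_on_mult f cont\<phi>)+
      have i3: "integrable sphere_vol (\<lambda>q. (f q - f w) * \<phi> J (q \<bullet> w))"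
        by (intro integrable_sphere_vol continuous_on_mult continuous_on_diff continuous_on_const f cont\<phi>)
      have "(\<integral>q. f q * \<phi> J (q \<bullet> w) \<partial>sphere_vol) - f w * (\<integral>q. \<phi> J (q \<bullet> w) \<partial>sphere_vol) = (\<integral>q. (f q - f w) * \<phi> J (q \<bullet> w) \<partial>sphere_vol)"
        using i1 i2 by (simp add: left_diff_distrib)
      also have "\<bar>\<dots>\<bar> \<le> (\<integral>q. \<bar>(f q - f w) * \<phi> J (q \<bullet> w)\<bar> \<partial>sphere_vol)"
        by (rule integral_abs_bound)
      also have "\<dots> \<le> (\<integral>q. e' * \<phi> J (q \<bullet> w) + 2 * B * \<eta> J \<partial>sphere_vol)"
      proof (rule integral_mono)
        show "integrable sphere_vol (\<lambda>q. \<bar>(f q - f w) * \<phi> J (q \<bullet> w)\<bar>)" using i3 by (rule integrable_abs)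
        show "integrable sphere_vol (\<lambda>q. e' * \<phi> J (q \<bullet> w) + 2 * B * \<eta> J)"
          using i2 by (intro Bochner_Integration.integrable_add integrable_mult_right) auto
        fix q :: 'a assume "q \<in> space sphere_vol"
        then have q: "q \<in> ?S" by simp
        have p: "0 \<le> \<phi> J (q \<bullet> w)" using inner_bound[OF q] J by (intro \<phi>_nonneg)
        show "\<bar>(f q - f w) * \<phi> J (q \<bullet> w)\<bar> \<le> e' * \<phi> J (q \<bullet> w) + 2 * B * \<eta> J"
        proof (cases "dist q w < d")
          case True
          then have "\<bar>f q - f w\<bar> \<le> e'" using d(2)[OF q] by (simp add: dist_real_def)
          then have "\<bar>f q - f w\<bar> * \<phi> J (q \<bullet> w) \<le> e' * \<phi> J (q \<bullet> w)" using p by (rule mult_right_mono)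
          moreover have "0 \<le> \<eta> J" using \<theta> by (simp add: \<eta>_def)
          then have "0 \<le> 2 * B * \<eta> J" using B(1) by simp
          ultimately show ?thesis using p by (simp add: abs_mult)
        next
          case False
          then have "d\<^sup>2 \<le> (dist q w)\<^sup>2" using d(1) by (intro power_mono) auto
          then have "q \<bullet> w \<le> 1 - c" using inner_eq_one_minus_dist[of q w] q w c(3) by simp
          then have "\<phi> J (q \<bullet> w) \<le> \<eta> J" using inner_bound[OF q] J by (intro far)
          moreover have "\<bar>f q - f w\<bar> \<le> 2 * B" using B(2)[OF q] B(2)[OF wS] by linarith
          ultimately have "\<bar>f q - f w\<bar> * \<phi> J (q \<bullet> w) \<le> 2 * B * \<eta> J" using p B(1) by (intro mult_mono) auto
          then show ?thesis using p e' by (simp add: abs_mult add_increasing)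
        qed
      qed
      also have "\<dots> = e' * (\<integral>q. \<phi> J (q \<bullet> w) \<partial>sphere_vol) + 2 * B * \<eta> J * \<sigma>"
        using i2 by (simp add: \<sigma>_def)
      finally show ?thesis .
    qed
    have "(\<lambda>J. e' * (\<integral>q. \<phi> J (q \<bullet> w) \<partial>sphere_vol) + 2 * B * \<eta> J * \<sigma>) \<longlonglongrightarrow> e' * ?m + 2 * B * 0 * \<sigma>"
      by (intro tendsto_add tendsto_mult tendsto_const mass_lim \<eta>0)
    moreover have "e' * ?m + 2 * B * 0 * \<sigma> < e"
    proof -
      have "e' * ?m \<le> e' * (\<bar>?m\<bar> + 1)" using e' by (intro mult_left_mono) auto
      also have "\<dots> = e / 2" by (simp add: e'_def field_simps add_nonneg_pos less_imp_neq[symmetric])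
      finally show ?thesis using e by simp
    qed
    ultimately have "\<forall>\<^sub>F J in sequentially. e' * (\<integral>q. \<phi> J (q \<bullet> w) \<partial>sphere_vol) + 2 * B * \<eta> J * \<sigma> < e"
      by (rule order_tendstoD(2))
    then show "\<forall>\<^sub>F J in sequentially. dist ((\<integral>q. f q * \<phi> J (q \<bullet> w) \<partial>sphere_vol) - f w * (\<integral>q. \<phi> J (q \<bullet> w) \<partial>sphere_vol)) 0 < e"
      using eventually_ge_at_top[of N]
    proof eventually_elim
      case (elim J)
      then show ?case using bound[of J] by (simp add: dist_real_def)
    qed
  qed
  have "(\<lambda>J. ((\<integral>q. f q * \<phi> J (q \<bullet> w) \<partial>sphere_vol) - f w * (\<integral>q. \<phi> J (q \<bullet> w) \<partial>sphere_vol)) + f w * (\<integral>q. \<phi> J (q \<bullet> w) \<partial>sphere_vol)) \<longlonglongrightarrow> 0 + f w * ?m"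
    by (intro tendsto_add main tendsto_mult tendsto_const mass_lim)
  then have "(\<lambda>J. \<integral>q. f q * \<phi> J (q \<bullet> w) \<partial>sphere_vol) \<longlonglongrightarrow> ?m * f w"
    by (simp add: mult.commute)
  moreover have "(\<integral>q. f q * \<phi> J (q \<bullet> w) \<partial>sphere_vol)
    = (\<Sum>k\<le>J. cw k * (cbin J k / cbin J 0) * (\<integral>q. f q * poly (?p k) (q \<bullet> w) \<partial>sphere_vol))" for J
  proof -
    have "integrable sphere_vol (\<lambda>q. f q * poly (?p k) (q \<bullet> w))" for k
      by (intro integrable_sphere_vol continuous_on_mult f contp)
    then have "(\<integral>q. (\<Sum>k\<le>J. cw k * (cbin J k / cbin J 0) * (f q * poly (?p k) (q \<bullet> w))) \<partial>sphere_vol)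
      = (\<Sum>k\<le>J. cw k * (cbin J k / cbin J 0) * (\<integral>q. f q * poly (?p k) (q \<bullet> w) \<partial>sphere_vol))"
      by (subst Bochner_Integration.integral_sum) auto
    then show ?thesis by (simp add: \<phi>_def sum_distrib_left mult_ac)
  qed
  ultimately show ?thesis by simp
qed

section \<open>The theta function\<close>

lemma summable_gauss_power:
  fixes B :: real
  assumes "0 < t"
  shows "summable (\<lambda>k. exp (- (real k)\<^sup>2 * t) * B ^ k)"
proof (rule summable_comparison_test_ev)
  have "((\<lambda>k. \<bar>B\<bar> * exp (- real k * t)) \<longlongrightarrow> \<bar>B\<bar> * 0) sequentially"
    using assms by (intro tendsto_mult tendsto_const) real_asymp
  then have "\<forall>\<^sub>F k in sequentially. \<bar>B\<bar> * exp (- real k * t) < 1 / 2"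
    by (rule order_tendstoD) simp
  then show "\<forall>\<^sub>F k in sequentially. norm (exp (- (real k)\<^sup>2 * t) * B ^ k) \<le> (1 / 2) ^ k"
  proof eventually_elim
    case (elim k)
    have "norm (exp (- (real k)\<^sup>2 * t) * B ^ k) = (\<bar>B\<bar> * exp (- real k * t)) ^ k"
      by (simp add: power_mult_distrib abs_mult power_abs exp_of_nat_mult[symmetric] power2_eq_square mult_ac)
    also have "\<dots> \<le> (1 / 2) ^ k" using elim by (intro power_mono) auto
    finally show ?case .
  qed
  show "summable (\<lambda>k. (1 / 2 :: real) ^ k)" by (rule summable_geometric) simp
qed

definition thetad :: "nat \<Rightarrow> real \<Rightarrow> real \<Rightarrow> real" where
  "thetad N t x = (\<Sum>k. cw k * exp (- (real k)\<^sup>2 * t) * poly ((pderiv ^^ N) (cheb k)) x)"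

lemma cheb_le_power:
  assumes "1 \<le> x"
  shows "poly (cheb k) x \<le> (2 * x) ^ k"
proof -
  obtain y where y: "0 \<le> y" "x = cosh y" using cosh_arcosh_ex[OF assms] .
  have "cosh (real k * y) \<le> exp (real k * y)"
    using y by (simp add: cosh_field_def)
  also have "\<dots> = exp y ^ k" by (simp add: exp_of_nat_mult)
  also have "\<dots> \<le> (2 * x) ^ k"
    by (rule power_mono) (simp_all add: y(2) cosh_field_def)
  finally show ?thesis by (simp add: y(2) cheb_cosh)
qed

lemma thetad_term_bound:
  assumes "0 < h"
  shows "\<bar>cw k * exp (- (real k)\<^sup>2 * t) * poly ((pderiv ^^ N) (cheb k)) x\<bar>
    \<le> 1 / h ^ N * (cw k * exp (- (real k)\<^sup>2 * t) * poly (cheb k) (max 1 \<bar>x\<bar> + real N * h))"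
proof -
  have "cw k * exp (- (real k)\<^sup>2 * t) * \<bar>poly ((pderiv ^^ N) (cheb k)) x\<bar>
    \<le> cw k * exp (- (real k)\<^sup>2 * t) * (poly (cheb k) (max 1 \<bar>x\<bar> + real N * h) / h ^ N)"
    by (intro mult_left_mono higher_pderiv_cheb_abs_le assms) auto
  then show ?thesis by (simp add: abs_mult)
qed

lemma summable_theta:
  assumes "0 < t" "1 \<le> x"
  shows "summable (\<lambda>k. cw k * exp (- (real k)\<^sup>2 * t) * poly (cheb k) x)"
proof (rule summable_comparison_test')
  show "summable (\<lambda>k. 2 * (exp (- (real k)\<^sup>2 * t) * (2 * x) ^ k))"
    by (intro summable_mult summable_gauss_power assms)
  fix k :: nat
  have "cw k * exp (- (real k)\<^sup>2 * t) * poly (cheb k) x \<le> 2 * exp (- (real k)\<^sup>2 * t) * (2 * x) ^ k"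
    using cheb_ge_1[OF assms(2), of k] by (intro mult_mono cheb_le_power assms) (auto simp: cw_def)
  then show "norm (cw k * exp (- (real k)\<^sup>2 * t) * poly (cheb k) x) \<le> 2 * (exp (- (real k)\<^sup>2 * t) * (2 * x) ^ k)"
    using cheb_ge_1[OF assms(2), of k] by (simp add: mult.assoc)
qed

lemma summable_thetad:
  assumes "0 < t"
  shows "summable (\<lambda>k. \<bar>cw k * exp (- (real k)\<^sup>2 * t) * poly ((pderiv ^^ N) (cheb k)) x\<bar>)"
proof (rule summable_comparison_test')
  show "summable (\<lambda>k. 1 / 1 ^ N * (cw k * exp (- (real k)\<^sup>2 * t) * poly (cheb k) (max 1 \<bar>x\<bar> + real N * 1)))"
    using assms by (intro summable_mult summable_theta) auto
  show "norm \<bar>cw k * exp (- (real k)\<^sup>2 * t) * poly ((pderiv ^^ N) (cheb k)) x\<bar>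
    \<le> 1 / 1 ^ N * (cw k * exp (- (real k)\<^sup>2 * t) * poly (cheb k) (max 1 \<bar>x\<bar> + real N * 1))" for k
    using thetad_term_bound[of 1 k t N x] by simp
qed

text \<open>The cone estimate applied termwise: N derivatives cost a shift of the argument by N h
  and a factor h^(-N), and the majorant is theta itself.\<close>

lemma thetad_abs_le:
  assumes "0 < t" "0 < h"
  shows "(\<Sum>k. \<bar>cw k * exp (- (real k)\<^sup>2 * t) * poly ((pderiv ^^ N) (cheb k)) x\<bar>)
    \<le> thetad 0 t (max 1 \<bar>x\<bar> + real N * h) / h ^ N"
proof -
  have "1 \<le> max 1 \<bar>x\<bar>" "0 \<le> real N * h" using assms by auto
  then have ge: "1 \<le> max 1 \<bar>x\<bar> + real N * h" by linarith
  have s: "summable (\<lambda>k. 1 / h ^ N * (cw k * exp (- (real k)\<^sup>2 * t) * poly (cheb k) (max 1 \<bar>x\<bar> + real N * h)))"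
    using assms by (intro summable_mult summable_theta ge) auto
  have "(\<Sum>k. \<bar>cw k * exp (- (real k)\<^sup>2 * t) * poly ((pderiv ^^ N) (cheb k)) x\<bar>)
    \<le> (\<Sum>k. 1 / h ^ N * (cw k * exp (- (real k)\<^sup>2 * t) * poly (cheb k) (max 1 \<bar>x\<bar> + real N * h)))"
    by (intro suminf_le thetad_term_bound assms summable_thetad s)
  also have "\<dots> = 1 / h ^ N * thetad 0 t (max 1 \<bar>x\<bar> + real N * h)"
    unfolding thetad_def funpow_0 by (rule suminf_mult[OF summable_theta[OF assms(1) ge]])
  finally show ?thesis by simp
qed

text \<open>Tannery's theorem. The multipliers will be the normalised q-binomials and, for the heat
  kernel, the normalised central binomials.\<close>

lemma thetad_multiplier_tendsto:
  fixes c :: "nat \<Rightarrow> nat \<Rightarrow> real"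
  assumes t: "0 < t" and c: "\<And>M k. 0 \<le> c M k" "\<And>M k. c M k \<le> 1" "\<And>k. (\<lambda>M. c M k) \<longlonglongrightarrow> 1"
    and c0: "\<And>M k. M < k \<Longrightarrow> c M k = 0"
  shows "(\<lambda>M. \<Sum>k\<le>M. cw k * (c M k) * (exp (- (real k)\<^sup>2 * t) * poly ((pderiv ^^ N) (cheb k)) x)) \<longlonglongrightarrow> thetad N t x"
proof -
  let ?a = "\<lambda>k. cw k * exp (- (real k)\<^sup>2 * t) * poly ((pderiv ^^ N) (cheb k)) x"
  have "(\<lambda>M. \<Sum>k. c M k * ?a k) \<longlonglongrightarrow> (\<Sum>k. 1 * ?a k)"
  proof (rule tannerys_theorem[THEN conjunct2, THEN conjunct2])
    show "((\<lambda>M. c M k * ?a k) \<longlongrightarrow> 1 * ?a k) sequentially" for k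
      by (intro tendsto_mult tendsto_const c)
    show "summable (\<lambda>k. \<bar>?a k\<bar>)" using t by (rule summable_thetad)
    have "norm (c M k * ?a k) \<le> \<bar>?a k\<bar>" for k M
      using mult_right_mono[OF c(2)[of M k], of "\<bar>?a k\<bar>"] c(1)[of M k] by (simp add: abs_mult)
    then show "\<forall>\<^sub>F (k, M) in sequentially \<times>\<^sub>F sequentially. norm (c M k * ?a k) \<le> \<bar>?a k\<bar>"
      by (intro always_eventually) auto
  qed simp
  moreover have "(\<Sum>k. c M k * ?a k) = (\<Sum>k\<le>M. cw k * (c M k) * (exp (- (real k)\<^sup>2 * t) * poly ((pderiv ^^ N) (cheb k)) x))" for M
    by (subst suminf_finite[of "{..M}"]) (auto simp: c0 mult_ac)
  ultimately show ?thesis by (simp add: thetad_def)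
qed

section \<open>Periodised Gaussians and Poisson summation\<close>

definition wgauss :: "real \<Rightarrow> nat \<Rightarrow> real \<Rightarrow> real" where
  "wgauss t l d = (if l = 0 then exp (- d\<^sup>2 / (4 * t))
     else exp (- (d + 2 * pi * real l)\<^sup>2 / (4 * t)) + exp (- (d - 2 * pi * real l)\<^sup>2 / (4 * t)))"

lemma wgauss_nonneg: "0 \<le> wgauss t l d"
  by (simp add: wgauss_def)

text \<open>Rescaled real part of the characteristic function of the standard normal
  distribution.\<close>

lemma gauss_cos_integral:
  assumes t: "0 < t"
  shows "integrable lborel (\<lambda>x. exp (- x\<^sup>2 / (4 * t)) * cos (b * x))"
    and "(\<integral>x. exp (- x\<^sup>2 / (4 * t)) * cos (b * x) \<partial>lborel) = sqrt (4 * pi * t) * exp (- b\<^sup>2 * t)"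
proof -
  have nd: "exp (- x\<^sup>2 / (4 * t)) = sqrt (4 * pi * t) * normal_density 0 (sqrt (2 * t)) x" for x
    using t by (simp add: normal_density_def mult_ac)
  have "integrable lborel (\<lambda>x. normal_density 0 (sqrt (2 * t)) x * cos (b * x))"
    by (rule Bochner_Integration.integrable_bound[OF integrable_normal_density[of "sqrt (2 * t)" 0]])
      (use t in \<open>auto simp: abs_mult mult_left_le\<close>)
  then show int: "integrable lborel (\<lambda>x. exp (- x\<^sup>2 / (4 * t)) * cos (b * x))"
    unfolding nd mult.assoc by (rule integrable_mult_right)
  let ?s = "sqrt (2 * t)"
  have s: "0 < ?s" using t by simp
  have std: "(\<integral>x. std_normal_density x * cos (c * x) \<partial>lborel) = exp (- c\<^sup>2 / 2)" for c
  proof -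
    interpret real_distribution std_normal_distribution by (rule real_dist_normal_dist)
    have i: "integrable std_normal_distribution (\<lambda>x. iexp (c * x))" 
      by (rule integrable_const_bound[where B = 1]) auto
    have "exp (- c\<^sup>2 / 2) = Re (char std_normal_distribution c)"
      by (simp add: char_std_normal_distribution)
    also have "\<dots> = (\<integral>x. Re (iexp (c * x)) \<partial>std_normal_distribution)"
      unfolding char_def using i by (rule integral_Re[symmetric])
    also have "\<dots> = (\<integral>x. std_normal_density x * cos (c * x) \<partial>lborel)"
      by (subst integral_density) (auto simp: Re_exp)
    finally show ?thesis by simp
  qed
  have "(\<integral>x. exp (- x\<^sup>2 / (4 * t)) * cos (b * x) \<partial>lborel) = ?s * (\<integral>x. exp (- (0 + ?s * x)\<^sup>2 / (4 * t)) * cos (b * (0 + ?s * x)) \<partial>lborel)"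
    using lborel_integral_real_affine[of ?s "\<lambda>x. exp (- x\<^sup>2 / (4 * t)) * cos (b * x)" 0] s by simp
  also have "\<dots> = ?s * (\<integral>x. sqrt (2 * pi) * (std_normal_density x * cos ((b * ?s) * x)) \<partial>lborel)"
  proof -
    have "exp (- (0 + ?s * x)\<^sup>2 / (4 * t)) = sqrt (2 * pi) * std_normal_density x" for x
      using t by (simp add: std_normal_density_def power_mult_distrib)
    then show ?thesis by (simp add: mult_ac)
  qed
  also have "\<dots> = ?s * (sqrt (2 * pi) * exp (- (b * ?s)\<^sup>2 / 2))"
    by (simp add: std)
  also have "\<dots> = sqrt (4 * pi * t) * exp (- b\<^sup>2 * t)"
  proof -
    have "?s * sqrt (2 * pi) = sqrt (4 * pi * t)" by (simp add: real_sqrt_mult[symmetric] mult_ac)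
    moreover have "(b * ?s)\<^sup>2 / 2 = b\<^sup>2 * t" using t by (simp add: power_mult_distrib)
    ultimately show ?thesis by (simp add: mult.assoc[symmetric])
  qed
  finally show "(\<integral>x. exp (- x\<^sup>2 / (4 * t)) * cos (b * x) \<partial>lborel) = sqrt (4 * pi * t) * exp (- b\<^sup>2 * t)" .
qed

text \<open>For |d| <= pi both translates lie at distance at least pi l from 0; replacing l^2 by l
  gives a geometric majorant.\<close>

lemma wgauss_bound:
  assumes t: "0 < t" and d: "\<bar>d\<bar> \<le> pi"
  shows "wgauss t l d \<le> 2 * exp (- (pi\<^sup>2 / (4 * t)) * real l)"
proof (cases "l = 0")
  case True
  have "exp (- d\<^sup>2 / (4 * t)) \<le> exp 0" unfolding exp_le_cancel_iff using t by simp
  also have "exp 0 \<le> (2::real)" by simp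
  finally show ?thesis using True by (simp add: wgauss_def)
next
  case False
  then have l1: "1 \<le> real l" by simp
  have *: "exp (- x\<^sup>2 / (4 * t)) \<le> exp (- (pi\<^sup>2 / (4 * t)) * real l)" if "pi * real l \<le> \<bar>x\<bar>" for x
  proof -
    have "(pi * real l)\<^sup>2 \<le> \<bar>x\<bar>\<^sup>2" using that by (intro power_mono) auto
    moreover have "pi\<^sup>2 * real l \<le> (pi * real l)\<^sup>2"
      using l1 by (simp add: power_mult_distrib power2_eq_square)
    ultimately have "pi\<^sup>2 * real l \<le> x\<^sup>2" by simp
    then show ?thesis using t by (simp add: divide_right_mono)
  qed
  have "pi * 1 \<le> pi * real l" using l1 by (intro mult_left_mono) auto
  then have "pi * real l \<le> \<bar>d + 2 * pi * real l\<bar>" "pi * real l \<le> \<bar>d - 2 * pi * real l\<bar>"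
    using d by linarith+
  from add_mono[OF this[THEN *]] show ?thesis
    using False by (simp only: wgauss_def if_False mult_2)
qed

lemma summable_wgauss_bound:
  assumes "0 < t" shows "summable (\<lambda>l. 2 * exp (- (pi\<^sup>2 / (4 * t)) * real l))"
proof -
  have "exp (- (pi\<^sup>2 / (4 * t)) * real l) = exp (- (pi\<^sup>2 / (4 * t))) ^ l" for l
    by (simp add: exp_of_nat_mult[symmetric] mult.commute)
  then show ?thesis using assms by (simp only:) (intro summable_mult summable_geometric, simp)
qed

lemma summable_wgauss:
  assumes "0 < t" "\<bar>d\<bar> \<le> pi"
  shows "summable (\<lambda>l. wgauss t l d)"
  by (rule summable_comparison_test'[OF summable_wgauss_bound[OF assms(1)]])
    (use wgauss_bound[OF assms] wgauss_nonneg in auto)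

lemma continuous_on_wgauss: "continuous_on A (wgauss t l)"
proof -
  have *: "continuous_on A (\<lambda>d. exp (- (d + c)\<^sup>2 / (4 * t)))" for c
    unfolding divide_inverse by (intro continuous_intros)
  show ?thesis
  proof (cases "l = 0")
    case True
    then have "wgauss t l = (\<lambda>d. exp (- (d + 0)\<^sup>2 / (4 * t)))" by (simp add: wgauss_def fun_eq_iff)
    then show ?thesis using * by (simp only:)
  next
    case False
    then have "wgauss t l = (\<lambda>d. exp (- (d + 2 * pi * real l)\<^sup>2 / (4 * t)) + exp (- (d + - (2 * pi * real l))\<^sup>2 / (4 * t)))"
      by (simp add: wgauss_def fun_eq_iff)
    then show ?thesis using continuous_on_add[OF * *] by (simp only:)
  qed
qed

lemma continuous_on_cos_mult: "continuous_on A (\<lambda>d. cos (b * d :: real))"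
  by (intro continuous_intros)

lemma cos_shift_2npi: "cos (real k * (d + 2 * pi * real l)) = cos (real k * d)"
proof -
  have "real k * (d + 2 * pi * real l) = real k * d + 2 * real (k * l) * pi"
    by (simp add: algebra_simps)
  then show ?thesis by (simp only: cos_add cos_2npi sin_2npi mult_1_right mult_zero_right diff_zero)
qed

text \<open>Poisson's unfolding: the translates of [-pi, pi] by 2 pi l with |l| <= L tile the larger
  interval, and cos (k d) is periodic. Since \<open>wgauss\<close> keeps l and -l in one term, the
  partial sums stay symmetric.\<close>

lemma wgauss_cos_partial_integral:
  "integral {-pi..pi} (\<lambda>d. (\<Sum>l\<le>L. wgauss t l d) * cos (real k * d))
    = integral {- ((2 * real L + 1) * pi)..(2 * real L + 1) * pi} (\<lambda>x. exp (- x\<^sup>2 / (4 * t)) * cos (real k * x))"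
proof (induction L)
  case 0
  show ?case by (simp add: wgauss_def)
next
  case (Suc L)
  define f where "f x = exp (- x\<^sup>2 / (4 * t)) * cos (real k * x)" for x
  define c where "c = 2 * pi * real (Suc L)"
  define a where "a = (2 * real L + 1) * pi"
  define b where "b = (2 * real (Suc L) + 1) * pi"
  have cf: "continuous_on A f" for A
    unfolding f_def[abs_def] divide_inverse by (intro continuous_intros)
  have cfs: "continuous_on A (\<lambda>x. f (y + x))" for A y
    unfolding f_def[abs_def] divide_inverse by (intro continuous_intros)
  have int: "f integrable_on {x..y}" for x y by (intro integrable_continuous_real cf)
  have ints: "(\<lambda>x. f (z + x)) integrable_on {x..y}" for x y z by (intro integrable_continuous_real cfs)
  have "0 \<le> a" unfolding a_def by simp
  moreover have "a \<le> b" unfolding a_def b_def by (intro mult_right_mono) auto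
  ultimately have ab: "- b \<le> - a" "- a \<le> a" "a \<le> b" "- b \<le> a" by linarith+
  have cosp: "cos (real k * (c + d)) = cos (real k * d)" "cos (real k * (- c + d)) = cos (real k * d)" for d
    using cos_shift_2npi[of k d "Suc L"] cos_shift_2npi[of k "- c + d" "Suc L"] by (simp_all add: c_def add.commute)
  have w: "wgauss t (Suc L) d * cos (real k * d) = f (c + d) + f (- c + d)" for d
    unfolding f_def cosp by (simp add: wgauss_def c_def distrib_right add.commute)
  have iw: "(\<lambda>d. (\<Sum>l\<le>L. wgauss t l d) * cos (real k * d)) integrable_on {-pi..pi}"
    by (intro integrable_continuous_real continuous_on_mult continuous_on_sum continuous_on_wgauss continuous_on_cos_mult)
  have "integral {-pi..pi} (\<lambda>d. (\<Sum>l\<le>Suc L. wgauss t l d) * cos (real k * d))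
    = integral {-pi..pi} (\<lambda>d. (\<Sum>l\<le>L. wgauss t l d) * cos (real k * d)) + integral {-pi..pi} (\<lambda>d. f (c + d) + f (- c + d))"
    unfolding sum.atMost_Suc distrib_right w
    by (rule Henstock_Kurzweil_Integration.integral_add[OF iw integrable_add[OF ints ints]])
  also have "integral {-pi..pi} (\<lambda>d. f (c + d) + f (- c + d)) = integral {-pi..pi} (\<lambda>d. f (c + d)) + integral {-pi..pi} (\<lambda>d. f (- c + d))"
    by (rule Henstock_Kurzweil_Integration.integral_add[OF ints ints])
  also have "integral {-pi..pi} (\<lambda>d. f (c + d)) = integral {a..b} f"
    using integral_shift_Icc_real[of "-pi" pi f c] by (simp add: o_def a_def b_def c_def algebra_simps)
  also have "integral {-pi..pi} (\<lambda>d. f (- c + d)) = integral {-b..-a} f"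
    using integral_shift_Icc_real[of "-pi" pi f "- c"] by (simp add: o_def a_def b_def c_def algebra_simps)
  also have "integral {-pi..pi} (\<lambda>d. (\<Sum>l\<le>L. wgauss t l d) * cos (real k * d)) = integral {-a..a} f"
    unfolding Suc a_def f_def ..
  also have "integral {-a..a} f + (integral {a..b} f + integral {-b..-a} f) = integral {-b..b} f"
    using Henstock_Kurzweil_Integration.integral_combine[OF ab(1,2) int]
      Henstock_Kurzweil_Integration.integral_combine[OF ab(4,3) int] by simp
  finally show ?case unfolding b_def f_def .
qed

lemma wgauss_cos_integral:
  assumes t: "0 < t"
  shows "continuous_on {-pi..pi} (\<lambda>d. \<Sum>l. wgauss t l d)"
    and "integral {-pi..pi} (\<lambda>d. (\<Sum>l. wgauss t l d) * cos (real k * d)) = sqrt (4 * pi * t) * exp (- (real k)\<^sup>2 * t)"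
proof -
  let ?f = "\<lambda>x. exp (- x\<^sup>2 / (4 * t)) * cos (real k * x)"
  have ul: "uniform_limit {-pi..pi} (\<lambda>n d. \<Sum>l<n. wgauss t l d) (\<lambda>d. \<Sum>l. wgauss t l d) sequentially"
    using wgauss_bound[OF t] wgauss_nonneg
    by (intro Weierstrass_m_test[OF _ summable_wgauss_bound[OF t]]) auto
  then have ul1: "uniform_limit {-pi..pi} (\<lambda>n d. \<Sum>l\<le>n. wgauss t l d) (\<lambda>d. \<Sum>l. wgauss t l d) sequentially"
    by (rule filterlim_sequentially_Suc[THEN iffD2, of "\<lambda>n d. \<Sum>l<n. wgauss t l d", unfolded lessThan_Suc_atMost])
  show c: "continuous_on {-pi..pi} (\<lambda>d. \<Sum>l. wgauss t l d)"
    by (rule uniform_limit_theorem[OF _ ul1])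
      (auto intro!: always_eventually continuous_on_sum continuous_on_wgauss)
  have bdd: "bounded ((\<lambda>d. \<Sum>l. wgauss t l d) ` {-pi..pi})" "bounded ((\<lambda>d. cos (real k * d)) ` {-pi..pi})"
    by (intro compact_imp_bounded compact_continuous_image c continuous_on_cos_mult; simp)+
  have ul2: "uniform_limit {-pi..pi} (\<lambda>n d. (\<Sum>l\<le>n. wgauss t l d) * cos (real k * d)) (\<lambda>d. (\<Sum>l. wgauss t l d) * cos (real k * d)) sequentially"
    by (intro uniform_lim_mult ul1 uniform_limit_const bdd)
  have "continuous_on {-pi..pi} (\<lambda>d. (\<Sum>l\<le>n. wgauss t l d) * cos (real k * d))" for n
    by (intro continuous_on_mult continuous_on_sum continuous_on_wgauss continuous_on_cos_mult)
  from uniform_limit_integral[OF ul2 this] obtain I J where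
    IJ: "\<And>n. ((\<lambda>d. (\<Sum>l\<le>n. wgauss t l d) * cos (real k * d)) has_integral I n) {-pi..pi}"
    "((\<lambda>d. (\<Sum>l. wgauss t l d) * cos (real k * d)) has_integral J) {-pi..pi}" "I \<longlonglongrightarrow> J"
    by auto
  define r where "r n = (2 * real n + 1) * pi" for n :: nat
  have In: "I n = (LINT x:{- r n..r n}|lborel. ?f x)" for n
  proof -
    have "I n = integral {- r n..r n} ?f"
      using IJ(1)[of n] wgauss_cos_partial_integral[of t n k] by (simp add: integral_unique r_def)
    moreover have "set_integrable lborel {- r n..r n} ?f"
      using gauss_cos_integral(1)[OF t, of "real k"] unfolding set_integrable_def
      by (rule integrable_mult_indicator[rotated]) simp
    ultimately show ?thesis by (simp add: set_borel_integral_eq_integral(2))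
  qed
  have "I \<longlonglongrightarrow> (\<integral>x. ?f x \<partial>lborel)"
    unfolding In[abs_def] set_lebesgue_integral_def
  proof (rule integral_dominated_convergence)
    show "integrable lborel (\<lambda>x. \<bar>?f x\<bar>)" by (intro integrable_abs gauss_cos_integral t)
    show "AE x in lborel. (\<lambda>n. indicator {- r n..r n} x *\<^sub>R ?f x) \<longlonglongrightarrow> ?f x"
    proof (rule AE_I2)
      fix x :: real
      have "\<forall>\<^sub>F n in sequentially. \<bar>x\<bar> \<le> real n"
        using eventually_ge_at_top[of "nat \<lceil>\<bar>x\<bar>\<rceil>"] by eventually_elim linarith
      then have "\<forall>\<^sub>F n in sequentially. ?f x = indicator {- r n..r n} x *\<^sub>R ?f x"
      proof eventually_elim
        case (elim n)
        have "real n * 1 \<le> (2 * real n + 1) * pi" using pi_ge_two by (intro mult_mono) auto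
        with elim have "x \<in> {- r n..r n}" by (auto simp: r_def)
        then show ?case by simp
      qed
      then show "(\<lambda>n. indicator {- r n..r n} x *\<^sub>R ?f x) \<longlonglongrightarrow> ?f x"
        by (rule Lim_transform_eventually[OF tendsto_const])
    qed
    show "AE x in lborel. norm (indicator {- r n..r n} x *\<^sub>R ?f x) \<le> \<bar>?f x\<bar>" for n
      by (auto simp: indicator_def)
  qed measurable
  then have "J = (\<integral>x. ?f x \<partial>lborel)" using IJ(3) LIMSEQ_unique by blast
  then show "integral {-pi..pi} (\<lambda>d. (\<Sum>l. wgauss t l d) * cos (real k * d)) = sqrt (4 * pi * t) * exp (- (real k)\<^sup>2 * t)"
    using IJ(2) gauss_cos_integral(2)[OF t, of "real k"] by (simp add: integral_unique)
qed

lemma integral_cos_2pi: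
  assumes "m \<noteq> (0::int)"
  shows "((\<lambda>d. cos (of_int m * d)) has_integral 0) {-pi..pi}"
proof -
  have "((\<lambda>d. cos (of_int m * d)) has_integral (sin (of_int m * pi) / of_int m - sin (of_int m * (-pi)) / of_int m)) {-pi..pi}"
    using assms by (intro fundamental_theorem_of_calculus)
      (auto intro!: derivative_eq_intros simp flip: has_real_derivative_iff_has_vector_derivative)
  moreover have "sin (of_int m * pi) = 0" by (simp add: sin_npi_int mult.commute)
  ultimately show ?thesis by simp
qed

lemma integral_cos_cos:
  "((\<lambda>d. cos (real j * d) * cos (real k * d)) has_integral (if j = k then 2 * pi / cw k else 0)) {-pi..pi}"
proof -
  have eq: "cos (real j * d) * cos (real k * d) = 1 / 2 * (cos (of_int (int j - int k) * d) + cos (of_int (int j + int k) * d))" for d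
    by (simp add: algebra_simps cos_add cos_diff)
  have one: "((\<lambda>d. cos (of_int 0 * d)) has_integral 2 * pi) {-pi..pi}"
    using has_integral_const_real[of "1::real" "-pi" pi] by simp
  have "((\<lambda>d. cos (of_int (int j - int k) * d)) has_integral (if j = k then 2 * pi else 0)) {-pi..pi}"
    using one integral_cos_2pi[of "int j - int k"] by auto
  moreover have "((\<lambda>d. cos (of_int (int j + int k) * d)) has_integral (if j = 0 \<and> k = 0 then 2 * pi else 0)) {-pi..pi}"
    using one integral_cos_2pi[of "int j + int k"] by auto
  ultimately have "((\<lambda>d. 1 / 2 * (cos (of_int (int j - int k) * d) + cos (of_int (int j + int k) * d))) has_integral
      1 / 2 * ((if j = k then 2 * pi else 0) + (if j = 0 \<and> k = 0 then 2 * pi else 0))) {-pi..pi}"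
    by (intro has_integral_mult_right has_integral_add)
  moreover have "1 / 2 * ((if j = k then 2 * pi else 0) + (if j = 0 \<and> k = 0 then 2 * pi else 0)) = (if j = k then 2 * pi / cw k else 0)"
    by (auto simp: cw_def)
  ultimately show ?thesis unfolding eq by simp
qed

lemma theta_cos_integral:
  assumes t: "0 < t"
  shows "continuous_on {-pi..pi} (\<lambda>d. thetad 0 t (cos d))"
    and "integral {-pi..pi} (\<lambda>d. thetad 0 t (cos d) * cos (real k * d)) = 2 * pi * exp (- (real k)\<^sup>2 * t)"
proof -
  let ?a = "\<lambda>j. cw j * exp (- (real j)\<^sup>2 * t)"
  have th: "thetad 0 t (cos d) = (\<Sum>j. ?a j * cos (real j * d))" for d
    by (simp add: thetad_def cheb_cos)
  have sa: "summable ?a" using summable_theta[OF t, of 1] cheb_cosh[of _ 0] by simp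
  have ul: "uniform_limit {-pi..pi} (\<lambda>n d. \<Sum>j<n. ?a j * cos (real j * d)) (\<lambda>d. thetad 0 t (cos d)) sequentially"
    unfolding th
  proof (intro Weierstrass_m_test[OF _ sa])
    fix j d
    have "?a j * \<bar>cos (real j * d)\<bar> \<le> ?a j" by (rule mult_left_le) auto
    then show "norm (?a j * cos (real j * d)) \<le> ?a j" by (simp add: abs_mult)
  qed
  show c: "continuous_on {-pi..pi} (\<lambda>d. thetad 0 t (cos d))"
    by (rule uniform_limit_theorem[OF _ ul])
      (intro always_eventually allI continuous_on_sum continuous_on_mult_left continuous_on_cos_mult, simp)
  have bdd: "bounded ((\<lambda>d. thetad 0 t (cos d)) ` {-pi..pi})" "bounded ((\<lambda>d. cos (real k * d)) ` {-pi..pi})"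
    by (intro compact_imp_bounded compact_continuous_image c continuous_on_cos_mult; simp)+
  have ul2: "uniform_limit {-pi..pi} (\<lambda>n d. (\<Sum>j<n. ?a j * cos (real j * d)) * cos (real k * d)) (\<lambda>d. thetad 0 t (cos d) * cos (real k * d)) sequentially"
    by (intro uniform_lim_mult ul uniform_limit_const bdd)
  have "continuous_on {-pi..pi} (\<lambda>d. (\<Sum>j<n. ?a j * cos (real j * d)) * cos (real k * d))" for n
    by (intro continuous_on_mult continuous_on_sum continuous_on_const continuous_on_cos_mult)
  from uniform_limit_integral[OF ul2 this] obtain I J where
    IJ: "\<And>n. ((\<lambda>d. (\<Sum>j<n. ?a j * cos (real j * d)) * cos (real k * d)) has_integral I n) {-pi..pi}"
    "((\<lambda>d. thetad 0 t (cos d) * cos (real k * d)) has_integral J) {-pi..pi}" "I \<longlonglongrightarrow> J"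
    by auto
  have In: "I n = 2 * pi * exp (- (real k)\<^sup>2 * t)" if "k < n" for n
  proof -
    have "((\<lambda>d. \<Sum>j<n. ?a j * (cos (real j * d) * cos (real k * d))) has_integral (\<Sum>j<n. ?a j * (if j = k then 2 * pi / cw k else 0))) {-pi..pi}"
      by (intro has_integral_sum has_integral_mult_right integral_cos_cos) simp
    moreover have "(\<Sum>j<n. ?a j * (if j = k then 2 * pi / cw k else 0)) = 2 * pi * exp (- (real k)\<^sup>2 * t)"
      using that by (subst sum.mono_neutral_right[of _ "{k}"]) (auto simp: cw_def)
    moreover have "(\<lambda>d. \<Sum>j<n. ?a j * (cos (real j * d) * cos (real k * d))) = (\<lambda>d. (\<Sum>j<n. ?a j * cos (real j * d)) * cos (real k * d))"
      by (simp add: sum_distrib_right mult.assoc)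
    ultimately have "((\<lambda>d. (\<Sum>j<n. ?a j * cos (real j * d)) * cos (real k * d)) has_integral 2 * pi * exp (- (real k)\<^sup>2 * t)) {-pi..pi}"
      by (simp only:)
    with IJ(1)[of n] show ?thesis by (rule has_integral_unique)
  qed
  have "\<forall>\<^sub>F n in sequentially. 2 * pi * exp (- (real k)\<^sup>2 * t) = I n"
    using eventually_gt_at_top[of k] by eventually_elim (simp only: In)
  then have "I \<longlonglongrightarrow> 2 * pi * exp (- (real k)\<^sup>2 * t)" by (rule Lim_transform_eventually[OF tendsto_const])
  then have "J = 2 * pi * exp (- (real k)\<^sup>2 * t)" using IJ(3) LIMSEQ_unique by blast
  then show "integral {-pi..pi} (\<lambda>d. thetad 0 t (cos d) * cos (real k * d)) = 2 * pi * exp (- (real k)\<^sup>2 * t)"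
    using IJ(2) by (simp add: integral_unique)
qed

text \<open>Product formulas turn vanishing cosine coefficients into vanishing integrals against
  polynomials in cos d. Evenness makes D a continuous function of cos d, so by Weierstrass
  approximation the integral of D^2 is at most e times that of |D| for every e > 0.\<close>

lemma even_fourier_unique:
  fixes D :: "real \<Rightarrow> real"
  assumes c: "continuous_on {-pi..pi} D" and even: "\<And>d. D (- d) = D d"
    and zero: "\<And>k. integral {-pi..pi} (\<lambda>d. D d * cos (real k * d)) = 0"
    and d: "\<bar>d\<bar> \<le> pi"
  shows "D d = 0"
proof -
  have ci: "(\<lambda>d. D d * g d) integrable_on {-pi..pi}" if "continuous_on {-pi..pi} g" for g
    by (intro integrable_continuous_real continuous_on_mult c that)
  have cosc: "continuous_on {-pi..pi} (\<lambda>d. cos d ^ i * cos (real k * d))" for i k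
    by (intro continuous_intros)
  have Z: "integral {-pi..pi} (\<lambda>d. D d * (cos d ^ i * cos (real k * d))) = 0" for i k
  proof (induction i arbitrary: k)
    case 0
    then show ?case using zero by simp
  next
    case (Suc i)
    show ?case
    proof (cases k)
      case 0
      have "(\<lambda>d. D d * (cos d ^ Suc i * cos (real k * d))) = (\<lambda>d. D d * (cos d ^ i * cos (real 1 * d)))"
        using 0 by (simp add: mult_ac)
      then show ?thesis using Suc[of 1] by simp
    next
      case (Suc k')
      have e: "cos d * cos (real k * d) = 1 / 2 * (cos (real (Suc k) * d) + cos (real k' * d))" for d
      proof -
        have "real (Suc k) * d = real k * d + d" "real k' * d = real k * d - d" using Suc by (simp_all add: algebra_simps)
        then show ?thesis by (simp add: cos_add cos_diff)
      qed
      have "D d * (cos d ^ Suc i * cos (real k * d)) = 1 / 2 * (D d * (cos d ^ i * cos (real (Suc k) * d)) + D d * (cos d ^ i * cos (real k' * d)))" for d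
      proof -
        have "D d * (cos d ^ Suc i * cos (real k * d)) = D d * (cos d ^ i * (cos d * cos (real k * d)))" by simp
        also have "\<dots> = 1 / 2 * (D d * (cos d ^ i * cos (real (Suc k) * d)) + D d * (cos d ^ i * cos (real k' * d)))"
          unfolding e by (simp only: distrib_left mult_ac)
        finally show ?thesis .
      qed
      then have "integral {-pi..pi} (\<lambda>d. D d * (cos d ^ Suc i * cos (real k * d)))
        = 1 / 2 * (integral {-pi..pi} (\<lambda>d. D d * (cos d ^ i * cos (real (Suc k) * d))) + integral {-pi..pi} (\<lambda>d. D d * (cos d ^ i * cos (real k' * d))))"
        by (simp only: Henstock_Kurzweil_Integration.integral_mult_right Henstock_Kurzweil_Integration.integral_add[OF ci[OF cosc] ci[OF cosc]])
      then show ?thesis by (simp only: Suc.IH add_0 mult_zero_right)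
    qed
  qed
  have P: "integral {-pi..pi} (\<lambda>d. D d * g (cos d)) = 0" if g: "real_polynomial_function g" for g
  proof -
    obtain a n where a: "g = (\<lambda>x. \<Sum>i\<le>n. a i * x ^ i)" using g real_polynomial_function_iff_sum by blast
    have "(\<lambda>d. D d * g (cos d)) = (\<lambda>d. \<Sum>i\<le>n. a i * (D d * (cos d ^ i * cos (real 0 * d))))"
      by (simp add: a sum_distrib_left mult_ac)
    then have "integral {-pi..pi} (\<lambda>d. D d * g (cos d)) = integral {-pi..pi} (\<lambda>d. \<Sum>i\<le>n. a i * (D d * (cos d ^ i * cos (real 0 * d))))"
      by (simp only:)
    also have "\<dots> = (\<Sum>i\<le>n. integral {-pi..pi} (\<lambda>d. a i * (D d * (cos d ^ i * cos (real 0 * d)))))"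
      by (rule Henstock_Kurzweil_Integration.integral_sum) (simp, intro integrable_on_mult_right ci cosc)
    also have "\<dots> = (\<Sum>i\<le>n. a i * 0)"
      by (simp only: Henstock_Kurzweil_Integration.integral_mult_right Z)
    finally show ?thesis by simp
  qed
  define u where "u x = D (arccos x)" for x
  have uc: "continuous_on {-1..1} u"
    unfolding u_def[abs_def]
  proof (rule continuous_on_compose2[OF c continuous_on_arccos'])
    show "arccos ` {-1..1} \<subseteq> {-pi..pi}"
    proof
      fix y assume "y \<in> arccos ` {-1..1}"
      then have "0 \<le> y" "y \<le> pi" using arccos_lbound arccos_ubound by auto
      then show "y \<in> {-pi..pi}" by simp
    qed
  qed
  have uD: "u (cos d) = D d" if "d \<in> {-pi..pi}" for d
    using that even[of d] arccos_cos_eq_abs[of d] by (auto simp: u_def abs_if)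
  have DD: "integral {-pi..pi} (\<lambda>d. D d * D d) \<le> e * integral {-pi..pi} (\<lambda>d. \<bar>D d\<bar>)" if e: "0 < e" for e
  proof -
    obtain g where g: "real_polynomial_function g" "\<And>x. x \<in> {-1..1} \<Longrightarrow> \<bar>u x - g x\<bar> < e"
      using Stone_Weierstrass_real_polynomial_function[OF compact_Icc uc e] by blast
    have gc: "continuous_on {-pi..pi} (\<lambda>d. g (cos d))"
    proof -
      have "continuous_on UNIV g" using g(1) by (intro continuous_on_polymonial_function) (simp add: real_polynomial_function_eq)
      then show ?thesis by (rule continuous_on_compose2[OF _ continuous_on_cos[OF continuous_on_id]]) simp
    qed
    have "integral {-pi..pi} (\<lambda>d. D d * D d) = integral {-pi..pi} (\<lambda>d. D d * D d - D d * g (cos d))"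
      by (subst Henstock_Kurzweil_Integration.integral_diff[OF ci[OF c] ci[OF gc]]) (simp add: P[OF g(1)])
    also have "\<dots> \<le> integral {-pi..pi} (\<lambda>d. e * \<bar>D d\<bar>)"
    proof (rule integral_le)
      show "(\<lambda>d. D d * D d - D d * g (cos d)) integrable_on {-pi..pi}" by (intro integrable_diff ci c gc)
      show "(\<lambda>d. e * \<bar>D d\<bar>) integrable_on {-pi..pi}"
        by (intro integrable_continuous_real continuous_on_mult continuous_on_const continuous_on_rabs c)
      fix x assume x: "x \<in> {-pi..pi}"
      have "D x * D x - D x * g (cos x) = D x * (u (cos x) - g (cos x))" by (simp add: uD[OF x] algebra_simps)
      also have "\<dots> \<le> \<bar>D x\<bar> * \<bar>u (cos x) - g (cos x)\<bar>" by (metis abs_ge_self abs_mult)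
      also have "\<dots> \<le> \<bar>D x\<bar> * e" using g(2)[of "cos x"] by (intro mult_left_mono) auto
      finally show "D x * D x - D x * g (cos x) \<le> e * \<bar>D x\<bar>" by (simp add: mult.commute)
    qed
    finally show ?thesis by simp
  qed
  have "((\<lambda>e. e * integral {-pi..pi} (\<lambda>d. \<bar>D d\<bar>)) \<longlongrightarrow> 0) (at_right 0)"
    by (rule tendsto_mult_left_zero) simp
  moreover have "\<forall>\<^sub>F e in at_right 0. integral {-pi..pi} (\<lambda>d. D d * D d) \<le> e * integral {-pi..pi} (\<lambda>d. \<bar>D d\<bar>)"
    using DD by (intro eventually_at_rightI[of 0 1]) auto
  ultimately have "integral {-pi..pi} (\<lambda>d. D d * D d) \<le> 0" by (rule tendsto_lowerbound) simp
  moreover have "0 \<le> integral {-pi..pi} (\<lambda>d. D d * D d)" by (intro integral_nonneg ci c) auto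
  ultimately have "integral {-pi..pi} (\<lambda>d. D d * D d) = 0" by simp
  then have "\<forall>d\<in>{-pi..pi}. D d * D d = 0"
    by (subst (asm) integral_eq_0_iff) (auto intro!: continuous_on_mult c)
  then show ?thesis using d by (auto simp: abs_le_iff)
qed

lemma wgauss_even: "wgauss t l (- d) = wgauss t l d"
proof -
  have "(- d + 2 * pi * real l)\<^sup>2 = (d - 2 * pi * real l)\<^sup>2" "(- d - 2 * pi * real l)\<^sup>2 = (d + 2 * pi * real l)\<^sup>2"
    by (simp_all add: power2_eq_square algebra_simps)
  then show ?thesis by (simp add: wgauss_def)
qed

text \<open>Both sides are even and continuous and have the same cosine coefficients, the
  normalisations matching through sqrt (t / pi) * 2 pi = sqrt (4 pi t).\<close>

lemma theta_transform:
  assumes t: "0 < t" and d: "\<bar>d\<bar> \<le> pi"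
  shows "sqrt (t / pi) * thetad 0 t (cos d) = (\<Sum>l. wgauss t l d)"
proof -
  let ?s = "sqrt (t / pi)"
  define D where "D d = (\<Sum>l. wgauss t l d) - ?s * thetad 0 t (cos d)" for d
  have c: "continuous_on {-pi..pi} D"
    unfolding D_def[abs_def] by (intro continuous_on_diff continuous_on_mult continuous_on_const wgauss_cos_integral theta_cos_integral t)
  have zero: "integral {-pi..pi} (\<lambda>d. D d * cos (real k * d)) = 0" for k
  proof -
    have i: "(\<lambda>d. (\<Sum>l. wgauss t l d) * cos (real k * d)) integrable_on {-pi..pi}"
      "(\<lambda>d. thetad 0 t (cos d) * cos (real k * d)) integrable_on {-pi..pi}"
      by (intro integrable_continuous_real continuous_on_mult wgauss_cos_integral theta_cos_integral continuous_on_cos_mult t)+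
    have "integral {-pi..pi} (\<lambda>d. D d * cos (real k * d)) = integral {-pi..pi} (\<lambda>d. (\<Sum>l. wgauss t l d) * cos (real k * d) - ?s * (thetad 0 t (cos d) * cos (real k * d)))"
      by (simp add: D_def left_diff_distrib mult.assoc)
    also have "\<dots> = integral {-pi..pi} (\<lambda>d. (\<Sum>l. wgauss t l d) * cos (real k * d)) - ?s * integral {-pi..pi} (\<lambda>d. thetad 0 t (cos d) * cos (real k * d))"
      using i by (simp add: Henstock_Kurzweil_Integration.integral_diff integrable_on_mult_right)
    also have "\<dots> = (sqrt (4 * pi * t) - ?s * (2 * pi)) * exp (- (real k)\<^sup>2 * t)"
      unfolding wgauss_cos_integral(2)[OF t] theta_cos_integral(2)[OF t] by (simp add: algebra_simps)
    also have "sqrt (4 * pi * t) = ?s * (2 * pi)"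
    proof -
      have "sqrt ((2 * pi)\<^sup>2) = 2 * pi" unfolding real_sqrt_abs by simp
      then have "?s * (2 * pi) = ?s * sqrt ((2 * pi)\<^sup>2)" by (simp only:)
      also have "\<dots> = sqrt (t / pi * (2 * pi)\<^sup>2)" by (rule real_sqrt_mult[symmetric])
      also have "t / pi * (2 * pi)\<^sup>2 = 4 * pi * t" by (simp add: power2_eq_square)
      finally show ?thesis by simp
    qed
    finally show ?thesis by simp
  qed
  have "D d = 0" by (rule even_fourier_unique[OF c _ zero d]) (simp add: D_def wgauss_even)
  then show ?thesis by (simp add: D_def)
qed

section \<open>Gaussian binomials and the finite Jacobi triple product\<close>

definition qpoch :: "real \<Rightarrow> nat \<Rightarrow> real" where
  "qpoch Q n = (\<Prod>i<n. 1 - Q ^ Suc i)"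

lemma qpoch_Suc: "qpoch Q (Suc n) = qpoch Q n * (1 - Q ^ Suc n)"
  by (simp add: qpoch_def)

lemma qpoch_0 [simp]: "qpoch Q 0 = 1"
  by (simp add: qpoch_def)

lemma qpoch_pos: "0 < Q \<Longrightarrow> Q < 1 \<Longrightarrow> 0 < qpoch Q n"
  unfolding qpoch_def by (intro prod_pos) (simp add: power_Suc_less_one del: power_Suc)

text \<open>The Gaussian binomial coefficient of 2M over M + k, indexed from the middle as
  \<open>cbin\<close> is.\<close>

definition qbin :: "real \<Rightarrow> nat \<Rightarrow> nat \<Rightarrow> real" where
  "qbin Q M k = (if k \<le> M then qpoch Q (2 * M) / (qpoch Q (M + k) * qpoch Q (M - k)) else 0)"

text \<open>The rational identity behind two q-Pascal steps. Here a and b stand for powers of Q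
  whose exponents add up to 2M; without the powers it reduces to one polynomial identity in Q, a and
  b.\<close>

lemma qbin_rec_aux:
  fixes a b Q X Y Z :: real
  assumes "X \<noteq> 0" "Y \<noteq> 0" "1 - Q * a \<noteq> 0" "1 - Q * b \<noteq> 0"
  shows "Z * (1 - Q * (a * b)) * (1 - Q * Q * (a * b)) / (X * (1 - Q * a) * (Y * (1 - Q * b)))
    = (1 + Q * (a * b)) * (Z / (X * Y)) + Q * b * (Z * (1 - a) / (X * (Y * (1 - Q * b)))) + Q * a * (Z * (1 - b) / (X * (1 - Q * a) * Y))"
proof -
  have frac: "Z * (u * A * B + v * p * A + w * r * B) / (X * A * (Y * B))
      = u * (Z / (X * Y)) + v * (Z * p / (X * (Y * B))) + w * (Z * r / (X * A * Y))"
    if "A \<noteq> 0" "B \<noteq> 0" for A B u v w p r :: real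
  proof -
    have "u * (Z / (X * Y)) = Z * (u * A * B) / (X * A * (Y * B))" using that by simp
    moreover have "v * (Z * p / (X * (Y * B))) = Z * (v * p * A) / (X * A * (Y * B))" using that by simp
    moreover have "w * (Z * r / (X * A * Y)) = Z * (w * r * B) / (X * A * (Y * B))" using that by (simp add: mult_ac)
    ultimately show ?thesis by (simp only: distrib_left add_divide_distrib)
  qed
  have "(1 - Q * (a * b)) * (1 - Q * Q * (a * b)) = (1 + Q * (a * b)) * (1 - Q * a) * (1 - Q * b)
      + Q * b * (1 - a) * (1 - Q * a) + Q * a * (1 - b) * (1 - Q * b)"
    by algebra
  then have "Z * (1 - Q * (a * b)) * (1 - Q * Q * (a * b)) = Z * ((1 + Q * (a * b)) * (1 - Q * a) * (1 - Q * b)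
      + Q * b * (1 - a) * (1 - Q * a) + Q * a * (1 - b) * (1 - Q * b))"
    by (simp only: mult.assoc)
  then show ?thesis by (simp only: frac[OF assms(3,4)])
qed

text \<open>The upper index 2M grows by 2, so three neighbours occur. The bound k <= M makes the
  truncated exponent \<open>M - k\<close> a true difference; at k = M the only surviving neighbour
  is k itself.\<close>

lemma qbin_Suc:
  assumes Q: "0 < Q" "Q < 1"
  shows "qbin Q (Suc M) 0 = (1 + Q ^ (2 * M + 1)) * qbin Q M 0 + 2 * Q ^ (M + 1) * qbin Q M 1"
    and "k \<le> M \<Longrightarrow> qbin Q (Suc M) (Suc k) = (1 + Q ^ (2 * M + 1)) * qbin Q M (Suc k) + Q ^ (M - k) * qbin Q M k
      + Q ^ (M + k + 2) * qbin Q M (Suc (Suc k))"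
proof -
  have nz: "qpoch Q n \<noteq> 0" for n using qpoch_pos[OF Q, of n] by simp
  have nz1: "1 - Q ^ Suc n \<noteq> 0" for n using power_Suc_less_one[OF Q, of n] by simp
  have P2: "qpoch Q (2 * Suc M) = qpoch Q (2 * M) * (1 - Q * Q ^ (2 * M)) * (1 - Q * Q * Q ^ (2 * M))"
    by (simp add: qpoch_Suc mult.assoc)
  show "qbin Q (Suc M) 0 = (1 + Q ^ (2 * M + 1)) * qbin Q M 0 + 2 * Q ^ (M + 1) * qbin Q M 1"
  proof (cases M)
    case 0
    have "1 - Q * Q = (1 - Q) * (1 + Q)" by (simp add: algebra_simps)
    then show ?thesis using nz1[of 0] 0 by (simp add: qbin_def qpoch_Suc numeral_2_eq_2)
  next
    case (Suc m)
    let ?a = "Q ^ M"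
    have h: "qpoch Q (2 * M) * (1 - ?a) / (qpoch Q M * (qpoch Q M * (1 - Q * ?a))) = qbin Q M 1"
      using nz nz1[of m] Suc by (simp add: qbin_def qpoch_Suc del: mult_Suc_right)
    have "qbin Q (Suc M) 0 = qpoch Q (2 * M) * (1 - Q * (?a * ?a)) * (1 - Q * Q * (?a * ?a)) / (qpoch Q M * (1 - Q * ?a) * (qpoch Q M * (1 - Q * ?a)))"
      unfolding qbin_def P2 by (simp add: qpoch_Suc power_add[symmetric] mult_2)
    also have "\<dots> = (1 + Q * (?a * ?a)) * (qpoch Q (2 * M) / (qpoch Q M * qpoch Q M)) + Q * ?a * (qpoch Q (2 * M) * (1 - ?a) / (qpoch Q M * (qpoch Q M * (1 - Q * ?a))))
       + Q * ?a * (qpoch Q (2 * M) * (1 - ?a) / (qpoch Q M * (1 - Q * ?a) * qpoch Q M))"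
      using nz nz1[of M] by (intro qbin_rec_aux) simp_all
    also have "qpoch Q (2 * M) * (1 - ?a) / (qpoch Q M * (qpoch Q M * (1 - Q * ?a))) = qbin Q M 1"
      by (rule h)
    also have "qpoch Q (2 * M) * (1 - ?a) / (qpoch Q M * (1 - Q * ?a) * qpoch Q M) = qbin Q M 1"
      unfolding mult.commute[of "qpoch Q M * (1 - Q * ?a)"] by (rule h)
    also have "qpoch Q (2 * M) / (qpoch Q M * qpoch Q M) = qbin Q M 0" by (simp add: qbin_def)
    also have "Q * (?a * ?a) = Q ^ (2 * M + 1)" by (simp add: power_add mult_2)
    finally show ?thesis by simp
  qed
  assume k: "k \<le> M"
  show "qbin Q (Suc M) (Suc k) = (1 + Q ^ (2 * M + 1)) * qbin Q M (Suc k) + Q ^ (M - k) * qbin Q M k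
      + Q ^ (M + k + 2) * qbin Q M (Suc (Suc k))"
  proof (cases "k = M")
    case True
    have "qpoch Q (2 * Suc M) = qpoch Q (Suc M + Suc M)" "qpoch Q (2 * M) = qpoch Q (M + M)" by (simp_all add: mult_2)
    then show ?thesis using nz by (simp add: qbin_def True)
  next
    case False
    then obtain d where d: "M = Suc (k + d)" using k by (metis le_neq_implies_less less_iff_Suc_add)
    let ?a = "Q ^ (M + Suc k)" and ?b = "Q ^ d"
    have "M + Suc k + d = 2 * M" using d by simp
    then have ab: "?a * ?b = Q ^ (2 * M)" by (simp only: power_add[symmetric])
    have s: "Suc M - Suc k = Suc d" "M - Suc k = d" "M - k = Suc d" "Suc M + Suc k = Suc (M + Suc k)" by (simp_all add: d)
    have "qbin Q (Suc M) (Suc k) = qpoch Q (2 * M) * (1 - Q * (?a * ?b)) * (1 - Q * Q * (?a * ?b)) /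
        (qpoch Q (M + Suc k) * (1 - Q * ?a) * (qpoch Q d * (1 - Q * ?b)))"
      unfolding ab using k by (simp add: qbin_def P2 s qpoch_Suc[of Q "M + Suc k"] qpoch_Suc[of Q d] del: add_Suc_right mult_Suc_right)
    also have "\<dots> = (1 + Q * (?a * ?b)) * (qpoch Q (2 * M) / (qpoch Q (M + Suc k) * qpoch Q d))
       + Q * ?b * (qpoch Q (2 * M) * (1 - ?a) / (qpoch Q (M + Suc k) * (qpoch Q d * (1 - Q * ?b))))
       + Q * ?a * (qpoch Q (2 * M) * (1 - ?b) / (qpoch Q (M + Suc k) * (1 - Q * ?a) * qpoch Q d))"
      using nz nz1[of "M + Suc k"] nz1[of d] by (intro qbin_rec_aux) simp_all
    also have "qpoch Q (2 * M) / (qpoch Q (M + Suc k) * qpoch Q d) = qbin Q M (Suc k)"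
      by (simp add: qbin_def s d del: add_Suc_right mult_Suc_right) 
    also have "qpoch Q (2 * M) * (1 - ?a) / (qpoch Q (M + Suc k) * (qpoch Q d * (1 - Q * ?b))) = qbin Q M k"
    proof -
      have "qpoch Q (M + Suc k) = qpoch Q (M + k) * (1 - ?a)" by (simp add: qpoch_Suc)
      moreover have "1 - ?a \<noteq> 0" using nz1[of "M + k"] by simp
      ultimately show ?thesis using k nz by (simp add: qbin_def s qpoch_Suc[of Q d] del: add_Suc_right mult_Suc_right)
    qed
    also have "qpoch Q (2 * M) * (1 - ?b) / (qpoch Q (M + Suc k) * (1 - Q * ?a) * qpoch Q d) = qbin Q M (Suc (Suc k))"
    proof (cases d)
      case 0
      then show ?thesis by (simp add: qbin_def d)
    next
      case (Suc e)
      have "qpoch Q d = qpoch Q e * (1 - ?b)" using Suc by (simp add: qpoch_Suc)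
      moreover have "1 - ?b \<noteq> 0" using nz1[of e] Suc by simp
      moreover have "M - Suc (Suc k) = e" "Suc (Suc k) \<le> M" using d Suc by simp_all
      moreover have "qpoch Q (M + Suc (Suc k)) = qpoch Q (M + Suc k) * (1 - Q * ?a)"
        using qpoch_Suc[of Q "M + Suc k"] by simp
      ultimately show ?thesis using nz by (simp add: qbin_def del: add_Suc_right mult_Suc_right)
    qed
    also have "Q * (?a * ?b) = Q ^ (2 * M + 1)" unfolding ab by simp
    also have "Q * ?b = Q ^ (M - k)" by (simp add: s)
    also have "Q * ?a = Q ^ (M + k + 2)" by simp
    finally show ?thesis .
  qed
qed

lemma qbin_pos: "0 < Q \<Longrightarrow> Q < 1 \<Longrightarrow> 0 < qbin Q M 0"
  using qpoch_pos[of Q] by (simp add: qbin_def)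

lemma qbin_nonneg: "0 < Q \<Longrightarrow> Q < 1 \<Longrightarrow> 0 \<le> qbin Q M k"
  using qpoch_pos[of Q] by (simp add: qbin_def less_imp_le)

lemma qbin_ratio:
  assumes Q: "0 < Q" "Q < 1" and k: "k \<le> M"
  shows "qbin Q M (Suc k) = qbin Q M k * ((1 - Q ^ (M - k)) / (1 - Q ^ (M + Suc k)))"
proof (cases "k = M")
  case False
  then obtain d where d: "M - k = Suc d" "M - Suc k = d" "Suc k \<le> M" using k
    by (metis Suc_diff_Suc Suc_leI le_neq_implies_less)
  have nz: "qpoch Q n \<noteq> 0" for n using qpoch_pos[OF Q, of n] by simp
  have B: "1 - Q ^ Suc d \<noteq> 0" using power_Suc_less_one[OF Q, of d] by simp
  have aux: "Z / (X * A * Y) = Z / (X * (Y * B)) * (B / A)" if "B \<noteq> 0" for X Y Z A B :: real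
    using that by (simp add: mult_ac)
  have "qbin Q M (Suc k) = qpoch Q (2 * M) / (qpoch Q (M + k) * (1 - Q ^ (M + Suc k)) * qpoch Q d)"
    using d by (simp add: qbin_def qpoch_Suc)
  also have "\<dots> = qpoch Q (2 * M) / (qpoch Q (M + k) * (qpoch Q d * (1 - Q ^ Suc d))) * ((1 - Q ^ Suc d) / (1 - Q ^ (M + Suc k)))"
    by (rule aux[OF B])
  also have "qpoch Q (2 * M) / (qpoch Q (M + k) * (qpoch Q d * (1 - Q ^ Suc d))) = qbin Q M k"
    using d k by (simp only: qbin_def qpoch_Suc if_True)
  finally show ?thesis using d by simp
qed (simp add: qbin_def)

lemma qbin_ratio_le: 
  assumes Q: "0 < Q" "Q < 1"
  shows "qbin Q M k / qbin Q M 0 \<le> 1"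
proof (induction k)
  case 0
  then show ?case using qbin_pos[OF Q, of M] by simp
next
  case (Suc k)
  show ?case
  proof (cases "k \<le> M")
    case True
    have "Q ^ (M + Suc k) \<le> Q ^ (M - k)" using Q by (intro power_decreasing) auto
    moreover have "Q ^ (M + Suc k) < 1" using power_Suc_less_one[OF Q, of "M + k"] by simp
    moreover have "Q ^ (M - k) \<le> 1" using Q by (intro power_le_one) auto
    ultimately have "(1 - Q ^ (M - k)) / (1 - Q ^ (M + Suc k)) \<le> 1" "0 \<le> (1 - Q ^ (M - k)) / (1 - Q ^ (M + Suc k))"
      by (simp_all del: power_Suc)
    then have "qbin Q M k / qbin Q M 0 * ((1 - Q ^ (M - k)) / (1 - Q ^ (M + Suc k))) \<le> 1 * 1"
      using Suc by (intro mult_mono) auto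
    moreover have "qbin Q M (Suc k) / qbin Q M 0 = qbin Q M k / qbin Q M 0 * ((1 - Q ^ (M - k)) / (1 - Q ^ (M + Suc k)))"
      unfolding qbin_ratio[OF Q True] by (simp only: times_divide_eq_left)
    ultimately show ?thesis by (simp only: mult_1)
  qed (simp add: qbin_def)
qed

lemma qbin_ratio_tendsto:
  assumes Q: "0 < Q" "Q < 1"
  shows "(\<lambda>M. qbin Q M k / qbin Q M 0) \<longlonglongrightarrow> 1"
proof (induction k)
  case 0
  have "qbin Q M 0 / qbin Q M 0 = 1" for M using qbin_pos[OF Q, of M] by simp
  then show ?case by simp
next
  case (Suc k)
  have Q0: "(\<lambda>n. Q ^ n) \<longlonglongrightarrow> 0" using Q by (intro LIMSEQ_power_zero) simp
  have "(\<lambda>M. (1 - Q ^ (M - k)) / (1 - Q ^ (M + Suc k))) \<longlonglongrightarrow> (1 - 0) / (1 - 0)"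
  proof (intro tendsto_divide tendsto_diff tendsto_const)
    show "(\<lambda>M. Q ^ (M - k)) \<longlonglongrightarrow> 0"
      by (rule LIMSEQ_offset[of _ k]) (simp add: Q0)
    show "(\<lambda>M. Q ^ (M + Suc k)) \<longlonglongrightarrow> 0" by (rule LIMSEQ_ignore_initial_segment[OF Q0])
  qed simp
  from tendsto_mult[OF Suc this] have "(\<lambda>M. qbin Q M k / qbin Q M 0 * ((1 - Q ^ (M - k)) / (1 - Q ^ (M + Suc k)))) \<longlonglongrightarrow> 1"
    by simp
  moreover have "\<forall>\<^sub>F M in sequentially. qbin Q M k / qbin Q M 0 * ((1 - Q ^ (M - k)) / (1 - Q ^ (M + Suc k))) = qbin Q M (Suc k) / qbin Q M 0"
    using eventually_ge_at_top[of k] by eventually_elim (simp add: qbin_ratio[OF Q])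
  ultimately show ?case by (rule Lim_transform_eventually)
qed

text \<open>With z = exp (i x) and y an odd power of exp (-t), the factor 1 + y^2 + 2 y cos x equals
  (1 + y z) (1 + y / z): a finite form of Jacobi's triple product, whose coefficients are Gaussian
  binomials for Q = exp (-2t).\<close>

lemma finite_triple_product:
  assumes t: "0 < t"
  shows "(\<Prod>i<M. [:1 + exp (- t * real (4 * i + 2)), 2 * exp (- t * real (2 * i + 1)):])
    = (\<Sum>k\<le>M. smult (cw k * (qbin (exp (- 2 * t)) M k * exp (- (real k)\<^sup>2 * t))) (cheb k))"
proof (rule cheb_product_expansion)
  let ?Q = "exp (- 2 * t)"
  have Q: "0 < ?Q" "?Q < 1" using t by simp_all
  have Qp: "?Q ^ n = exp (- 2 * t * real n)" for n by (simp add: exp_of_nat_mult[symmetric] mult.commute)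
  show "qbin ?Q 0 0 * exp (- (real 0)\<^sup>2 * t) = 1" by (simp add: qbin_def)
  fix M
  show "qbin ?Q (Suc M) 0 * exp (- (real 0)\<^sup>2 * t) = (1 + exp (- t * real (4 * M + 2))) * (qbin ?Q M 0 * exp (- (real 0)\<^sup>2 * t))
    + 2 * exp (- t * real (2 * M + 1)) * (qbin ?Q M 1 * exp (- (real 1)\<^sup>2 * t))"
    unfolding qbin_Suc(1)[OF Q] Qp by (simp add: algebra_simps exp_add[symmetric])
  fix k
  show "M < k \<Longrightarrow> qbin ?Q M k * exp (- (real k)\<^sup>2 * t) = 0" by (simp add: qbin_def)
  show "qbin ?Q (Suc M) (Suc k) * exp (- (real (Suc k))\<^sup>2 * t)
    = (1 + exp (- t * real (4 * M + 2))) * (qbin ?Q M (Suc k) * exp (- (real (Suc k))\<^sup>2 * t))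
     + exp (- t * real (2 * M + 1)) * (qbin ?Q M k * exp (- (real k)\<^sup>2 * t) + qbin ?Q M (Suc (Suc k)) * exp (- (real (Suc (Suc k)))\<^sup>2 * t))"
  proof (cases "k \<le> M")
    case True
    have e1: "?Q ^ (2 * M + 1) = exp (- t * real (4 * M + 2))" unfolding Qp by (simp add: algebra_simps)
    have e2: "?Q ^ (M - k) * exp (- (real (Suc k))\<^sup>2 * t) = exp (- t * real (2 * M + 1)) * exp (- (real k)\<^sup>2 * t)"
      unfolding Qp exp_add[symmetric] using True by (simp add: of_nat_diff algebra_simps power2_eq_square)
    have e3: "?Q ^ (M + k + 2) * exp (- (real (Suc k))\<^sup>2 * t) = exp (- t * real (2 * M + 1)) * exp (- (real (Suc (Suc k)))\<^sup>2 * t)"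
      unfolding Qp exp_add[symmetric] by (simp add: algebra_simps power2_eq_square)
    have "qbin ?Q (Suc M) (Suc k) * exp (- (real (Suc k))\<^sup>2 * t)
      = (1 + ?Q ^ (2 * M + 1)) * (qbin ?Q M (Suc k) * exp (- (real (Suc k))\<^sup>2 * t))
       + qbin ?Q M k * (?Q ^ (M - k) * exp (- (real (Suc k))\<^sup>2 * t))
       + qbin ?Q M (Suc (Suc k)) * (?Q ^ (M + k + 2) * exp (- (real (Suc k))\<^sup>2 * t))"
    proof -
      have "(u * x + v * y + w * z) * E = u * (x * E) + y * (v * E) + z * (w * E)" for u v w x y z E :: real
        by (simp add: algebra_simps)
      then show ?thesis unfolding qbin_Suc(2)[OF Q True] .
    qed
    then show ?thesis unfolding e1 e2 e3 by (simp only: distrib_left mult_ac add_ac)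
  qed (simp add: qbin_def)
qed

section \<open>Finite differences\<close>

fun fdiff :: "nat \<Rightarrow> (nat \<Rightarrow> real) \<Rightarrow> real" where
  "fdiff 0 u = u 0"
| "fdiff (Suc n) u = fdiff n (\<lambda>i. u (Suc i) - u i)"

lemma fdiff_cmult: "fdiff n (\<lambda>i. c * u i) = c * fdiff n u"
  by (induction n arbitrary: u) (simp_all flip: right_diff_distrib)

lemma fdiff_power: "fdiff n (\<lambda>i. z ^ i) = (z - 1) ^ n"
proof (induction n)
  case (Suc n)
  have "(\<lambda>i. z ^ Suc i - z ^ i) = (\<lambda>i. (z - 1) * z ^ i)" by (simp add: algebra_simps)
  then show ?case using Suc by (simp only: fdiff.simps fdiff_cmult) simp
qed simp

lemma tendsto_fdiff:
  assumes "\<And>i. ((\<lambda>x. u x i) \<longlongrightarrow> v i) F"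
  shows "((\<lambda>x. fdiff n (u x)) \<longlongrightarrow> fdiff n v) F"
  using assms
proof (induction n arbitrary: u v)
  case (Suc n)
  show ?case unfolding fdiff.simps by (rule Suc.IH) (intro tendsto_diff Suc.prems)
qed simp

lemma has_bochner_integral_fdiff:
  assumes "\<And>i. i \<le> n \<Longrightarrow> has_bochner_integral M (\<lambda>x. u x i) (v i)"
  shows "has_bochner_integral M (\<lambda>x. fdiff n (u x)) (fdiff n v)"
  using assms
proof (induction n arbitrary: u v)
  case (Suc n)
  show ?case unfolding fdiff.simps by (rule Suc.IH) (intro has_bochner_integral_diff Suc.prems; simp)
qed simp

text \<open>The mean value theorem, once per difference: the n-th derivative of the first difference
  g lies between h L and h U on the shortened interval.\<close>

lemma fdiff_bounds:
  assumes "\<And>j z. (f j has_real_derivative f (Suc j) z) (at z)" "0 < h"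
    "\<And>z. x \<le> z \<Longrightarrow> z \<le> x + real n * h \<Longrightarrow> L \<le> f n z \<and> f n z \<le> U"
  shows "h ^ n * L \<le> fdiff n (\<lambda>i. f 0 (x + real i * h)) \<and> fdiff n (\<lambda>i. f 0 (x + real i * h)) \<le> h ^ n * U"
  using assms(1,3)
proof (induction n arbitrary: f L U)
  case 0
  then show ?case by simp
next
  case (Suc n)
  define g where "g j z = f j (z + h) - f j z" for j z
  have gd: "(g j has_real_derivative g (Suc j) z) (at z)" for j z
  proof -
    have "((\<lambda>z. f j (z + h)) has_real_derivative f (Suc j) (z + h)) (at z)"
      using Suc.prems(1)[of j "z + h"] by (simp only: DERIV_shift[symmetric])
    from DERIV_diff[OF this Suc.prems(1)] show ?thesis by (simp add: g_def[abs_def])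
  qed
  have gb: "h * L \<le> g n z \<and> g n z \<le> h * U" if "x \<le> z" "z \<le> x + real n * h" for z
  proof -
    have "\<exists>y. z < y \<and> y < z + h \<and> f n (z + h) - f n z = (z + h - z) * f (Suc n) y"
      using assms(2) Suc.prems(1) by (intro MVT2) auto
    then obtain y where y: "z < y" "y < z + h" "g n z = h * f (Suc n) y" by (auto simp: g_def)
    have "L \<le> f (Suc n) y \<and> f (Suc n) y \<le> U"
      using that y by (intro Suc.prems(2)) (auto simp: algebra_simps)
    then show ?thesis using y(3) assms(2) by (simp add: mult_left_mono)
  qed
  have "fdiff (Suc n) (\<lambda>i. f 0 (x + real i * h)) = fdiff n (\<lambda>i. g 0 (x + real i * h))"
    by (simp add: g_def algebra_simps)
  moreover have "h ^ n * (h * L) \<le> fdiff n (\<lambda>i. g 0 (x + real i * h)) \<and> fdiff n (\<lambda>i. g 0 (x + real i * h)) \<le> h ^ n * (h * U)"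
    by (rule Suc.IH[OF gd gb])
  ultimately show ?case by (simp add: mult_ac)
qed

section \<open>Absolutely monotone approximants of theta\<close>

definition abs_mono :: "real poly \<Rightarrow> bool" where
  "abs_mono p \<longleftrightarrow> (\<forall>j. \<forall>x\<ge>-1. 0 \<le> poly ((pderiv ^^ j) p) x)"

lemma higher_pderiv_mult_linear:
  "(pderiv ^^ Suc j) ([:a, b:] * p) = [:a, b:] * (pderiv ^^ Suc j) p + smult (real (Suc j) * b) ((pderiv ^^ j) p)"
proof (induction j)
  case 0
  show ?case by (simp add: pderiv_mult pderiv_pCons del: mult_pCons_left)
next
  case (Suc j)
  have "(pderiv ^^ Suc (Suc j)) ([:a, b:] * p) = pderiv ([:a, b:] * (pderiv ^^ Suc j) p + smult (real (Suc j) * b) ((pderiv ^^ j) p))"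
    using Suc by (simp del: mult_pCons_left)
  also have "\<dots> = [:a, b:] * (pderiv ^^ Suc (Suc j)) p + smult b ((pderiv ^^ Suc j) p) + smult (real (Suc j) * b) ((pderiv ^^ Suc j) p)"
    by (simp add: pderiv_add pderiv_mult pderiv_smult pderiv_pCons del: mult_pCons_left)
  finally show ?case by (simp add: smult_add_left[symmetric] algebra_simps del: mult_pCons_left)
qed

text \<open>Leibniz's rule for a linear factor has only two terms, and b <= a makes a + b x
  nonnegative from -1 on.\<close>

lemma abs_mono_mult_linear:
  assumes "abs_mono p" "0 \<le> b" "b \<le> a"
  shows "abs_mono ([:a, b:] * p)"
  unfolding abs_mono_def
proof (intro allI impI)
  fix j and x :: real assume x: "-1 \<le> x"
  have "b * (-1) \<le> b * x" using x assms by (intro mult_left_mono) auto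
  then have l: "0 \<le> a + b * x" using assms by simp
  show "0 \<le> poly ((pderiv ^^ j) ([:a, b:] * p)) x"
  proof (cases j)
    case 0
    have "0 \<le> poly ((pderiv ^^ 0) p) x" using assms(1) x unfolding abs_mono_def by blast
    then have "0 \<le> (a + b * x) * poly p x" using l by simp
    then show ?thesis using 0 by (simp add: algebra_simps)
  next
    case (Suc i)
    have p: "0 \<le> poly ((pderiv ^^ Suc i) p) x" "0 \<le> poly ((pderiv ^^ i) p) x"
      using assms(1) x unfolding abs_mono_def by blast+
    have "poly ((pderiv ^^ j) ([:a, b:] * p)) x = (a + b * x) * poly ((pderiv ^^ Suc i) p) x + real (Suc i) * b * poly ((pderiv ^^ i) p) x"
      unfolding Suc higher_pderiv_mult_linear by (simp add: algebra_simps del: funpow.simps)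
    then show ?thesis using p l assms(2) by simp
  qed
qed

text \<open>The condition of \<open>abs_mono_mult_linear\<close> on each factor reads 2y <= 1 +
  y^2.\<close>

lemma abs_mono_triple_product:
  assumes t: "0 < t"
  shows "abs_mono (\<Prod>i<M. [:1 + exp (- t * real (4 * i + 2)), 2 * exp (- t * real (2 * i + 1)):])"
proof (induction M)
  case 0
  have "(pderiv ^^ Suc j) (1 :: real poly) = 0" for j by (induction j) (simp_all add: pderiv_1)
  then have "0 \<le> poly ((pderiv ^^ j) 1) (x::real)" for j x by (cases j) (simp_all only: funpow_0 poly_1 poly_0 zero_le_one order_refl)
  then show ?case by (simp add: abs_mono_def)
next
  case (Suc M)
  let ?y = "exp (- t * real (2 * M + 1))"
  have "exp (- t * real (4 * M + 2)) = ?y\<^sup>2" by (simp add: power2_eq_square exp_add[symmetric] algebra_simps)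
  moreover have "0 \<le> (1 - ?y)\<^sup>2" by simp
  ultimately have "2 * ?y \<le> 1 + exp (- t * real (4 * M + 2))" by (simp add: power2_eq_square algebra_simps)
  then have "abs_mono ([:1 + exp (- t * real (4 * M + 2)), 2 * ?y:] * (\<Prod>i<M. [:1 + exp (- t * real (4 * i + 2)), 2 * exp (- t * real (2 * i + 1)):]))"
    by (intro abs_mono_mult_linear Suc) auto
  then show ?case by (simp only: prod.lessThan_Suc mult.commute)
qed

text \<open>Dividing the finite product by its central coefficient makes every Chebyshev multiplier
  tend to 1 and absorbs the constant of the infinite product. One sequence serves all orders n at
  once, because the difference estimates compare different derivatives of the same function.\<close>

lemma thetad_approx:
  assumes t: "0 < t"
  shows "\<exists>p :: nat \<Rightarrow> real poly. (\<forall>M. abs_mono (p M)) \<and> (\<forall>n x. (\<lambda>M. poly ((pderiv ^^ n) (p M)) x) \<longlonglongrightarrow> thetad n t x)"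
proof -
  let ?Q = "exp (- 2 * t)"
  have Q: "0 < ?Q" "?Q < 1" using t by simp_all
  define p where "p M = smult (1 / qbin ?Q M 0) (\<Prod>i<M. [:1 + exp (- t * real (4 * i + 2)), 2 * exp (- t * real (2 * i + 1)):])" for M
  have 1: "abs_mono (p M)" for M
    using abs_mono_triple_product[OF t, of M] qbin_pos[OF Q, of M] unfolding abs_mono_def p_def higher_pderiv_smult by simp
  have 2: "(\<lambda>M. poly ((pderiv ^^ n) (p M)) x) \<longlonglongrightarrow> thetad n t x" for n x
  proof -
    have "poly ((pderiv ^^ n) (p M)) x = (\<Sum>k\<le>M. cw k * (qbin ?Q M k / qbin ?Q M 0) * (exp (- (real k)\<^sup>2 * t) * poly ((pderiv ^^ n) (cheb k)) x))" for M
      unfolding p_def finite_triple_product[OF t] higher_pderiv_smult higher_pderiv_sum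
      by (simp add: poly_sum sum_distrib_left mult_ac)
    moreover have "(\<lambda>M. \<Sum>k\<le>M. cw k * (qbin ?Q M k / qbin ?Q M 0) * (exp (- (real k)\<^sup>2 * t) * poly ((pderiv ^^ n) (cheb k)) x)) \<longlonglongrightarrow> thetad n t x"
    proof (rule thetad_multiplier_tendsto[OF t])
      show "0 \<le> qbin ?Q M k / qbin ?Q M 0" for M k using qbin_nonneg[OF Q] by simp
      show "qbin ?Q M k / qbin ?Q M 0 \<le> 1" for M k by (rule qbin_ratio_le[OF Q])
      show "(\<lambda>M. qbin ?Q M k / qbin ?Q M 0) \<longlonglongrightarrow> 1" for k by (rule qbin_ratio_tendsto[OF Q])
    qed (simp add: qbin_def)
    ultimately show ?thesis by simp
  qed
  from 1 2 show ?thesis by blast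
qed

lemma abs_mono_poly_mono:
  assumes p: "abs_mono p" and x: "-1 \<le> x" "x \<le> y"
  shows "poly ((pderiv ^^ n) p) x \<le> poly ((pderiv ^^ n) p) y"
proof (rule DERIV_nonneg_imp_nondecreasing[OF x(2)])
  fix z assume "x \<le> z"
  then have "0 \<le> poly ((pderiv ^^ Suc n) p) z" using p x unfolding abs_mono_def by (meson order_trans)
  then show "\<exists>d. (poly ((pderiv ^^ n) p) has_real_derivative d) (at z) \<and> 0 \<le> d"
    using poly_DERIV[of "(pderiv ^^ n) p" z] by (intro exI[of _ "poly ((pderiv ^^ Suc n) p) z"]) simp
qed

lemma thetad_nonneg:
  assumes "0 < t" "-1 \<le> x" shows "0 \<le> thetad n t x"
proof -
  obtain p :: "nat \<Rightarrow> real poly" where p: "\<And>M. abs_mono (p M)" "\<And>n x. (\<lambda>M. poly ((pderiv ^^ n) (p M)) x) \<longlonglongrightarrow> thetad n t x"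
    using thetad_approx[OF assms(1)] by blast
  show ?thesis by (rule LIMSEQ_le_const[OF p(2)]) (use p(1) assms(2) in \<open>auto simp: abs_mono_def\<close>)
qed

lemma thetad_mono:
  assumes "0 < t" "-1 \<le> x" "x \<le> y" shows "thetad n t x \<le> thetad n t y"
proof -
  obtain p :: "nat \<Rightarrow> real poly" where p: "\<And>M. abs_mono (p M)" "\<And>n x. (\<lambda>M. poly ((pderiv ^^ n) (p M)) x) \<longlonglongrightarrow> thetad n t x"
    using thetad_approx[OF assms(1)] by blast
  show ?thesis by (rule LIMSEQ_le[OF p(2) p(2)]) (use abs_mono_poly_mono[OF p(1) assms(2,3)] in auto)
qed

text \<open>Absolute monotonicity makes the n-th derivative of each approximant increasing, so on
  [x, x + n h] it lies between its end values; the mean value estimate for differences then survives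
  the limit.\<close>

lemma thetad_fdiff:
  assumes t: "0 < t" and x: "-1 \<le> x" and h: "0 < h"
  shows "h ^ n * thetad n t x \<le> fdiff n (\<lambda>i. thetad 0 t (x + real i * h))"
    and "fdiff n (\<lambda>i. thetad 0 t (x + real i * h)) \<le> h ^ n * thetad n t (x + real n * h)"
proof -
  obtain p :: "nat \<Rightarrow> real poly" where p: "\<And>M. abs_mono (p M)" "\<And>n x. (\<lambda>M. poly ((pderiv ^^ n) (p M)) x) \<longlonglongrightarrow> thetad n t x"
    using thetad_approx[OF t] by blast
  have b: "h ^ n * poly ((pderiv ^^ n) (p M)) x \<le> fdiff n (\<lambda>i. poly (p M) (x + real i * h)) \<and>
     fdiff n (\<lambda>i. poly (p M) (x + real i * h)) \<le> h ^ n * poly ((pderiv ^^ n) (p M)) (x + real n * h)" for M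
  proof -
    have 1: "(poly ((pderiv ^^ j) (p M)) has_real_derivative poly ((pderiv ^^ Suc j) (p M)) z) (at z)" for j z
      using poly_DERIV[of "(pderiv ^^ j) (p M)" z] by simp
    have 2: "poly ((pderiv ^^ n) (p M)) x \<le> poly ((pderiv ^^ n) (p M)) z \<and> poly ((pderiv ^^ n) (p M)) z \<le> poly ((pderiv ^^ n) (p M)) (x + real n * h)"
      if "x \<le> z" "z \<le> x + real n * h" for z
      using that x abs_mono_poly_mono[OF p(1)] by simp
    show ?thesis
      using fdiff_bounds[of "\<lambda>j. poly ((pderiv ^^ j) (p M))" h x n, OF 1 h 2] by simp
  qed
  have l: "(\<lambda>M. fdiff n (\<lambda>i. poly (p M) (x + real i * h))) \<longlonglongrightarrow> fdiff n (\<lambda>i. thetad 0 t (x + real i * h))"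
    using p(2)[of 0] by (intro tendsto_fdiff) simp
  have r: "(\<lambda>M. h ^ n * poly ((pderiv ^^ n) (p M)) y) \<longlonglongrightarrow> h ^ n * thetad n t y" for y
    by (intro tendsto_mult tendsto_const p)
  show "h ^ n * thetad n t x \<le> fdiff n (\<lambda>i. thetad 0 t (x + real i * h))"
    by (rule LIMSEQ_le[OF r l]) (use b in auto)
  show "fdiff n (\<lambda>i. thetad 0 t (x + real i * h)) \<le> h ^ n * thetad n t (x + real n * h)"
    by (rule LIMSEQ_le[OF l r]) (use b in auto)
qed

section \<open>Gaussian bounds for the theta function\<close>

text \<open>Normalised so that the principal term of the theta transformation is exactly exp (- d^2
  / (4 t)) at cos d.\<close>

definition ntheta :: "real \<Rightarrow> real \<Rightarrow> real" where
  "ntheta t x = sqrt (t / pi) * thetad 0 t x"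

text \<open>For 0 <= d <= pi/2 the squared distances to the translates by 2 pi m exceed d^2 by at
  least 2 pi^2 m. The range of d matters: at d = pi the first translate would tie with the principal
  term.\<close>

lemma wgauss_Suc_le:
  assumes t: "0 < t" and d: "0 \<le> d" "d \<le> pi / 2"
  shows "wgauss t (Suc l) d \<le> exp (- d\<^sup>2 / (4 * t)) * (2 * exp (- pi\<^sup>2 / (2 * t)) ^ Suc l)"
proof -
  let ?m = "real (Suc l)"
  have *: "exp (- x\<^sup>2 / (4 * t)) \<le> exp (- d\<^sup>2 / (4 * t)) * exp (- pi\<^sup>2 / (2 * t)) ^ Suc l"
    if "d\<^sup>2 + 2 * pi\<^sup>2 * ?m \<le> x\<^sup>2" for x
  proof -
    have "- x\<^sup>2 / (4 * t) \<le> - (d\<^sup>2 + 2 * pi\<^sup>2 * ?m) / (4 * t)"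
      using that t by (intro divide_right_mono) auto
    also have "\<dots> = - d\<^sup>2 / (4 * t) + ?m * (- pi\<^sup>2 / (2 * t))"
      using t by (simp add: field_simps)
    finally show ?thesis by (simp only: exp_add[symmetric] exp_of_nat_mult[symmetric] exp_le_cancel_iff)
  qed
  have m: "1 \<le> ?m" by simp
  have "pi * (pi * (2 * ?m)) \<le> pi * (pi * (2 * (?m * ?m)))"
    using m by (intro mult_left_mono) auto
  then have q: "2 * pi\<^sup>2 * ?m \<le> 2 * pi\<^sup>2 * ?m\<^sup>2" by (simp add: power2_eq_square mult_ac)
  have "(pi * ?m) * (4 * d) \<le> (pi * ?m) * (2 * pi)"
    using d by (intro mult_left_mono) auto
  then have dd: "4 * pi * ?m * d \<le> 2 * pi\<^sup>2 * ?m" by (simp add: power2_eq_square algebra_simps)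
  have n: "0 \<le> 4 * pi * ?m * d" "0 \<le> 2 * pi\<^sup>2 * ?m" using d by simp_all
  have "(d + 2 * pi * ?m)\<^sup>2 = d\<^sup>2 + 4 * pi * ?m * d + 4 * pi\<^sup>2 * ?m\<^sup>2"
    "(d - 2 * pi * ?m)\<^sup>2 = d\<^sup>2 - 4 * pi * ?m * d + 4 * pi\<^sup>2 * ?m\<^sup>2"
    by (simp_all add: power2_eq_square algebra_simps)
  then have "d\<^sup>2 + 2 * pi\<^sup>2 * ?m \<le> (d + 2 * pi * ?m)\<^sup>2" "d\<^sup>2 + 2 * pi\<^sup>2 * ?m \<le> (d - 2 * pi * ?m)\<^sup>2"
    using q dd n by linarith+
  from add_mono[OF this[THEN *]] show ?thesis by (simp add: wgauss_def mult.left_commute)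
qed

lemma ntheta_cos_bounds:
  assumes t: "0 < t" and d: "0 \<le> d" "d \<le> pi / 2"
  shows "exp (- d\<^sup>2 / (4 * t)) \<le> ntheta t (cos d)"
    and "ntheta t (cos d) \<le> exp (- d\<^sup>2 / (4 * t)) * (1 + 2 * (exp (- pi\<^sup>2 / (2 * t)) / (1 - exp (- pi\<^sup>2 / (2 * t)))))"
proof -
  let ?y = "exp (- pi\<^sup>2 / (2 * t))"
  have y: "?y < 1" using t by (simp add: field_simps)
  have d': "\<bar>d\<bar> \<le> pi" using d by simp
  have s: "summable (\<lambda>l. wgauss t l d)" by (rule summable_wgauss[OF t d'])
  have eq: "ntheta t (cos d) = exp (- d\<^sup>2 / (4 * t)) + (\<Sum>l. wgauss t (Suc l) d)"
    unfolding ntheta_def theta_transform[OF t d'] suminf_split_head[OF s] by (simp add: wgauss_def)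
  have s1: "summable (\<lambda>l. wgauss t (Suc l) d)" using s by (subst summable_Suc_iff)
  have g: "(\<lambda>l. ?y ^ Suc l) sums (?y * (1 / (1 - ?y)))"
    unfolding power_Suc using y by (intro sums_mult geometric_sums) simp
  have sb: "(\<lambda>l. exp (- d\<^sup>2 / (4 * t)) * (2 * ?y ^ Suc l)) sums (exp (- d\<^sup>2 / (4 * t)) * (2 * (?y * (1 / (1 - ?y)))))"
    by (intro sums_mult g)
  have "(\<Sum>l. wgauss t (Suc l) d) \<le> (\<Sum>l. exp (- d\<^sup>2 / (4 * t)) * (2 * ?y ^ Suc l))"
    by (intro suminf_le wgauss_Suc_le assms s1 sums_summable[OF sb])
  also have "\<dots> = exp (- d\<^sup>2 / (4 * t)) * (2 * (?y * (1 / (1 - ?y))))" using sb by (simp add: sums_iff)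
  finally show "ntheta t (cos d) \<le> exp (- d\<^sup>2 / (4 * t)) * (1 + 2 * (?y / (1 - ?y)))"
    unfolding eq by (simp add: algebra_simps)
  show "exp (- d\<^sup>2 / (4 * t)) \<le> ntheta t (cos d)"
    unfolding eq by (simp add: suminf_nonneg[OF s1] wgauss_nonneg)
qed

text \<open>For t <= 1 the ratio exp (- pi^2 / (2 t)) is at most 1/2, so the geometric tail adds at
  most 2 to the principal term 1.\<close>

lemma ntheta_cos_le:
  assumes t: "0 < t" "t \<le> 1" and d: "0 \<le> d" "d \<le> pi / 2"
  shows "ntheta t (cos d) \<le> 3 * exp (- d\<^sup>2 / (4 * t))"
proof -
  let ?y = "exp (- pi\<^sup>2 / (2 * t))"
  have "2 * t \<le> 2 * 2" using t by simp
  also have "2 * 2 \<le> pi * pi" using pi_gt3 by (intro mult_mono) auto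
  finally have "1 \<le> pi\<^sup>2 / (2 * t)" using t by (simp add: power2_eq_square)
  then have "1 + 1 \<le> exp (pi\<^sup>2 / (2 * t))"
    using exp_ge_add_one_self[of "pi\<^sup>2 / (2 * t)"] by linarith
  then have y: "?y \<le> 1 / 2" by (simp add: exp_minus field_simps)
  then have "0 < 1 - ?y" "?y \<le> 1 - ?y" by linarith+
  then have "?y / (1 - ?y) \<le> 1" by (simp only: divide_le_eq_1_pos)
  then have "exp (- d\<^sup>2 / (4 * t)) * (1 + 2 * (?y / (1 - ?y))) \<le> exp (- d\<^sup>2 / (4 * t)) * 3"
    by (intro mult_left_mono) auto
  then show ?thesis using ntheta_cos_bounds(2)[OF t(1) d] by linarith
qed

text \<open>Split at the integer part of c: each half is dominated by the sum centred at 0, so the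
  bound is uniform in c.\<close>

lemma shifted_gauss_sum_le:
  assumes t: "0 < t" and c: "0 \<le> c"
  shows "summable (\<lambda>k. exp (- t * (real k - c)\<^sup>2))"
    and "(\<Sum>k. exp (- t * (real k - c)\<^sup>2)) \<le> 2 * (\<Sum>k. exp (- t * (real k)\<^sup>2))"
proof -
  let ?g = "\<lambda>k. exp (- t * (real k)\<^sup>2)"
  have sg: "summable ?g" using summable_gauss_power[OF t, of 1] by (simp add: mult.commute)
  define m where "m = nat \<lfloor>c\<rfloor>"
  have m: "real m \<le> c" "c < real m + 1" using c unfolding m_def by linarith+
  have hi: "exp (- t * (real (k + Suc m) - c)\<^sup>2) \<le> ?g k" for k
  proof -
    have "(real k)\<^sup>2 \<le> (real (k + Suc m) - c)\<^sup>2" using m by (intro power_mono) auto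
    then show ?thesis using t by simp
  qed
  show s: "summable (\<lambda>k. exp (- t * (real k - c)\<^sup>2))"
    by (subst summable_iff_shift[of _ "Suc m", symmetric], rule summable_comparison_test'[OF sg]) (use hi in auto)
  have "(\<Sum>k. exp (- t * (real (k + Suc m) - c)\<^sup>2)) \<le> (\<Sum>k. ?g k)"
    by (rule suminf_le[OF hi _ sg]) (use s in \<open>subst summable_iff_shift\<close>)
  moreover have "(\<Sum>k<Suc m. exp (- t * (real k - c)\<^sup>2)) \<le> (\<Sum>k. ?g k)"
  proof -
    have "(\<Sum>k<Suc m. exp (- t * (real k - c)\<^sup>2)) \<le> (\<Sum>k<Suc m. ?g (m - k))"
    proof (rule sum_mono)
      fix k assume "k \<in> {..<Suc m}"
      then have k: "k \<le> m" by simp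
      then have "(real (m - k))\<^sup>2 \<le> (c - real k)\<^sup>2" using m by (intro power_mono) auto
      then show "exp (- t * (real k - c)\<^sup>2) \<le> ?g (m - k)" using t by (simp add: power2_commute)
    qed
    also have "\<dots> = (\<Sum>k<Suc m. ?g k)" by (rule sum.reindex_bij_witness[of _ "\<lambda>k. m - k" "\<lambda>k. m - k"]) auto
    also have "\<dots> \<le> (\<Sum>k. ?g k)" by (rule sum_le_suminf[OF sg]) auto
    finally show ?thesis .
  qed
  ultimately show "(\<Sum>k. exp (- t * (real k - c)\<^sup>2)) \<le> 2 * (\<Sum>k. ?g k)"
    using suminf_split_initial_segment[OF s, of "Suc m"] by simp
qed

text \<open>Beyond 1 the series is estimated directly, completing the square around k = \<xi> / (2
  t). The constant 12 is 2 for the weights, times 2 for the shifted sum, times 3 for the normalised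
  value at 1.\<close>

lemma ntheta_cosh_le:
  assumes t: "0 < t" "t \<le> 1" and x: "0 \<le> \<xi>"
  shows "ntheta t (cosh \<xi>) \<le> 12 * exp (\<xi>\<^sup>2 / (4 * t))"
proof -
  let ?c = "\<xi> / (2 * t)"
  let ?E = "exp (\<xi>\<^sup>2 / (4 * t))"
  have c: "0 \<le> ?c" using t x by simp
  have sg: "summable (\<lambda>k. exp (- t * (real k)\<^sup>2))" using summable_gauss_power[OF t(1), of 1] by (simp add: mult.commute)
  have term_le: "cw k * exp (- (real k)\<^sup>2 * t) * poly (cheb k) (cosh \<xi>) \<le> 2 * ?E * exp (- t * (real k - ?c)\<^sup>2)" for k
  proof -
    have "cosh (real k * \<xi>) \<le> exp (real k * \<xi>)" using x by (simp add: cosh_field_def)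
    then have "cw k * exp (- (real k)\<^sup>2 * t) * cosh (real k * \<xi>) \<le> 2 * exp (- (real k)\<^sup>2 * t) * exp (real k * \<xi>)"
      by (intro mult_mono) (auto simp: cw_def)
    also have "\<dots> = 2 * exp (- (real k)\<^sup>2 * t + real k * \<xi>)" by (simp only: exp_add mult.assoc)
    also have "- (real k)\<^sup>2 * t + real k * \<xi> = \<xi>\<^sup>2 / (4 * t) + - t * (real k - ?c)\<^sup>2"
      using t(1) by (simp add: field_simps power2_eq_square)
    finally show ?thesis by (simp only: cheb_cosh exp_add mult.assoc)
  qed
  have "thetad 0 t (cosh \<xi>) \<le> (\<Sum>k. 2 * ?E * exp (- t * (real k - ?c)\<^sup>2))"
    unfolding thetad_def funpow_0
    by (intro suminf_le term_le summable_theta t summable_mult shifted_gauss_sum_le c cosh_real_ge_1)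
  also have "\<dots> = 2 * ?E * (\<Sum>k. exp (- t * (real k - ?c)\<^sup>2))"
    by (intro suminf_mult shifted_gauss_sum_le t c)
  also have "\<dots> \<le> 2 * ?E * (2 * (\<Sum>k. exp (- t * (real k)\<^sup>2)))"
    by (intro mult_left_mono shifted_gauss_sum_le t c) auto
  also have "(\<Sum>k. exp (- t * (real k)\<^sup>2)) \<le> thetad 0 t 1"
    unfolding thetad_def funpow_0
  proof (rule suminf_le[OF _ sg summable_theta[OF t(1)]])
    show "exp (- t * (real k)\<^sup>2) \<le> cw k * exp (- (real k)\<^sup>2 * t) * poly (cheb k) 1" for k
      using cheb_cos[of k 0] by (simp add: cw_def mult.commute)
  qed simp
  finally have "thetad 0 t (cosh \<xi>) \<le> 4 * ?E * thetad 0 t 1" by simp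
  then have "ntheta t (cosh \<xi>) \<le> sqrt (t / pi) * (4 * ?E * thetad 0 t 1)"
    unfolding ntheta_def using t by (intro mult_left_mono) auto
  also have "\<dots> = 4 * ?E * ntheta t (cos 0)" by (simp add: ntheta_def)
  also have "\<dots> \<le> 4 * ?E * (3 * exp (- 0\<^sup>2 / (4 * t)))" by (intro mult_left_mono ntheta_cos_le t) auto
  finally show ?thesis by simp
qed

text \<open>\<open>arccos\<^sup>2\<close> continues analytically past \<open>1\<close> as \<open>- arcosh\<^sup>2\<close>.\<close>

definition acsq :: "real \<Rightarrow> real" where
  "acsq x = (if x \<le> 1 then (arccos x)\<^sup>2 else - (arcosh x)\<^sup>2)"

lemma ntheta_le:
  assumes t: "0 < t" "t \<le> 1" and x: "0 \<le> x"
  shows "ntheta t x \<le> 12 * exp (- acsq x / (4 * t))"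
proof (cases "x \<le> 1")
  case True
  have "ntheta t (cos (arccos x)) \<le> 3 * exp (- (arccos x)\<^sup>2 / (4 * t))"
    using x True arccos_le_pi2[of x] arccos_lbound[of x] by (intro ntheta_cos_le t) auto
  moreover have "0 \<le> exp (- (arccos x)\<^sup>2 / (4 * t))" by simp
  ultimately have "ntheta t (cos (arccos x)) \<le> 12 * exp (- (arccos x)\<^sup>2 / (4 * t))" by linarith
  then show ?thesis using True x by (simp add: acsq_def)
next
  case False
  then show ?thesis using ntheta_cosh_le[OF t, of "arcosh x"] by (simp add: acsq_def)
qed

lemma ntheta_nonneg: "0 < t \<Longrightarrow> -1 \<le> x \<Longrightarrow> 0 \<le> ntheta t x"
  by (simp add: ntheta_def thetad_nonneg)

text \<open>Allows monotonicity of expressions in \<open>acsq\<close> to be read off from its two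
  branches, leaving out the point where they meet.\<close>

lemma nondecreasing_except_point:
  fixes f :: "real \<Rightarrow> real"
  assumes ab: "a \<le> b" and c: "continuous_on {a..b} f"
    and d: "\<And>x. a < x \<Longrightarrow> x < b \<Longrightarrow> x \<noteq> z \<Longrightarrow> \<exists>D. (f has_real_derivative D) (at x) \<and> 0 \<le> D"
  shows "f a \<le> f b"
proof -
  have mono: "f u \<le> f v" if "a \<le> u" "u \<le> v" "v \<le> b" "z \<le> u \<or> v \<le> z" for u v
  proof (rule DERIV_nonneg_imp_increasing_open[OF that(2)])
    show "continuous_on {u..v} f" using that by (intro continuous_on_subset[OF c]) auto
    show "\<exists>D. (f has_real_derivative D) (at x) \<and> 0 \<le> D" if "u < x" "x < v" for x
      using that \<open>a \<le> u\<close> \<open>v \<le> b\<close> \<open>z \<le> u \<or> v \<le> z\<close> by (intro d) linarith+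
  qed
  show ?thesis
  proof (cases "a < z \<and> z < b")
    case True
    then have "f a \<le> f z" "f z \<le> f b" by (intro mono; linarith)+
    then show ?thesis by linarith
  next
    case False
    then show ?thesis using ab by (intro mono) linarith+
  qed
qed

section \<open>Calculus of \<open>acsq\<close> and monotonicity of the phase\<close>

lemma continuous_on_acsq: "continuous_on {-1..} acsq"
proof -
  have "continuous_on ({-1..1} \<union> {1..}) (\<lambda>x. if x \<le> 1 then (arccos x)\<^sup>2 else - (arcosh x)\<^sup>2)"
    by (intro continuous_on_If closed_atLeast closed_atLeastAtMost continuous_on_minus continuous_on_power
        continuous_on_arccos' continuous_on_arcosh) auto
  moreover have "{-1..1} \<union> {1..} = {-1::real..}" by auto
  ultimately show ?thesis by (simp add: acsq_def[abs_def])
qed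

lemma DERIV_acsq_lt_1:
  assumes "-1 < x" "x < 1"
  shows "(acsq has_real_derivative - 2 * (arccos x / sin (arccos x))) (at x)"
proof -
  have "((\<lambda>x. (arccos x)\<^sup>2) has_real_derivative - 2 * (arccos x / sin (arccos x))) (at x)"
    using assms by (auto intro!: derivative_eq_intros simp: sin_arccos_abs divide_inverse)
  then show ?thesis
    by (rule has_field_derivative_transform_within_open[of _ _ _ "{..<1}"])
      (use assms in \<open>auto simp: acsq_def\<close>)
qed

lemma DERIV_acsq_gt_1:
  assumes "1 < x"
  shows "(acsq has_real_derivative - 2 * (arcosh x / sinh (arcosh x))) (at x)"
proof -
  have "((\<lambda>x. - (arcosh x)\<^sup>2) has_real_derivative - 2 * (arcosh x / sinh (arcosh x))) (at x)"
    using assms by (auto intro!: derivative_eq_intros simp: sinh_arcosh_real divide_inverse)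
  then show ?thesis
    by (rule has_field_derivative_transform_within_open[of _ _ _ "{1<..}"])
      (use assms in \<open>auto simp: acsq_def\<close>)
qed

lemma mult_cos_less_sin:
  assumes "0 < d" "d < pi" shows "d * cos d < sin (d::real)"
proof -
  have "sin 0 - 0 * cos 0 < sin d - d * cos d"
  proof (rule DERIV_pos_imp_increasing_open[OF assms(1)])
    fix x assume "0 < x" "x < d"
    then have "0 < x * sin x" using assms sin_gt_zero[of x] by auto
    moreover have "((\<lambda>x. sin x - x * cos x) has_real_derivative x * sin x) (at x)"
      by (auto intro!: derivative_eq_intros)
    ultimately show "\<exists>y. ((\<lambda>x. sin x - x * cos x) has_real_derivative y) (at x) \<and> 0 < y" by blast
  qed (intro continuous_intros)
  then show ?thesis by simp
qed

lemma sinh_le_mult_cosh: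
  assumes "0 \<le> y" shows "sinh y \<le> y * cosh (y::real)"
proof -
  have "0 * cosh 0 - sinh 0 \<le> y * cosh y - sinh y"
  proof (rule DERIV_nonneg_imp_nondecreasing[OF assms(1)])
    fix x :: real assume "0 \<le> x" "x \<le> y"
    then have "0 \<le> x * sinh x" by auto
    moreover have "((\<lambda>x. x * cosh x - sinh x) has_real_derivative x * sinh x) (at x)"
      by (auto intro!: derivative_eq_intros)
    ultimately show "\<exists>D. ((\<lambda>x. x * cosh x - sinh x) has_real_derivative D) (at x) \<and> 0 \<le> D" by blast
  qed
  then show ?thesis by simp
qed

lemma le_sinh_mult_cosh:
  assumes "0 \<le> y" shows "y \<le> sinh y * cosh (y::real)"
proof -
  have "sinh 0 - 0 \<le> sinh y - y"
  proof (rule DERIV_nonneg_imp_nondecreasing[OF assms])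
    fix x :: real
    have "((\<lambda>x. sinh x - x) has_real_derivative cosh x - 1) (at x)"
      by (auto intro!: derivative_eq_intros)
    then show "\<exists>D. ((\<lambda>x. sinh x - x) has_real_derivative D) (at x) \<and> 0 \<le> D"
      using cosh_real_ge_1[of x] by (intro exI[of _ "cosh x - 1"]) simp
  qed
  then have "y \<le> sinh y" by simp
  also have "\<dots> = sinh y * 1" by simp
  also have "\<dots> \<le> sinh y * cosh y" using assms cosh_real_ge_1[of y] by (intro mult_left_mono) auto
  finally show ?thesis .
qed

lemma div_sin_mono:
  assumes "0 < a" "a \<le> b" "b < pi" shows "a / sin a \<le> b / sin (b::real)"
proof (rule DERIV_nonneg_imp_nondecreasing[OF assms(2)])
  fix x assume x: "a \<le> x" "x \<le> b"
  then have s: "0 < sin x" using assms by (intro sin_gt_zero) auto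
  have "((\<lambda>x. x / sin x) has_real_derivative (sin x - x * cos x) / (sin x * sin x)) (at x)"
    using s by (auto intro!: derivative_eq_intros)
  moreover have "0 \<le> (sin x - x * cos x) / (sin x * sin x)"
    using x assms mult_cos_less_sin[of x] by (intro divide_nonneg_nonneg) auto
  ultimately show "\<exists>D. ((\<lambda>x. x / sin x) has_real_derivative D) (at x) \<and> 0 \<le> D" by blast
qed

lemma mult_coth_mono:
  assumes "0 < a" "a \<le> b" shows "a * cosh a / sinh a \<le> b * cosh b / sinh (b::real)"
proof (rule DERIV_nonneg_imp_nondecreasing[OF assms(2)])
  fix x assume x: "a \<le> x" "x \<le> b"
  then have s: "0 < sinh x" using assms by simp
  have "(1 * cosh x + sinh x * 1 * x) * sinh x - x * cosh x * (cosh x * 1) = sinh x * cosh x - x * ((cosh x)\<^sup>2 - (sinh x)\<^sup>2)"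
    by (simp add: power2_eq_square algebra_simps)
  then have e: "((1 * cosh x + sinh x * 1 * x) * sinh x - x * cosh x * (cosh x * 1)) / (sinh x * sinh x)
    = (sinh x * cosh x - x) / (sinh x * sinh x)"
    by (simp only: hyperbolic_pythagoras mult_1_right)
  have "((\<lambda>x. x * cosh x / sinh x) has_real_derivative
      ((1 * cosh x + sinh x * 1 * x) * sinh x - x * cosh x * (cosh x * 1)) / (sinh x * sinh x)) (at x)"
    using s by (auto intro!: derivative_eq_intros)
  moreover have "0 \<le> (sinh x * cosh x - x) / (sinh x * sinh x)"
    using x assms le_sinh_mult_cosh[of x] by (intro divide_nonneg_nonneg) auto
  ultimately show "\<exists>D. ((\<lambda>x. x * cosh x / sinh x) has_real_derivative D) (at x) \<and> 0 \<le> D" unfolding e by blast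
qed

lemma continuous_on_acsq_cosh:
  assumes "0 \<le> \<rho>" shows "continuous_on A (\<lambda>y. acsq (\<rho> * cosh y))"
proof (rule continuous_on_compose2[OF continuous_on_acsq])
  show "continuous_on A (\<lambda>y. \<rho> * cosh y)" by (intro continuous_on_mult continuous_on_const continuous_on_cosh continuous_on_id)
  have "0 \<le> \<rho> * cosh y" for y using assms by simp
  then have "-1 \<le> \<rho> * cosh y" for y by (rule order_trans[rotated]) simp
  then show "(\<lambda>y. \<rho> * cosh y) ` A \<subseteq> {-1..}" by auto
qed

text \<open>The derivative is 2z - 2 (d / sin d) \<rho> sinh z while the argument is below 1, and
  its hyperbolic analogue beyond. Below 1, d cot d <= 1 and tanh z <= z suffice; beyond 1,
  monotonicity of y coth y is used with \<xi> <= z, which holds since \<rho> <= 1.\<close>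

lemma action_mono:
  assumes \<rho>: "0 < \<rho>" "\<rho> \<le> 1" and y: "0 \<le> a" "a \<le> b"
  shows "a\<^sup>2 + acsq (\<rho> * cosh a) \<le> b\<^sup>2 + acsq (\<rho> * cosh b)"
proof (rule nondecreasing_except_point[OF y(2), where z = "arcosh (1 / \<rho>)"])
  show "continuous_on {a..b} (\<lambda>y. y\<^sup>2 + acsq (\<rho> * cosh y))"
    using \<rho> by (intro continuous_intros continuous_on_acsq_cosh) auto
  fix z assume z: "a < z" "z < b" "z \<noteq> arcosh (1 / \<rho>)"
  let ?x = "\<rho> * cosh z"
  have z0: "0 < z" and x0: "0 < ?x" using z y \<rho> by auto
  have x1: "?x \<noteq> 1"
  proof
    assume "?x = 1"
    then have "cosh z = 1 / \<rho>" using \<rho> by (simp add: field_simps)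
    then show False using z z0 arcosh_cosh_real[of z] by simp
  qed
  have chain: "((\<lambda>y. y\<^sup>2 + acsq (\<rho> * cosh y)) has_real_derivative 2 * z + D * (\<rho> * sinh z)) (at z)"
    if "(acsq has_real_derivative D) (at ?x)" for D
  proof -
    have "((\<lambda>y. acsq (\<rho> * cosh y)) has_real_derivative D * (\<rho> * sinh z)) (at z)"
      by (rule DERIV_chain2[where g = "\<lambda>y. \<rho> * cosh y", OF that]) (auto intro!: derivative_eq_intros)
    then show ?thesis by (auto intro!: derivative_eq_intros)
  qed
  show "\<exists>D. ((\<lambda>y. y\<^sup>2 + acsq (\<rho> * cosh y)) has_real_derivative D) (at z) \<and> 0 \<le> D"
  proof (cases "?x < 1")
    case True
    define d where "d = arccos ?x"
    have d: "0 < d" "d < pi" "cos d = ?x" using True x0 arccos_lt_bounded[of ?x] by (auto simp: d_def)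
    have "d / sin d * (\<rho> * sinh z) \<le> d / sin d * (\<rho> * (z * cosh z))"
      using d \<rho> z0 sinh_le_mult_cosh[of z] sin_gt_zero[of d] by (intro mult_left_mono) auto
    also have "\<dots> = z * (d * cos d / sin d)" by (simp add: d)
    also have "\<dots> \<le> z * 1"
      using d z0 mult_cos_less_sin[of d] sin_gt_zero[of d] by (intro mult_left_mono) (auto simp: divide_simps)
    finally have "0 \<le> 2 * z + - 2 * (d / sin d) * (\<rho> * sinh z)" by simp
    then show ?thesis using chain[OF DERIV_acsq_lt_1] True x0 unfolding d_def by force
  next
    case False
    with x1 have x1: "1 < ?x" by simp
    define \<xi> where "\<xi> = arcosh ?x"
    have \<xi>: "0 < \<xi>" "cosh \<xi> = ?x" using x1 by (auto simp: \<xi>_def)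
    have "cosh \<xi> \<le> 1 * cosh z" unfolding \<xi>(2) using \<rho> by (intro mult_right_mono) auto
    then have "\<xi> \<le> z" using \<xi>(1) z0 cosh_real_nonneg_le_iff[of \<xi> z] by simp
    then have "\<xi> * cosh \<xi> / sinh \<xi> \<le> z * cosh z / sinh z" using \<xi>(1) by (rule mult_coth_mono[rotated])
    then have "(\<xi> / sinh \<xi> * \<rho>) * cosh z \<le> (z / sinh z) * cosh z" by (simp add: \<xi>(2))
    then have "\<xi> / sinh \<xi> * \<rho> \<le> z / sinh z" by (simp only: mult_le_cancel_right_pos cosh_real_pos)
    then have "\<xi> / sinh \<xi> * \<rho> * sinh z \<le> z / sinh z * sinh z" using z0 by (intro mult_right_mono) auto
    then have "\<xi> / sinh \<xi> * \<rho> * sinh z \<le> z" using z0 by simp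
    moreover have "- 2 * (\<xi> / sinh \<xi>) * (\<rho> * sinh z) = - 2 * (\<xi> / sinh \<xi> * \<rho> * sinh z)" by simp
    ultimately have "0 \<le> 2 * z + - 2 * (\<xi> / sinh \<xi>) * (\<rho> * sinh z)" by linarith
    then show ?thesis using chain[OF DERIV_acsq_gt_1[OF x1]] unfolding \<xi>_def by force
  qed
qed

text \<open>As z grows the angle d shrinks, so d / sin d stays below its value at z = 0, and k
  bounds \<rho> times that value. The slack in k cosh y <= 1 - c becomes the quadratic gain.\<close>

lemma action_small:
  assumes \<rho>: "0 < \<rho>" "\<rho> < 1" and y: "0 \<le> y" "\<rho> * cosh y \<le> 1"
    and k: "arccos \<rho> / sin (arccos \<rho>) * \<rho> \<le> k" "k * cosh y \<le> 1 - c"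
  shows "(arccos \<rho>)\<^sup>2 + c * y\<^sup>2 \<le> y\<^sup>2 + acsq (\<rho> * cosh y)"
proof -
  have "0\<^sup>2 + acsq (\<rho> * cosh 0) - c * 0\<^sup>2 \<le> y\<^sup>2 + acsq (\<rho> * cosh y) - c * y\<^sup>2"
  proof (rule nondecreasing_except_point[OF y(1), where z = 0])
    show "continuous_on {0..y} (\<lambda>y. y\<^sup>2 + acsq (\<rho> * cosh y) - c * y\<^sup>2)"
      using \<rho> by (intro continuous_intros continuous_on_acsq_cosh) auto
    fix z assume z: "0 < z" "z < y"
    let ?x = "\<rho> * cosh z"
    have cz: "cosh z < cosh y" using z cosh_real_nonneg_less_iff[of z y] by simp
    then have "?x < \<rho> * cosh y" using \<rho> by simp
    moreover have "\<rho> * 1 \<le> ?x" using cosh_real_ge_1[of z] \<rho> by (intro mult_left_mono) auto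
    ultimately have x: "\<rho> \<le> ?x" "?x < 1" "-1 < ?x" using y \<rho> by linarith+
    define d where "d = arccos ?x"
    have d: "0 < d" "d \<le> arccos \<rho>" "arccos \<rho> < pi"
      using x \<rho> arccos_lt_bounded[of ?x] arccos_lt_bounded[of \<rho>] arccos_le_mono[of ?x \<rho>] by (auto simp: d_def)
    have "0 \<le> arccos \<rho> / sin (arccos \<rho>) * \<rho>"
      using d \<rho> sin_gt_zero[of "arccos \<rho>"] by auto
    then have k0: "0 \<le> k" using k by linarith
    have "d / sin d * (\<rho> * sinh z) \<le> arccos \<rho> / sin (arccos \<rho>) * (\<rho> * sinh z)"
      using div_sin_mono[OF d] z \<rho> by (intro mult_right_mono) auto
    also have "\<dots> \<le> k * sinh z" using mult_right_mono[OF k(1), of "sinh z"] z by (simp add: mult_ac)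
    also have "\<dots> \<le> k * (z * cosh z)" using k0 z by (intro mult_left_mono sinh_le_mult_cosh) auto
    also have "\<dots> \<le> z * (k * cosh y)" using mult_left_mono[OF mult_left_mono[of "cosh z" "cosh y" k], of z] k0 z cz by (simp add: mult.left_commute)
    also have "\<dots> \<le> z * (1 - c)" using k z by (intro mult_left_mono) auto
    finally have A: "d / sin d * (\<rho> * sinh z) \<le> z * (1 - c)" .
    have e: "2 * z + - 2 * (d / sin d) * (\<rho> * sinh z) - c * (2 * z) = 2 * (z * (1 - c) - d / sin d * (\<rho> * sinh z))"
      by (simp add: algebra_simps)
    have "0 \<le> 2 * z + - 2 * (d / sin d) * (\<rho> * sinh z) - c * (2 * z)" unfolding e using A by simp
    moreover have "((\<lambda>y. acsq (\<rho> * cosh y)) has_real_derivative - 2 * (d / sin d) * (\<rho> * sinh z)) (at z)"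
      unfolding d_def using x \<rho> by (intro DERIV_chain2[where g = "\<lambda>y. \<rho> * cosh y", OF DERIV_acsq_lt_1]) (auto intro!: derivative_eq_intros)
    then have "((\<lambda>y. y\<^sup>2 + acsq (\<rho> * cosh y) - c * y\<^sup>2) has_real_derivative 2 * z + - 2 * (d / sin d) * (\<rho> * sinh z) - c * (2 * z)) (at z)"
      by (auto intro!: derivative_eq_intros)
    ultimately show "\<exists>D. ((\<lambda>y. y\<^sup>2 + acsq (\<rho> * cosh y) - c * y\<^sup>2) has_real_derivative D) (at z) \<and> 0 \<le> D" by blast
  qed
  then show ?thesis using \<rho> by (simp add: acsq_def)
qed

text \<open>Because \<rho> cosh y <= exp (-l) cosh y <= cosh (y - l), \<open>acsq\<close> costs at
  most (y - l)^2; against y^2 a gain linear in y remains.\<close>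

lemma acsq_exp_cosh_ge:
  assumes "0 \<le> \<rho>" "\<rho> \<le> exp (- l)" "0 \<le> l" "l \<le> y"
  shows "- (y - l)\<^sup>2 \<le> acsq (\<rho> * cosh y)"
proof (cases "\<rho> * cosh y \<le> 1")
  case True
  have "- (y - l)\<^sup>2 \<le> 0" "0 \<le> (arccos (\<rho> * cosh y))\<^sup>2" by simp_all
  then have "- (y - l)\<^sup>2 \<le> (arccos (\<rho> * cosh y))\<^sup>2" by linarith
  then show ?thesis using True by (simp add: acsq_def)
next
  case False
  then have x: "1 \<le> \<rho> * cosh y" by simp
  have "\<rho> * cosh y \<le> exp (- l) * cosh y" using assms by (intro mult_right_mono) auto
  also have "exp (- l) = cosh l - sinh l" by (simp add: cosh_minus_sinh)
  also have "(cosh l - sinh l) * cosh y \<le> cosh y * cosh l - sinh y * sinh l"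
    using sinh_le_cosh_real[of y] mult_left_mono[of "sinh y" "cosh y" "sinh l"] assms by (simp add: algebra_simps)
  also have "\<dots> = cosh (y - l)" by (simp add: cosh_diff)
  finally have "cosh (arcosh (\<rho> * cosh y)) \<le> cosh (y - l)" using x by simp
  then have "arcosh (\<rho> * cosh y) \<le> y - l"
    using x assms by (subst (asm) cosh_real_nonneg_le_iff) auto
  then have "(arcosh (\<rho> * cosh y))\<^sup>2 \<le> (y - l)\<^sup>2" using x by (intro power_mono) auto
  then show ?thesis using False by (simp add: acsq_def)
qed

text \<open>
  The phase of the Laplace integral has its unique minimum at \<open>y = 0\<close>, uniformly for \<open>\<rho>\<close> bounded away
  from \<open>1\<close>: it is quadratic near \<open>0\<close>, monotone, and of linear growth at infinity.
\<close>

lemma action_lower_bound: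
  assumes b: "0 < b" "b < 1" and k: "0 \<le> k" "k < 1"
  shows "\<exists>c>0. \<forall>\<rho> y. 0 < \<rho> \<longrightarrow> \<rho> \<le> b \<longrightarrow> arccos \<rho> / sin (arccos \<rho>) * \<rho> \<le> k \<longrightarrow> 0 \<le> y
    \<longrightarrow> (arccos \<rho>)\<^sup>2 + c * min (y\<^sup>2) y \<le> y\<^sup>2 + acsq (\<rho> * cosh y)"
proof -
  \<comment> \<open>Half of the margin 1 - k becomes the quadratic gain, the other half pays for
    cosh y1 > 1.\<close>
  define c1 where "c1 = (1 - k) / 2"
  have c1: "0 < c1" using k by (simp add: c1_def)
  have "((\<lambda>y. b * cosh y) \<longlongrightarrow> b * cosh 0) (at_right 0)" "((\<lambda>y. k * cosh y) \<longlongrightarrow> k * cosh 0) (at_right (0::real))"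
    by (intro tendsto_intros)+
  moreover have "b * cosh 0 < 1" "k * cosh 0 < 1 - c1" using b k by (simp_all add: c1_def field_simps)
  ultimately have "\<forall>\<^sub>F y in at_right 0. b * cosh y < 1" "\<forall>\<^sub>F y in at_right 0. k * cosh y < 1 - c1"
    by (blast dest: order_tendstoD(2))+
  moreover have "\<forall>\<^sub>F y::real in at_right 0. 0 < y" by (rule eventually_at_right_less)
  ultimately have "\<forall>\<^sub>F y in at_right 0. 0 < y \<and> b * cosh y < 1 \<and> k * cosh y < 1 - c1"
    by eventually_elim auto
  then obtain y1 where y1: "0 < y1" "b * cosh y1 < 1" "k * cosh y1 < 1 - c1"
    using eventually_happens'[of "at_right (0::real)"] by auto
  define l where "l = - ln b"
  have l: "0 < l" "exp (- l) = b" using b by (auto simp: l_def)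
  \<comment> \<open>From Y on, half of the linear gain 2 l y covers (pi / 2)^2 + l^2.\<close>
  define Y where "Y = max y1 (((pi / 2)\<^sup>2 + l\<^sup>2) / l)"
  have Y0: "0 < Y" using y1 by (simp add: Y_def)
  \<comment> \<open>One constant for three ranges: quadratic gain up to y1, the gain at y1 kept by
    monotonicity up to Y, linear gain afterwards.\<close>
  define c where "c = min c1 (min (c1 * y1\<^sup>2 / Y) l)"
  have c: "0 < c" "c \<le> c1" "c \<le> c1 * y1\<^sup>2 / Y" "c \<le> l" using c1 y1 Y0 l by (auto simp: c_def)
  show ?thesis
  proof (intro exI[of _ c] conjI allI impI c)
    fix \<rho> y assume \<rho>: "0 < \<rho>" "\<rho> \<le> b" and k': "arccos \<rho> / sin (arccos \<rho>) * \<rho> \<le> k" and y: "0 \<le> (y::real)"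
    have small: "(arccos \<rho>)\<^sup>2 + c1 * z\<^sup>2 \<le> z\<^sup>2 + acsq (\<rho> * cosh z)" if z: "0 \<le> z" "z \<le> y1" for z
    proof (rule action_small[OF \<rho>(1) _ z(1) _ k'])
      have cz: "cosh z \<le> cosh y1" using z by (simp add: cosh_real_nonneg_le_iff)
      show "\<rho> < 1" using \<rho> b by simp
      have "\<rho> * cosh z \<le> b * cosh y1" using \<rho> b cz by (intro mult_mono) auto
      then show "\<rho> * cosh z \<le> 1" using y1 by simp
      have "k * cosh z \<le> k * cosh y1" using k cz by (intro mult_left_mono) auto
      then show "k * cosh z \<le> 1 - c1" using y1 by simp
    qed
    have min: "min (y\<^sup>2) y \<le> y\<^sup>2" "min (y\<^sup>2) y \<le> y" "0 \<le> min (y\<^sup>2) y" using y by auto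
    consider "y \<le> y1" | "y1 \<le> y" "y \<le> Y" | "Y \<le> y" by linarith
    then show "(arccos \<rho>)\<^sup>2 + c * min (y\<^sup>2) y \<le> y\<^sup>2 + acsq (\<rho> * cosh y)"
    proof cases
      case 1
      have "c * min (y\<^sup>2) y \<le> c1 * y\<^sup>2" using min c by (intro mult_mono) auto
      then show ?thesis using small[OF y 1] by simp
    next
      case 2
      have "c * min (y\<^sup>2) y \<le> c1 * y1\<^sup>2 / Y * Y" using min c 2 by (intro mult_mono) auto
      then have "(arccos \<rho>)\<^sup>2 + c * min (y\<^sup>2) y \<le> y1\<^sup>2 + acsq (\<rho> * cosh y1)"
        using small[of y1] y1 Y0 by simp
      also have "\<dots> \<le> y\<^sup>2 + acsq (\<rho> * cosh y)" using \<rho> b y1 2 by (intro action_mono) auto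
      finally show ?thesis .
    next
      case 3
      have "((pi / 2)\<^sup>2 + l\<^sup>2) / l \<le> y" using 3 by (simp add: Y_def)
      then have yl: "(pi / 2)\<^sup>2 + l\<^sup>2 \<le> l * y" using l by (simp add: field_simps)
      have "l\<^sup>2 \<le> l * y" using yl by (rule order_trans[rotated]) simp
      then have ly: "l \<le> y" using l by (simp add: power2_eq_square)
      have "(arccos \<rho>)\<^sup>2 \<le> (pi / 2)\<^sup>2"
        using \<rho> b arccos_le_pi2[of \<rho>] arccos_lbound[of \<rho>] by (intro power_mono) auto
      moreover have "c * min (y\<^sup>2) y \<le> l * y" using min c l y by (intro mult_mono) auto
      moreover have "- (y - l)\<^sup>2 \<le> acsq (\<rho> * cosh y)" using \<rho> l ly by (intro acsq_exp_cosh_ge) auto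
      moreover have "(y - l)\<^sup>2 = y\<^sup>2 - 2 * (l * y) + l\<^sup>2" by (simp add: power2_eq_square algebra_simps)
      ultimately show ?thesis using yl by linarith
    qed
  qed
qed

section \<open>An integral formula for the heat kernel\<close>

lemma integrable_exp_abs:
  assumes a: "0 < a"
  shows "integrable lborel (\<lambda>y::real. exp (- a * \<bar>y\<bar>))"
proof (rule Bochner_Integration.integrable_bound)
  define m where "m = min 1 (a\<^sup>2 / 2)"
  have m: "0 < m" using a by (simp add: m_def)
  show "integrable lborel (\<lambda>y::real. 1 / m * inverse (1 + y\<^sup>2))"
    using integrable_inverse_1_plus_square unfolding set_integrable_def einterval_eq
    by (intro integrable_mult_right) simp
  show "(\<lambda>y::real. exp (- a * \<bar>y\<bar>)) \<in> borel_measurable lborel" by measurable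
  show "AE y in lborel. norm (exp (- a * \<bar>y\<bar>)) \<le> norm (1 / m * inverse (1 + y\<^sup>2))"
  proof (rule AE_I2)
    fix y :: real
    have "m * y\<^sup>2 \<le> a\<^sup>2 / 2 * y\<^sup>2" by (intro mult_right_mono) (auto simp: m_def)
    moreover have "m \<le> 1" by (simp add: m_def)
    moreover have "1 + a * \<bar>y\<bar> + (a * \<bar>y\<bar>)\<^sup>2 / 2 \<le> exp (a * \<bar>y\<bar>)"
      using a by (intro exp_lower_Taylor_quadratic) auto
    moreover have "0 \<le> a * \<bar>y\<bar>" using a by simp
    ultimately have "m * (1 + y\<^sup>2) \<le> exp (a * \<bar>y\<bar>)" by (simp add: power_mult_distrib algebra_simps)
    moreover have "0 < m * (1 + y\<^sup>2)" using m by (simp add: add_pos_nonneg)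
    ultimately have "inverse (exp (a * \<bar>y\<bar>)) \<le> inverse (m * (1 + y\<^sup>2))" by (rule le_imp_inverse_le)
    then show "norm (exp (- a * \<bar>y\<bar>)) \<le> norm (1 / m * inverse (1 + y\<^sup>2))"
      using m by (simp add: exp_minus divide_inverse)
  qed
qed

text \<open>For large |y| theta grows like exp ((|y| - l)^2 / (4 t)), where exp (-l) lies strictly
  between \<rho> and 1. Against exp (- y^2 / (4 t)) this leaves exp (- l |y| / (2 t)), which
  outweighs y sinh y only for small t.\<close>

lemma thetad_series_gauss_bound:
  assumes \<rho>: "0 < \<rho>" "\<rho> < 1" and N: "N \<noteq> 0"
  shows "\<exists>t0>0. \<forall>t. 0 < t \<longrightarrow> t < t0 \<longrightarrow> (\<exists>C. \<forall>y. normal_density 0 (sqrt (2 * t)) y * \<bar>y * sinh y\<bar> *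
     (\<Sum>k. \<bar>cw k * exp (- (real k)\<^sup>2 * t) * poly ((pderiv ^^ N) (cheb k)) (\<rho> * cosh y)\<bar>) \<le> C * exp (- \<bar>y\<bar>))"
proof -
  \<comment> \<open>Half of the gap between \<rho> and 1 is reserved for the shift of the argument
    that N derivatives cost.\<close>
  define \<eta> where "\<eta> = (1 - \<rho>) / 2"
  define l where "l = - ln (\<rho> + \<eta>)"
  define M where "M = max l (arcosh (1 + \<eta>))"
  define h where "h = \<eta> / real N"
  have \<eta>: "0 < \<eta>" "\<rho> + \<eta> < 1" using \<rho> by (auto simp: \<eta>_def field_simps)
  have l: "0 < l" "exp (- l) = \<rho> + \<eta>" using \<rho> \<eta> by (auto simp: l_def)
  have h: "0 < h" "real N * h = \<eta>" using \<eta> N by (auto simp: h_def)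
  have M: "l \<le> M" "0 \<le> M" using l by (auto simp: M_def)
  have cM: "1 + \<eta> \<le> cosh M"
  proof -
    have "cosh (arcosh (1 + \<eta>)) \<le> cosh M"
      using \<eta> M by (subst cosh_real_nonneg_le_iff) (auto simp: M_def)
    then show ?thesis using \<eta> by simp
  qed
  define \<xi> where "\<xi> y = max M (\<bar>y\<bar> - l)" for y
  have arg: "max 1 \<bar>\<rho> * cosh y\<bar> + real N * h \<le> cosh (\<xi> y)" for y
  proof -
    have 1: "1 + \<eta> \<le> cosh (\<xi> y)"
    proof -
      have "cosh M \<le> cosh (\<xi> y)" using M by (subst cosh_real_nonneg_le_iff) (auto simp: \<xi>_def)
      then show ?thesis using cM by simp
    qed
    have "\<rho> * cosh y + \<eta> * 1 \<le> \<rho> * cosh y + \<eta> * cosh y"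
      using \<eta> cosh_real_ge_1[of y] by (intro add_left_mono mult_left_mono) auto
    also have "\<dots> = exp (- l) * cosh \<bar>y\<bar>" unfolding l(2) by (simp add: distrib_right)
    also have "exp (- l) = cosh l - sinh l" by (simp add: cosh_minus_sinh)
    also have "(cosh l - sinh l) * cosh \<bar>y\<bar> \<le> cosh \<bar>y\<bar> * cosh l - sinh \<bar>y\<bar> * sinh l"
      using sinh_le_cosh_real[of "\<bar>y\<bar>"] mult_left_mono[of "sinh \<bar>y\<bar>" "cosh \<bar>y\<bar>" "sinh l"] l by (simp add: algebra_simps)
    also have "\<dots> = cosh \<bar>\<bar>y\<bar> - l\<bar>" by (simp add: cosh_diff)
    also have "\<dots> \<le> cosh (\<xi> y)"
      using M by (subst cosh_real_nonneg_le_iff) (auto simp: \<xi>_def)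
    finally have 2: "\<rho> * cosh y + \<eta> \<le> cosh (\<xi> y)" by simp
    have "0 \<le> \<rho> * cosh y" using \<rho> by simp
    then show ?thesis using 1 2 h by (auto simp: max_def)
  qed
  show ?thesis
  \<comment> \<open>For t < l / 6 the decay rate l / (2 t) exceeds 3: two units absorb exp (2 |y|)
    and one remains.\<close>
  proof (rule exI[of _ "min 1 (l / 6)"], intro conjI allI impI)
    show "0 < min 1 (l / 6)" using l by simp
    fix t :: real assume t: "0 < t" "t < min 1 (l / 6)"
    let ?S = "\<lambda>y. \<Sum>k. \<bar>cw k * exp (- (real k)\<^sup>2 * t) * poly ((pderiv ^^ N) (cheb k)) (\<rho> * cosh y)\<bar>"
    define A where "A = 12 / (sqrt (t / pi) * h ^ N)"
    have A0: "0 \<le> A" using t h by (simp add: A_def)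
    have S: "?S y \<le> A * (exp (M\<^sup>2 / (4 * t)) + exp ((\<bar>y\<bar> - l)\<^sup>2 / (4 * t)))" for y
    proof -
      have \<xi>0: "0 \<le> \<xi> y" using M by (auto simp: \<xi>_def)
      have "?S y \<le> thetad 0 t (max 1 \<bar>\<rho> * cosh y\<bar> + real N * h) / h ^ N"
        using t h by (intro thetad_abs_le) auto
      also have "thetad 0 t (max 1 \<bar>\<rho> * cosh y\<bar> + real N * h) \<le> thetad 0 t (cosh (\<xi> y))"
      proof (rule thetad_mono[OF t(1) _ arg])
        show "-1 \<le> max 1 \<bar>\<rho> * cosh y\<bar> + real N * h" using h(2) \<eta>(1) max.cobounded1[of 1 "\<bar>\<rho> * cosh y\<bar>"] by linarith
      qed
      also have "\<dots> = ntheta t (cosh (\<xi> y)) / sqrt (t / pi)" using t by (simp add: ntheta_def)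
      also have "ntheta t (cosh (\<xi> y)) \<le> 12 * exp ((\<xi> y)\<^sup>2 / (4 * t))" using t \<xi>0 by (intro ntheta_cosh_le) auto
      also have "exp ((\<xi> y)\<^sup>2 / (4 * t)) \<le> exp (M\<^sup>2 / (4 * t)) + exp ((\<bar>y\<bar> - l)\<^sup>2 / (4 * t))"
        by (simp add: \<xi>_def max_def)
      finally show ?thesis using t h by (simp add: A_def divide_right_mono)
    qed
    show "\<exists>C. \<forall>y. normal_density 0 (sqrt (2 * t)) y * \<bar>y * sinh y\<bar> * ?S y \<le> C * exp (- \<bar>y\<bar>)"
    proof (intro exI allI)
      fix y :: real
      define B where "B = 1 / sqrt (4 * pi * t)"
      have nd: "normal_density 0 (sqrt (2 * t)) y = B * exp (- y\<^sup>2 / (4 * t))"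
        using t by (simp add: normal_density_def B_def)
      have B0: "0 \<le> B" using t by (simp add: B_def)
      have "exp y \<le> exp \<bar>y\<bar>" "exp (- y) \<le> exp \<bar>y\<bar>" "0 < exp y" "0 < exp (- y)" by simp_all
      then have "\<bar>exp y - exp (- y)\<bar> \<le> 2 * exp \<bar>y\<bar>" by linarith
      then have "\<bar>sinh y\<bar> \<le> exp \<bar>y\<bar>" by (simp add: sinh_field_def)
      moreover have "\<bar>y\<bar> \<le> exp \<bar>y\<bar>" using exp_ge_add_one_self[of "\<bar>y\<bar>"] by linarith
      ultimately have ys: "\<bar>y * sinh y\<bar> \<le> exp (2 * \<bar>y\<bar>)"
        unfolding abs_mult mult_2 exp_add by (intro mult_mono) auto
      have "normal_density 0 (sqrt (2 * t)) y * \<bar>y * sinh y\<bar> * ?S y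
        \<le> B * exp (- y\<^sup>2 / (4 * t)) * exp (2 * \<bar>y\<bar>) * (A * (exp (M\<^sup>2 / (4 * t)) + exp ((\<bar>y\<bar> - l)\<^sup>2 / (4 * t))))"
        unfolding nd using B0 t by (intro mult_mono ys S order_refl mult_nonneg_nonneg suminf_nonneg summable_thetad) auto
      also have "\<dots> = B * A * (exp (- y\<^sup>2 / (4 * t) + 2 * \<bar>y\<bar> + M\<^sup>2 / (4 * t)) + exp (- y\<^sup>2 / (4 * t) + 2 * \<bar>y\<bar> + (\<bar>y\<bar> - l)\<^sup>2 / (4 * t)))"
        unfolding exp_add by (simp add: algebra_simps)
      also have "\<dots> \<le> B * A * (exp (9 * t + M\<^sup>2 / (4 * t) + - \<bar>y\<bar>) + exp (l\<^sup>2 / (4 * t) + - \<bar>y\<bar>))"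
      proof (intro mult_left_mono add_mono)
        have "0 \<le> (\<bar>y\<bar> - 6 * t)\<^sup>2 / (4 * t)" using t by simp
        also have "\<dots> = y\<^sup>2 / (4 * t) - 3 * \<bar>y\<bar> + 9 * t" using t by (simp add: power2_eq_square field_simps)
        finally show "exp (- y\<^sup>2 / (4 * t) + 2 * \<bar>y\<bar> + M\<^sup>2 / (4 * t)) \<le> exp (9 * t + M\<^sup>2 / (4 * t) + - \<bar>y\<bar>)" by simp
        have "- y\<^sup>2 / (4 * t) + (\<bar>y\<bar> - l)\<^sup>2 / (4 * t) = l\<^sup>2 / (4 * t) - l / (2 * t) * \<bar>y\<bar>"
          using t by (simp add: power2_eq_square field_simps)
        moreover have "3 * \<bar>y\<bar> \<le> l / (2 * t) * \<bar>y\<bar>" using t by (intro mult_right_mono) (auto simp: field_simps)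
        ultimately show "exp (- y\<^sup>2 / (4 * t) + 2 * \<bar>y\<bar> + (\<bar>y\<bar> - l)\<^sup>2 / (4 * t)) \<le> exp (l\<^sup>2 / (4 * t) + - \<bar>y\<bar>)"
          unfolding exp_le_cancel_iff by linarith
      qed (use A0 B0 in auto)
      also have "\<dots> = B * A * (exp (9 * t + M\<^sup>2 / (4 * t)) + exp (l\<^sup>2 / (4 * t))) * exp (- \<bar>y\<bar>)"
        unfolding exp_add by (simp add: algebra_simps)
      finally show "normal_density 0 (sqrt (2 * t)) y * \<bar>y * sinh y\<bar> * ?S y
        \<le> 1 / sqrt (4 * pi * t) * A * (exp (9 * t + M\<^sup>2 / (4 * t)) + exp (l\<^sup>2 / (4 * t))) * exp (- \<bar>y\<bar>)"
        unfolding B_def .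
    qed
  qed
qed

lemma cbin_eq_0: "J < k \<Longrightarrow> cbin J k = 0"
  by (simp add: cbin_def)

text \<open>The same partial sums are evaluated in two ways: on the sphere the approximate identity
  sends them to the value of the kernel at w, and as integrals in y they converge by domination.
  Equality of the limits is the formula.\<close>

lemma (in sub_heat) heat_kernel_integral:
  fixes p :: "real \<Rightarrow> 'n hvec \<Rightarrow> real" and w :: "'n hvec"
  assumes p: "\<And>t. 0 < t \<Longrightarrow> continuous_on S (p t)"
    "\<And>t f. 0 < t \<Longrightarrow> continuous_on S f \<Longrightarrow> P t f north_pole = (\<integral>q. p t q * f q \<partial>sphere_vol)"
    and w: "norm w = 1" and N: "N = 2 * CARD('n) + 1"
    and \<rho>: "north_pole \<bullet> w = \<rho>" "qnorm2 w north_pole = \<rho>\<^sup>2" "0 < \<rho>" "\<rho> < 1"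
  shows "\<exists>t0>0. \<forall>t. 0 < t \<longrightarrow> t < t0 \<longrightarrow>
    has_bochner_integral lborel (\<lambda>y. normal_density 0 (sqrt (2 * t)) y * (y * sinh y) * thetad N t (\<rho> * cosh y))
      (2 * t * exp ((1 - (real N)\<^sup>2) * t) * (2 ^ N * fact N * sphere_moment w 0 * p t w))"
proof -
  have N0: "N \<noteq> 0" using N by simp
  obtain t0 where t0: "0 < t0" "\<And>t. 0 < t \<Longrightarrow> t < t0 \<Longrightarrow> \<exists>C. \<forall>y. normal_density 0 (sqrt (2 * t)) y * \<bar>y * sinh y\<bar> *
     (\<Sum>k. \<bar>cw k * exp (- (real k)\<^sup>2 * t) * poly ((pderiv ^^ N) (cheb k)) (\<rho> * cosh y)\<bar>) \<le> C * exp (- \<bar>y\<bar>)"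
    using thetad_series_gauss_bound[OF \<rho>(3,4) N0] by blast
  show ?thesis
  proof (intro exI[of _ t0] conjI allI impI t0)
    fix t assume t: "0 < t" "t < t0"
    obtain C where C: "\<And>y. normal_density 0 (sqrt (2 * t)) y * \<bar>y * sinh y\<bar> *
      (\<Sum>k. \<bar>cw k * exp (- (real k)\<^sup>2 * t) * poly ((pderiv ^^ N) (cheb k)) (\<rho> * cosh y)\<bar>) \<le> C * exp (- \<bar>y\<bar>)"
      using t0(2)[OF t] by blast
    let ?p = "\<lambda>k. (pderiv ^^ N) (cheb k)"
    let ?c = "\<lambda>J k. cbin J k / cbin J 0"
    let ?nd = "\<lambda>y. normal_density 0 (sqrt (2 * t)) y * (y * sinh y)"
    let ?a = "\<lambda>k y. exp (- (real k)\<^sup>2 * t) * poly (?p k) (\<rho> * cosh y)"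
    let ?K = "2 * t * exp ((1 - (real N)\<^sup>2) * t)"
    define s where "s J y = ?nd y * (\<Sum>k\<le>J. cw k * ?c J k * ?a k y)" for J y
    have hb: "has_bochner_integral lborel (s J) (?K * (\<Sum>k\<le>J. cw k * ?c J k * (\<integral>q. p t q * poly (?p k) (q \<bullet> w) \<partial>sphere_vol)))" for J
    proof -
      have "has_bochner_integral lborel (\<lambda>y. \<Sum>k\<le>J. cw k * ?c J k * (?nd y * ?a k y))
        (\<Sum>k\<le>J. cw k * ?c J k * (?K * P t (\<lambda>x. poly (?p k) (x \<bullet> w)) north_pole))"
        by (intro has_bochner_integral_sum has_bochner_integral_mult_right P_cheb_derivative_integral w N t \<rho>)
      moreover have "P t (\<lambda>x. poly (?p k) (x \<bullet> w)) north_pole = (\<integral>q. p t q * poly (?p k) (q \<bullet> w) \<partial>sphere_vol)" for k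
      proof (rule p(2)[OF t(1)])
        show "continuous_on S (\<lambda>x. poly (?p k) (x \<bullet> w))"
          by (intro continuous_on_poly continuous_on_inner continuous_on_id continuous_on_const)
      qed
      moreover have "(\<lambda>y. \<Sum>k\<le>J. cw k * ?c J k * (?nd y * ?a k y)) = s J"
        unfolding s_def sum_distrib_left by (intro ext sum.cong refl) (simp only: mult_ac)
      ultimately show ?thesis by (simp only: sum_distrib_left mult.left_commute)
    qed
    have c01: "0 \<le> ?c J k" "?c J k \<le> 1" "(\<lambda>J. ?c J k) \<longlonglongrightarrow> 1" for J k
      by (rule cbin_ratio_nonneg cbin_ratio_le cbin_ratio_tendsto)+
    have lim: "(\<lambda>J. s J y) \<longlonglongrightarrow> ?nd y * thetad N t (\<rho> * cosh y)" for y
      unfolding s_def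
      by (intro tendsto_mult tendsto_const thetad_multiplier_tendsto[OF t(1)] c01) (simp add: cbin_eq_0)
    have meas: "s J \<in> borel_measurable lborel" for J
      using hb[of J, THEN integrable.intros] by (rule borel_measurable_integrable)
    have bound: "norm (s J y) \<le> C * exp (- \<bar>y\<bar>)" for J y
    proof -
      have "\<bar>\<Sum>k\<le>J. cw k * ?c J k * ?a k y\<bar> \<le> (\<Sum>k\<le>J. \<bar>cw k * exp (- (real k)\<^sup>2 * t) * poly (?p k) (\<rho> * cosh y)\<bar>)"
      proof (rule order_trans[OF sum_abs sum_mono])
        fix k
        have "\<bar>cw k * ?c J k * ?a k y\<bar> = ?c J k * \<bar>cw k * exp (- (real k)\<^sup>2 * t) * poly (?p k) (\<rho> * cosh y)\<bar>"
          using c01(1)[of J k] by (simp only: abs_mult abs_of_nonneg mult_ac)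
        also have "\<dots> \<le> 1 * \<bar>cw k * exp (- (real k)\<^sup>2 * t) * poly (?p k) (\<rho> * cosh y)\<bar>"
          by (intro mult_right_mono c01 abs_ge_zero)
        finally show "\<bar>cw k * ?c J k * ?a k y\<bar> \<le> \<bar>cw k * exp (- (real k)\<^sup>2 * t) * poly (?p k) (\<rho> * cosh y)\<bar>" by simp
      qed
      also have "\<dots> \<le> (\<Sum>k. \<bar>cw k * exp (- (real k)\<^sup>2 * t) * poly (?p k) (\<rho> * cosh y)\<bar>)"
        by (intro sum_le_suminf summable_thetad t) auto
      finally have "norm (s J y) \<le> normal_density 0 (sqrt (2 * t)) y * \<bar>y * sinh y\<bar> * (\<Sum>k. \<bar>cw k * exp (- (real k)\<^sup>2 * t) * poly (?p k) (\<rho> * cosh y)\<bar>)"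
        unfolding s_def real_norm_def abs_mult[of "?nd y"] abs_mult[of "normal_density 0 (sqrt (2 * t)) y"]
        by (simp only: abs_of_nonneg[OF normal_density_nonneg]) (intro mult_left_mono mult_nonneg_nonneg normal_density_nonneg abs_ge_zero)
      then show ?thesis using C[of y] by linarith
    qed
    have intC: "integrable lborel (\<lambda>y::real. C * exp (- \<bar>y\<bar>))"
      using integrable_exp_abs[of 1] by simp
    have measl: "(\<lambda>y. ?nd y * thetad N t (\<rho> * cosh y)) \<in> borel_measurable lborel"
      by (rule borel_measurable_LIMSEQ_real[OF lim meas])
    have AEl: "AE y in lborel. (\<lambda>J. s J y) \<longlonglongrightarrow> ?nd y * thetad N t (\<rho> * cosh y)"
      and AEb: "\<And>J. AE y in lborel. norm (s J y) \<le> C * exp (- \<bar>y\<bar>)"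
      using lim bound by (auto intro: AE_I2)
    note dc = integrable_dominated_convergence[OF measl meas intC AEl AEb]
      integral_dominated_convergence[OF measl meas intC AEl AEb]
    have "(\<lambda>J. integral\<^sup>L lborel (s J)) \<longlonglongrightarrow> ?K * (2 ^ N * fact N * sphere_moment w 0 * p t w)"
      unfolding has_bochner_integral_integral_eq[OF hb]
      by (intro tendsto_mult tendsto_const sphere_approximate_identity w N0 p t) (simp add: N)
    then have "(\<integral>y. ?nd y * thetad N t (\<rho> * cosh y) \<partial>lborel) = ?K * (2 ^ N * fact N * sphere_moment w 0 * p t w)"
      using dc(2) LIMSEQ_unique by blast
    with dc(1) show "has_bochner_integral lborel (\<lambda>y. ?nd y * thetad N t (\<rho> * cosh y)) (?K * (2 ^ N * fact N * sphere_moment w 0 * p t w))"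
      by (simp only: has_bochner_integral_iff)
  qed
qed

section \<open>Asymptotics of the integral\<close>

lemma borel_measurable_thetad [measurable]: "thetad n t \<in> borel_measurable borel"
  unfolding thetad_def[abs_def]
  by (intro borel_measurable_suminf borel_measurable_continuous_onI continuous_on_mult continuous_on_const
      continuous_on_poly continuous_on_id)

lemma borel_measurable_ntheta [measurable]: "ntheta t \<in> borel_measurable borel"
  unfolding ntheta_def[abs_def] by measurable

text \<open>Caratheodory's form of the derivative is used because x t may equal cos r, where a
  difference quotient has no meaning.\<close>

lemma acsq_slope_tendsto:
  assumes r: "0 < r" "r < pi / 2" and x: "(x \<longlongrightarrow> cos r) (at_right 0)" "((\<lambda>t. (x t - cos r) / t) \<longlongrightarrow> m) (at_right 0)"
  shows "((\<lambda>t. (r\<^sup>2 - acsq (x t)) / (4 * t)) \<longlongrightarrow> r / (2 * sin r) * m) (at_right 0)"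
proof -
  have c: "0 < cos r" "cos r < 1" using r cos_gt_zero_pi[of r] cos_monotone_0_pi[of 0 r] by auto
  have a: "acsq (cos r) = r\<^sup>2" using r c by (simp add: acsq_def arccos_cos)
  have "(acsq has_real_derivative - 2 * (arccos (cos r) / sin (arccos (cos r)))) (at (cos r))"
    using c by (intro DERIV_acsq_lt_1) auto
  then obtain g where g: "\<And>z. acsq z - acsq (cos r) = g z * (z - cos r)" "isCont g (cos r)" "g (cos r) = - 2 * (r / sin r)"
    unfolding CARAT_DERIV using r by (auto simp: arccos_cos)
  have "((\<lambda>t. - (g (x t)) / 4 * ((x t - cos r) / t)) \<longlongrightarrow> - (g (cos r)) / 4 * m) (at_right 0)"
    by (intro tendsto_intros isCont_tendsto_compose[OF g(2)] x) simp
  moreover have "- (g (x t)) / 4 * ((x t - cos r) / t) = (r\<^sup>2 - acsq (x t)) / (4 * t)" for t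
  proof -
    have "r\<^sup>2 - acsq (x t) = - (g (x t) * (x t - cos r))" using g(1)[of "x t"] a by simp
    then show ?thesis by simp
  qed
  ultimately show ?thesis by (simp add: g(3))
qed

section \<open>Laplace's method after rescaling by sqrt t\<close>

lemma sinh_sqrt_tendsto: "((\<lambda>t. sinh (sqrt t * c) / sqrt t) \<longlongrightarrow> c) (at_right 0)"
proof -
  have "((\<lambda>h. sinh (h * c)) has_real_derivative c) (at 0)"
    by (auto intro!: derivative_eq_intros)
  then have "((\<lambda>h. sinh (h * c) / h) \<longlongrightarrow> c) (at 0)" by (simp add: DERIV_def)
  moreover have "filterlim sqrt (at 0) (at_right 0)"
    unfolding filterlim_at
  proof
    show "\<forall>\<^sub>F t in at_right 0. sqrt t \<in> UNIV \<and> sqrt t \<noteq> 0"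
      using eventually_at_right_less[of 0] by eventually_elim simp
    show "(sqrt \<longlongrightarrow> 0) (at_right 0)" using tendsto_real_sqrt[OF tendsto_ident_at[of 0 "{0<..}"]] by simp
  qed
  ultimately show ?thesis by (rule filterlim_compose)
qed

lemma cosh_sqrt_slope_tendsto: "((\<lambda>t. (cosh (sqrt t * c) - 1) / t) \<longlongrightarrow> c\<^sup>2 / 2) (at_right 0)"
proof (rule Lim_transform_eventually)
  show "((\<lambda>t. 2 * (sinh (sqrt t * (c / 2)) / sqrt t)\<^sup>2) \<longlongrightarrow> c\<^sup>2 / 2) (at_right 0)"
    using tendsto_mult[OF tendsto_const[of 2] tendsto_power[OF sinh_sqrt_tendsto[of "c / 2"], of 2]]
    by (simp add: power_divide)
  show "\<forall>\<^sub>F t in at_right 0. 2 * (sinh (sqrt t * (c / 2)) / sqrt t)\<^sup>2 = (cosh (sqrt t * c) - 1) / t"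
    using eventually_at_right_less[of 0]
  proof eventually_elim
    case (elim t)
    have "cosh (2 * (sqrt t * (c / 2))) = 1 + 2 * (sinh (sqrt t * (c / 2)))\<^sup>2"
      by (simp only: cosh_double cosh_square_eq)
    then show ?case using elim by (simp add: power_divide)
  qed
qed

lemma has_bochner_integral_square_gauss:
  assumes "0 < a"
  shows "has_bochner_integral lborel (\<lambda>v::real. v\<^sup>2 * exp (- a * v\<^sup>2)) (sqrt (pi / a) / (2 * a))"
proof -
  let ?s = "sqrt (1 / (2 * a))"
  have "has_bochner_integral lborel (\<lambda>x. normal_density 0 ?s x * (x - 0) ^ (2 * 1)) (fact (2 * 1) / ((2 / ?s\<^sup>2) ^ 1 * fact 1))"
    using assms by (intro normal_moment_even) simp
  from has_bochner_integral_mult_right[OF this, of "sqrt (pi / a)"]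
  have "has_bochner_integral lborel (\<lambda>x. sqrt (pi / a) * (normal_density 0 ?s x * x\<^sup>2)) (sqrt (pi / a) * (1 / (2 * a)))"
    using assms by simp
  moreover have "sqrt (pi / a) * (normal_density 0 ?s x * x\<^sup>2) = x\<^sup>2 * exp (- a * x\<^sup>2)" for x
    using assms by (simp add: normal_density_def field_simps)
  ultimately show ?thesis by simp
qed

text \<open>The parameter \<sigma> displaces the argument of theta by t \<sigma> cosh y. The
  denominator cosh y ^ N in \<open>G\<close> makes its N-th differences in \<sigma> comparable to (t
  \<sigma>)^N times the integrand with the N-th derivative. The constant \<beta> is a quarter of the
  modulus of the slope of \<open>acsq\<close> at cos r.\<close>

context
  fixes r \<rho> \<kappa> \<beta> :: real and N :: nat and G :: "real \<Rightarrow> real \<Rightarrow> real \<Rightarrow> real"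
  assumes r: "0 < r" "r < pi / 2" and N: "N \<noteq> 0"
  defines "\<rho> \<equiv> cos r" and "\<kappa> \<equiv> r * cot r" and "\<beta> \<equiv> r / (2 * sin r)"
    and "G \<equiv> \<lambda>t \<sigma> y. exp (- y\<^sup>2 / (4 * t)) * (y * sinh y / cosh y ^ N) * ntheta t ((\<rho> + t * \<sigma>) * cosh y)"
begin

lemma colatitude_facts: "0 < \<rho>" "\<rho> < 1" "0 < sin r" "0 < \<kappa>" "\<kappa> < 1" "arccos \<rho> = r" "0 < \<beta>"
proof -
  show *: "0 < \<rho>" "\<rho> < 1" "0 < sin r"
    using r cos_gt_zero_pi[of r] cos_monotone_0_pi[of 0 r] sin_gt_zero[of r] by (auto simp: \<rho>_def)
  show "0 < \<kappa>" "0 < \<beta>" using * r by (auto simp: \<kappa>_def \<beta>_def cot_def \<rho>_def)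
  show "\<kappa> < 1" using * r mult_cos_less_sin[of r] by (simp add: \<kappa>_def cot_def)
  show "arccos \<rho> = r" using r by (simp add: \<rho>_def arccos_cos)
qed

text \<open>Substitution y = sqrt t v. The factor 1 / t compensates y sinh y, the exponential
  compensates the principal term at y = 0.\<close>

definition scaled_integrand :: "real \<Rightarrow> real \<Rightarrow> real \<Rightarrow> real" where
  "scaled_integrand \<sigma> t v = exp (r\<^sup>2 / (4 * t)) * G t \<sigma> (sqrt t * v) / t"

lemma shifted_cosh_tendsto:
  "((\<lambda>t. (\<rho> + t * \<sigma>) * cosh (sqrt t * v)) \<longlongrightarrow> \<rho>) (at_right 0)"
  "((\<lambda>t. ((\<rho> + t * \<sigma>) * cosh (sqrt t * v) - \<rho>) / t) \<longlongrightarrow> \<sigma> + \<rho> * (v\<^sup>2 / 2)) (at_right 0)"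
proof -
  have ch: "((\<lambda>t. cosh (sqrt t * v)) \<longlongrightarrow> 1) (at_right 0)"
    using tendsto_cosh[OF tendsto_mult[OF tendsto_real_sqrt[OF tendsto_ident_at[of 0 "{0<..}"]] tendsto_const[of v]]] by simp
  show "((\<lambda>t. (\<rho> + t * \<sigma>) * cosh (sqrt t * v)) \<longlongrightarrow> \<rho>) (at_right 0)"
    using tendsto_mult[OF tendsto_add[OF tendsto_const[of \<rho>] tendsto_mult[OF tendsto_ident_at[of 0 "{0<..}"] tendsto_const[of \<sigma>]]] ch] by simp
  show "((\<lambda>t. ((\<rho> + t * \<sigma>) * cosh (sqrt t * v) - \<rho>) / t) \<longlongrightarrow> \<sigma> + \<rho> * (v\<^sup>2 / 2)) (at_right 0)"
  proof (rule Lim_transform_eventually)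
    show "((\<lambda>t. \<sigma> * cosh (sqrt t * v) + \<rho> * ((cosh (sqrt t * v) - 1) / t)) \<longlongrightarrow> \<sigma> + \<rho> * (v\<^sup>2 / 2)) (at_right 0)"
      using tendsto_add[OF tendsto_mult[OF tendsto_const[of \<sigma>] ch] tendsto_mult[OF tendsto_const[of \<rho>] cosh_sqrt_slope_tendsto[of v]]] by simp
    show "\<forall>\<^sub>F t in at_right 0. \<sigma> * cosh (sqrt t * v) + \<rho> * ((cosh (sqrt t * v) - 1) / t) = ((\<rho> + t * \<sigma>) * cosh (sqrt t * v) - \<rho>) / t"
      using eventually_at_right_less[of 0] by eventually_elim (simp add: field_simps)
  qed
qed

lemma exponent_tendsto:
  "((\<lambda>t. (r\<^sup>2 - acsq ((\<rho> + t * \<sigma>) * cosh (sqrt t * v))) / (4 * t)) \<longlongrightarrow> \<beta> * (\<sigma> + \<rho> * (v\<^sup>2 / 2))) (at_right 0)"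
  using acsq_slope_tendsto[OF r shifted_cosh_tendsto[unfolded \<rho>_def]] unfolding \<beta>_def \<rho>_def .

text \<open>The limiting exponent is - v^2 / 4 + \<beta> (\<sigma> + \<rho> v^2 / 2), and \<beta>
  \<rho> = \<kappa> / 2 merges the quadratic parts into - (1 - \<kappa>) v^2 / 4. This is a decaying
  Gaussian because r cot r < 1.\<close>

lemma scaled_integrand_tendsto:
  "((\<lambda>t. scaled_integrand \<sigma> t v) \<longlongrightarrow> exp (\<beta> * \<sigma>) * (v\<^sup>2 * exp (- ((1 - \<kappa>) / 4) * v\<^sup>2))) (at_right 0)"
proof -
  let ?x = "\<lambda>t. (\<rho> + t * \<sigma>) * cosh (sqrt t * v)"
  let ?e = "\<lambda>t. exp ((r\<^sup>2 - acsq (?x t)) / (4 * t))"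
  let ?y = "\<lambda>t. exp (- pi\<^sup>2 / (2 * t))"
  have e: "(?e \<longlongrightarrow> exp (\<beta> * (\<sigma> + \<rho> * (v\<^sup>2 / 2)))) (at_right 0)"
    by (intro tendsto_exp exponent_tendsto)
  have y1: "((\<lambda>t. 1 + 2 * (?y t / (1 - ?y t))) \<longlongrightarrow> 1) (at_right 0)"
    by real_asymp
  have "\<forall>\<^sub>F t in at_right 0. 0 < ?x t" "\<forall>\<^sub>F t in at_right 0. ?x t < 1"
    using order_tendstoD[OF shifted_cosh_tendsto(1)] colatitude_facts by auto
  then have ev: "\<forall>\<^sub>F t in at_right 0. ?e t \<le> exp (r\<^sup>2 / (4 * t)) * ntheta t (?x t) \<and>
      exp (r\<^sup>2 / (4 * t)) * ntheta t (?x t) \<le> ?e t * (1 + 2 * (?y t / (1 - ?y t)))"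
    using eventually_at_right_less[of 0]
  proof eventually_elim
    case (elim t)
    let ?d = "arccos (?x t)"
    have d: "0 \<le> ?d" "?d \<le> pi / 2" "cos ?d = ?x t" "acsq (?x t) = ?d\<^sup>2"
      using elim arccos_le_pi2[of "?x t"] arccos_lbound[of "?x t"] by (auto simp: acsq_def)
    have E: "?e t = exp (r\<^sup>2 / (4 * t)) * exp (- ?d\<^sup>2 / (4 * t))"
      unfolding d(4) by (simp add: exp_add[symmetric] diff_divide_distrib)
    have "exp (- ?d\<^sup>2 / (4 * t)) \<le> ntheta t (?x t)"
      "ntheta t (?x t) \<le> exp (- ?d\<^sup>2 / (4 * t)) * (1 + 2 * (?y t / (1 - ?y t)))"
      using ntheta_cos_bounds[OF elim(3) d(1,2)] unfolding d(3) by auto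
    then show ?case unfolding E mult.assoc by (intro conjI mult_left_mono) auto
  qed
  have th: "((\<lambda>t. exp (r\<^sup>2 / (4 * t)) * ntheta t (?x t)) \<longlongrightarrow> exp (\<beta> * (\<sigma> + \<rho> * (v\<^sup>2 / 2)))) (at_right 0)"
  proof (rule tendsto_sandwich[OF _ _ e])
    show "\<forall>\<^sub>F t in at_right 0. ?e t \<le> exp (r\<^sup>2 / (4 * t)) * ntheta t (?x t)"
      using ev by eventually_elim simp
    show "\<forall>\<^sub>F t in at_right 0. exp (r\<^sup>2 / (4 * t)) * ntheta t (?x t) \<le> ?e t * (1 + 2 * (?y t / (1 - ?y t)))"
      using ev by eventually_elim simp
    show "((\<lambda>t. ?e t * (1 + 2 * (?y t / (1 - ?y t)))) \<longlongrightarrow> exp (\<beta> * (\<sigma> + \<rho> * (v\<^sup>2 / 2)))) (at_right 0)"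
      using tendsto_mult[OF e y1] by simp
  qed
  have ch: "((\<lambda>t. cosh (sqrt t * v) ^ N) \<longlongrightarrow> 1) (at_right 0)"
    using tendsto_power[OF tendsto_cosh[OF tendsto_mult[OF tendsto_real_sqrt[OF tendsto_ident_at[of 0 "{0<..}"]] tendsto_const[of v]]], of N] by simp
  have L: "((\<lambda>t. exp (- v\<^sup>2 / 4) * (v * (sinh (sqrt t * v) / sqrt t) / cosh (sqrt t * v) ^ N) * (exp (r\<^sup>2 / (4 * t)) * ntheta t (?x t)))
     \<longlongrightarrow> exp (- v\<^sup>2 / 4) * (v * v / 1) * exp (\<beta> * (\<sigma> + \<rho> * (v\<^sup>2 / 2)))) (at_right 0)"
    by (intro tendsto_mult tendsto_divide tendsto_const sinh_sqrt_tendsto ch th) simp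
  have "exp (- v\<^sup>2 / 4) * (v * v / 1) * exp (\<beta> * (\<sigma> + \<rho> * (v\<^sup>2 / 2))) = exp (\<beta> * \<sigma>) * (v\<^sup>2 * exp (- ((1 - \<kappa>) / 4) * v\<^sup>2))"
  proof -
    have k: "\<beta> * \<rho> = \<kappa> / 2" by (simp add: \<beta>_def \<kappa>_def \<rho>_def cot_def)
    have "\<beta> * (\<sigma> + \<rho> * (v\<^sup>2 / 2)) = \<beta> * \<sigma> + \<beta> * \<rho> * (v\<^sup>2 / 2)" by (simp add: algebra_simps)
    also have "\<dots> = \<beta> * \<sigma> + \<kappa> / 4 * v\<^sup>2" unfolding k by simp
    finally have "- v\<^sup>2 / 4 + \<beta> * (\<sigma> + \<rho> * (v\<^sup>2 / 2)) = \<beta> * \<sigma> + - ((1 - \<kappa>) / 4) * v\<^sup>2"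
      by (simp add: field_simps)
    then have "exp (- v\<^sup>2 / 4) * exp (\<beta> * (\<sigma> + \<rho> * (v\<^sup>2 / 2))) = exp (\<beta> * \<sigma>) * exp (- ((1 - \<kappa>) / 4) * v\<^sup>2)"
      by (simp only: exp_add[symmetric])
    then show ?thesis by (simp add: power2_eq_square)
  qed
  then have L': "((\<lambda>t. exp (- v\<^sup>2 / 4) * (v * (sinh (sqrt t * v) / sqrt t) / cosh (sqrt t * v) ^ N) * (exp (r\<^sup>2 / (4 * t)) * ntheta t (?x t)))
     \<longlongrightarrow> exp (\<beta> * \<sigma>) * (v\<^sup>2 * exp (- ((1 - \<kappa>) / 4) * v\<^sup>2))) (at_right 0)"
    using L by (simp only:)
  show ?thesis
  proof (rule Lim_transform_eventually[OF L'])
    show "\<forall>\<^sub>F t in at_right 0. exp (- v\<^sup>2 / 4) * (v * (sinh (sqrt t * v) / sqrt t) / cosh (sqrt t * v) ^ N) * (exp (r\<^sup>2 / (4 * t)) * ntheta t (?x t)) = scaled_integrand \<sigma> t v"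
      using eventually_at_right_less[of 0]
    proof eventually_elim
      case (elim t)
      have q: "sqrt t / t = 1 / sqrt t" using elim by (simp add: divide_eq_eq eq_divide_eq)
      have "sqrt t * v * sinh (sqrt t * v) / c / t = sqrt t / t * (v * sinh (sqrt t * v) / c)" for c
        by (simp add: divide_inverse mult_ac)
      then have 1: "sqrt t * v * sinh (sqrt t * v) / c / t = v * (sinh (sqrt t * v) / sqrt t) / c" for c
        unfolding q by simp
      have 2: "- (sqrt t * v)\<^sup>2 / (4 * t) = - v\<^sup>2 / 4" using elim by (simp add: power_mult_distrib)
      have "scaled_integrand \<sigma> t v = exp (- (sqrt t * v)\<^sup>2 / (4 * t)) * (sqrt t * v * sinh (sqrt t * v) / cosh (sqrt t * v) ^ N / t)
          * (exp (r\<^sup>2 / (4 * t)) * ntheta t (?x t))"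
        unfolding scaled_integrand_def G_def by simp
      then show ?case unfolding 1 2 by simp
    qed
  qed
qed

text \<open>The phase bound is applied at \<rho> + t \<sigma>, which for small t respects the
  uniform limits b and k. Moving from \<rho> to \<rho> + t \<sigma> changes the phase at y = 0 by
  O(t), hence the integrand by a constant factor only.\<close>

lemma scaled_integrand_bound:
  "\<exists>C a t0. 0 < a \<and> 0 < t0 \<and> (\<forall>t v. 0 < t \<longrightarrow> t < t0 \<longrightarrow> \<bar>scaled_integrand \<sigma> t v\<bar> \<le> C * exp (- a * \<bar>v\<bar>))"
proof -
  define b where "b = (1 + \<rho>) / 2"
  define k where "k = (1 + \<kappa>) / 2"
  have b: "0 < b" "b < 1" "\<rho> < b" using colatitude_facts by (auto simp: b_def field_simps)
  have k: "0 \<le> k" "k < 1" "\<kappa> < k" using colatitude_facts by (auto simp: k_def field_simps)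
  obtain c where c: "0 < c" and act: "\<And>\<rho> y. 0 < \<rho> \<Longrightarrow> \<rho> \<le> b \<Longrightarrow> arccos \<rho> / sin (arccos \<rho>) * \<rho> \<le> k \<Longrightarrow> 0 \<le> y
    \<Longrightarrow> (arccos \<rho>)\<^sup>2 + c * min (y\<^sup>2) y \<le> y\<^sup>2 + acsq (\<rho> * cosh y)"
    using action_lower_bound[OF b(1,2) k(1,2)] by blast
  let ?\<rho> = "\<lambda>t. \<rho> + t * \<sigma>"
  have lim: "(?\<rho> \<longlongrightarrow> \<rho>) (at_right 0)" using shifted_cosh_tendsto(1)[of \<sigma> 0] by simp
  have ac: "((\<lambda>t. arccos (?\<rho> t)) \<longlongrightarrow> r) (at_right 0)"
    using isCont_tendsto_compose[OF isCont_arccos lim] colatitude_facts by simp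
  have kl: "((\<lambda>t. arccos (?\<rho> t) / sin (arccos (?\<rho> t)) * ?\<rho> t) \<longlongrightarrow> r / sin r * \<rho>) (at_right 0)"
    using colatitude_facts by (intro tendsto_mult tendsto_divide tendsto_sin ac lim) auto
  have kk: "r / sin r * \<rho> < k" using k(3) by (simp add: \<kappa>_def cot_def \<rho>_def)
  have ex: "((\<lambda>t. (r\<^sup>2 - acsq (?\<rho> t)) / (4 * t)) \<longlongrightarrow> \<beta> * \<sigma>) (at_right 0)"
    using exponent_tendsto[of \<sigma> 0] by simp
  have "\<forall>\<^sub>F t in at_right 0. 0 < ?\<rho> t \<and> ?\<rho> t < b \<and> arccos (?\<rho> t) / sin (arccos (?\<rho> t)) * ?\<rho> t < k
      \<and> (r\<^sup>2 - acsq (?\<rho> t)) / (4 * t) < \<beta> * \<sigma> + 1"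
    using order_tendstoD(1)[OF lim colatitude_facts(1)] order_tendstoD(2)[OF lim b(3)] order_tendstoD(2)[OF kl kk]
      order_tendstoD(2)[OF ex less_add_one] by eventually_elim auto
  then obtain t1 where t1: "0 < t1" "\<And>t. 0 < t \<Longrightarrow> t < t1 \<Longrightarrow> 0 < ?\<rho> t \<and> ?\<rho> t < b \<and> arccos (?\<rho> t) / sin (arccos (?\<rho> t)) * ?\<rho> t < k
      \<and> (r\<^sup>2 - acsq (?\<rho> t)) / (4 * t) < \<beta> * \<sigma> + 1"
    unfolding eventually_at_right_field by auto
  show ?thesis
  \<comment> \<open>12 comes from \<open>ntheta_le\<close>, the summand c / 4 from replacing |v| by
    |v| - 1 in the phase bound, and 128 / c^2 is the price of absorbing v^2 into half of the decay
    exp (- c |v| / 4).\<close>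
  proof (rule exI[of _ "12 * exp (\<beta> * \<sigma> + 1 + c / 4) * (128 / c\<^sup>2)"], rule exI[of _ "c / 8"], rule exI[of _ "min 1 t1"], intro conjI allI impI)
    show "0 < c / 8" "0 < min 1 t1" using c t1 by auto
    fix t v assume t: "0 < t" "t < min 1 t1"
    note T = t1(2)[of t]
    define s where "s = sqrt t"
    have s: "0 < s" "s \<le> 1" "s * s = t" using t by (auto simp: s_def)
    let ?y = "s * \<bar>v\<bar>"
    have cosh: "cosh (s * v) = cosh ?y" using s by (cases "0 \<le> v") simp_all
    have y0: "0 \<le> ?y" using s by simp
    have x0: "0 \<le> ?\<rho> t * cosh ?y" using T t by simp
    have th: "ntheta t (?\<rho> t * cosh ?y) \<le> 12 * exp (- acsq (?\<rho> t * cosh ?y) / (4 * t))"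
      using t x0 by (intro ntheta_le) auto
    have th0: "0 \<le> ntheta t (?\<rho> t * cosh ?y)" using t x0 by (intro ntheta_nonneg) auto
    have aq: "acsq (?\<rho> t) = (arccos (?\<rho> t))\<^sup>2" using T t b by (simp add: acsq_def)
    have A: "acsq (?\<rho> t) + c * min (?y\<^sup>2) ?y \<le> ?y\<^sup>2 + acsq (?\<rho> t * cosh ?y)"
      unfolding aq using T t y0 by (intro act) auto
    have y2: "?y\<^sup>2 = t * v\<^sup>2" by (simp add: power_mult_distrib power2_eq_square s(3)[symmetric])
    \<comment> \<open>After rescaling, the quadratic and the linear regime of the phase dominate the
      same linear function of |v|, uniformly in t <= 1.\<close>
    have "t * (\<bar>v\<bar> - 1) \<le> min (?y\<^sup>2) ?y"
    proof -
      have "0 \<le> (\<bar>v\<bar> - 1 / 2)\<^sup>2" by simp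
      then have "\<bar>v\<bar> - 1 \<le> v\<^sup>2" by (simp add: power2_eq_square algebra_simps)
      then have "t * (\<bar>v\<bar> - 1) \<le> ?y\<^sup>2" unfolding y2 using t by (intro mult_left_mono) auto
      moreover have "t * (\<bar>v\<bar> - 1) \<le> t * \<bar>v\<bar>" using t by (simp add: algebra_simps)
      moreover have "t \<le> s" using s mult_right_mono[of s 1 s] by simp
      then have "t * \<bar>v\<bar> \<le> ?y" by (intro mult_right_mono) auto
      ultimately show ?thesis by simp
    qed
    then have "c * (t * (\<bar>v\<bar> - 1)) \<le> c * min (?y\<^sup>2) ?y" using c by (intro mult_left_mono) auto
    with A have B: "- (t * v\<^sup>2) - acsq (?\<rho> t * cosh ?y) \<le> - acsq (?\<rho> t) - c * (t * (\<bar>v\<bar> - 1))"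
      unfolding y2 by linarith
    have "r\<^sup>2 / (4 * t) + - v\<^sup>2 / 4 + - acsq (?\<rho> t * cosh ?y) / (4 * t) = (r\<^sup>2 + (- (t * v\<^sup>2) - acsq (?\<rho> t * cosh ?y))) / (4 * t)"
      using t by (simp add: field_simps)
    also have "\<dots> \<le> (r\<^sup>2 + (- acsq (?\<rho> t) - c * (t * (\<bar>v\<bar> - 1)))) / (4 * t)"
      using t B by (intro divide_right_mono add_left_mono) auto
    also have "\<dots> = (r\<^sup>2 - acsq (?\<rho> t)) / (4 * t) + c / 4 - c / 4 * \<bar>v\<bar>"
      using t by (simp add: field_simps)
    also have "\<dots> \<le> \<beta> * \<sigma> + 1 + c / 4 - c / 4 * \<bar>v\<bar>" using T t by simp
    finally have E: "r\<^sup>2 / (4 * t) + - v\<^sup>2 / 4 + - acsq (?\<rho> t * cosh ?y) / (4 * t) \<le> \<beta> * \<sigma> + 1 + c / 4 - c / 4 * \<bar>v\<bar>" .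
    have K: "\<bar>s * v * sinh (s * v) / cosh (s * v) ^ N / t\<bar> \<le> v\<^sup>2"
    proof -
      have c1: "1 \<le> cosh ?y" by (rule cosh_real_ge_1)
      have "\<bar>sinh (s * v)\<bar> = sinh ?y" using s sinh_real_abs[of "s * v"] by (simp add: abs_mult)
      then have "\<bar>s * v * sinh (s * v)\<bar> = ?y * sinh ?y" using s by (simp add: abs_mult)
      also have "\<dots> \<le> ?y * (?y * cosh ?y)" using y0 by (intro mult_left_mono sinh_le_mult_cosh) auto
      also have "\<dots> = t * v\<^sup>2 * cosh ?y ^ 1" using y2 by (simp add: power2_eq_square)
      also have "\<dots> \<le> t * v\<^sup>2 * cosh ?y ^ N" using t c1 N by (intro mult_left_mono power_increasing) auto
      finally have "\<bar>s * v * sinh (s * v)\<bar> / cosh ?y ^ N / t \<le> v\<^sup>2"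
        using t c1 by (simp add: divide_le_eq mult_ac)
      then show ?thesis unfolding cosh using t by (simp add: abs_divide)
    qed
    have v2: "v\<^sup>2 \<le> 128 / c\<^sup>2 * exp (c / 8 * \<bar>v\<bar>)"
    proof -
      have "1 + c / 8 * \<bar>v\<bar> + (c / 8 * \<bar>v\<bar>)\<^sup>2 / 2 \<le> exp (c / 8 * \<bar>v\<bar>)"
        using c by (intro exp_lower_Taylor_quadratic) auto
      moreover have "0 \<le> c / 8 * \<bar>v\<bar>" using c by simp
      ultimately have "(c / 8 * \<bar>v\<bar>)\<^sup>2 / 2 \<le> exp (c / 8 * \<bar>v\<bar>)" by linarith
      then have "c\<^sup>2 / 128 * v\<^sup>2 \<le> exp (c / 8 * \<bar>v\<bar>)" by (simp add: power_mult_distrib power_divide)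
      then show ?thesis using c by (simp add: field_simps)
    qed
    have g: "(s * v)\<^sup>2 / (4 * t) = v\<^sup>2 / 4" using t by (simp add: s_def power_mult_distrib)
    have "scaled_integrand \<sigma> t v = (exp (r\<^sup>2 / (4 * t)) * exp (- v\<^sup>2 / 4)) * (s * v * sinh (s * v) / cosh (s * v) ^ N / t) * ntheta t (?\<rho> t * cosh ?y)"
      unfolding scaled_integrand_def G_def s_def[symmetric] cosh by (simp add: g)
    then have "\<bar>scaled_integrand \<sigma> t v\<bar> = (exp (r\<^sup>2 / (4 * t)) * exp (- v\<^sup>2 / 4)) * \<bar>s * v * sinh (s * v) / cosh (s * v) ^ N / t\<bar> * ntheta t (?\<rho> t * cosh ?y)"
      using th0 by (simp only: abs_mult abs_of_nonneg exp_ge_zero)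
    also have "\<dots> \<le> (exp (r\<^sup>2 / (4 * t)) * exp (- v\<^sup>2 / 4)) * v\<^sup>2 * (12 * exp (- acsq (?\<rho> t * cosh ?y) / (4 * t)))"
      using th0 by (intro mult_mono K th order_refl mult_nonneg_nonneg) auto
    also have "\<dots> = 12 * v\<^sup>2 * exp (r\<^sup>2 / (4 * t) + - v\<^sup>2 / 4 + - acsq (?\<rho> t * cosh ?y) / (4 * t))"
      by (simp only: exp_add mult_ac)
    also have "\<dots> \<le> 12 * (128 / c\<^sup>2 * exp (c / 8 * \<bar>v\<bar>)) * exp (\<beta> * \<sigma> + 1 + c / 4 - c / 4 * \<bar>v\<bar>)"
      using v2 E by (intro mult_mono) auto
    also have "\<dots> = 12 * exp (\<beta> * \<sigma> + 1 + c / 4) * (128 / c\<^sup>2) * exp (- (c / 8) * \<bar>v\<bar>)"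
    proof -
      have "\<beta> * \<sigma> + 1 + c / 4 - c / 4 * \<bar>v\<bar> = (\<beta> * \<sigma> + 1 + c / 4) + - (c / 8) * \<bar>v\<bar> + - (c / 8 * \<bar>v\<bar>)" by simp
      then have "exp (\<beta> * \<sigma> + 1 + c / 4 - c / 4 * \<bar>v\<bar>) = exp (\<beta> * \<sigma> + 1 + c / 4) * exp (- (c / 8) * \<bar>v\<bar>) * exp (- (c / 8 * \<bar>v\<bar>))"
        by (simp only: exp_add)
      then show ?thesis by (simp add: exp_minus)
    qed
    finally show "\<bar>scaled_integrand \<sigma> t v\<bar> \<le> 12 * exp (\<beta> * \<sigma> + 1 + c / 4) * (128 / c\<^sup>2) * exp (- (c / 8) * \<bar>v\<bar>)" .
  qed
qed

text \<open>The power t sqrt t is the t of the rescaled integrand times the sqrt t from dy = sqrt t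
  dv.\<close>

lemma laplace_limit:
  "\<exists>t0>0. \<forall>t. 0 < t \<longrightarrow> t < t0 \<longrightarrow> integrable lborel (G t \<sigma>)"
  "((\<lambda>t. exp (r\<^sup>2 / (4 * t)) / (t * sqrt t) * integral\<^sup>L lborel (G t \<sigma>)) \<longlongrightarrow>
     exp (\<beta> * \<sigma>) * (sqrt (pi / ((1 - \<kappa>) / 4)) / (2 * ((1 - \<kappa>) / 4)))) (at_right 0)"
proof -
  obtain C a t0 where a: "0 < a" and t0: "0 < t0" and bound: "\<And>t v. 0 < t \<Longrightarrow> t < t0 \<Longrightarrow> \<bar>scaled_integrand \<sigma> t v\<bar> \<le> C * exp (- a * \<bar>v\<bar>)"
    using scaled_integrand_bound[of \<sigma>] by blast
  have meas: "scaled_integrand \<sigma> t \<in> borel_measurable lborel" for t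
    unfolding scaled_integrand_def[abs_def] G_def sinh_field_def cosh_field_def by measurable
  have intC: "integrable lborel (\<lambda>v. C * exp (- a * \<bar>v\<bar>))"
    by (intro integrable_mult_right integrable_exp_abs a)
  have int: "integrable lborel (scaled_integrand \<sigma> t)" if "0 < t" "t < t0" for t
    by (rule Bochner_Integration.integrable_bound[OF intC meas])
      (use bound[OF that] in \<open>auto intro: order_trans[OF _ abs_ge_self]\<close>)
  have G: "G t \<sigma> (0 + sqrt t * v) = t * exp (- r\<^sup>2 / (4 * t)) * scaled_integrand \<sigma> t v" if "0 < t" for t v
    using that by (simp add: scaled_integrand_def exp_minus)
  show "\<exists>t0>0. \<forall>t. 0 < t \<longrightarrow> t < t0 \<longrightarrow> integrable lborel (G t \<sigma>)"
  proof (rule exI[of _ t0], intro conjI allI impI t0)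
    fix t assume t: "0 < t" "t < t0"
    have "integrable lborel (\<lambda>v. G t \<sigma> (0 + sqrt t * v))"
      unfolding G[OF t(1)] by (intro integrable_mult_right int t)
    then show "integrable lborel (G t \<sigma>)"
      using t lborel_integrable_real_affine_iff[of "sqrt t" "G t \<sigma>" 0] by simp
  qed
  have lim: "((\<lambda>t. integral\<^sup>L lborel (scaled_integrand \<sigma> t)) \<longlongrightarrow> (\<integral>v. exp (\<beta> * \<sigma>) * (v\<^sup>2 * exp (- ((1 - \<kappa>) / 4) * v\<^sup>2)) \<partial>lborel)) (at_right 0)"
  proof (rule tendsto_at_right_sequentially[OF t0])
    fix S :: "nat \<Rightarrow> real" assume S: "\<And>n. 0 < S n" "\<And>n. S n < t0" "S \<longlonglongrightarrow> 0"
    have fl: "filterlim S (at_right 0) sequentially"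
      using S less_imp_neq[OF S(1)] by (simp add: filterlim_at)
    show "(\<lambda>n. integral\<^sup>L lborel (scaled_integrand \<sigma> (S n))) \<longlonglongrightarrow> (\<integral>v. exp (\<beta> * \<sigma>) * (v\<^sup>2 * exp (- ((1 - \<kappa>) / 4) * v\<^sup>2)) \<partial>lborel)"
    proof (rule integral_dominated_convergence[OF _ meas intC])
      show "(\<lambda>v. exp (\<beta> * \<sigma>) * (v\<^sup>2 * exp (- ((1 - \<kappa>) / 4) * v\<^sup>2))) \<in> borel_measurable lborel" by measurable
      show "AE v in lborel. (\<lambda>n. scaled_integrand \<sigma> (S n) v) \<longlonglongrightarrow> exp (\<beta> * \<sigma>) * (v\<^sup>2 * exp (- ((1 - \<kappa>) / 4) * v\<^sup>2))"
        by (intro AE_I2 filterlim_compose[OF scaled_integrand_tendsto fl])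
      show "AE v in lborel. norm (scaled_integrand \<sigma> (S n) v) \<le> C * exp (- a * \<bar>v\<bar>)" for n
        using bound[OF S(1,2)] by (intro AE_I2) simp
    qed
  qed
  have val: "(\<integral>v. exp (\<beta> * \<sigma>) * (v\<^sup>2 * exp (- ((1 - \<kappa>) / 4) * v\<^sup>2)) \<partial>lborel)
     = exp (\<beta> * \<sigma>) * (sqrt (pi / ((1 - \<kappa>) / 4)) / (2 * ((1 - \<kappa>) / 4)))"
    using colatitude_facts(5) by (intro has_bochner_integral_integral_eq has_bochner_integral_mult_right has_bochner_integral_square_gauss) simp
  show "((\<lambda>t. exp (r\<^sup>2 / (4 * t)) / (t * sqrt t) * integral\<^sup>L lborel (G t \<sigma>)) \<longlongrightarrow>
     exp (\<beta> * \<sigma>) * (sqrt (pi / ((1 - \<kappa>) / 4)) / (2 * ((1 - \<kappa>) / 4)))) (at_right 0)"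
  proof (rule Lim_transform_eventually[OF lim[unfolded val]])
    show "\<forall>\<^sub>F t in at_right 0. integral\<^sup>L lborel (scaled_integrand \<sigma> t) = exp (r\<^sup>2 / (4 * t)) / (t * sqrt t) * integral\<^sup>L lborel (G t \<sigma>)"
      using eventually_at_right_less[of 0]
    proof eventually_elim
      case (elim t)
      have "integral\<^sup>L lborel (G t \<sigma>) = sqrt t * (\<integral>v. G t \<sigma> (0 + sqrt t * v) \<partial>lborel)"
        using lborel_integral_real_affine[of "sqrt t" "G t \<sigma>" 0] elim by simp
      also have "\<dots> = sqrt t * (t * exp (- r\<^sup>2 / (4 * t)) * integral\<^sup>L lborel (scaled_integrand \<sigma> t))"
        unfolding G[OF elim] by simp
      finally show ?case using elim by (simp add: exp_minus)
    qed
  qed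
qed

end

lemma has_bochner_integral_mono:
  fixes f g :: "'a \<Rightarrow> real"
  assumes "has_bochner_integral M f x" "has_bochner_integral M g y" "\<And>z. f z \<le> g z"
  shows "x \<le> y"
  using integral_mono[of M f g] assms unfolding has_bochner_integral_iff by blast

text \<open>
  As all derivatives of \<open>\<Theta>\<close> are nonnegative on \<open>[-1, \<infinity>)\<close>, its \<open>N\<close>-th derivative at \<open>\<rho> cosh y\<close> lies between
  \<open>N\<close>-th difference quotients with step \<open>t \<sigma> cosh y\<close>.  Their limits as \<open>t \<rightarrow> 0\<close> are known, and agree as \<open>\<sigma> \<rightarrow> 0\<close>.
\<close>

lemma theta_derivative_integral_tendsto:
  assumes r: "0 < r" "r < pi / 2" and N: "N \<noteq> 0" and t0: "0 < t0"
    and F: "\<And>t. 0 < t \<Longrightarrow> t < t0 \<Longrightarrow> has_bochner_integral lborel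
      (\<lambda>y. exp (- y\<^sup>2 / (4 * t)) * (y * sinh y) * (sqrt (t / pi) * thetad N t (cos r * cosh y))) (F t)"
  shows "((\<lambda>t. exp (r\<^sup>2 / (4 * t)) / (t * sqrt t) * (t ^ N * F t)) \<longlongrightarrow>
    (r / (2 * sin r)) ^ N * (sqrt (pi / ((1 - r * cot r) / 4)) / (2 * ((1 - r * cot r) / 4)))) (at_right 0)"
proof -
  define \<rho> where "\<rho> = cos r"
  define \<beta> where "\<beta> = r / (2 * sin r)"
  define K where "K = sqrt (pi / ((1 - r * cot r) / 4)) / (2 * ((1 - r * cot r) / 4))"
  define G where "G t \<sigma> y = exp (- y\<^sup>2 / (4 * t)) * (y * sinh y / cosh y ^ N) * ntheta t ((\<rho> + t * \<sigma>) * cosh y)" for t \<sigma> y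
  define e where "e t = exp (r\<^sup>2 / (4 * t)) / (t * sqrt t)" for t
  have lim: "((\<lambda>t. e t * integral\<^sup>L lborel (G t \<sigma>)) \<longlongrightarrow> exp (\<beta> * \<sigma>) * K) (at_right 0)" for \<sigma>
    using laplace_limit(2)[OF r N, of \<sigma>] unfolding e_def G_def[abs_def] \<rho>_def \<beta>_def K_def .
  have "\<exists>t1>0. \<forall>t. 0 < t \<longrightarrow> t < t1 \<longrightarrow> integrable lborel (G t \<sigma>)" for \<sigma>
    using laplace_limit(1)[OF r N, of \<sigma>] unfolding G_def[abs_def] \<rho>_def .
  then have int1: "\<forall>\<^sub>F t in at_right 0. integrable lborel (G t \<sigma>)" for \<sigma>
    unfolding eventually_at_right_field by blast
  have int: "\<forall>\<^sub>F t in at_right 0. \<forall>i\<in>{..N}. integrable lborel (G t (f i))" for f :: "nat \<Rightarrow> real"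
    by (intro eventually_ball_finite finite_atMost ballI int1)
  define U where "U f t = e t * fdiff N (\<lambda>i. integral\<^sup>L lborel (G t (f i)))" for f t
  have U: "(U f \<longlongrightarrow> fdiff N (\<lambda>i. exp (\<beta> * f i) * K)) (at_right 0)" for f
    unfolding U_def[abs_def] fdiff_cmult[symmetric] by (intro tendsto_fdiff lim)
  have \<rho>0: "0 < \<rho>" using r cos_gt_zero_pi[of r] by (simp add: \<rho>_def)
  have ysinh: "0 \<le> y * sinh (y::real)" for y by (simp add: zero_le_mult_iff) linarith
  have factor: "0 \<le> exp (- y\<^sup>2 / (4 * t)) * (y * sinh y / cosh y ^ N) * sqrt (t / pi)" if "0 < t" for t y :: real
    using that by (intro mult_nonneg_nonneg divide_nonneg_nonneg ysinh) auto
  have small: "\<forall>\<^sub>F t in at_right 0. t < c" if "0 < c" for c :: real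
    using that unfolding eventually_at_right_field by blast
  have fint: "has_bochner_integral lborel (\<lambda>y. fdiff N (\<lambda>i. G t (f i) y)) (fdiff N (\<lambda>i. integral\<^sup>L lborel (G t (f i))))"
    if "\<forall>i\<in>{..N}. integrable lborel (G t (f i))" for t f
    using that by (intro has_bochner_integral_fdiff has_bochner_integral_integrable) auto
  have fG: "fdiff N (\<lambda>i. G t (f i) y) = exp (- y\<^sup>2 / (4 * t)) * (y * sinh y / cosh y ^ N) * sqrt (t / pi)
      * fdiff N (\<lambda>i. thetad 0 t ((\<rho> + t * f i) * cosh y))" for t f y
    unfolding G_def ntheta_def mult.assoc[symmetric] by (rule fdiff_cmult)
  \<comment> \<open>The denominator cosh y ^ N cancels the dependence of the step on y.\<close>
  have cancel: "exp (- y\<^sup>2 / (4 * t)) * (y * sinh y / cosh y ^ N) * sqrt (t / pi) * ((t * \<sigma> * cosh y) ^ N * thetad N t (\<rho> * cosh y))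
      = (t * \<sigma>) ^ N * (exp (- y\<^sup>2 / (4 * t)) * (y * sinh y) * (sqrt (t / pi) * thetad N t (\<rho> * cosh y)))" for t \<sigma> y :: real
    by (simp add: power_mult_distrib)
  have upper: "\<forall>\<^sub>F t in at_right 0. e t * (t ^ N * F t) \<le> U (\<lambda>i. real i * \<sigma>) t / \<sigma> ^ N" if \<sigma>: "0 < \<sigma>" for \<sigma>
    using eventually_at_right_less[of 0] small[OF t0] int[of "\<lambda>i. real i * \<sigma>"]
  proof eventually_elim
    case (elim t)
    note f = fint[OF elim(3)]
    have "(t * \<sigma>) ^ N * F t \<le> fdiff N (\<lambda>i. integral\<^sup>L lborel (G t (real i * \<sigma>)))"
    proof (rule has_bochner_integral_mono)
      show "has_bochner_integral lborel (\<lambda>y. (t * \<sigma>) ^ N * (exp (- y\<^sup>2 / (4 * t)) * (y * sinh y) * (sqrt (t / pi) * thetad N t (\<rho> * cosh y)))) ((t * \<sigma>) ^ N * F t)"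
        using F[OF elim(1,2)] unfolding \<rho>_def by (rule has_bochner_integral_mult_right)
      show "has_bochner_integral lborel (\<lambda>y. fdiff N (\<lambda>i. G t (real i * \<sigma>) y)) (fdiff N (\<lambda>i. integral\<^sup>L lborel (G t (real i * \<sigma>))))"
        by (rule f)
      fix y
      have "0 \<le> \<rho> * cosh y" using \<rho>0 by simp
      then have "-1 \<le> \<rho> * cosh y" by linarith
      moreover have "0 < t * \<sigma> * cosh y" using elim \<sigma> by simp
      ultimately have "(t * \<sigma> * cosh y) ^ N * thetad N t (\<rho> * cosh y) \<le> fdiff N (\<lambda>i. thetad 0 t (\<rho> * cosh y + real i * (t * \<sigma> * cosh y)))"
        by (rule thetad_fdiff(1)[OF elim(1)])
      also have "(\<lambda>i. thetad 0 t (\<rho> * cosh y + real i * (t * \<sigma> * cosh y))) = (\<lambda>i. thetad 0 t ((\<rho> + t * (real i * \<sigma>)) * cosh y))"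
        by (simp add: algebra_simps)
      finally show "(t * \<sigma>) ^ N * (exp (- y\<^sup>2 / (4 * t)) * (y * sinh y) * (sqrt (t / pi) * thetad N t (\<rho> * cosh y))) \<le> fdiff N (\<lambda>i. G t (real i * \<sigma>) y)"
        unfolding fG cancel[symmetric] by (intro mult_left_mono factor elim)
    qed
    moreover have "0 \<le> e t" using elim(1) by (simp add: e_def)
    ultimately have "e t * ((t * \<sigma>) ^ N * F t) \<le> U (\<lambda>i. real i * \<sigma>) t" unfolding U_def by (intro mult_left_mono)
    then show ?case using \<sigma> by (simp add: field_simps power_mult_distrib)
  qed
  have lower: "\<forall>\<^sub>F t in at_right 0. U (\<lambda>i. (real i - real N) * \<sigma>) t / \<sigma> ^ N \<le> e t * (t ^ N * F t)" if \<sigma>: "0 < \<sigma>" for \<sigma>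
  proof -
    \<comment> \<open>Differences from the left reach back to (\<rho> - N t \<sigma>) cosh y; small
      t keeps this point nonnegative, within the range of absolute monotonicity.\<close>
    have "0 < \<rho> / (real N * \<sigma>)" using \<rho>0 N \<sigma> by simp
    from eventually_at_right_less[of 0] small[OF t0] int[of "\<lambda>i. (real i - real N) * \<sigma>"] small[OF this]
    show ?thesis
    proof eventually_elim
      case (elim t)
      note f = fint[OF elim(3)]
      have "fdiff N (\<lambda>i. integral\<^sup>L lborel (G t ((real i - real N) * \<sigma>))) \<le> (t * \<sigma>) ^ N * F t"
      proof (rule has_bochner_integral_mono)
        show "has_bochner_integral lborel (\<lambda>y. (t * \<sigma>) ^ N * (exp (- y\<^sup>2 / (4 * t)) * (y * sinh y) * (sqrt (t / pi) * thetad N t (\<rho> * cosh y)))) ((t * \<sigma>) ^ N * F t)"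
          using F[OF elim(1,2)] unfolding \<rho>_def by (rule has_bochner_integral_mult_right)
        show "has_bochner_integral lborel (\<lambda>y. fdiff N (\<lambda>i. G t ((real i - real N) * \<sigma>) y)) (fdiff N (\<lambda>i. integral\<^sup>L lborel (G t ((real i - real N) * \<sigma>))))"
          by (rule f)
        fix y
        let ?x = "(\<rho> - real N * (t * \<sigma>)) * cosh y"
        have "t * (real N * \<sigma>) < \<rho>" using elim(4) N \<sigma> by (simp add: less_divide_eq)
        then have "0 \<le> ?x" by (simp add: algebra_simps)
        then have "-1 \<le> ?x" by linarith
        moreover have "0 < t * \<sigma> * cosh y" using elim \<sigma> by simp
        ultimately have "fdiff N (\<lambda>i. thetad 0 t (?x + real i * (t * \<sigma> * cosh y))) \<le> (t * \<sigma> * cosh y) ^ N * thetad N t (?x + real N * (t * \<sigma> * cosh y))"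
          by (rule thetad_fdiff(2)[OF elim(1)])
        also have "(\<lambda>i. thetad 0 t (?x + real i * (t * \<sigma> * cosh y))) = (\<lambda>i. thetad 0 t ((\<rho> + t * ((real i - real N) * \<sigma>)) * cosh y))"
          by (simp add: algebra_simps)
        also have "?x + real N * (t * \<sigma> * cosh y) = \<rho> * cosh y" by (simp add: algebra_simps)
        finally show "fdiff N (\<lambda>i. G t ((real i - real N) * \<sigma>) y) \<le> (t * \<sigma>) ^ N * (exp (- y\<^sup>2 / (4 * t)) * (y * sinh y) * (sqrt (t / pi) * thetad N t (\<rho> * cosh y)))"
          unfolding fG cancel[symmetric] by (intro mult_left_mono factor elim)
      qed
      moreover have "0 \<le> e t" using elim(1) by (simp add: e_def)
      ultimately have "U (\<lambda>i. (real i - real N) * \<sigma>) t \<le> e t * ((t * \<sigma>) ^ N * F t)" unfolding U_def by (intro mult_left_mono)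
      then show ?case using \<sigma> by (simp add: field_simps power_mult_distrib)
    qed
  qed
  \<comment> \<open>The limits form a geometric sequence in i, whose N-th difference is a power of
    its ratio minus 1.\<close>
  have ulim: "fdiff N (\<lambda>i. exp (\<beta> * (real i * \<sigma>)) * K) / \<sigma> ^ N = K * ((exp (\<beta> * \<sigma>) - 1) / \<sigma>) ^ N" for \<sigma>
  proof -
    have "(\<lambda>i. exp (\<beta> * (real i * \<sigma>)) * K) = (\<lambda>i. K * exp (\<beta> * \<sigma>) ^ i)"
      by (simp add: exp_of_nat_mult[symmetric] mult_ac)
    then show ?thesis by (simp add: fdiff_cmult fdiff_power power_divide)
  qed
  have llim: "fdiff N (\<lambda>i. exp (\<beta> * ((real i - real N) * \<sigma>)) * K) / \<sigma> ^ N = K * ((1 - exp (- \<beta> * \<sigma>)) / \<sigma>) ^ N" for \<sigma>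
  proof -
    have "(\<lambda>i. exp (\<beta> * ((real i - real N) * \<sigma>)) * K) = (\<lambda>i. K * exp (- \<beta> * \<sigma>) ^ N * exp (\<beta> * \<sigma>) ^ i)"
      by (simp add: exp_of_nat_mult[symmetric] mult_exp_exp algebra_simps)
    moreover have "exp (- \<beta> * \<sigma>) ^ N * (exp (\<beta> * \<sigma>) - 1) ^ N = (1 - exp (- \<beta> * \<sigma>)) ^ N"
      by (simp add: power_mult_distrib[symmetric] right_diff_distrib mult_exp_exp)
    ultimately show ?thesis by (simp add: fdiff_cmult fdiff_power power_divide mult.assoc)
  qed
  have slope: "((\<lambda>\<sigma>. (exp (\<beta> * \<sigma>) - 1) / \<sigma>) \<longlongrightarrow> \<beta>) (at_right 0)" "((\<lambda>\<sigma>. (1 - exp (- \<beta> * \<sigma>)) / \<sigma>) \<longlongrightarrow> \<beta>) (at_right 0)"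
  proof -
    have *: "((\<lambda>\<sigma>. (exp (b * \<sigma>) - 1) / \<sigma>) \<longlongrightarrow> b) (at_right 0)" for b :: real
    proof -
      have "((\<lambda>\<sigma>. exp (b * \<sigma>)) has_real_derivative b) (at 0 within {0<..})"
        by (auto intro!: derivative_eq_intros)
      then show ?thesis by (simp add: has_field_derivative_iff)
    qed
    show "((\<lambda>\<sigma>. (exp (\<beta> * \<sigma>) - 1) / \<sigma>) \<longlongrightarrow> \<beta>) (at_right 0)" by (rule *)
    show "((\<lambda>\<sigma>. (1 - exp (- \<beta> * \<sigma>)) / \<sigma>) \<longlongrightarrow> \<beta>) (at_right 0)"
      using tendsto_minus[OF *[of "- \<beta>"]] by (simp add: minus_divide_left)
  qed
  have "((\<lambda>t. e t * (t ^ N * F t)) \<longlongrightarrow> K * \<beta> ^ N) (at_right 0)"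
  \<comment> \<open>First \<sigma> is fixed so that the limiting difference quotient lies on the
    right side of a, and only then t tends to 0.\<close>
  proof (rule order_tendstoI)
    fix a assume a: "a < K * \<beta> ^ N"
    have "((\<lambda>\<sigma>. K * ((1 - exp (- \<beta> * \<sigma>)) / \<sigma>) ^ N) \<longlongrightarrow> K * \<beta> ^ N) (at_right 0)"
      by (intro tendsto_mult tendsto_power tendsto_const slope)
    from order_tendstoD(1)[OF this a] eventually_at_right_less[of 0]
    have "\<forall>\<^sub>F \<sigma> in at_right 0. 0 < \<sigma> \<and> a < K * ((1 - exp (- \<beta> * \<sigma>)) / \<sigma>) ^ N" by eventually_elim auto
    then obtain \<sigma> where \<sigma>: "0 < \<sigma>" "a < fdiff N (\<lambda>i. exp (\<beta> * ((real i - real N) * \<sigma>)) * K) / \<sigma> ^ N"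
      unfolding llim using eventually_happens'[of "at_right (0::real)"] by auto
    have "((\<lambda>t. U (\<lambda>i. (real i - real N) * \<sigma>) t / \<sigma> ^ N) \<longlongrightarrow> fdiff N (\<lambda>i. exp (\<beta> * ((real i - real N) * \<sigma>)) * K) / \<sigma> ^ N) (at_right 0)"
      using \<sigma>(1) by (intro tendsto_divide U tendsto_const) simp
    from order_tendstoD(1)[OF this \<sigma>(2)] lower[OF \<sigma>(1)]
    show "\<forall>\<^sub>F t in at_right 0. a < e t * (t ^ N * F t)" by eventually_elim simp
  next
    fix a assume a: "K * \<beta> ^ N < a"
    have "((\<lambda>\<sigma>. K * ((exp (\<beta> * \<sigma>) - 1) / \<sigma>) ^ N) \<longlongrightarrow> K * \<beta> ^ N) (at_right 0)"
      by (intro tendsto_mult tendsto_power tendsto_const slope)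
    from order_tendstoD(2)[OF this a] eventually_at_right_less[of 0]
    have "\<forall>\<^sub>F \<sigma> in at_right 0. 0 < \<sigma> \<and> K * ((exp (\<beta> * \<sigma>) - 1) / \<sigma>) ^ N < a" by eventually_elim auto
    then obtain \<sigma> where \<sigma>: "0 < \<sigma>" "fdiff N (\<lambda>i. exp (\<beta> * (real i * \<sigma>)) * K) / \<sigma> ^ N < a"
      unfolding ulim using eventually_happens'[of "at_right (0::real)"] by auto
    have "((\<lambda>t. U (\<lambda>i. real i * \<sigma>) t / \<sigma> ^ N) \<longlongrightarrow> fdiff N (\<lambda>i. exp (\<beta> * (real i * \<sigma>)) * K) / \<sigma> ^ N) (at_right 0)"
      using \<sigma>(1) by (intro tendsto_divide U tendsto_const) simp
    from order_tendstoD(2)[OF this \<sigma>(2)] upper[OF \<sigma>(1)]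
    show "\<forall>\<^sub>F t in at_right 0. e t * (t ^ N * F t) < a" by eventually_elim simp
  qed
  then show ?thesis unfolding e_def \<beta>_def K_def by (simp only: mult.commute)
qed

text \<open>With eta = 0 the real part of the last coordinate has full modulus, so this coordinate
  is real and the vectors \<open>hact S q\<close> are orthogonal to the north pole. The pole then
  has zonal argument cos r and parameter (cos r)^2.\<close>

lemma cyl_coords_zero:
  fixes q :: "'n::finite hvec"
  assumes "has_cyl_coords q r 0"
  shows "norm q = 1" "north_pole \<bullet> q = cos r" "qnorm2 q north_pole = (cos r)\<^sup>2"
proof -
  have q: "norm q = 1" "norm (snd q) = cos r" "Re (fst (snd q)) = cos r"
    using assms by (auto simp: has_cyl_coords_def qRe_def)
  then show "norm q = 1" by simp
  show i: "north_pole \<bullet> q = cos r"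
    using q(3) by (simp add: north_pole_def qone_def inner_prod_def inner_complex_def)
  have "(norm (snd q))\<^sup>2 = (cmod (fst (snd q)))\<^sup>2 + (cmod (snd (snd q)))\<^sup>2"
    by (simp add: norm_prod_def)
  then have "(Im (fst (snd q)))\<^sup>2 + (cmod (snd (snd q)))\<^sup>2 = 0"
    using q(2,3) by (simp add: cmod_power2)
  then have "Im (fst (snd q)) = 0" "snd (snd q) = 0"
    by (simp_all add: add_nonneg_eq_0_iff)
  then have "north_pole \<bullet> hact S q = 0" if "S \<in> qunits" for S
    using that by (auto simp: north_pole_def qone_def inner_prod_def hact_def qmult_def qI_def qJ_def qK_def inner_complex_def)
  then show "qnorm2 q north_pole = (cos r)\<^sup>2" by (simp add: qnorm2_def i)
qed

theorem proposition2p12: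
  fixes p :: "real \<Rightarrow> 'n::finite hvec \<Rightarrow> real" and r :: real and q :: "'n hvec"
  assumes "is_subelliptic_heat_kernel p"
    and "0 < r" and "r < pi / 2"
    and "has_cyl_coords q r 0"
  shows "(\<lambda>t. p t q) \<sim>[at_right 0]
    (\<lambda>t. 1 / (4 * pi * t) powr (2 * real CARD('n) + 3 / 2)
         * (r / sin r) ^ (2 * CARD('n) + 1)
         * exp (- r\<^sup>2 / (4 * t))
         * (1 / (1 - r * cot r)) powr (3 / 2))"
proof -
  obtain P where P: "is_sub_heat_semigroup P"
    and p: "\<And>t. 0 < t \<Longrightarrow> continuous_on (sphere 0 1) (p t)"
      "\<And>t f. 0 < t \<Longrightarrow> continuous_on (sphere 0 1) f \<Longrightarrow> P t f north_pole = (\<integral>q. p t q * f q \<partial>sphere_vol)"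
    using assms(1) unfolding is_subelliptic_heat_kernel_def by blast
  interpret sub_heat P by standard (rule P)
  note r = assms(2,3)
  note q = cyl_coords_zero[OF assms(4)]
  define N where "N = 2 * CARD('n) + 1"
  have N0: "N \<noteq> 0" by (simp add: N_def)
  define M where "M = 2 ^ N * fact N * sphere_moment q 0"
  define d where "d = 1 - r * cot r"
  have rf: "0 < cos r" "cos r < 1" "0 < sin r" "0 < d"
    using colatitude_facts[OF r N0] by (auto simp: d_def)
  \<comment> \<open>The sphere of dimension 2N + 1 has volume 2 pi^(N+1) / N!, and its factorial
    cancels that of the approximate identity.\<close>
  have M: "M = (2 * pi) ^ Suc N"
  proof -
    have D: "DIM('n hvec) = 2 * Suc N" by (simp add: N_def)
    have "sphere_moment q 0 = real (2 * Suc N) * (pi ^ Suc N / fact (Suc N))"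
      unfolding sphere_moment_0 D unit_ball_vol_even ..
    also have "\<dots> = 2 * pi ^ Suc N / fact N"
      by (simp only: fact_Suc of_nat_mult) (simp del: of_nat_Suc power_Suc)
    finally show ?thesis by (simp add: M_def power_mult_distrib)
  qed
  define E where "E t = exp ((1 - (real N)\<^sup>2) * t)" for t
  obtain t0 where t0: "0 < t0" and hk: "\<And>t. 0 < t \<Longrightarrow> t < t0 \<Longrightarrow>
    has_bochner_integral lborel (\<lambda>y. normal_density 0 (sqrt (2 * t)) y * (y * sinh y) * thetad N t (cos r * cosh y))
      (2 * t * E t * (M * p t q))"
    using heat_kernel_integral[OF p q(1) N_def q(2,3) rf(1,2)] unfolding M_def E_def by blast
  have F: "has_bochner_integral lborel
      (\<lambda>y. exp (- y\<^sup>2 / (4 * t)) * (y * sinh y) * (sqrt (t / pi) * thetad N t (cos r * cosh y))) (4 * t\<^sup>2 * E t * M * p t q)"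
    if t: "0 < t" "t < t0" for t
  proof -
    have "has_bochner_integral lborel (\<lambda>y. 2 * t * (normal_density 0 (sqrt (2 * t)) y * (y * sinh y) * thetad N t (cos r * cosh y)))
      (2 * t * (2 * t * E t * (M * p t q)))"
      by (intro has_bochner_integral_mult_right hk t)
    \<comment> \<open>One factor 2t converts the normal density into the normalisation sqrt (t / pi)
      of theta.\<close>
    moreover have "2 * t * normal_density 0 (sqrt (2 * t)) y = exp (- y\<^sup>2 / (4 * t)) * sqrt (t / pi)" for y
    proof -
      have "sqrt (4 * pi * t) * sqrt (t / pi) = 2 * t"
        using t by (simp add: real_sqrt_mult[symmetric] power2_eq_square[symmetric] real_sqrt_mult)
      then have "2 * t * (exp (- y\<^sup>2 / (4 * t)) / sqrt (4 * pi * t)) = sqrt (4 * pi * t) * sqrt (t / pi) * (exp (- y\<^sup>2 / (4 * t)) / sqrt (4 * pi * t))"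
        by (simp only:)
      also have "\<dots> = exp (- y\<^sup>2 / (4 * t)) * sqrt (t / pi)" using t by simp
      finally show ?thesis using t by (simp add: normal_density_def mult.assoc)
    qed
    then have "2 * t * (normal_density 0 (sqrt (2 * t)) y * (y * sinh y) * thetad N t (cos r * cosh y))
        = exp (- y\<^sup>2 / (4 * t)) * (y * sinh y) * (sqrt (t / pi) * thetad N t (cos r * cosh y))" for y
      by (simp only: mult.assoc[symmetric]) (simp only: mult_ac)
    moreover have "2 * t * (2 * t * E t * (M * p t q)) = 4 * t\<^sup>2 * E t * M * p t q" by (simp add: power2_eq_square)
    ultimately show ?thesis by (simp only:)
  qed
  let ?K = "(r / (2 * sin r)) ^ N * (sqrt (pi / (d / 4)) / (2 * (d / 4)))"
  have L: "((\<lambda>t. exp (r\<^sup>2 / (4 * t)) / (t * sqrt t) * (t ^ N * (4 * t\<^sup>2 * E t * M * p t q))) \<longlongrightarrow> ?K) (at_right 0)"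
    unfolding d_def by (rule theta_derivative_integral_tendsto[OF r N0 t0 F])
  have K0: "?K \<noteq> 0" using r rf by simp
  \<comment> \<open>The spectral shift exp ((1 - N^2) t) tends to 1 and leaves no trace in the
    asymptotics.\<close>
  have E1: "((\<lambda>t. 1 / E t) \<longlongrightarrow> 1 / 1) (at_right 0)"
  proof (intro tendsto_divide tendsto_const)
    show "(E \<longlongrightarrow> 1) (at_right 0)"
      using tendsto_exp[OF tendsto_mult[OF tendsto_const[of "1 - (real N)\<^sup>2"] tendsto_ident_at[of 0 "{0<..}"]]] by (simp add: E_def[abs_def])
  qed simp
  show ?thesis
  proof (rule asymp_equivI', rule Lim_transform_eventually)
    show "((\<lambda>t. exp (r\<^sup>2 / (4 * t)) / (t * sqrt t) * (t ^ N * (4 * t\<^sup>2 * E t * M * p t q)) * (1 / E t) / ?K) \<longlongrightarrow> 1) (at_right 0)"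
    proof -
      have "?K * (1 / 1) / ?K = 1" using divide_self[OF K0] by (simp only: div_by_1 mult_1_right)
      then show ?thesis using tendsto_divide[OF tendsto_mult[OF L E1] tendsto_const[of ?K] K0] by (simp only:)
    qed
    show "\<forall>\<^sub>F t in at_right 0. exp (r\<^sup>2 / (4 * t)) / (t * sqrt t) * (t ^ N * (4 * t\<^sup>2 * E t * M * p t q)) * (1 / E t) / ?K
      = p t q / (1 / (4 * pi * t) powr (2 * real CARD('n) + 3 / 2) * (r / sin r) ^ (2 * CARD('n) + 1)
         * exp (- r\<^sup>2 / (4 * t)) * (1 / (1 - r * cot r)) powr (3 / 2))"
      using eventually_at_right_less[of 0]
    proof eventually_elim
      case (elim t)
      have "2 * real CARD('n) + 3 / 2 = real N + 1 / 2" by (simp add: N_def)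
      then have "(4 * pi * t) powr (2 * real CARD('n) + 3 / 2) = (4 * pi * t) powr (real N + 1 / 2)"
        by (simp only:)
      also have "\<dots> = (4 * pi * t) ^ N * sqrt (4 * pi * t)"
        using elim by (simp add: powr_add powr_realpow powr_half_sqrt)
      also have "\<dots> = 2 ^ N * 2 ^ N * pi ^ N * t ^ N * (2 * sqrt pi * sqrt t)"
      proof -
        have "4 * pi * t = 2 * 2 * pi * t" by simp
        then have "(4 * pi * t) ^ N = 2 ^ N * 2 ^ N * pi ^ N * t ^ N" by (simp only: power_mult_distrib)
        then show ?thesis by (simp add: real_sqrt_mult)
      qed
      finally have p1: "(4 * pi * t) powr (2 * real CARD('n) + 3 / 2) = 2 ^ N * 2 ^ N * pi ^ N * t ^ N * (2 * sqrt pi * sqrt t)" .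
      have "(1 / d) powr (3 / 2) = (1 / d) powr (1 + 1 / 2)" by simp
      also have "\<dots> = 1 / d * sqrt (1 / d)"
        unfolding powr_add using rf by (simp add: powr_half_sqrt)
      finally have p2: "(1 / (1 - r * cot r)) powr (3 / 2) = 1 / (d * sqrt d)" by (simp add: d_def real_sqrt_divide)
      have p3: "exp (- r\<^sup>2 / (4 * t)) = 1 / exp (r\<^sup>2 / (4 * t))" by (simp add: exp_minus inverse_eq_divide)
      have p4: "sqrt (pi / (d / 4)) / (2 * (d / 4)) = 4 * sqrt pi / (d * sqrt d)"
        by (simp add: real_sqrt_divide real_sqrt_mult)
      \<comment> \<open>Square roots and N-th powers become independent letters, with S = sqrt t and
        Q = sqrt pi, so the comparison of constants is pure field arithmetic.\<close>
      have alg: "R / (S * S * S) * (T * (4 * (S * S)\<^sup>2 * e * (2 * (Q * Q) * (B * C)) * w)) * (1 / e) / (A / B * (4 * Q / X))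
          = w / (1 / (B * B * C * T * (2 * Q * S)) * A * (1 / R) * (1 / X))"
        if "R \<noteq> 0" "S \<noteq> 0" "T \<noteq> 0" "e \<noteq> 0" "Q \<noteq> 0" "A \<noteq> 0" "B \<noteq> 0" "C \<noteq> 0" "X \<noteq> 0"
        for R S T e Q A B C X w :: real
      proof -
        have "R / (S * S * S) * (T * (4 * (S * S)\<^sup>2 * e * (2 * (Q * Q) * (B * C)) * w)) * (1 / e) / (A / B * (4 * Q / X))
          = 2 * R * S * T * Q * B * B * C * w * X / A"
          using that by (simp add: divide_simps power2_eq_square)
        also have "\<dots> = w / (1 / (B * B * C * T * (2 * Q * S)) * A * (1 / R) * (1 / X))"
          using that by (simp add: divide_simps)
        finally show ?thesis .
      qed
      have sq: "sqrt t * sqrt t = t" "sqrt pi * sqrt pi = pi" using elim by simp_all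
      have MM: "M = 2 * pi * (2 ^ N * pi ^ N)" by (simp add: M power_mult_distrib)
      have rr: "(r / (2 * sin r)) ^ N = (r / sin r) ^ N / 2 ^ N" by (simp add: power_divide power_mult_distrib)
      have nz: "exp (r\<^sup>2 / (4 * t)) \<noteq> 0" "sqrt t \<noteq> 0" "t ^ N \<noteq> 0" "E t \<noteq> 0" "sqrt pi \<noteq> 0" "(r / sin r) ^ N \<noteq> 0"
        "(2::real) ^ N \<noteq> 0" "pi ^ N \<noteq> 0" "d * sqrt d \<noteq> 0"
        using elim rf r by (simp_all add: E_def)
      show ?case
        unfolding p1 p2 p3 p4 N_def[symmetric] MM rr using alg[OF nz, of "p t q"] unfolding sq .
    qed
  qed
qed

end
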